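(* Let $\mathcal K$ be an algebraic triangulated category and let $\mathcal E$ be a Frobenius class of triangles in $\mathcal K$. Then the relative stable category $\underline{\mathcal K}_{\mathcal E}$, with its triangulated structure, is again an algebraic triangulated category.
   Context: A triangulated category is algebraic if it is equivalent, as a triangulated category, to the stable category of a Frobenius exact category (with its usual triangulation). Standing assumption: $\mathcal K$ is essentially small, with suspension $\Sigma$. Subcategories are full and replete. Let $\mathcal E$ be a family of distinguished triangles $X\xrightarrow{f}Y\xrightarrow{g}Z\xrightarrow{h}\Sigma X$ in $\mathcal K$; for a triangle in $\mathcal E$ one calls $f$ an $\mathcal E$-monomorphism, $g$ an $\mathcal E$-epimorphism and $h$ an $\mathcal E$-phantom. $\mathcal E$ is a proper class of triangles if it is closed under isomorphisms, suspension (triple rotation), finite sums and retracts; contains all triangles $X\xrightarrow{\mathrm{id}}X\to0\to\Sigma X$ and $0\to Y\xrightarrow{\mathrm{id}}Y\to0$; $\mathcal E$-monomorphisms are closed under homotopy pushouts and $\mathcal E$-epimorphisms under homotopy pullbacks (along arbitrary morphisms); and $\mathcal E$ is saturated: if the homotopy pullback of a morphism $g$ along an $\mathcal E$-epimorphism is an $\mathcal E$-epimorphism, then $g$ is an $\mathcal E$-epimorphism. An object $P$ is $\mathcal E$-projective if $0\to\mathcal K(P,X)\to\mathcal K(P,Y)\to\mathcal K(P,Z)\to0$ is exact for every triangle in $\mathcal E$; $\mathcal E$-injectives are defined dually; $\operatorname{proj}(\mathcal E)$ and $\operatorname{inj}(\mathcal E)$ denote the classes of these. $\mathcal E$ has enough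 projectives (injectives) if every $X$ admits an $\mathcal E$-epimorphism $P\to X$ with $P\in\operatorname{proj}(\mathcal E)$ (an $\mathcal E$-monomorphism $X\to I$ with $I\in\operatorname{inj}(\mathcal E)$). $\mathcal E$ is Frobenius if it is a proper class with enough projectives, enough injectives and $\operatorname{proj}(\mathcal E)=\operatorname{inj}(\mathcal E)$. For $\mathcal E$ Frobenius, the relative stable category is the additive quotient $\pi\colon\mathcal K\to\underline{\mathcal K}_{\mathcal E}=\mathcal K/\operatorname{proj}(\mathcal E)$ (same objects, morphisms modulo those factoring through an object of $\operatorname{proj}(\mathcal E)$). It is triangulated (Beligiannis): for each $X$ choose an $\mathcal E$-monomorphism $i_X\colon X\to X_{\mathcal E}$ with $X_{\mathcal E}\in\operatorname{inj}(\mathcal E)$ and a distinguished triangle $X\xrightarrow{i_X}X_{\mathcal E}\to X'\to\Sigma X$, and set $\Sigma_{\mathcal E}X=\pi(X')$. For $f\colon X\to Y$ in $\mathcal K$ form the homotopy pushout $Z$ of $X_{\mathcal E}\leftarrow X\xrightarrow{f}Y$ and the induced map from $X\to X_{\mathcal E}\to X'\to\Sigma X$ to the distinguished triangle $Y\xrightarrow{g}Z\xrightarrow{h}X'\to\Sigma Y$ which is the identity on $X'$; the distinguished triangles in $\underline{\mathcal K}_{\mathcal E}$ are those isomorphic to some $X\xrightarrow{\pi f}Y\xrightarrow{\pi g}Z\xrightarrow{\pi h}\Sigma_{\mathcal E}X$. *)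

theory Defs
  imports "HOL-Algebra.Group"
begin

section \<open>Categories\<close>

text \<open>
  A category consists of a set of objects and a set of arrows, every arrow having a unique source
  and target.  Composition is written in the order of function application: \<open>g \<cdot> f\<close> is
  ``first \<open>f\<close>, then \<open>g\<close>''.  Object and arrow collections are sets, so all categories are small;
  an essentially small category is represented by an equivalent small one.
\<close>

record ('o, 'm) precat =
  ob :: "'o set"
  arr :: "'m set"
  src :: "'m \<Rightarrow> 'o"
  tgt :: "'m \<Rightarrow> 'o"
  ident :: "'o \<Rightarrow> 'm"
  cmp :: "'m \<Rightarrow> 'm \<Rightarrow> 'm"  (infixl "\<cdot>\<index>" 70)

definition Hom :: "('o, 'm, 'z) precat_scheme \<Rightarrow> 'o \<Rightarrow> 'o \<Rightarrow> 'm set" where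
  "Hom C X Y = {f \<in> arr C. src C f = X \<and> tgt C f = Y}"

locale category =
  fixes C :: "('o, 'm, 'z) precat_scheme" (structure)
  assumes src_ob: "f \<in> arr C \<Longrightarrow> src C f \<in> ob C"
    and tgt_ob: "f \<in> arr C \<Longrightarrow> tgt C f \<in> ob C"
    and ident_hom: "X \<in> ob C \<Longrightarrow> ident C X \<in> Hom C X X"
    and cmp_hom: "\<lbrakk>f \<in> Hom C X Y; g \<in> Hom C Y Z\<rbrakk> \<Longrightarrow> g \<cdot> f \<in> Hom C X Z"
    and cmp_ident_right: "f \<in> Hom C X Y \<Longrightarrow> f \<cdot> ident C X = f"
    and cmp_ident_left: "f \<in> Hom C X Y \<Longrightarrow> ident C Y \<cdot> f = f"
    and cmp_assoc: "\<lbrakk>f \<in> Hom C W X; g \<in> Hom C X Y; h \<in> Hom C Y Z\<rbrakk>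
      \<Longrightarrow> (h \<cdot> g) \<cdot> f = h \<cdot> (g \<cdot> f)"

definition iso_arr :: "('o, 'm, 'z) precat_scheme \<Rightarrow> 'o \<Rightarrow> 'o \<Rightarrow> 'm \<Rightarrow> bool" where
  "iso_arr C X Y f \<longleftrightarrow> f \<in> Hom C X Y \<and>
    (\<exists>g \<in> Hom C Y X. g \<cdot>\<^bsub>C\<^esub> f = ident C X \<and> f \<cdot>\<^bsub>C\<^esub> g = ident C Y)"

definition is_pushout ::
  "('o, 'm, 'z) precat_scheme \<Rightarrow> 'm \<Rightarrow> 'm \<Rightarrow> 'm \<Rightarrow> 'm \<Rightarrow> bool" where
  \<comment> \<open>\<open>f : X \<rightarrow> Y\<close> and \<open>u : X \<rightarrow> X'\<close> are completed by \<open>v : Y \<rightarrow> Y'\<close> and \<open>f' : X' \<rightarrow> Y'\<close>\<close>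
  "is_pushout C f u v f' \<longleftrightarrow>
    (\<exists>X Y X' Y'. f \<in> Hom C X Y \<and> u \<in> Hom C X X' \<and> v \<in> Hom C Y Y' \<and> f' \<in> Hom C X' Y' \<and>
      v \<cdot>\<^bsub>C\<^esub> f = f' \<cdot>\<^bsub>C\<^esub> u \<and>
      (\<forall>T \<in> ob C. \<forall>a \<in> Hom C Y T. \<forall>b \<in> Hom C X' T. a \<cdot>\<^bsub>C\<^esub> f = b \<cdot>\<^bsub>C\<^esub> u \<longrightarrow>
        (\<exists>!t. t \<in> Hom C Y' T \<and> t \<cdot>\<^bsub>C\<^esub> v = a \<and> t \<cdot>\<^bsub>C\<^esub> f' = b)))"

definition is_pullback ::
  "('o, 'm, 'z) precat_scheme \<Rightarrow> 'm \<Rightarrow> 'm \<Rightarrow> 'm \<Rightarrow> 'm \<Rightarrow> bool" where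
  \<comment> \<open>\<open>v : Y \<rightarrow> Y'\<close> and \<open>f' : X' \<rightarrow> Y'\<close> are completed by \<open>f : X \<rightarrow> Y\<close> and \<open>u : X \<rightarrow> X'\<close>\<close>
  "is_pullback C f u v f' \<longleftrightarrow>
    (\<exists>X Y X' Y'. f \<in> Hom C X Y \<and> u \<in> Hom C X X' \<and> v \<in> Hom C Y Y' \<and> f' \<in> Hom C X' Y' \<and>
      v \<cdot>\<^bsub>C\<^esub> f = f' \<cdot>\<^bsub>C\<^esub> u \<and>
      (\<forall>T \<in> ob C. \<forall>a \<in> Hom C T Y. \<forall>b \<in> Hom C T X'. v \<cdot>\<^bsub>C\<^esub> a = f' \<cdot>\<^bsub>C\<^esub> b \<longrightarrow>
        (\<exists>!t. t \<in> Hom C T X \<and> f \<cdot>\<^bsub>C\<^esub> t = a \<and> u \<cdot>\<^bsub>C\<^esub> t = b)))"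

locale cat_functor = C: category C + D: category D
  for C :: "('o, 'm, 'z) precat_scheme" and D :: "('p, 'n, 'y) precat_scheme" +
  fixes FO :: "'o \<Rightarrow> 'p" and FM :: "'m \<Rightarrow> 'n"
  assumes functor_ob: "X \<in> ob C \<Longrightarrow> FO X \<in> ob D"
    and functor_hom: "f \<in> Hom C X Y \<Longrightarrow> FM f \<in> Hom D (FO X) (FO Y)"
    and functor_ident: "X \<in> ob C \<Longrightarrow> FM (ident C X) = ident D (FO X)"
    and functor_cmp: "\<lbrakk>f \<in> Hom C X Y; g \<in> Hom C Y Z\<rbrakk> \<Longrightarrow> FM (g \<cdot>\<^bsub>C\<^esub> f) = FM g \<cdot>\<^bsub>D\<^esub> FM f"

definition natural_iso ::
  "('o, 'm, 'z) precat_scheme \<Rightarrow> ('p, 'n, 'y) precat_scheme \<Rightarrow>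
   ('o \<Rightarrow> 'p) \<Rightarrow> ('m \<Rightarrow> 'n) \<Rightarrow> ('o \<Rightarrow> 'p) \<Rightarrow> ('m \<Rightarrow> 'n) \<Rightarrow> ('o \<Rightarrow> 'n) \<Rightarrow> bool" where
  "natural_iso C D FO FM GO GM \<eta> \<longleftrightarrow>
    (\<forall>X \<in> ob C. iso_arr D (FO X) (GO X) (\<eta> X)) \<and>
    (\<forall>X \<in> ob C. \<forall>Y \<in> ob C. \<forall>f \<in> Hom C X Y. \<eta> Y \<cdot>\<^bsub>D\<^esub> FM f = GM f \<cdot>\<^bsub>D\<^esub> \<eta> X)"

definition equivalence ::
  "('o, 'm, 'z) precat_scheme \<Rightarrow> ('p, 'n, 'y) precat_scheme \<Rightarrow>
   ('o \<Rightarrow> 'p) \<Rightarrow> ('m \<Rightarrow> 'n) \<Rightarrow> bool" where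
  "equivalence C D FO FM \<longleftrightarrow> cat_functor C D FO FM \<and>
    (\<exists>GO GM \<eta> \<epsilon>. cat_functor D C GO GM \<and>
      natural_iso C C id id (GO \<circ> FO) (GM \<circ> FM) \<eta> \<and>
      natural_iso D D (FO \<circ> GO) (FM \<circ> GM) id id \<epsilon>)"


section \<open>Additive categories\<close>

record ('o, 'm) ab_cat = "('o, 'm) precat" +
  addm :: "'m \<Rightarrow> 'm \<Rightarrow> 'm"
  zerom :: "'o \<Rightarrow> 'o \<Rightarrow> 'm"

definition hom_group :: "('o, 'm, 'z) ab_cat_scheme \<Rightarrow> 'o \<Rightarrow> 'o \<Rightarrow> 'm monoid" where
  "hom_group C X Y = \<lparr>carrier = Hom C X Y, monoid.mult = addm C, one = zerom C X Y\<rparr>"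

definition negm :: "('o, 'm, 'z) ab_cat_scheme \<Rightarrow> 'm \<Rightarrow> 'm" where
  "negm C f = inv\<^bsub>hom_group C (src C f) (tgt C f)\<^esub> f"

definition subm :: "('o, 'm, 'z) ab_cat_scheme \<Rightarrow> 'm \<Rightarrow> 'm \<Rightarrow> 'm" where
  "subm C f g = addm C f (negm C g)"

definition zero_object :: "('o, 'm, 'z) precat_scheme \<Rightarrow> 'o \<Rightarrow> bool" where
  "zero_object C N \<longleftrightarrow> N \<in> ob C \<and>
    (\<forall>X \<in> ob C. (\<exists>!f. f \<in> Hom C N X) \<and> (\<exists>!f. f \<in> Hom C X N))"

definition biproduct ::
  "('o, 'm, 'z) ab_cat_scheme \<Rightarrow> 'o \<Rightarrow> 'o \<Rightarrow> 'o \<Rightarrow> 'm \<Rightarrow> 'm \<Rightarrow> 'm \<Rightarrow> 'm \<Rightarrow> bool" where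
  "biproduct C A B S i1 i2 p1 p2 \<longleftrightarrow>
    A \<in> ob C \<and> B \<in> ob C \<and> S \<in> ob C \<and>
    i1 \<in> Hom C A S \<and> i2 \<in> Hom C B S \<and> p1 \<in> Hom C S A \<and> p2 \<in> Hom C S B \<and>
    p1 \<cdot>\<^bsub>C\<^esub> i1 = ident C A \<and> p2 \<cdot>\<^bsub>C\<^esub> i2 = ident C B \<and>
    p2 \<cdot>\<^bsub>C\<^esub> i1 = zerom C A B \<and> p1 \<cdot>\<^bsub>C\<^esub> i2 = zerom C B A \<and>
    addm C (i1 \<cdot>\<^bsub>C\<^esub> p1) (i2 \<cdot>\<^bsub>C\<^esub> p2) = ident C S"

locale additive_category = category C
  for C :: "('o, 'm, 'z) ab_cat_scheme" (structure) +
  assumes hom_comm_group: "\<lbrakk>X \<in> ob C; Y \<in> ob C\<rbrakk> \<Longrightarrow> comm_group (hom_group C X Y)"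
    and cmp_add_left: "\<lbrakk>f \<in> Hom C X Y; g \<in> Hom C Y Z; g' \<in> Hom C Y Z\<rbrakk>
      \<Longrightarrow> addm C g g' \<cdot> f = addm C (g \<cdot> f) (g' \<cdot> f)"
    and cmp_add_right: "\<lbrakk>f \<in> Hom C X Y; f' \<in> Hom C X Y; g \<in> Hom C Y Z\<rbrakk>
      \<Longrightarrow> g \<cdot> addm C f f' = addm C (g \<cdot> f) (g \<cdot> f')"
    and ex_zero_object: "\<exists>N. zero_object C N"
    and ex_biproduct: "\<lbrakk>A \<in> ob C; B \<in> ob C\<rbrakk> \<Longrightarrow> \<exists>S i1 i2 p1 p2. biproduct C A B S i1 i2 p1 p2"

definition additive_equivalence ::
  "('o, 'm, 'z) ab_cat_scheme \<Rightarrow> ('p, 'n, 'y) ab_cat_scheme \<Rightarrow>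
   ('o \<Rightarrow> 'p) \<Rightarrow> ('m \<Rightarrow> 'n) \<Rightarrow> bool" where
  "additive_equivalence C D FO FM \<longleftrightarrow> equivalence C D FO FM \<and>
    (\<forall>X \<in> ob C. \<forall>Y \<in> ob C. \<forall>f \<in> Hom C X Y. \<forall>g \<in> Hom C X Y.
      FM (addm C f g) = addm D (FM f) (FM g))"


subsection \<open>Additive quotients\<close>

definition factors_through :: "('o, 'm, 'z) ab_cat_scheme \<Rightarrow> 'o set \<Rightarrow> 'm \<Rightarrow> bool" where
  "factors_through C P f \<longleftrightarrow>
    (\<exists>Q \<in> P. \<exists>a \<in> Hom C (src C f) Q. \<exists>b \<in> Hom C Q (tgt C f). f = b \<cdot>\<^bsub>C\<^esub> a)"

definition cls :: "('o, 'm, 'z) ab_cat_scheme \<Rightarrow> 'o set \<Rightarrow> 'm \<Rightarrow> 'm set" where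
  "cls C P f = {g \<in> Hom C (src C f) (tgt C f). factors_through C P (subm C g f)}"

definition rep :: "'m set \<Rightarrow> 'm" where
  "rep S = (SOME f. f \<in> S)"

text \<open>
  The operations on classes are computed on representatives; this is independent of the choice
  of representatives whenever \<open>P\<close> is closed under finite direct sums.
\<close>

definition quotient_cat ::
  "('o, 'm, 'z) ab_cat_scheme \<Rightarrow> 'o set \<Rightarrow> ('o, 'm set) ab_cat" where
  "quotient_cat C P =
    \<lparr>ob = ob C,
     arr = cls C P ` arr C,
     src = (\<lambda>S. src C (rep S)),
     tgt = (\<lambda>S. tgt C (rep S)),
     ident = (\<lambda>X. cls C P (ident C X)),
     cmp = (\<lambda>S T. cls C P (rep S \<cdot>\<^bsub>C\<^esub> rep T)),
     addm = (\<lambda>S T. cls C P (addm C (rep S) (rep T))),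
     zerom = (\<lambda>X Y. cls C P (zerom C X Y))\<rparr>"


section \<open>Triangulated categories\<close>

text \<open>
  A triangle \<open>X \<rightarrow> Y \<rightarrow> Z \<rightarrow> \<Sigma>X\<close> is represented by the triple of its three arrows.
\<close>

record ('o, 'm) tricat = "('o, 'm) ab_cat" +
  susO :: "'o \<Rightarrow> 'o"
  susM :: "'m \<Rightarrow> 'm"
  Tri :: "('m \<times> 'm \<times> 'm) set"

definition triangle_on ::
  "('o, 'm, 'z) tricat_scheme \<Rightarrow> 'o \<Rightarrow> 'o \<Rightarrow> 'o \<Rightarrow> 'm \<times> 'm \<times> 'm \<Rightarrow> bool" where
  "triangle_on K X Y Z = (\<lambda>(f, g, h).
    f \<in> Hom K X Y \<and> g \<in> Hom K Y Z \<and> h \<in> Hom K Z (susO K X))"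

definition tri_morphism ::
  "('o, 'm, 'z) tricat_scheme \<Rightarrow> 'm \<times> 'm \<times> 'm \<Rightarrow> 'm \<times> 'm \<times> 'm \<Rightarrow>
   'm \<Rightarrow> 'm \<Rightarrow> 'm \<Rightarrow> bool" where
  "tri_morphism K = (\<lambda>(f, g, h) (f', g', h') u v w.
    u \<in> Hom K (src K f) (src K f') \<and>
    v \<in> Hom K (tgt K f) (tgt K f') \<and>
    w \<in> Hom K (tgt K g) (tgt K g') \<and>
    v \<cdot>\<^bsub>K\<^esub> f = f' \<cdot>\<^bsub>K\<^esub> u \<and>
    w \<cdot>\<^bsub>K\<^esub> g = g' \<cdot>\<^bsub>K\<^esub> v \<and>
    susM K u \<cdot>\<^bsub>K\<^esub> h = h' \<cdot>\<^bsub>K\<^esub> w)"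

definition tri_iso ::
  "('o, 'm, 'z) tricat_scheme \<Rightarrow> 'm \<times> 'm \<times> 'm \<Rightarrow> 'm \<times> 'm \<times> 'm \<Rightarrow> bool" where
  "tri_iso K S T \<longleftrightarrow>
    (\<exists>X Y Z X' Y' Z' u v w. triangle_on K X Y Z S \<and> triangle_on K X' Y' Z' T \<and>
      tri_morphism K S T u v w \<and> iso_arr K X X' u \<and> iso_arr K Y Y' v \<and> iso_arr K Z Z' w)"

locale triangulated_category = additive_category K
  for K :: "('o, 'm, 'z) tricat_scheme" (structure) +
  assumes suspension: "additive_equivalence K K (susO K) (susM K)"
    and Tri_triangle: "T \<in> Tri K \<Longrightarrow> \<exists>X Y Z. triangle_on K X Y Z T"
    and Tri_iso: "\<lbrakk>S \<in> Tri K; tri_iso K S T\<rbrakk> \<Longrightarrow> T \<in> Tri K"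
    and Tri_ident: "\<lbrakk>X \<in> ob K; zero_object K N\<rbrakk>
      \<Longrightarrow> (ident K X, zerom K X N, zerom K N (susO K X)) \<in> Tri K"
    and Tri_cone: "f \<in> arr K \<Longrightarrow> \<exists>g h. (f, g, h) \<in> Tri K"
    and Tri_rotate: "triangle_on K X Y Z (f, g, h)
      \<Longrightarrow> (f, g, h) \<in> Tri K \<longleftrightarrow> (g, h, negm K (susM K f)) \<in> Tri K"
    and Tri_complete:
      "\<lbrakk>(f, g, h) \<in> Tri K; (f', g', h') \<in> Tri K;
        u \<in> Hom K (src K f) (src K f'); v \<in> Hom K (tgt K f) (tgt K f'); v \<cdot> f = f' \<cdot> u\<rbrakk>
      \<Longrightarrow> \<exists>w. tri_morphism K (f, g, h) (f', g', h') u v w"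
    and Tri_octahedral:
      "\<lbrakk>f \<in> Hom K X Y; g \<in> Hom K Y Z;
        (f, f1, f2) \<in> Tri K; (g, g1, g2) \<in> Tri K; (g \<cdot> f, k1, k2) \<in> Tri K\<rbrakk>
      \<Longrightarrow> \<exists>a b. (a, b, susM K f1 \<cdot> g2) \<in> Tri K \<and>
            triangle_on K (tgt K f1) (tgt K k1) (tgt K g1) (a, b, susM K f1 \<cdot> g2) \<and>
            a \<cdot> f1 = k1 \<cdot> g \<and> k2 \<cdot> a = f2 \<and> b \<cdot> k1 = g1 \<and> g2 \<cdot> b = susM K f \<cdot> k2"

definition triangle_equivalence ::
  "('o, 'm, 'z) tricat_scheme \<Rightarrow> ('p, 'n, 'y) tricat_scheme \<Rightarrow>
   ('o \<Rightarrow> 'p) \<Rightarrow> ('m \<Rightarrow> 'n) \<Rightarrow> ('o \<Rightarrow> 'n) \<Rightarrow> bool" where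
  "triangle_equivalence K L FO FM \<phi> \<longleftrightarrow> additive_equivalence K L FO FM \<and>
    natural_iso K L (FO \<circ> susO K) (FM \<circ> susM K) (susO L \<circ> FO) (susM L \<circ> FM) \<phi> \<and>
    (\<forall>(f, g, h) \<in> Tri K. (FM f, FM g, \<phi> (src K f) \<cdot>\<^bsub>L\<^esub> FM h) \<in> Tri L)"

text \<open>
  Equips an additive category with a suspension and with the triangles isomorphic to a given
  family of standard triangles.
\<close>

definition with_triangles ::
  "('o, 'm) ab_cat \<Rightarrow> ('o \<Rightarrow> 'o) \<Rightarrow> ('m \<Rightarrow> 'm) \<Rightarrow> ('m \<times> 'm \<times> 'm) set \<Rightarrow> ('o, 'm) tricat" where
  "with_triangles Q sO sM Std =
    (let Q' = ab_cat.extend Q (tricat.fields sO sM {})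
     in Q'\<lparr>Tri := {T. \<exists>S \<in> Std. tri_iso Q' S T}\<rparr>)"


section \<open>Frobenius exact categories and algebraic triangulated categories\<close>

record ('o, 'm) excat = "('o, 'm) ab_cat" +
  Confl :: "('m \<times> 'm) set"

definition kernel_cokernel_pair ::
  "('o, 'm, 'z) ab_cat_scheme \<Rightarrow> 'o \<Rightarrow> 'o \<Rightarrow> 'o \<Rightarrow> 'm \<Rightarrow> 'm \<Rightarrow> bool" where
  "kernel_cokernel_pair C X Y Z i p \<longleftrightarrow>
    i \<in> Hom C X Y \<and> p \<in> Hom C Y Z \<and> p \<cdot>\<^bsub>C\<^esub> i = zerom C X Z \<and>
    (\<forall>T \<in> ob C. \<forall>t \<in> Hom C T Y. p \<cdot>\<^bsub>C\<^esub> t = zerom C T Z \<longrightarrow>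
      (\<exists>!s. s \<in> Hom C T X \<and> i \<cdot>\<^bsub>C\<^esub> s = t)) \<and>
    (\<forall>T \<in> ob C. \<forall>t \<in> Hom C Y T. t \<cdot>\<^bsub>C\<^esub> i = zerom C X T \<longrightarrow>
      (\<exists>!s. s \<in> Hom C Z T \<and> s \<cdot>\<^bsub>C\<^esub> p = t))"

definition inflation :: "('o, 'm, 'z) excat_scheme \<Rightarrow> 'm \<Rightarrow> bool" where
  "inflation C i \<longleftrightarrow> (\<exists>p. (i, p) \<in> Confl C)"

definition deflation :: "('o, 'm, 'z) excat_scheme \<Rightarrow> 'm \<Rightarrow> bool" where
  "deflation C p \<longleftrightarrow> (\<exists>i. (i, p) \<in> Confl C)"

locale exact_category = additive_category C
  for C :: "('o, 'm, 'z) excat_scheme" (structure) +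
  assumes conflation_pair: "(i, p) \<in> Confl C \<Longrightarrow> \<exists>X Y Z. kernel_cokernel_pair C X Y Z i p"
    and conflation_iso:
      "\<lbrakk>(i, p) \<in> Confl C; i \<in> Hom C X Y; p \<in> Hom C Y Z; i' \<in> Hom C X' Y'; p' \<in> Hom C Y' Z';
        iso_arr C X X' u; iso_arr C Y Y' v; iso_arr C Z Z' w;
        v \<cdot> i = i' \<cdot> u; w \<cdot> p = p' \<cdot> v\<rbrakk> \<Longrightarrow> (i', p') \<in> Confl C"
    and inflation_ident: "X \<in> ob C \<Longrightarrow> inflation C (ident C X)"
    and deflation_ident: "X \<in> ob C \<Longrightarrow> deflation C (ident C X)"
    and inflation_cmp: "\<lbrakk>i \<in> Hom C X Y; j \<in> Hom C Y Z; inflation C i; inflation C j\<rbrakk>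
      \<Longrightarrow> inflation C (j \<cdot> i)"
    and deflation_cmp: "\<lbrakk>p \<in> Hom C X Y; q \<in> Hom C Y Z; deflation C p; deflation C q\<rbrakk>
      \<Longrightarrow> deflation C (q \<cdot> p)"
    and inflation_pushout: "\<lbrakk>i \<in> Hom C X Y; inflation C i; f \<in> Hom C X X'\<rbrakk>
      \<Longrightarrow> \<exists>v i'. is_pushout C i f v i' \<and> inflation C i'"
    and deflation_pullback: "\<lbrakk>p \<in> Hom C Y Z; deflation C p; f \<in> Hom C Z' Z\<rbrakk>
      \<Longrightarrow> \<exists>v p'. is_pullback C v p' p f \<and> deflation C p'"

definition exact_proj :: "('o, 'm, 'z) excat_scheme \<Rightarrow> 'o set" where
  "exact_proj C = {P \<in> ob C. \<forall>p \<in> arr C. deflation C p \<longrightarrow>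
    (\<forall>f \<in> Hom C P (tgt C p). \<exists>g \<in> Hom C P (src C p). p \<cdot>\<^bsub>C\<^esub> g = f)}"

definition exact_inj :: "('o, 'm, 'z) excat_scheme \<Rightarrow> 'o set" where
  "exact_inj C = {I \<in> ob C. \<forall>i \<in> arr C. inflation C i \<longrightarrow>
    (\<forall>f \<in> Hom C (src C i) I. \<exists>g \<in> Hom C (tgt C i) I. g \<cdot>\<^bsub>C\<^esub> i = f)}"

locale frobenius_category = exact_category C
  for C :: "('o, 'm, 'z) excat_scheme" (structure) +
  assumes enough_projectives:
      "X \<in> ob C \<Longrightarrow> \<exists>P p. P \<in> exact_proj C \<and> p \<in> Hom C P X \<and> deflation C p"
    and enough_injectives:
      "X \<in> ob C \<Longrightarrow> \<exists>I i. I \<in> exact_inj C \<and> i \<in> Hom C X I \<and> inflation C i"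
    and proj_eq_inj: "exact_proj C = exact_inj C"

text \<open>
  The suspension in the stable category depends on the choice of a conflation
  \<open>X \<rightarrow> I X \<rightarrow> \<Sigma>X\<close> with \<open>I X\<close> injective for every object \<open>X\<close>.
\<close>

definition injective_conflations ::
  "('o, 'm, 'z) excat_scheme \<Rightarrow> ('o \<Rightarrow> 'm) \<Rightarrow> ('o \<Rightarrow> 'm) \<Rightarrow> bool" where
  "injective_conflations C i p \<longleftrightarrow>
    (\<forall>X \<in> ob C. (i X, p X) \<in> Confl C \<and> src C (i X) = X \<and> tgt C (i X) \<in> exact_inj C)"

text \<open>
  Happel's triangulation.  On morphisms, \<open>\<Sigma>\<close> sends the class of \<open>f : X \<rightarrow> Y\<close> to the class of any
  \<open>w\<close> occurring in a morphism of conflations \<open>(f, v, w)\<close>.  For the standard triangle of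
  \<open>f : X \<rightarrow> Y\<close> one forms the pushout of \<open>i X\<close> along \<open>f\<close>, with legs \<open>f' : I X \<rightarrow> Z\<close> and
  \<open>g : Y \<rightarrow> Z\<close>, and takes \<open>h : Z \<rightarrow> \<Sigma>X\<close> with \<open>h \<cdot> f' = p X\<close> and \<open>h \<cdot> g = 0\<close>.
\<close>

definition stable_category ::
  "('o, 'm) excat \<Rightarrow> ('o \<Rightarrow> 'm) \<Rightarrow> ('o \<Rightarrow> 'm) \<Rightarrow> ('o, 'm set) tricat" where
  "stable_category C i p =
    (let \<pi> = cls C (exact_proj C) in
     with_triangles (quotient_cat C (exact_proj C))
       (\<lambda>X. tgt C (p X))
       (\<lambda>S. \<pi> (SOME w. \<exists>f \<in> S. \<exists>v.
          v \<in> Hom C (tgt C (i (src C f))) (tgt C (i (tgt C f))) \<and>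
          w \<in> Hom C (tgt C (p (src C f))) (tgt C (p (tgt C f))) \<and>
          v \<cdot>\<^bsub>C\<^esub> i (src C f) = i (tgt C f) \<cdot>\<^bsub>C\<^esub> f \<and>
          w \<cdot>\<^bsub>C\<^esub> p (src C f) = p (tgt C f) \<cdot>\<^bsub>C\<^esub> v))
       {(\<pi> f, \<pi> g, \<pi> h) | f g h. \<exists>X Y Z f'.
          f \<in> Hom C X Y \<and> g \<in> Hom C Y Z \<and> h \<in> Hom C Z (tgt C (p X)) \<and>
          is_pushout C (i X) f f' g \<and>
          h \<cdot>\<^bsub>C\<^esub> f' = p X \<and> h \<cdot>\<^bsub>C\<^esub> g = zerom C Y (tgt C (p X))})"

text \<open>
  The argument of type \<open>('p \<times> 'q) itself\<close> names the types in which the objects and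
  the morphisms of the Frobenius category live, since one cannot quantify over types.
\<close>

definition algebraic_triangulated ::
  "('p \<times> 'q) itself \<Rightarrow> ('o, 'm) tricat \<Rightarrow> bool" where
  "algebraic_triangulated _ K \<longleftrightarrow> triangulated_category K \<and>
    (\<exists>(C :: ('p, 'q) excat) i p. frobenius_category C \<and> injective_conflations C i p \<and>
      (\<exists>FO FM \<phi>. triangle_equivalence K (stable_category C i p) FO FM \<phi>))"


section \<open>Proper classes of triangles\<close>

definition E_mono :: "('m \<times> 'm \<times> 'm) set \<Rightarrow> 'm \<Rightarrow> bool" where
  "E_mono E f \<longleftrightarrow> (\<exists>g h. (f, g, h) \<in> E)"

definition E_epi :: "('m \<times> 'm \<times> 'm) set \<Rightarrow> 'm \<Rightarrow> bool" where
  "E_epi E g \<longleftrightarrow> (\<exists>f h. (f, g, h) \<in> E)"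

text \<open>
  The square with \<open>f : X \<rightarrow> Y\<close>, \<open>u : X \<rightarrow> X'\<close>, \<open>v : Y \<rightarrow> Y'\<close>, \<open>f' : X' \<rightarrow> Y'\<close> is homotopy cartesian
  if it is completed by some arrow to a distinguished triangle
  \<open>X \<rightarrow> Y \<oplus> X' \<rightarrow> Y' \<rightarrow> \<Sigma>X\<close> with first map \<open>(f, u)\<close> and second map \<open>(v, - f')\<close>.
  Then \<open>f'\<close> is a homotopy pushout of \<open>f\<close> along \<open>u\<close>, and \<open>u\<close> is a homotopy pullback of
  \<open>v\<close> along \<open>f'\<close>.
\<close>

definition homotopy_cartesian ::
  "('o, 'm, 'z) tricat_scheme \<Rightarrow> 'm \<Rightarrow> 'm \<Rightarrow> 'm \<Rightarrow> 'm \<Rightarrow> bool" where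
  "homotopy_cartesian K f u v f' \<longleftrightarrow>
    (\<exists>X Y X' Y' S i1 i2 p1 p2 d.
      f \<in> Hom K X Y \<and> u \<in> Hom K X X' \<and> v \<in> Hom K Y Y' \<and> f' \<in> Hom K X' Y' \<and>
      biproduct K Y X' S i1 i2 p1 p2 \<and>
      (addm K (i1 \<cdot>\<^bsub>K\<^esub> f) (i2 \<cdot>\<^bsub>K\<^esub> u), subm K (v \<cdot>\<^bsub>K\<^esub> p1) (f' \<cdot>\<^bsub>K\<^esub> p2), d) \<in> Tri K)"

definition tri_direct_sum ::
  "('o, 'm, 'z) tricat_scheme \<Rightarrow> 'm \<times> 'm \<times> 'm \<Rightarrow> 'm \<times> 'm \<times> 'm \<Rightarrow> 'm \<times> 'm \<times> 'm \<Rightarrow> bool" where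
  "tri_direct_sum K T1 T2 T \<longleftrightarrow>
    (\<exists>X1 Y1 Z1 X2 Y2 Z2 X Y Z a1 a2 a1' a2' b1 b2 b1' b2' c1 c2 c1' c2'.
      triangle_on K X1 Y1 Z1 T1 \<and> triangle_on K X2 Y2 Z2 T2 \<and> triangle_on K X Y Z T \<and>
      biproduct K X1 X2 X a1 a2 a1' a2' \<and>
      biproduct K Y1 Y2 Y b1 b2 b1' b2' \<and>
      biproduct K Z1 Z2 Z c1 c2 c1' c2' \<and>
      tri_morphism K T1 T a1 b1 c1 \<and> tri_morphism K T2 T a2 b2 c2)"

definition tri_retract ::
  "('o, 'm, 'z) tricat_scheme \<Rightarrow> 'm \<times> 'm \<times> 'm \<Rightarrow> 'm \<times> 'm \<times> 'm \<Rightarrow> bool" where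
  "tri_retract K T S \<longleftrightarrow>
    (\<exists>X Y Z u v w u' v' w'. triangle_on K X Y Z T \<and>
      tri_morphism K T S u v w \<and> tri_morphism K S T u' v' w' \<and>
      u' \<cdot>\<^bsub>K\<^esub> u = ident K X \<and> v' \<cdot>\<^bsub>K\<^esub> v = ident K Y \<and> w' \<cdot>\<^bsub>K\<^esub> w = ident K Z)"

locale proper_class = triangulated_category K
  for K :: "('o, 'm, 'z) tricat_scheme" (structure) +
  fixes E :: "('m \<times> 'm \<times> 'm) set"
  assumes E_Tri: "E \<subseteq> Tri K"
    and E_iso: "\<lbrakk>S \<in> E; tri_iso K S T\<rbrakk> \<Longrightarrow> T \<in> E"
    and E_suspension: "(f, g, h) \<in> E
      \<Longrightarrow> (negm K (susM K f), negm K (susM K g), negm K (susM K h)) \<in> E"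
    and E_sum: "\<lbrakk>T1 \<in> E; T2 \<in> E; T \<in> Tri K; tri_direct_sum K T1 T2 T\<rbrakk> \<Longrightarrow> T \<in> E"
    and E_retract: "\<lbrakk>S \<in> E; T \<in> Tri K; tri_retract K T S\<rbrakk> \<Longrightarrow> T \<in> E"
    and E_ident_left: "\<lbrakk>X \<in> ob K; zero_object K N\<rbrakk>
      \<Longrightarrow> (ident K X, zerom K X N, zerom K N (susO K X)) \<in> E"
    and E_ident_right: "\<lbrakk>Y \<in> ob K; zero_object K N\<rbrakk>
      \<Longrightarrow> (zerom K N Y, ident K Y, zerom K Y (susO K N)) \<in> E"
    and E_mono_pushout: "\<lbrakk>homotopy_cartesian K f u v f'; E_mono E f\<rbrakk> \<Longrightarrow> E_mono E f'"
    and E_epi_pullback: "\<lbrakk>homotopy_cartesian K f u v f'; E_epi E v\<rbrakk> \<Longrightarrow> E_epi E u"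
    and E_saturated: "\<lbrakk>homotopy_cartesian K f u v f'; E_epi E f'; E_epi E u\<rbrakk> \<Longrightarrow> E_epi E v"

definition E_proj :: "('o, 'm, 'z) tricat_scheme \<Rightarrow> ('m \<times> 'm \<times> 'm) set \<Rightarrow> 'o set" where
  \<comment> \<open>exactness of \<open>0 \<rightarrow> K(P,X) \<rightarrow> K(P,Y) \<rightarrow> K(P,Z) \<rightarrow> 0\<close>\<close>
  "E_proj K E = {P \<in> ob K. \<forall>X Y Z f g h. (f, g, h) \<in> E \<and> triangle_on K X Y Z (f, g, h) \<longrightarrow>
    inj_on (\<lambda>a. f \<cdot>\<^bsub>K\<^esub> a) (Hom K P X) \<and>
    (\<lambda>a. f \<cdot>\<^bsub>K\<^esub> a) ` Hom K P X = {b \<in> Hom K P Y. g \<cdot>\<^bsub>K\<^esub> b = zerom K P Z} \<and>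
    (\<lambda>b. g \<cdot>\<^bsub>K\<^esub> b) ` Hom K P Y = Hom K P Z}"

definition E_inj :: "('o, 'm, 'z) tricat_scheme \<Rightarrow> ('m \<times> 'm \<times> 'm) set \<Rightarrow> 'o set" where
  \<comment> \<open>exactness of \<open>0 \<rightarrow> K(Z,I) \<rightarrow> K(Y,I) \<rightarrow> K(X,I) \<rightarrow> 0\<close>\<close>
  "E_inj K E = {I \<in> ob K. \<forall>X Y Z f g h. (f, g, h) \<in> E \<and> triangle_on K X Y Z (f, g, h) \<longrightarrow>
    inj_on (\<lambda>c. c \<cdot>\<^bsub>K\<^esub> g) (Hom K Z I) \<and>
    (\<lambda>c. c \<cdot>\<^bsub>K\<^esub> g) ` Hom K Z I = {b \<in> Hom K Y I. b \<cdot>\<^bsub>K\<^esub> f = zerom K X I} \<and>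
    (\<lambda>b. b \<cdot>\<^bsub>K\<^esub> f) ` Hom K Y I = Hom K X I}"

locale frobenius_class = proper_class K E
  for K :: "('o, 'm, 'z) tricat_scheme" (structure) and E +
  assumes E_enough_projectives:
      "X \<in> ob K \<Longrightarrow> \<exists>P e. P \<in> E_proj K E \<and> e \<in> Hom K P X \<and> E_epi E e"
    and E_enough_injectives:
      "X \<in> ob K \<Longrightarrow> \<exists>I m. I \<in> E_inj K E \<and> m \<in> Hom K X I \<and> E_mono E m"
    and E_proj_eq_inj: "E_proj K E = E_inj K E"


section \<open>The relative stable category\<close>

text \<open>
  The choice, for every object \<open>X\<close>, of a distinguished triangle
  \<open>X \<rightarrow> X\<^sub>E \<rightarrow> X' \<rightarrow> \<Sigma>X\<close> with maps \<open>i X\<close>, \<open>p X\<close>, \<open>q X\<close>, such that \<open>i X\<close> is an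
  E-monomorphism into an E-injective object.
\<close>

definition injective_triangles ::
  "('o, 'm, 'z) tricat_scheme \<Rightarrow> ('m \<times> 'm \<times> 'm) set \<Rightarrow>
   ('o \<Rightarrow> 'm) \<Rightarrow> ('o \<Rightarrow> 'm) \<Rightarrow> ('o \<Rightarrow> 'm) \<Rightarrow> bool" where
  "injective_triangles K E i p q \<longleftrightarrow>
    (\<forall>X \<in> ob K. (i X, p X, q X) \<in> Tri K \<and> E_mono E (i X) \<and>
      src K (i X) = X \<and> tgt K (i X) \<in> E_inj K E)"

text \<open>
  On morphisms, the relative suspension sends the class of \<open>f : X \<rightarrow> Y\<close> to the class of any \<open>w\<close>
  occurring in a morphism \<open>(f, v, w)\<close> between the chosen triangles of \<open>X\<close> and \<open>Y\<close>.
\<close>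

definition relative_stable_category ::
  "('o, 'm) tricat \<Rightarrow> ('m \<times> 'm \<times> 'm) set \<Rightarrow>
   ('o \<Rightarrow> 'm) \<Rightarrow> ('o \<Rightarrow> 'm) \<Rightarrow> ('o \<Rightarrow> 'm) \<Rightarrow> ('o, 'm set) tricat" where
  "relative_stable_category K E i p q =
    (let \<pi> = cls K (E_proj K E);
         \<Delta> = (\<lambda>X. (i X, p X, q X)) in
     with_triangles (quotient_cat K (E_proj K E))
       (\<lambda>X. tgt K (p X))
       (\<lambda>S. \<pi> (SOME w. \<exists>f \<in> S. \<exists>v. tri_morphism K (\<Delta> (src K f)) (\<Delta> (tgt K f)) f v w))
       {(\<pi> f, \<pi> g, \<pi> h) | f g h. \<exists>X Y f' k.
          f \<in> Hom K X Y \<and>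
          homotopy_cartesian K (i X) f f' g \<and>
          (g, h, k) \<in> Tri K \<and>
          tri_morphism K (\<Delta> X) (g, h, k) f f' (ident K (tgt K (p X)))})"

end

theory Submission
  imports Defs
begin

text \<open>
  Up to equivalence \<open>K\<close> is the stable category of a Frobenius category \<open>C\<close>.  The idea is to keep the
  category \<open>C\<close> and to make its exact structure smaller.  Let \<open>P\<close> consist of the objects of \<open>C\<close> that
  correspond to \<open>E\<close>-projective objects.  A conflation of \<open>C\<close> gives a triangle of \<open>K\<close>; it is kept if the
  connecting map of this triangle is a phantom, which means that it vanishes on all maps from objects
  of \<open>P\<close>.  Then \<open>C\<close> with the remaining conflations is again a Frobenius category, and its
  projective-injective objects are those of \<open>P\<close> (\<open>E_frobenius\<close>, \<open>exact_proj_E\<close>).  As an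
  additive category, its stable category \<open>C/P\<close> is equivalent to \<open>K/proj(E)\<close>.

  That the smaller class of conflations is an exact structure rests on a symmetry.  Because there are
  enough \<open>E\<close>-projectives and \<open>E\<close>-injectives and the two classes coincide, a map \<open>Z \<rightarrow> \<Sigma>X\<close> is a phantom
  if and only if it is killed by \<open>\<Sigma>b\<close> for every map \<open>b\<close> from \<open>X\<close> to an object of \<open>P\<close>
  (\<open>phantom_iff_cophantom\<close>).  In terms of conflations: maps from objects of \<open>P\<close> lift along the
  deflation if and only if maps to objects of \<open>P\<close> extend along the inflation.  The first property is
  visibly stable under composition and pullback of deflations, the second one under composition and
  pushout of inflations.  Enough projectives exist since every map \<open>Z \<rightarrow> \<Sigma>X\<close> of the stable category is
  the connecting map of a conflation (\<open>realize_third_arrow\<close>).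

  It remains to compare the triangulations of \<open>K/proj(E)\<close> and \<open>C/P\<close>.  Both follow one recipe, the
  locale \<open>stable_quotient\<close>: choose triangles \<open>X \<rightarrow> I \<rightarrow> X' \<rightarrow> \<Sigma>X\<close> with \<open>I\<close> in \<open>P\<close> whose connecting map
  \<open>q\<close> is a phantom; the new suspension of \<open>X\<close> is \<open>X'\<close>, and the standard triangles on \<open>f : X \<rightarrow> Y\<close> are
  those \<open>(f, g, h)\<close> for which \<open>(g, h, \<Sigma>f \<cdot> q)\<close> is a triangle of the old triangulation.  Composition with
  \<open>q\<close> identifies maps into \<open>X'\<close> modulo \<open>P\<close> with phantoms into \<open>\<Sigma>X\<close> (\<open>factor_phantom\<close>,
  \<open>factors_of_eq\<close>).  Therefore the recipe is independent of all choices and invariant under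
  equivalences, which gives an equivalence of triangulated categories
  (\<open>comparison_equivalence\<close>).  The comparison of third objects of triangles needs a five lemma modulo
  \<open>P\<close>, for which it suffices that the error terms have square zero (\<open>middle_iso\<close>, \<open>iso_of_nilpotent\<close>).

  Happel's theorem (\<open>stable_triangulated\<close>) says that stable categories of Frobenius categories are
  triangulated.  It is applied to both exact structures on \<open>C\<close>: for the original one it makes the
  calculus of triangles and phantoms available, for the smaller one it yields the axioms for \<open>C/P\<close>,
  and these are transported to \<open>K/proj(E)\<close> along the equivalence (\<open>K_triangulated\<close>).
\<close>

section \<open>Categories and equivalences\<close>

notation addm ("_ \<oplus>\<index> _" [65,66] 65)
notation subm ("_ \<ominus>\<index> _" [65,66] 65)
notation negm ("\<ominus>\<index> _" [81] 80)

lemma Hom_iff [simp]: "f \<in> Hom C X Y \<longleftrightarrow> f \<in> arr C \<and> src C f = X \<and> tgt C f = Y"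
  by (auto simp: Hom_def)

context category
begin

lemma src_in_ob [simp]: "f \<in> arr C \<Longrightarrow> src C f \<in> ob C"
  and tgt_in_ob [simp]: "f \<in> arr C \<Longrightarrow> tgt C f \<in> ob C"
  by (auto intro: src_ob tgt_ob)

lemma Hom_ob: assumes "f \<in> Hom C X Y" shows "X \<in> ob C" "Y \<in> ob C"
  using assms by (auto intro: src_ob tgt_ob)

lemma ident_arr [simp]:
  "X \<in> ob C \<Longrightarrow> ident C X \<in> arr C"
  "X \<in> ob C \<Longrightarrow> src C (ident C X) = X"
  "X \<in> ob C \<Longrightarrow> tgt C (ident C X) = X"
  using ident_hom[of X] by auto

lemma cmp_arr [simp]:
  assumes "f \<in> arr C" "g \<in> arr C" "tgt C f = src C g"
  shows "g \<cdot> f \<in> arr C" "src C (g \<cdot> f) = src C f" "tgt C (g \<cdot> f) = tgt C g"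
  using cmp_hom[of f "src C f" "tgt C f" g "tgt C g"] assms by auto

lemma cmp_ident [simp]:
  "\<lbrakk>f \<in> arr C; src C f = X\<rbrakk> \<Longrightarrow> f \<cdot> ident C X = f"
  "\<lbrakk>f \<in> arr C; tgt C f = X\<rbrakk> \<Longrightarrow> ident C X \<cdot> f = f"
  using cmp_ident_right[of f X "tgt C f"] cmp_ident_left[of f "src C f" X] by auto

lemma assoc [simp]:
  assumes "f \<in> arr C" "g \<in> arr C" "h \<in> arr C" "tgt C f = src C g" "tgt C g = src C h"
  shows "h \<cdot> g \<cdot> f = h \<cdot> (g \<cdot> f)"
  using cmp_assoc[of f "src C f" "tgt C f" g "tgt C g" h "tgt C h"] assms by auto

text \<open>
  The simplifier brackets composites to the right, so an equation for \<open>g \<cdot> f\<close> does not apply inside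
  \<open>g \<cdot> (f \<cdot> t)\<close>; this rule provides its version with a tail \<open>t\<close>.
\<close>

lemma reassoc:
  assumes "g \<cdot> f = k" "f \<in> arr C" "g \<in> arr C" "t \<in> arr C" "tgt C f = src C g" "tgt C t = src C f"
  shows "g \<cdot> (f \<cdot> t) = k \<cdot> t"
  using assms by (metis assoc)

lemma iso_arrI:
  assumes "f \<in> Hom C X Y" "g \<in> Hom C Y X" "g \<cdot> f = ident C X" "f \<cdot> g = ident C Y"
  shows "iso_arr C X Y f"
  using assms unfolding iso_arr_def by blast

lemma iso_arrE:
  assumes "iso_arr C X Y f"
  obtains g where "f \<in> Hom C X Y" "g \<in> Hom C Y X" "g \<cdot> f = ident C X" "f \<cdot> g = ident C Y"
    "iso_arr C Y X g"
  using assms unfolding iso_arr_def by blast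

lemma iso_ident: "X \<in> ob C \<Longrightarrow> iso_arr C X X (ident C X)"
  by (rule iso_arrI[where g = "ident C X"]) auto

lemma iso_cmp:
  assumes "iso_arr C X Y f" "iso_arr C Y Z g"
  shows "iso_arr C X Z (g \<cdot> f)"
proof -
  obtain f' where f: "f \<in> Hom C X Y" "f' \<in> Hom C Y X" "f' \<cdot> f = ident C X" "f \<cdot> f' = ident C Y"
    using assms(1) by (auto elim: iso_arrE)
  obtain g' where g: "g \<in> Hom C Y Z" "g' \<in> Hom C Z Y" "g' \<cdot> g = ident C Y" "g \<cdot> g' = ident C Z"
    using assms(2) by (auto elim: iso_arrE)
  show ?thesis
    by (rule iso_arrI[where g = "f' \<cdot> g'"])
      (use f g in \<open>auto simp: reassoc[OF f(3)] reassoc[OF f(4)] reassoc[OF g(3)] reassoc[OF g(4)]\<close>)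
qed

lemma iso_cancel_left:
  assumes "iso_arr C Y Z g" "f \<in> Hom C X Y" "f' \<in> Hom C X Y" "g \<cdot> f = g \<cdot> f'"
  shows "f = f'"
proof -
  obtain g' where g: "g \<in> Hom C Y Z" "g' \<in> Hom C Z Y" "g' \<cdot> g = ident C Y"
    using assms(1) by (auto elim: iso_arrE)
  have "f = g' \<cdot> (g \<cdot> f)" "f' = g' \<cdot> (g \<cdot> f')"
    using g assms(2,3) by (auto simp: reassoc[OF g(3)])
  then show ?thesis using assms(4) by simp
qed

lemma iso_cancel_right:
  assumes "iso_arr C X Y g" "f \<in> Hom C Y Z" "f' \<in> Hom C Y Z" "f \<cdot> g = f' \<cdot> g"
  shows "f = f'"
proof -
  obtain g' where g: "g \<in> Hom C X Y" "g' \<in> Hom C Y X" "g \<cdot> g' = ident C Y"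
    using assms(1) by (auto elim: iso_arrE)
  have "f = f \<cdot> g \<cdot> g'" "f' = f' \<cdot> g \<cdot> g'"
    using g assms(2,3) by auto
  then show ?thesis using assms(4) by simp
qed

lemma zero_object_unique:
  assumes "zero_object C N" "f \<in> arr C" "g \<in> arr C" "src C f = src C g" "tgt C f = tgt C g"
    "src C f = N \<or> tgt C f = N"
  shows "f = g"
proof -
  have "f \<in> Hom C (src C f) (tgt C f)" "g \<in> Hom C (src C f) (tgt C f)" using assms by auto
  moreover have "\<exists>!f'. f' \<in> Hom C (src C f) (tgt C f)"
    using assms unfolding zero_object_def by (metis src_ob tgt_ob)
  ultimately show ?thesis by blast
qed

lemma zero_object_hom:
  assumes "zero_object C N" "X \<in> ob C"
  obtains f g where "f \<in> Hom C N X" "g \<in> Hom C X N"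
  using assms unfolding zero_object_def by metis

lemma zero_object_iso:
  assumes "zero_object C N" "zero_object C N'"
  shows "\<exists>u. iso_arr C N N' u"
proof -
  have N: "N \<in> ob C" "N' \<in> ob C" using assms by (auto simp: zero_object_def)
  obtain u v where uv: "u \<in> Hom C N N'" "v \<in> Hom C N' N"
    using zero_object_hom[OF assms(1) N(2)] .
  have "v \<cdot> u = ident C N" "u \<cdot> v = ident C N'"
    by (rule zero_object_unique[OF assms(1)], use N uv in auto)
       (rule zero_object_unique[OF assms(2)], use N uv in auto)
  then show ?thesis using uv iso_arrI by blast
qed

end

context cat_functor
begin

lemma functor_arr [simp]:
  assumes "f \<in> arr C"
  shows "FM f \<in> arr D" "src D (FM f) = FO (src C f)" "tgt D (FM f) = FO (tgt C f)"
  using functor_hom[of f "src C f" "tgt C f"] assms by auto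

lemma functor_obj [simp]: "X \<in> ob C \<Longrightarrow> FO X \<in> ob D"
  by (rule functor_ob)

lemma functor_comp [simp]:
  assumes "f \<in> arr C" "g \<in> arr C" "tgt C f = src C g"
  shows "FM (g \<cdot>\<^bsub>C\<^esub> f) = FM g \<cdot>\<^bsub>D\<^esub> FM f"
  using functor_cmp[of f "src C f" "tgt C f" g "tgt C g"] assms by auto

lemma functor_id [simp]: "X \<in> ob C \<Longrightarrow> FM (ident C X) = ident D (FO X)"
  by (rule functor_ident)

lemma functor_iso:
  assumes "iso_arr C X Y f" shows "iso_arr D (FO X) (FO Y) (FM f)"
proof -
  obtain g where g: "f \<in> Hom C X Y" "g \<in> Hom C Y X" "g \<cdot>\<^bsub>C\<^esub> f = ident C X" "f \<cdot>\<^bsub>C\<^esub> g = ident C Y"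
    using assms by (auto elim: C.iso_arrE)
  have "FM (g \<cdot>\<^bsub>C\<^esub> f) = FM g \<cdot>\<^bsub>D\<^esub> FM f" "FM (f \<cdot>\<^bsub>C\<^esub> g) = FM f \<cdot>\<^bsub>D\<^esub> FM g"
    using g(1,2) by auto
  then show ?thesis
    by (intro D.iso_arrI[where g = "FM g"]) (use g C.Hom_ob[OF g(1)] functor_hom in auto)
qed

text \<open>
  Choose an object and an isomorphism \<open>e Y\<close> over every \<open>Y\<close>; a map of \<open>D\<close>, conjugated by these
  isomorphisms, has a unique preimage, and this defines the quasi-inverse.  Equations in \<open>C\<close> hold
  because they hold after applying the faithful functor.
\<close>

lemma equivalenceI:
  assumes full: "\<And>X Y g. \<lbrakk>X \<in> ob C; Y \<in> ob C; g \<in> Hom D (FO X) (FO Y)\<rbrakk> \<Longrightarrow> \<exists>f \<in> Hom C X Y. FM f = g"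
    and faithful: "\<And>X Y f f'. \<lbrakk>f \<in> Hom C X Y; f' \<in> Hom C X Y; FM f = FM f'\<rbrakk> \<Longrightarrow> f = f'"
    and ess: "\<And>Y. Y \<in> ob D \<Longrightarrow> \<exists>X \<in> ob C. \<exists>e. iso_arr D (FO X) Y e"
  shows "equivalence C D FO FM"
proof -
  have "\<forall>Y. \<exists>X e e'. Y \<in> ob D \<longrightarrow> X \<in> ob C \<and> e \<in> Hom D (FO X) Y \<and> e' \<in> Hom D Y (FO X) \<and>
     e' \<cdot>\<^bsub>D\<^esub> e = ident D (FO X) \<and> e \<cdot>\<^bsub>D\<^esub> e' = ident D Y"
    using ess unfolding iso_arr_def by metis
  then obtain GO e e' where
    "\<And>Y. Y \<in> ob D \<Longrightarrow> GO Y \<in> ob C \<and> e Y \<in> Hom D (FO (GO Y)) Y \<and> e' Y \<in> Hom D Y (FO (GO Y)) \<and>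
     e' Y \<cdot>\<^bsub>D\<^esub> e Y = ident D (FO (GO Y)) \<and> e Y \<cdot>\<^bsub>D\<^esub> e' Y = ident D Y"
    by metis
  then have G [simp]: "Y \<in> ob D \<Longrightarrow> GO Y \<in> ob C"
    "Y \<in> ob D \<Longrightarrow> e Y \<in> arr D" "Y \<in> ob D \<Longrightarrow> src D (e Y) = FO (GO Y)" "Y \<in> ob D \<Longrightarrow> tgt D (e Y) = Y"
    "Y \<in> ob D \<Longrightarrow> e' Y \<in> arr D" "Y \<in> ob D \<Longrightarrow> src D (e' Y) = Y" "Y \<in> ob D \<Longrightarrow> tgt D (e' Y) = FO (GO Y)"
    "Y \<in> ob D \<Longrightarrow> e' Y \<cdot>\<^bsub>D\<^esub> e Y = ident D (FO (GO Y))" "Y \<in> ob D \<Longrightarrow> e Y \<cdot>\<^bsub>D\<^esub> e' Y = ident D Y" for Y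
    by auto
  have [simp]: "e' Y \<cdot>\<^bsub>D\<^esub> (e Y \<cdot>\<^bsub>D\<^esub> t) = t" if "Y \<in> ob D" "t \<in> arr D" "tgt D t = FO (GO Y)" for Y t
    using that by (simp add: D.reassoc[OF G(8)])
  have [simp]: "e Y \<cdot>\<^bsub>D\<^esub> (e' Y \<cdot>\<^bsub>D\<^esub> t) = t" if "Y \<in> ob D" "t \<in> arr D" "tgt D t = Y" for Y t
    using that by (simp add: D.reassoc[OF G(9)])
  have "\<forall>g. \<exists>f. g \<in> arr D \<longrightarrow> f \<in> Hom C (GO (src D g)) (GO (tgt D g)) \<and> FM f = e' (tgt D g) \<cdot>\<^bsub>D\<^esub> (g \<cdot>\<^bsub>D\<^esub> e (src D g))"
  proof
    fix g
    show "\<exists>f. g \<in> arr D \<longrightarrow> f \<in> Hom C (GO (src D g)) (GO (tgt D g)) \<and> FM f = e' (tgt D g) \<cdot>\<^bsub>D\<^esub> (g \<cdot>\<^bsub>D\<^esub> e (src D g))"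
    proof (cases "g \<in> arr D")
      case True
      then show ?thesis
        using full[of "GO (src D g)" "GO (tgt D g)" "e' (tgt D g) \<cdot>\<^bsub>D\<^esub> (g \<cdot>\<^bsub>D\<^esub> e (src D g))"] by auto
    qed auto
  qed
  then obtain GM where "\<And>g. g \<in> arr D \<Longrightarrow> GM g \<in> Hom C (GO (src D g)) (GO (tgt D g)) \<and>
      FM (GM g) = e' (tgt D g) \<cdot>\<^bsub>D\<^esub> (g \<cdot>\<^bsub>D\<^esub> e (src D g))" by metis
  then have GM [simp]: "g \<in> arr D \<Longrightarrow> GM g \<in> arr C" "g \<in> arr D \<Longrightarrow> src C (GM g) = GO (src D g)"
     "g \<in> arr D \<Longrightarrow> tgt C (GM g) = GO (tgt D g)"
     "g \<in> arr D \<Longrightarrow> FM (GM g) = e' (tgt D g) \<cdot>\<^bsub>D\<^esub> (g \<cdot>\<^bsub>D\<^esub> e (src D g))" for g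
    by auto
  have "\<forall>X. \<exists>f. X \<in> ob C \<longrightarrow> f \<in> Hom C X (GO (FO X)) \<and> FM f = e' (FO X)"
  proof
    fix X
    show "\<exists>f. X \<in> ob C \<longrightarrow> f \<in> Hom C X (GO (FO X)) \<and> FM f = e' (FO X)"
    proof (cases "X \<in> ob C")
      case True
      then show ?thesis using full[of X "GO (FO X)" "e' (FO X)"] by auto
    qed simp
  qed
  then obtain \<eta> where "\<And>X. X \<in> ob C \<Longrightarrow> \<eta> X \<in> Hom C X (GO (FO X)) \<and> FM (\<eta> X) = e' (FO X)"
    by metis
  then have eta [simp]: "X \<in> ob C \<Longrightarrow> \<eta> X \<in> arr C" "X \<in> ob C \<Longrightarrow> src C (\<eta> X) = X"
     "X \<in> ob C \<Longrightarrow> tgt C (\<eta> X) = GO (FO X)" "X \<in> ob C \<Longrightarrow> FM (\<eta> X) = e' (FO X)" for X by auto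
  have eq: "f = f'" if "FM f = FM f'" "f \<in> arr C" "f' \<in> arr C" "src C f = src C f'" "tgt C f = tgt C f'" for f f'
    using that faithful by auto
  have F1: "cat_functor D C GO GM"
  proof unfold_locales
    fix f X Y assume "f \<in> Hom D X Y" then show "GM f \<in> Hom C (GO X) (GO Y)" by auto
  next
    fix X assume "X \<in> ob D" then show "GM (ident D X) = ident C (GO X)"
      by - (rule eq; auto)
  next
    fix f g X Y Z assume "f \<in> Hom D X Y" "g \<in> Hom D Y Z"
    then show "GM (g \<cdot>\<^bsub>D\<^esub> f) = GM g \<cdot>\<^bsub>C\<^esub> GM f" by - (rule eq; auto simp: D.Hom_ob)
  qed simp
  have "iso_arr C X (GO (FO X)) (\<eta> X)" if X: "X \<in> ob C" for X
  proof -
    obtain f where "f \<in> Hom C (GO (FO X)) X" "FM f = e (FO X)"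
      using full[of "GO (FO X)" X "e (FO X)"] X by auto
    then have f [simp]: "f \<in> arr C" "src C f = GO (FO X)" "tgt C f = X" "FM f = e (FO X)" by auto
    have "f \<cdot>\<^bsub>C\<^esub> \<eta> X = ident C X" "\<eta> X \<cdot>\<^bsub>C\<^esub> f = ident C (GO (FO X))"
      by (rule eq; use X in simp)+
    then show ?thesis using X by (intro C.iso_arrI[where g = f]) auto
  qed
  moreover have "\<eta> Y \<cdot>\<^bsub>C\<^esub> f = GM (FM f) \<cdot>\<^bsub>C\<^esub> \<eta> X" if "f \<in> Hom C X Y" "X \<in> ob C" "Y \<in> ob C" for X Y f
  proof -
    have [unfolded Hom_iff, simp]: "f \<in> Hom C X Y" using that by auto
    show ?thesis by (rule eq; use that(2,3) in simp)
  qed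
  ultimately have N1: "natural_iso C C id id (GO \<circ> FO) (GM \<circ> FM) \<eta>"
    unfolding natural_iso_def by auto
  have "iso_arr D (FO (GO Y)) Y (e Y)" if "Y \<in> ob D" for Y
    by (rule D.iso_arrI[where g = "e' Y"]) (use that in auto)
  then have N2: "natural_iso D D (FO \<circ> GO) (FM \<circ> GM) id id e"
    unfolding natural_iso_def by auto
  show ?thesis unfolding equivalence_def using F1 N1 N2 cat_functor_axioms by blast
qed

end

lemma natural_isoD:
  assumes "natural_iso C D FO FM GO GM \<eta>"
  shows "X \<in> ob C \<Longrightarrow> iso_arr D (FO X) (GO X) (\<eta> X)"
    "\<lbrakk>X \<in> ob C; Y \<in> ob C; f \<in> Hom C X Y\<rbrakk> \<Longrightarrow> \<eta> Y \<cdot>\<^bsub>D\<^esub> FM f = GM f \<cdot>\<^bsub>D\<^esub> \<eta> X"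
  using assms unfolding natural_iso_def by blast+

lemma equivalence_faithful:
  assumes "equivalence C D FO FM" "f \<in> Hom C X Y" "f' \<in> Hom C X Y" "FM f = FM f'"
  shows "f = f'"
proof -
  obtain GO GM \<eta> \<epsilon> where G: "cat_functor D C GO GM" "natural_iso C C id id (GO \<circ> FO) (GM \<circ> FM) \<eta>"
    using assms(1) unfolding equivalence_def by blast
  interpret cat_functor C D FO FM using assms(1) unfolding equivalence_def by blast
  have ob: "X \<in> ob C" "Y \<in> ob C" using assms(2) C.Hom_ob by blast+
  have "\<eta> Y \<cdot>\<^bsub>C\<^esub> f = \<eta> Y \<cdot>\<^bsub>C\<^esub> f'"
    using natural_isoD(2)[OF G(2) ob assms(2)] natural_isoD(2)[OF G(2) ob assms(3)] assms(4) by simp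
  moreover have "iso_arr C Y (GO (FO Y)) (\<eta> Y)" using natural_isoD(1)[OF G(2) ob(2)] by simp
  ultimately show ?thesis using C.iso_cancel_left assms(2,3) by blast
qed

lemma equivalence_ess_surj:
  assumes "equivalence C D FO FM" "Y \<in> ob D"
  obtains X e where "X \<in> ob C" "iso_arr D (FO X) Y e"
proof -
  obtain GO GM \<eta> \<epsilon> where G: "cat_functor D C GO GM" "natural_iso D D (FO \<circ> GO) (FM \<circ> GM) id id \<epsilon>"
    using assms(1) unfolding equivalence_def by blast
  show ?thesis
  proof (rule that)
    show "GO Y \<in> ob C" using cat_functor.functor_ob[OF G(1) assms(2)] .
    show "iso_arr D (FO (GO Y)) Y (\<epsilon> Y)" using natural_isoD(1)[OF G(2) assms(2)] by simp
  qed
qed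

text \<open>
  The preimage of \<open>g\<close> is \<open>G g\<close> conjugated by the unit.  It has the right image because \<open>G\<close> takes
  both maps to the same value and the counit is a natural isomorphism.
\<close>

lemma equivalence_full:
  assumes "equivalence C D FO FM" "X \<in> ob C" "Y \<in> ob C" "g \<in> Hom D (FO X) (FO Y)"
  obtains f where "f \<in> Hom C X Y" "FM f = g"
proof -
  obtain GO GM \<eta> \<epsilon> where G: "cat_functor D C GO GM" "natural_iso C C id id (GO \<circ> FO) (GM \<circ> FM) \<eta>"
    "natural_iso D D (FO \<circ> GO) (FM \<circ> GM) id id \<epsilon>"
    using assms(1) unfolding equivalence_def by blast
  interpret F: cat_functor C D FO FM using assms(1) unfolding equivalence_def by blast
  interpret G: cat_functor D C GO GM by fact
  obtain m where m: "\<eta> Y \<in> Hom C Y (GO (FO Y))" "m \<in> Hom C (GO (FO Y)) Y" "m \<cdot>\<^bsub>C\<^esub> \<eta> Y = ident C Y" "\<eta> Y \<cdot>\<^bsub>C\<^esub> m = ident C (GO (FO Y))"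
    using natural_isoD(1)[OF G(2) assms(3)] by (auto elim: F.C.iso_arrE)
  have x: "\<eta> X \<in> Hom C X (GO (FO X))" "iso_arr C X (GO (FO X)) (\<eta> X)" using natural_isoD(1)[OF G(2) assms(2)] by (auto elim: F.C.iso_arrE)
  define f where "f = m \<cdot>\<^bsub>C\<^esub> (GM g \<cdot>\<^bsub>C\<^esub> \<eta> X)"
  have f: "f \<in> Hom C X Y" using assms m x by (auto simp: f_def)
  have nat: "\<eta> Y \<cdot>\<^bsub>C\<^esub> f = GM (FM f) \<cdot>\<^bsub>C\<^esub> \<eta> X"
    using natural_isoD(2)[OF G(2) assms(2,3) f] by simp
  have "\<eta> Y \<cdot>\<^bsub>C\<^esub> f = GM g \<cdot>\<^bsub>C\<^esub> \<eta> X"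
    unfolding f_def using m x assms by (simp add: F.C.reassoc[OF m(4)])
  then have "GM (FM f) \<cdot>\<^bsub>C\<^esub> \<eta> X = GM g \<cdot>\<^bsub>C\<^esub> \<eta> X" using nat by simp
  then have GG: "GM (FM f) = GM g"
    using F.C.iso_cancel_right[OF x(2), of "GM (FM f)" _ "GM g"] f assms by simp
  have ob: "FO X \<in> ob D" "FO Y \<in> ob D" and Ff: "FM f \<in> Hom D (FO X) (FO Y)" using assms f by auto
  have "iso_arr D (FO (GO (FO X))) (FO X) (\<epsilon> (FO X))" using natural_isoD(1)[OF G(3) ob(1)] by simp
  moreover have "FM f \<cdot>\<^bsub>D\<^esub> \<epsilon> (FO X) = g \<cdot>\<^bsub>D\<^esub> \<epsilon> (FO X)"
    using natural_isoD(2)[OF G(3) ob Ff] natural_isoD(2)[OF G(3) ob assms(4)] GG by simp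
  ultimately have "FM f = g"
    using F.D.iso_cancel_right Ff assms(4) by blast
  with f show ?thesis by (rule that)
qed

lemma equivalence_reflects_iso:
  assumes "equivalence C D FO FM" "f \<in> Hom C X Y" "iso_arr D (FO X) (FO Y) (FM f)"
  shows "iso_arr C X Y f"
proof -
  interpret F: cat_functor C D FO FM using assms(1) unfolding equivalence_def by blast
  obtain h where h: "h \<in> Hom D (FO Y) (FO X)" "h \<cdot>\<^bsub>D\<^esub> FM f = ident D (FO X)" "FM f \<cdot>\<^bsub>D\<^esub> h = ident D (FO Y)"
    using assms(3) by (auto elim: F.D.iso_arrE)
  have ob: "X \<in> ob C" "Y \<in> ob C" using assms(2) F.C.Hom_ob by blast+
  obtain g where g: "g \<in> Hom C Y X" "FM g = h" using equivalence_full[OF assms(1) ob(2,1) h(1)] .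
  show ?thesis
  proof (rule F.C.iso_arrI[OF assms(2) g(1)])
    show "g \<cdot>\<^bsub>C\<^esub> f = ident C X"
      by (rule equivalence_faithful[OF assms(1), of _ X X]) (use g h assms(2) ob in auto)
    show "f \<cdot>\<^bsub>C\<^esub> g = ident C Y"
      by (rule equivalence_faithful[OF assms(1), of _ Y Y]) (use g h assms(2) ob in auto)
  qed
qed

section \<open>Additive categories\<close>

context additive_category
begin

lemma add_arr [simp]:
  assumes "f \<in> arr C" "g \<in> arr C" "src C f = src C g" "tgt C f = tgt C g"
  shows "f \<oplus> g \<in> arr C" "src C (f \<oplus> g) = src C g" "tgt C (f \<oplus> g) = tgt C g"
proof -
  interpret comm_group "hom_group C (src C g) (tgt C g)" using assms by (auto intro: hom_comm_group)
  show "f \<oplus> g \<in> arr C" "src C (f \<oplus> g) = src C g" "tgt C (f \<oplus> g) = tgt C g"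
    using m_closed[of f g] assms by (auto simp: hom_group_def)
qed

lemma zero_arr [simp]:
  assumes "X \<in> ob C" "Y \<in> ob C"
  shows "zerom C X Y \<in> arr C" "src C (zerom C X Y) = X" "tgt C (zerom C X Y) = Y"
proof -
  interpret comm_group "hom_group C X Y" using assms by (auto intro: hom_comm_group)
  show "zerom C X Y \<in> arr C" "src C (zerom C X Y) = X" "tgt C (zerom C X Y) = Y"
    using one_closed by (auto simp: hom_group_def)
qed

lemma neg_arr [simp]:
  assumes "f \<in> arr C"
  shows "\<ominus> f \<in> arr C" "src C (\<ominus> f) = src C f" "tgt C (\<ominus> f) = tgt C f"
proof -
  interpret comm_group "hom_group C (src C f) (tgt C f)" using assms by (auto intro: hom_comm_group)
  show "\<ominus> f \<in> arr C" "src C (\<ominus> f) = src C f" "tgt C (\<ominus> f) = tgt C f"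
    using inv_closed[of f] assms by (auto simp: hom_group_def negm_def)
qed

lemma add_assoc:
  assumes "f \<in> arr C" "g \<in> arr C" "h \<in> arr C" "src C f = src C g" "tgt C f = tgt C g"
    "src C g = src C h" "tgt C g = tgt C h"
  shows "f \<oplus> g \<oplus> h = f \<oplus> (g \<oplus> h)"
proof -
  interpret comm_group "hom_group C (src C h) (tgt C h)" using assms by (auto intro: hom_comm_group)
  show ?thesis using m_assoc[of f g h] assms by (auto simp: hom_group_def)
qed

lemma add_commute:
  assumes "f \<in> arr C" "g \<in> arr C" "src C f = src C g" "tgt C f = tgt C g"
  shows "f \<oplus> g = g \<oplus> f"
proof -
  interpret comm_group "hom_group C (src C g) (tgt C g)" using assms by (auto intro: hom_comm_group)
  show ?thesis using m_comm[of f g] assms by (auto simp: hom_group_def)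
qed

lemma add_left_commute:
  assumes "f \<in> arr C" "g \<in> arr C" "h \<in> arr C" "src C f = src C g" "tgt C f = tgt C g"
    "src C g = src C h" "tgt C g = tgt C h"
  shows "f \<oplus> (g \<oplus> h) = g \<oplus> (f \<oplus> h)"
  using assms by (metis add_assoc add_commute)

lemmas add_ac = add_assoc add_commute add_left_commute

lemma add_zero [simp]:
  assumes "f \<in> arr C" "src C f = X" "tgt C f = Y"
  shows "f \<oplus> zerom C X Y = f" "zerom C X Y \<oplus> f = f"
proof -
  interpret comm_group "hom_group C (src C f) (tgt C f)" using assms by (auto intro: hom_comm_group)
  show "f \<oplus> zerom C X Y = f" "zerom C X Y \<oplus> f = f"
    using r_one[of f] l_one[of f] assms by (auto simp: hom_group_def)
qed

lemma add_neg [simp]: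
  assumes "f \<in> arr C"
  shows "f \<oplus> \<ominus> f = zerom C (src C f) (tgt C f)" "\<ominus> f \<oplus> f = zerom C (src C f) (tgt C f)"
proof -
  interpret comm_group "hom_group C (src C f) (tgt C f)" using assms by (auto intro: hom_comm_group)
  show "f \<oplus> \<ominus> f = zerom C (src C f) (tgt C f)" "\<ominus> f \<oplus> f = zerom C (src C f) (tgt C f)"
    using r_inv[of f] l_inv[of f] assms by (auto simp: hom_group_def negm_def)
qed

lemma add_cancel:
  assumes "f \<in> arr C" "g \<in> arr C" "h \<in> arr C" "src C f = src C g" "tgt C f = tgt C g"
    "src C g = src C h" "tgt C g = tgt C h" "f \<oplus> g = f \<oplus> h"
  shows "g = h"
proof -
  have "g = \<ominus> f \<oplus> f \<oplus> g" "h = \<ominus> f \<oplus> f \<oplus> h" using assms(1-7) by simp_all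
  moreover have "\<ominus> f \<oplus> f \<oplus> g = \<ominus> f \<oplus> (f \<oplus> g)" "\<ominus> f \<oplus> f \<oplus> h = \<ominus> f \<oplus> (f \<oplus> h)"
    using assms(1-7) by (intro add_assoc; simp)+
  ultimately show ?thesis using assms(8) by simp
qed

lemma add_neg_cancel [simp]:
  assumes "f \<in> arr C" "g \<in> arr C" "src C f = src C g" "tgt C f = tgt C g"
  shows "f \<oplus> (\<ominus> f \<oplus> g) = g" "\<ominus> f \<oplus> (f \<oplus> g) = g"
    "f \<oplus> \<ominus> g \<oplus> g = f" "f \<oplus> g \<oplus> \<ominus> g = f"
proof -
  show "f \<oplus> (\<ominus> f \<oplus> g) = g" "\<ominus> f \<oplus> (f \<oplus> g) = g"
    using assms add_assoc[of f "\<ominus> f" g] add_assoc[of "\<ominus> f" f g] by auto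
  show "f \<oplus> \<ominus> g \<oplus> g = f" "f \<oplus> g \<oplus> \<ominus> g = f"
    using assms by (simp_all add: add_assoc)
qed

lemma add_neg_cancel' [simp]:
  assumes "f \<in> arr C" "g \<in> arr C" "src C f = src C g" "tgt C f = tgt C g"
  shows "f \<oplus> (g \<oplus> \<ominus> f) = g"
  using assms by (subst add_left_commute) auto

lemma neg_unique:
  assumes "f \<in> arr C" "g \<in> arr C" "src C f = src C g" "tgt C f = tgt C g"
    "f \<oplus> g = zerom C (src C f) (tgt C f)"
  shows "g = \<ominus> f"
  by (rule add_cancel[of f]) (use assms in auto)

lemma neg_neg [simp]: "f \<in> arr C \<Longrightarrow> \<ominus> (\<ominus> f) = f"
  by (rule neg_unique[symmetric]) auto

lemma neg_eq_iff:
  assumes "f \<in> arr C" "g \<in> arr C"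
  shows "\<ominus> f = \<ominus> g \<longleftrightarrow> f = g"
  using assms by (metis neg_neg)

lemma neg_add:
  assumes "f \<in> arr C" "g \<in> arr C" "src C f = src C g" "tgt C f = tgt C g"
  shows "\<ominus> (f \<oplus> g) = \<ominus> f \<oplus> \<ominus> g"
proof -
  have "f \<oplus> g \<oplus> (\<ominus> f \<oplus> \<ominus> g) = (f \<oplus> \<ominus> f) \<oplus> (g \<oplus> \<ominus> g)"
    using assms by (simp only: add_ac neg_arr add_arr)
  then show ?thesis using assms by (intro neg_unique[symmetric]) auto
qed

lemma sub_arr [simp]:
  assumes "f \<in> arr C" "g \<in> arr C" "src C f = src C g" "tgt C f = tgt C g"
  shows "f \<ominus> g \<in> arr C" "src C (f \<ominus> g) = src C g" "tgt C (f \<ominus> g) = tgt C g"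
  using assms by (auto simp: subm_def)

lemma sub_eq_zero_iff:
  assumes "f \<in> arr C" "g \<in> arr C" "src C f = src C g" "tgt C f = tgt C g"
  shows "f \<ominus> g = zerom C (src C g) (tgt C g) \<longleftrightarrow> f = g"
proof
  assume "f \<ominus> g = zerom C (src C g) (tgt C g)"
  then have "f \<oplus> \<ominus> g \<oplus> g = zerom C (src C g) (tgt C g) \<oplus> g" by (simp add: subm_def)
  then show "f = g" using assms by simp
qed (use assms in \<open>simp add: subm_def\<close>)

lemma sub_eq_iff:
  assumes "f \<in> arr C" "g \<in> arr C" "h \<in> arr C" "src C f = src C g" "tgt C f = tgt C g"
    "src C h = src C g" "tgt C h = tgt C g"
  shows "f \<ominus> g = h \<longleftrightarrow> f = h \<oplus> g"
proof
  assume "f \<ominus> g = h"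
  then have "f \<oplus> \<ominus> g \<oplus> g = h \<oplus> g" by (simp add: subm_def)
  then show "f = h \<oplus> g" using assms by simp
qed (use assms in \<open>simp add: subm_def\<close>)

lemma cmp_distrib [simp]:
  "\<lbrakk>f \<in> arr C; g \<in> arr C; g' \<in> arr C; tgt C f = src C g'; src C g = src C g'; tgt C g = tgt C g'\<rbrakk>
      \<Longrightarrow> (g \<oplus> g') \<cdot> f = (g \<cdot> f) \<oplus> (g' \<cdot> f)"
  "\<lbrakk>f \<in> arr C; f' \<in> arr C; g \<in> arr C; tgt C f' = src C g; src C f = src C f'; tgt C f = tgt C f'\<rbrakk>
      \<Longrightarrow> g \<cdot> (f \<oplus> f') = (g \<cdot> f) \<oplus> (g \<cdot> f')"
  using cmp_add_left[of f "src C f" "tgt C f" g "tgt C g" g']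
    cmp_add_right[of f "src C f" "tgt C f" f' g "tgt C g"] by auto

lemma cmp_zero [simp]:
  assumes "f \<in> arr C"
  shows "\<lbrakk>tgt C f = X; Y \<in> ob C\<rbrakk> \<Longrightarrow> zerom C X Y \<cdot> f = zerom C (src C f) Y"
    "\<lbrakk>src C f = X; Y \<in> ob C\<rbrakk> \<Longrightarrow> f \<cdot> zerom C Y X = zerom C Y (tgt C f)"
proof -
  show "zerom C X Y \<cdot> f = zerom C (src C f) Y" if X: "tgt C f = X" "Y \<in> ob C"
  proof -
    have ob: "X \<in> ob C" using assms X by auto
    have *: "zerom C X Y \<cdot> f \<in> arr C" "src C (zerom C X Y \<cdot> f) = src C f" "tgt C (zerom C X Y \<cdot> f) = Y"
      using assms X ob by auto
    have "(zerom C X Y \<oplus> zerom C X Y) \<cdot> f = zerom C X Y \<cdot> f \<oplus> zerom C X Y \<cdot> f"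
      using assms X ob by (intro cmp_distrib) auto
    then have "zerom C X Y \<cdot> f \<oplus> zerom C X Y \<cdot> f = zerom C X Y \<cdot> f \<oplus> zerom C (src C f) Y"
      using * ob X assms by simp
    then show ?thesis by (rule add_cancel[rotated -1]) (use * ob X assms in auto)
  qed
  show "f \<cdot> zerom C Y X = zerom C Y (tgt C f)" if X: "src C f = X" "Y \<in> ob C"
  proof -
    have ob: "X \<in> ob C" using assms X by auto
    have *: "f \<cdot> zerom C Y X \<in> arr C" "src C (f \<cdot> zerom C Y X) = Y" "tgt C (f \<cdot> zerom C Y X) = tgt C f"
      using assms X ob by auto
    have "f \<cdot> (zerom C Y X \<oplus> zerom C Y X) = f \<cdot> zerom C Y X \<oplus> f \<cdot> zerom C Y X"
      using assms X ob by (intro cmp_distrib) auto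
    then have "f \<cdot> zerom C Y X \<oplus> f \<cdot> zerom C Y X = f \<cdot> zerom C Y X \<oplus> zerom C Y (tgt C f)"
      using * ob X assms by simp
    then show ?thesis by (rule add_cancel[rotated -1]) (use * ob X assms in auto)
  qed
qed

lemma cmp_neg [simp]:
  assumes "f \<in> arr C" "g \<in> arr C" "tgt C f = src C g"
  shows "(\<ominus> g) \<cdot> f = \<ominus> (g \<cdot> f)" "g \<cdot> (\<ominus> f) = \<ominus> (g \<cdot> f)"
proof -
  have "(g \<oplus> \<ominus> g) \<cdot> f = g \<cdot> f \<oplus> (\<ominus> g) \<cdot> f" "g \<cdot> (f \<oplus> \<ominus> f) = g \<cdot> f \<oplus> g \<cdot> (\<ominus> f)"
    using assms by (intro cmp_distrib; simp)+
  then show "(\<ominus> g) \<cdot> f = \<ominus> (g \<cdot> f)" "g \<cdot> (\<ominus> f) = \<ominus> (g \<cdot> f)"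
    using assms by (intro neg_unique; simp)+
qed

lemma cmp_sub [simp]:
  "\<lbrakk>f \<in> arr C; g \<in> arr C; g' \<in> arr C; tgt C f = src C g'; src C g = src C g'; tgt C g = tgt C g'\<rbrakk>
      \<Longrightarrow> (g \<ominus> g') \<cdot> f = (g \<cdot> f) \<ominus> (g' \<cdot> f)"
  "\<lbrakk>f \<in> arr C; f' \<in> arr C; g \<in> arr C; tgt C f' = src C g; src C f = src C f'; tgt C f = tgt C f'\<rbrakk>
      \<Longrightarrow> g \<cdot> (f \<ominus> f') = (g \<cdot> f) \<ominus> (g \<cdot> f')"
  by (auto simp: subm_def)

lemma neg_zero [simp]: "\<lbrakk>X \<in> ob C; Y \<in> ob C\<rbrakk> \<Longrightarrow> \<ominus> (zerom C X Y) = zerom C X Y"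
  by (rule neg_unique[symmetric]) auto

lemma sub_self [simp]: "f \<in> arr C \<Longrightarrow> f \<ominus> f = zerom C (src C f) (tgt C f)"
  by (simp add: subm_def)

lemma sub_zero [simp]: "\<lbrakk>f \<in> arr C; src C f = X; tgt C f = Y\<rbrakk> \<Longrightarrow> f \<ominus> zerom C X Y = f"
  using src_in_ob[of f] tgt_in_ob[of f] by (auto simp: subm_def)

lemma neg_sub:
  assumes "f \<in> arr C" "g \<in> arr C" "src C f = src C g" "tgt C f = tgt C g"
  shows "\<ominus> (f \<ominus> g) = g \<ominus> f"
  using assms by (simp add: subm_def neg_add add_commute)

lemma sub_add_sub:
  assumes "f \<in> arr C" "g \<in> arr C" "h \<in> arr C" "src C f = src C g" "tgt C f = tgt C g"
    "src C h = src C g" "tgt C h = tgt C g"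
  shows "(f \<ominus> g) \<oplus> (g \<ominus> h) = f \<ominus> h"
proof -
  have "f \<oplus> \<ominus> g \<oplus> (g \<oplus> \<ominus> h) = f \<oplus> (\<ominus> g \<oplus> (g \<oplus> \<ominus> h))" using assms by (intro add_assoc) auto
  then show ?thesis using assms by (simp add: subm_def)
qed

lemma add_sub_add:
  assumes "f \<in> arr C" "g \<in> arr C" "h \<in> arr C" "k \<in> arr C" "src C f = src C g" "tgt C f = tgt C g"
    "src C h = src C g" "tgt C h = tgt C g" "src C k = src C g" "tgt C k = tgt C g"
  shows "(f \<oplus> g) \<ominus> (h \<oplus> k) = (f \<ominus> h) \<oplus> (g \<ominus> k)"
  using assms by (simp add: subm_def neg_add add_ac)

lemma zero_object_zerom:
  assumes "zero_object C N" "f \<in> arr C" "src C f = N \<or> tgt C f = N"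
  shows "f = zerom C (src C f) (tgt C f)"
  by (rule zero_object_unique[OF assms(1)]) (use assms in auto)

lemma zero_object_ident: "zero_object C N \<Longrightarrow> ident C N = zerom C N N"
  using zero_object_zerom[of N "ident C N"] by (auto simp: zero_object_def)

lemma zero_objectI:
  assumes "N \<in> ob C" "ident C N = zerom C N N"
  shows "zero_object C N"
proof -
  have "f = zerom C N X" if "f \<in> Hom C N X" "X \<in> ob C" for f X
  proof -
    have "f = f \<cdot> ident C N" using that by simp
    also have "\<dots> = zerom C N X" using that assms by auto
    finally show ?thesis .
  qed
  moreover have "f = zerom C X N" if "f \<in> Hom C X N" "X \<in> ob C" for f X
  proof -
    have "f = ident C N \<cdot> f" using that by simp
    also have "\<dots> = zerom C X N" unfolding assms(2) using that assms(1) by auto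
    finally show ?thesis .
  qed
  ultimately show ?thesis unfolding zero_object_def using assms(1)
    by (metis (no_types, lifting) Hom_iff zero_arr)
qed

subsection \<open>Biproducts\<close>

lemma biproduct_simps:
  assumes "biproduct C A B S i1 i2 p1 p2"
  shows "A \<in> ob C" "B \<in> ob C" "S \<in> ob C"
    "i1 \<in> arr C" "src C i1 = A" "tgt C i1 = S"
    "i2 \<in> arr C" "src C i2 = B" "tgt C i2 = S"
    "p1 \<in> arr C" "src C p1 = S" "tgt C p1 = A"
    "p2 \<in> arr C" "src C p2 = S" "tgt C p2 = B"
    "p1 \<cdot> i1 = ident C A" "p2 \<cdot> i2 = ident C B"
    "p2 \<cdot> i1 = zerom C A B" "p1 \<cdot> i2 = zerom C B A"
    "\<lbrakk>t \<in> arr C; tgt C t = A\<rbrakk> \<Longrightarrow> p1 \<cdot> (i1 \<cdot> t) = t"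
    "\<lbrakk>t \<in> arr C; tgt C t = B\<rbrakk> \<Longrightarrow> p2 \<cdot> (i2 \<cdot> t) = t"
    "\<lbrakk>t \<in> arr C; tgt C t = A\<rbrakk> \<Longrightarrow> p2 \<cdot> (i1 \<cdot> t) = zerom C (src C t) B"
    "\<lbrakk>t \<in> arr C; tgt C t = B\<rbrakk> \<Longrightarrow> p1 \<cdot> (i2 \<cdot> t) = zerom C (src C t) A"
proof -
  show *: "A \<in> ob C" "B \<in> ob C" "S \<in> ob C"
    "i1 \<in> arr C" "src C i1 = A" "tgt C i1 = S"
    "i2 \<in> arr C" "src C i2 = B" "tgt C i2 = S"
    "p1 \<in> arr C" "src C p1 = S" "tgt C p1 = A"
    "p2 \<in> arr C" "src C p2 = S" "tgt C p2 = B"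
    and e: "p1 \<cdot> i1 = ident C A" "p2 \<cdot> i2 = ident C B"
    "p2 \<cdot> i1 = zerom C A B" "p1 \<cdot> i2 = zerom C B A"
    using assms unfolding biproduct_def by auto
  show "\<lbrakk>t \<in> arr C; tgt C t = A\<rbrakk> \<Longrightarrow> p1 \<cdot> (i1 \<cdot> t) = t"
    "\<lbrakk>t \<in> arr C; tgt C t = B\<rbrakk> \<Longrightarrow> p2 \<cdot> (i2 \<cdot> t) = t"
    "\<lbrakk>t \<in> arr C; tgt C t = A\<rbrakk> \<Longrightarrow> p2 \<cdot> (i1 \<cdot> t) = zerom C (src C t) B"
    "\<lbrakk>t \<in> arr C; tgt C t = B\<rbrakk> \<Longrightarrow> p1 \<cdot> (i2 \<cdot> t) = zerom C (src C t) A"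
    using * by (auto simp: reassoc[OF e(1)] reassoc[OF e(2)] reassoc[OF e(3)] reassoc[OF e(4)])
qed

lemma biproduct_decomp_out:
  assumes "biproduct C A B S i1 i2 p1 p2" "f \<in> arr C" "src C f = S"
  shows "f = (f \<cdot> i1) \<cdot> p1 \<oplus> (f \<cdot> i2) \<cdot> p2"
proof -
  note [simp] = biproduct_simps[OF assms(1)]
  have "f = f \<cdot> (i1 \<cdot> p1 \<oplus> i2 \<cdot> p2)" using assms by (simp add: biproduct_def)
  then show ?thesis using assms by simp
qed

lemma biproduct_decomp_in:
  assumes "biproduct C A B S i1 i2 p1 p2" "f \<in> arr C" "tgt C f = S"
  shows "f = i1 \<cdot> (p1 \<cdot> f) \<oplus> i2 \<cdot> (p2 \<cdot> f)"
proof -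
  note [simp] = biproduct_simps[OF assms(1)]
  have "f = (i1 \<cdot> p1 \<oplus> i2 \<cdot> p2) \<cdot> f" using assms by (simp add: biproduct_def)
  also have "\<dots> = i1 \<cdot> (p1 \<cdot> f) \<oplus> i2 \<cdot> (p2 \<cdot> f)" using assms(2,3) by (subst cmp_distrib) auto
  finally show ?thesis .
qed

lemma biproduct_eq_out:
  assumes "biproduct C A B S i1 i2 p1 p2" "f \<in> arr C" "g \<in> arr C" "src C f = S" "src C g = S"
    "f \<cdot> i1 = g \<cdot> i1" "f \<cdot> i2 = g \<cdot> i2"
  shows "f = g"
  using biproduct_decomp_out[OF assms(1,2,4)] biproduct_decomp_out[OF assms(1,3,5)] assms(6,7) by simp

lemma biproduct_eq_in:
  assumes "biproduct C A B S i1 i2 p1 p2" "f \<in> arr C" "g \<in> arr C" "tgt C f = S" "tgt C g = S"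
    "p1 \<cdot> f = p1 \<cdot> g" "p2 \<cdot> f = p2 \<cdot> g"
  shows "f = g"
  using biproduct_decomp_in[OF assms(1,2,4)] biproduct_decomp_in[OF assms(1,3,5)] assms(6,7) by simp

text \<open>
  The inverse is \<open>(1 - n) \<cdot> w'\<close>.  In a triangulated category, maps completing a morphism of triangles are
  inverse to each other only up to such errors of square zero.
\<close>

lemma iso_of_nilpotent:
  assumes w: "w \<in> Hom C X Y" "w' \<in> Hom C Y X"
    and n: "n \<in> Hom C X X" "w' \<cdot> w = ident C X \<oplus> n" "n \<cdot> n = zerom C X X"
    and m: "m \<in> Hom C Y Y" "w \<cdot> w' = ident C Y \<oplus> m" "m \<cdot> m = zerom C Y Y"
  shows "iso_arr C X Y w"
proof -
  have ob: "X \<in> ob C" "Y \<in> ob C" using w Hom_ob by blast+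
  have [unfolded Hom_iff, simp]: "w \<in> Hom C X Y" "w' \<in> Hom C Y X" "n \<in> Hom C X X" "m \<in> Hom C Y Y" using w n m by auto
  define l where "l = (ident C X \<ominus> n) \<cdot> w'"
  define r where "r = w' \<cdot> (ident C Y \<ominus> m)"
  have [unfolded Hom_iff, simp]: "l \<in> Hom C Y X" "r \<in> Hom C Y X"
    using ob by (auto simp: l_def r_def)
  have "l \<cdot> w = (ident C X \<ominus> n) \<cdot> (w' \<cdot> w)" using ob by (simp add: l_def)
  also have "\<dots> = (ident C X \<oplus> n) \<ominus> (n \<oplus> n \<cdot> n)"
    unfolding n(2) using ob by (simp add: subm_def neg_add add_ac)
  also have "\<dots> = ident C X" unfolding n(3) using ob by (simp add: subm_def)
  finally have l: "l \<cdot> w = ident C X" .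
  have "w \<cdot> r = (w \<cdot> w') \<cdot> (ident C Y \<ominus> m)" using ob by (simp add: r_def)
  also have "\<dots> = (ident C Y \<oplus> m) \<ominus> (m \<oplus> m \<cdot> m)"
    unfolding m(2) using ob by (simp add: subm_def neg_add add_ac)
  also have "\<dots> = ident C Y" unfolding m(3) using ob by (simp add: subm_def)
  finally have r: "w \<cdot> r = ident C Y" .
  have "l = l \<cdot> (w \<cdot> r)" unfolding r using ob by simp
  also have "\<dots> = r" using ob reassoc[OF l] by simp
  finally have "l = r" .
  then show ?thesis by (intro iso_arrI[where g = l]) (use l r in auto)
qed

end

lemma additive_equivalenceD:
  assumes "additive_equivalence C D FO FM"
  shows "equivalence C D FO FM" "cat_functor C D FO FM"
    "\<lbrakk>f \<in> Hom C X Y; g \<in> Hom C X Y\<rbrakk> \<Longrightarrow> FM (addm C f g) = addm D (FM f) (FM g)"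
proof -
  show "equivalence C D FO FM" and c: "cat_functor C D FO FM"
    using assms by (auto simp: additive_equivalence_def equivalence_def)
  interpret cat_functor C D FO FM by fact
  show "FM (addm C f g) = addm D (FM f) (FM g)" if "f \<in> Hom C X Y" "g \<in> Hom C X Y"
    using assms that C.Hom_ob[OF that(1)] unfolding additive_equivalence_def by blast
qed

locale additive_functor = cat_functor C D FO FM + C: additive_category C + D: additive_category D
  for C :: "('o, 'm, 'z) ab_cat_scheme" and D :: "('p, 'n, 'y) ab_cat_scheme" and FO FM +
  assumes FM_add: "\<lbrakk>f \<in> Hom C X Y; g \<in> Hom C X Y\<rbrakk> \<Longrightarrow> FM (f \<oplus>\<^bsub>C\<^esub> g) = FM f \<oplus>\<^bsub>D\<^esub> FM g"
begin

lemma functor_add [simp]: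
  "\<lbrakk>f \<in> arr C; g \<in> arr C; src C f = src C g; tgt C f = tgt C g\<rbrakk> \<Longrightarrow> FM (f \<oplus>\<^bsub>C\<^esub> g) = FM f \<oplus>\<^bsub>D\<^esub> FM g"
  using FM_add[of f "src C f" "tgt C f" g] by auto

lemma functor_zero [simp]:
  assumes "X \<in> ob C" "Y \<in> ob C"
  shows "FM (zerom C X Y) = zerom D (FO X) (FO Y)"
proof (rule D.add_cancel[of "FM (zerom C X Y)"])
  show "FM (zerom C X Y) \<oplus>\<^bsub>D\<^esub> FM (zerom C X Y) = FM (zerom C X Y) \<oplus>\<^bsub>D\<^esub> zerom D (FO X) (FO Y)"
    using functor_add[of "zerom C X Y" "zerom C X Y"] assms by (simp del: functor_add)
qed (use assms in auto)

lemma functor_neg [simp]: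
  assumes "f \<in> arr C" shows "FM (\<ominus>\<^bsub>C\<^esub> f) = \<ominus>\<^bsub>D\<^esub> (FM f)"
  by (rule D.neg_unique) (use functor_add[of f "\<ominus>\<^bsub>C\<^esub> f"] assms in \<open>auto simp del: functor_add\<close>)

lemma functor_sub [simp]:
  "\<lbrakk>f \<in> arr C; g \<in> arr C; src C f = src C g; tgt C f = tgt C g\<rbrakk> \<Longrightarrow> FM (f \<ominus>\<^bsub>C\<^esub> g) = FM f \<ominus>\<^bsub>D\<^esub> FM g"
  by (simp add: subm_def)

lemma functor_zero_object:
  assumes "zero_object C N" shows "zero_object D (FO N)"
proof (rule D.zero_objectI)
  show N: "FO N \<in> ob D" using assms by (auto simp: zero_object_def)
  have "FM (ident C N) = FM (zerom C N N)" using C.zero_object_ident[OF assms] by simp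
  then show "ident D (FO N) = zerom D (FO N) (FO N)" using assms by (simp add: zero_object_def)
qed

end

lemma additive_equivalence_functor:
  assumes "additive_equivalence C D FO FM" "additive_category C" "additive_category D"
  shows "additive_functor C D FO FM"
  using assms additive_equivalenceD[OF assms(1)]
  by (auto simp: additive_functor_def additive_functor_axioms_def)

section \<open>Additive quotients\<close>

lemma factors_through_iff:
  "factors_through C P f \<longleftrightarrow> (\<exists>Q \<in> P. \<exists>a b. a \<in> Hom C (src C f) Q \<and> b \<in> Hom C Q (tgt C f) \<and> f = b \<cdot>\<^bsub>C\<^esub> a)"
  unfolding factors_through_def by blast

locale additive_ideal = additive_category C
  for C :: "('o, 'm, 'z) ab_cat_scheme" (structure) +
  fixes P :: "'o set"
  assumes P_ob: "P \<subseteq> ob C"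
    and P_nonempty: "P \<noteq> {}"
    and P_sum: "\<lbrakk>A \<in> P; B \<in> P\<rbrakk> \<Longrightarrow> \<exists>S i1 i2 p1 p2. S \<in> P \<and> biproduct C A B S i1 i2 p1 p2"
begin

abbreviation "fac \<equiv> factors_through C P"
abbreviation "\<pi> \<equiv> cls C P"

lemma facI: "\<lbrakk>a \<in> Hom C X Q; b \<in> Hom C Q Y; Q \<in> P\<rbrakk> \<Longrightarrow> fac (b \<cdot> a)"
  unfolding factors_through_iff by auto

lemma facE:
  assumes "fac f"
  obtains Q a b where "Q \<in> P" "Q \<in> ob C" "a \<in> Hom C (src C f) Q" "b \<in> Hom C Q (tgt C f)" "f = b \<cdot> a"
  using assms P_ob unfolding factors_through_def by blast

lemma facE_hom:
  assumes "fac f" "f \<in> Hom C X Y"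
  obtains Q a b where "Q \<in> P" "a \<in> Hom C X Q" "b \<in> Hom C Q Y" "f = b \<cdot> a"
proof -
  have e: "src C f = X" "tgt C f = Y" using assms(2) by auto
  show ?thesis using facE[OF assms(1)] that unfolding e by blast
qed

lemma fac_zero [simp]: assumes "X \<in> ob C" "Y \<in> ob C" shows "fac (zerom C X Y)"
proof -
  obtain Q where Q: "Q \<in> P" "Q \<in> ob C" using P_nonempty P_ob by blast
  have "fac (zerom C Q Y \<cdot> zerom C X Q)" using Q assms by (intro facI[of _ X Q _ Y]) auto
  then show ?thesis using Q assms by simp
qed

lemma fac_cmp_left:
  assumes "fac f" "f \<in> arr C" "g \<in> arr C" "src C g = tgt C f"
  shows "fac (g \<cdot> f)"
proof -
  from assms(1) obtain Q a b where Q: "Q \<in> P" "Q \<in> ob C" "a \<in> Hom C (src C f) Q" "b \<in> Hom C Q (tgt C f)" "f = b \<cdot> a"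
    by (rule facE)
  have "fac ((g \<cdot> b) \<cdot> a)" using Q(1-4) assms by (intro facI[of _ "src C f" Q _ "tgt C g"]) auto
  moreover have "(g \<cdot> b) \<cdot> a = g \<cdot> f" unfolding Q(5) using Q(1-4) assms(2-) by (intro assoc) auto
  ultimately show ?thesis by simp
qed

lemma fac_cmp_right:
  assumes "fac f" "f \<in> arr C" "g \<in> arr C" "tgt C g = src C f"
  shows "fac (f \<cdot> g)"
proof -
  from assms(1) obtain Q a b where Q: "Q \<in> P" "Q \<in> ob C" "a \<in> Hom C (src C f) Q" "b \<in> Hom C Q (tgt C f)" "f = b \<cdot> a"
    by (rule facE)
  have "fac (b \<cdot> (a \<cdot> g))" using Q(1-4) assms by (intro facI[of _ "src C g" Q _ "tgt C f"]) auto
  moreover have "b \<cdot> (a \<cdot> g) = f \<cdot> g" unfolding Q(5) using Q(1-4) assms(2-) by (intro assoc[symmetric]) auto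
  ultimately show ?thesis by simp
qed

lemma fac_add:
  assumes "fac f" "fac g" "f \<in> arr C" "g \<in> arr C" "src C f = src C g" "tgt C f = tgt C g"
  shows "fac (f \<oplus> g)"
proof -
  from assms(1) obtain Q a b where Q: "Q \<in> P" "Q \<in> ob C" "a \<in> Hom C (src C f) Q" "b \<in> Hom C Q (tgt C f)" "f = b \<cdot> a"
    by (rule facE)
  from assms(2) obtain R c d where R: "R \<in> P" "R \<in> ob C" "c \<in> Hom C (src C g) R" "d \<in> Hom C R (tgt C g)" "g = d \<cdot> c"
    by (rule facE)
  obtain S i1 i2 p1 p2 where S: "S \<in> P" "biproduct C Q R S i1 i2 p1 p2" using P_sum Q R by blast
  note [simp] = biproduct_simps[OF S(2)]
  have [unfolded Hom_iff, simp]: "a \<in> Hom C (src C g) Q" "b \<in> Hom C Q (tgt C g)" "c \<in> Hom C (src C g) R"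
    "d \<in> Hom C R (tgt C g)"
    using Q(3,4) R(3,4) assms(3-) by auto
  have "(b \<cdot> p1 \<oplus> d \<cdot> p2) \<cdot> (i1 \<cdot> a \<oplus> i2 \<cdot> c) = b \<cdot> a \<oplus> d \<cdot> c"
    using assms(4) by simp
  then have "f \<oplus> g = (b \<cdot> p1 \<oplus> d \<cdot> p2) \<cdot> (i1 \<cdot> a \<oplus> i2 \<cdot> c)"
    by (simp only: Q(5)[symmetric] R(5)[symmetric])
  moreover have "fac ((b \<cdot> p1 \<oplus> d \<cdot> p2) \<cdot> (i1 \<cdot> a \<oplus> i2 \<cdot> c))"
    by (rule facI[of _ "src C g" S _ "tgt C g"]) (use S in auto)
  ultimately show ?thesis by simp
qed

lemma fac_neg:
  assumes "fac f" "f \<in> arr C"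
  shows "fac (\<ominus> f)"
proof -
  have "fac (\<ominus> (ident C (tgt C f)) \<cdot> f)" using assms by (intro fac_cmp_left) auto
  then show ?thesis using assms by simp
qed

lemma fac_P: "\<lbrakk>f \<in> arr C; src C f \<in> P \<or> tgt C f \<in> P\<rbrakk> \<Longrightarrow> fac f"
  using facI[of "ident C (src C f)" "src C f" "src C f" f "tgt C f"]
    facI[of f "src C f" "tgt C f" "ident C (tgt C f)" "tgt C f"] by auto

lemma mem_cls:
  "f \<in> arr C \<Longrightarrow> g \<in> \<pi> f \<longleftrightarrow> g \<in> arr C \<and> src C g = src C f \<and> tgt C g = tgt C f \<and> fac (g \<ominus> f)"
  by (auto simp: cls_def)

lemma cls_self: "f \<in> arr C \<Longrightarrow> f \<in> \<pi> f"
  by (simp add: mem_cls)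

lemma cls_eq_iff:
  assumes "f \<in> arr C" "g \<in> arr C" "src C f = src C g" "tgt C f = tgt C g"
  shows "\<pi> f = \<pi> g \<longleftrightarrow> fac (f \<ominus> g)"
proof
  assume "\<pi> f = \<pi> g" then have "f \<in> \<pi> g" using cls_self[OF assms(1)] by simp
  then show "fac (f \<ominus> g)" using assms by (simp add: mem_cls)
next
  assume fg: "fac (f \<ominus> g)"
  have gf: "fac (g \<ominus> f)" using fac_neg[OF fg] assms by (simp add: neg_sub)
  have "h \<in> \<pi> f \<longleftrightarrow> h \<in> \<pi> g" for h
  proof -
    have "fac (h \<ominus> f) \<longleftrightarrow> fac (h \<ominus> g)" if "h \<in> arr C" "src C h = src C g" "tgt C h = tgt C g"
    proof
      assume "fac (h \<ominus> f)" then have "fac ((h \<ominus> f) \<oplus> (f \<ominus> g))" using fg assms that by (intro fac_add) auto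
      moreover have "(h \<ominus> f) \<oplus> (f \<ominus> g) = h \<ominus> g" by (rule sub_add_sub) (use assms that in auto)
      ultimately show "fac (h \<ominus> g)" by (simp only:)
    next
      assume "fac (h \<ominus> g)" then have "fac ((h \<ominus> g) \<oplus> (g \<ominus> f))" using gf assms that by (intro fac_add) auto
      moreover have "(h \<ominus> g) \<oplus> (g \<ominus> f) = h \<ominus> f" by (rule sub_add_sub) (use assms that in auto)
      ultimately show "fac (h \<ominus> f)" by (simp only:)
    qed
    then show ?thesis using assms by (auto simp: mem_cls)
  qed
  then show "\<pi> f = \<pi> g" by blast
qed

lemma rep_cls:
  assumes "f \<in> arr C"
  shows "rep (\<pi> f) \<in> arr C" "src C (rep (\<pi> f)) = src C f" "tgt C (rep (\<pi> f)) = tgt C f"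
    "fac (rep (\<pi> f) \<ominus> f)" "\<pi> (rep (\<pi> f)) = \<pi> f"
proof -
  have "rep (\<pi> f) \<in> \<pi> f" unfolding rep_def using cls_self[OF assms] by (rule someI)
  then show *: "rep (\<pi> f) \<in> arr C" "src C (rep (\<pi> f)) = src C f" "tgt C (rep (\<pi> f)) = tgt C f"
    "fac (rep (\<pi> f) \<ominus> f)" using assms by (auto simp: mem_cls)
  show "\<pi> (rep (\<pi> f)) = \<pi> f" by (rule cls_eq_iff[THEN iffD2]) (use * assms in auto)
qed

end

text \<open>
  The structure \<open>D\<close> is required to agree with the quotient only in its fields; in this way the
  results apply to the quotient category with a triangulated structure on top.
\<close>

locale additive_quotient = additive_ideal C P
  for C :: "('o, 'm, 'z) ab_cat_scheme" (structure) and P +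
  fixes D :: "('o, 'm set, 'y) ab_cat_scheme"
  assumes ob_D: "ob D = ob C"
    and arr_D: "arr D = cls C P ` arr C"
    and src_D: "src D = (\<lambda>S. src C (rep S))"
    and tgt_D: "tgt D = (\<lambda>S. tgt C (rep S))"
    and ident_D: "ident D = (\<lambda>X. cls C P (ident C X))"
    and cmp_D: "cmp D = (\<lambda>S T. cls C P (rep S \<cdot> rep T))"
    and addm_D: "addm D = (\<lambda>S T. cls C P (rep S \<oplus> rep T))"
    and zerom_D: "zerom D = (\<lambda>X Y. cls C P (zerom C X Y))"
begin

lemma quot_arr [simp]:
  assumes "f \<in> arr C"
  shows "\<pi> f \<in> arr D" "src D (\<pi> f) = src C f" "tgt D (\<pi> f) = tgt C f"
  using assms rep_cls[OF assms] by (auto simp: arr_D src_D tgt_D)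

lemma quot_lift:
  assumes "S \<in> Hom D X Y"
  obtains f where "f \<in> Hom C X Y" "S = \<pi> f"
proof -
  have "S \<in> \<pi> ` arr C" using assms arr_D by simp
  then obtain f where f: "f \<in> arr C" "S = \<pi> f" by blast
  then show ?thesis using assms by (intro that[of f]) auto
qed

lemma quot_cmp:
  assumes "f \<in> arr C" "g \<in> arr C" "tgt C f = src C g"
  shows "\<pi> g \<cdot>\<^bsub>D\<^esub> \<pi> f = \<pi> (g \<cdot> f)"
proof -
  let ?f = "rep (\<pi> f)" and ?g = "rep (\<pi> g)"
  note [simp] = rep_cls(1-3)[OF assms(1)] rep_cls(1-3)[OF assms(2)]
  have "fac ((?g \<ominus> g) \<cdot> ?f)" "fac (g \<cdot> (?f \<ominus> f))"
    using assms rep_cls(4)[OF assms(1)] rep_cls(4)[OF assms(2)]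
    by (intro fac_cmp_right fac_cmp_left; simp)+
  then have "fac ((?g \<cdot> ?f \<ominus> g \<cdot> ?f) \<oplus> (g \<cdot> ?f \<ominus> g \<cdot> f))"
    using assms by (intro fac_add) auto
  then have "fac (?g \<cdot> ?f \<ominus> g \<cdot> f)" using assms by (subst (asm) sub_add_sub) auto
  then show ?thesis unfolding cmp_D using assms by (subst cls_eq_iff) auto
qed

lemma quot_add:
  assumes "f \<in> arr C" "g \<in> arr C" "src C f = src C g" "tgt C f = tgt C g"
  shows "\<pi> f \<oplus>\<^bsub>D\<^esub> \<pi> g = \<pi> (f \<oplus> g)"
proof -
  let ?f = "rep (\<pi> f)" and ?g = "rep (\<pi> g)"
  note [simp] = rep_cls(1-3)[OF assms(1)] rep_cls(1-3)[OF assms(2)]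
  have "fac ((?f \<ominus> f) \<oplus> (?g \<ominus> g))"
    using assms rep_cls(4)[OF assms(1)] rep_cls(4)[OF assms(2)] by (intro fac_add) auto
  then have "fac ((?f \<oplus> ?g) \<ominus> (f \<oplus> g))" using assms by (subst add_sub_add) auto
  then show ?thesis unfolding addm_D using assms by (subst cls_eq_iff) auto
qed

lemma quot_ident: "ident D X = \<pi> (ident C X)"
  by (simp add: ident_D)

lemma quot_zerom: "zerom D X Y = \<pi> (zerom C X Y)"
  by (simp add: zerom_D)

lemma quot_category: "category D"
proof
  fix f assume "f \<in> arr D"
  then obtain f' where "f' \<in> arr C" "f = \<pi> f'" by (auto simp: arr_D)
  then show "src D f \<in> ob D" "tgt D f \<in> ob D" by (auto simp: ob_D)
next
  fix X assume "X \<in> ob D" then show "ident D X \<in> Hom D X X" by (auto simp: ob_D quot_ident)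
next
  fix f g X Y Z assume "f \<in> Hom D X Y" "g \<in> Hom D Y Z"
  then obtain f' g' where "f' \<in> Hom C X Y" "f = \<pi> f'" "g' \<in> Hom C Y Z" "g = \<pi> g'" by (metis quot_lift)
  then show "g \<cdot>\<^bsub>D\<^esub> f \<in> Hom D X Z" by (auto simp: quot_cmp)
next
  fix f X Y assume "f \<in> Hom D X Y"
  then obtain f' where f': "f' \<in> Hom C X Y" "f = \<pi> f'" by (metis quot_lift)
  then have "X \<in> ob C" "Y \<in> ob C" by auto
  then show "f \<cdot>\<^bsub>D\<^esub> ident D X = f" "ident D Y \<cdot>\<^bsub>D\<^esub> f = f"
    using f' by (auto simp: quot_cmp quot_ident)
next
  fix f g h W X Y Z assume "f \<in> Hom D W X" "g \<in> Hom D X Y" "h \<in> Hom D Y Z"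
  then obtain f' g' h' where "f' \<in> Hom C W X" "f = \<pi> f'" "g' \<in> Hom C X Y" "g = \<pi> g'"
    "h' \<in> Hom C Y Z" "h = \<pi> h'" by (metis quot_lift)
  then show "h \<cdot>\<^bsub>D\<^esub> g \<cdot>\<^bsub>D\<^esub> f = h \<cdot>\<^bsub>D\<^esub> (g \<cdot>\<^bsub>D\<^esub> f)" by (auto simp: quot_cmp)
qed

sublocale D: category D
  by (rule quot_category)

lemma quot_hom_group:
  assumes "X \<in> ob C" "Y \<in> ob C"
  shows "comm_group (hom_group D X Y)"
proof (rule comm_groupI)
  show "\<one>\<^bsub>hom_group D X Y\<^esub> \<in> carrier (hom_group D X Y)"
    using assms by (auto simp: hom_group_def quot_zerom)
next
  fix x assume "x \<in> carrier (hom_group D X Y)"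
  then obtain f where f: "f \<in> Hom C X Y" "x = \<pi> f" by (metis hom_group_def partial_object.select_convs(1) quot_lift)
  then show "\<exists>y\<in>carrier (hom_group D X Y). y \<otimes>\<^bsub>hom_group D X Y\<^esub> x = \<one>\<^bsub>hom_group D X Y\<^esub>"
    by (intro bexI[of _ "\<pi> (\<ominus> f)"]) (auto simp: hom_group_def quot_add quot_zerom)
  show "\<one>\<^bsub>hom_group D X Y\<^esub> \<otimes>\<^bsub>hom_group D X Y\<^esub> x = x"
    using f assms by (auto simp: hom_group_def quot_add quot_zerom)
next
  fix x y assume "x \<in> carrier (hom_group D X Y)" "y \<in> carrier (hom_group D X Y)"
  then obtain f g where f: "f \<in> Hom C X Y" "x = \<pi> f" "g \<in> Hom C X Y" "y = \<pi> g"
    by (metis hom_group_def partial_object.select_convs(1) quot_lift)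
  then show "x \<otimes>\<^bsub>hom_group D X Y\<^esub> y \<in> carrier (hom_group D X Y)"
    by (auto simp: hom_group_def quot_add)
  show "x \<otimes>\<^bsub>hom_group D X Y\<^esub> y = y \<otimes>\<^bsub>hom_group D X Y\<^esub> x"
    using f by (auto simp: hom_group_def quot_add add_commute)
next
  fix x y z assume "x \<in> carrier (hom_group D X Y)" "y \<in> carrier (hom_group D X Y)" "z \<in> carrier (hom_group D X Y)"
  then obtain f g h where f: "f \<in> Hom C X Y" "x = \<pi> f" "g \<in> Hom C X Y" "y = \<pi> g" "h \<in> Hom C X Y" "z = \<pi> h"
    by (metis hom_group_def partial_object.select_convs(1) quot_lift)
  then show "x \<otimes>\<^bsub>hom_group D X Y\<^esub> y \<otimes>\<^bsub>hom_group D X Y\<^esub> z = x \<otimes>\<^bsub>hom_group D X Y\<^esub> (y \<otimes>\<^bsub>hom_group D X Y\<^esub> z)"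
    by (auto simp: hom_group_def quot_add add_assoc)
qed

lemma quot_biproduct:
  assumes "biproduct C A B S i1 i2 p1 p2"
  shows "biproduct D A B S (\<pi> i1) (\<pi> i2) (\<pi> p1) (\<pi> p2)"
  using assms biproduct_simps[OF assms] unfolding biproduct_def
  by (auto simp: ob_D quot_cmp quot_ident quot_zerom quot_add)

lemma quot_zero_object:
  assumes "zero_object C N" shows "zero_object D N"
proof -
  have N: "N \<in> ob C" using assms by (simp add: zero_object_def)
  have "\<exists>!f. f \<in> Hom D N X" "\<exists>!f. f \<in> Hom D X N" if X: "X \<in> ob C" for X
  proof -
    have "f = \<pi> (zerom C N X)" if "f \<in> Hom D N X" for f
      using zero_object_zerom[OF assms] that by (metis Hom_iff quot_lift)
    moreover have "\<pi> (zerom C N X) \<in> Hom D N X" using N X by simp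
    ultimately show "\<exists>!f. f \<in> Hom D N X" by blast
    have "f = \<pi> (zerom C X N)" if "f \<in> Hom D X N" for f
      using zero_object_zerom[OF assms] that by (metis Hom_iff quot_lift)
    moreover have "\<pi> (zerom C X N) \<in> Hom D X N" using N X by simp
    ultimately show "\<exists>!f. f \<in> Hom D X N" by blast
  qed
  then show ?thesis using N by (simp add: zero_object_def ob_D del: Hom_iff)
qed

lemma quot_additive: "additive_category D"
proof (intro additive_category.intro additive_category_axioms.intro quot_category)
  fix X Y assume "X \<in> ob D" "Y \<in> ob D"
  then show "comm_group (hom_group D X Y)" by (simp add: quot_hom_group ob_D)
next
  fix f g g' X Y Z assume "f \<in> Hom D X Y" "g \<in> Hom D Y Z" "g' \<in> Hom D Y Z"
  then obtain f1 g1 h1 where "f1 \<in> Hom C X Y" "f = \<pi> f1" "g1 \<in> Hom C Y Z" "g = \<pi> g1"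
    "h1 \<in> Hom C Y Z" "g' = \<pi> h1" by (metis quot_lift)
  then show "(g \<oplus>\<^bsub>D\<^esub> g') \<cdot>\<^bsub>D\<^esub> f = (g \<cdot>\<^bsub>D\<^esub> f) \<oplus>\<^bsub>D\<^esub> (g' \<cdot>\<^bsub>D\<^esub> f)"
    by (auto simp: quot_cmp quot_add)
next
  fix f f' g X Y Z assume "f \<in> Hom D X Y" "f' \<in> Hom D X Y" "g \<in> Hom D Y Z"
  then obtain f1 g1 h1 where "f1 \<in> Hom C X Y" "f = \<pi> f1" "g1 \<in> Hom C X Y" "f' = \<pi> g1"
    "h1 \<in> Hom C Y Z" "g = \<pi> h1" by (metis quot_lift)
  then show "g \<cdot>\<^bsub>D\<^esub> (f \<oplus>\<^bsub>D\<^esub> f') = (g \<cdot>\<^bsub>D\<^esub> f) \<oplus>\<^bsub>D\<^esub> (g \<cdot>\<^bsub>D\<^esub> f')"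
    by (auto simp: quot_cmp quot_add)
next
  show "\<exists>N. zero_object D N" using ex_zero_object quot_zero_object by blast
next
  fix A B assume "A \<in> ob D" "B \<in> ob D"
  then show "\<exists>S i1 i2 p1 p2. biproduct D A B S i1 i2 p1 p2"
    using ex_biproduct[of A B] quot_biproduct by (metis ob_D)
qed

sublocale D: additive_category D
  by (rule quot_additive)

lemma quot_neg: assumes "f \<in> arr C" shows "\<ominus>\<^bsub>D\<^esub> \<pi> f = \<pi> (\<ominus> f)"
  by (rule D.neg_unique[symmetric]) (use assms in \<open>auto simp: quot_add quot_zerom\<close>)

lemma quot_eq_zero_iff:
  assumes "f \<in> arr C" "src C f = X" "tgt C f = Y"
  shows "\<pi> f = zerom D X Y \<longleftrightarrow> fac f"
proof -
  have "X \<in> ob C" "Y \<in> ob C" using assms by auto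
  then show ?thesis unfolding quot_zerom using assms by (subst cls_eq_iff) auto
qed

lemma P_zero_object:
  assumes "N \<in> P" shows "zero_object D N"
proof (rule D.zero_objectI)
  show "N \<in> ob D" using assms P_ob ob_D by blast
  have "N \<in> ob C" using assms P_ob by blast
  then show "ident D N = zerom D N N"
    unfolding quot_ident by (subst quot_eq_zero_iff) (use assms in \<open>auto intro: fac_P\<close>)
qed

end

section \<open>Pretriangulated categories\<close>

lemma with_triangles_simps [simp]:
  "ob (with_triangles Q sO sM Std) = ob Q"
  "arr (with_triangles Q sO sM Std) = arr Q"
  "src (with_triangles Q sO sM Std) = src Q"
  "tgt (with_triangles Q sO sM Std) = tgt Q"
  "ident (with_triangles Q sO sM Std) = ident Q"
  "cmp (with_triangles Q sO sM Std) = cmp Q"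
  "addm (with_triangles Q sO sM Std) = addm Q"
  "zerom (with_triangles Q sO sM Std) = zerom Q"
  "susO (with_triangles Q sO sM Std) = sO"
  "susM (with_triangles Q sO sM Std) = sM"
  by (simp_all add: with_triangles_def Let_def ab_cat.defs tricat.defs)

lemma tri_iso_cong:
  fixes K :: "('o, 'm, 'z) tricat_scheme" and L :: "('o, 'm, 'y) tricat_scheme"
  assumes "ob K = ob L" "arr K = arr L" "src K = src L" "tgt K = tgt L" "ident K = ident L"
    "cmp K = cmp L" "susO K = susO L" "susM K = susM L"
  shows "tri_iso K = tri_iso L"
proof -
  have "Hom K = Hom L" unfolding fun_eq_iff Hom_def assms by simp
  then show ?thesis
    unfolding fun_eq_iff tri_iso_def triangle_on_def tri_morphism_def iso_arr_def assms by simp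
qed

lemma Tri_with_triangles:
  "Tri (with_triangles Q sO sM Std) = {T. \<exists>S \<in> Std. tri_iso (with_triangles Q sO sM Std) S T}"
proof -
  have "tri_iso (ab_cat.extend Q (tricat.fields sO sM {})) = tri_iso (with_triangles Q sO sM Std)"
    by (rule tri_iso_cong) (simp_all add: ab_cat.defs tricat.defs)
  then show ?thesis by (simp add: with_triangles_def Let_def)
qed

lemma (in additive_ideal) additive_quotient_with_triangles:
  "additive_quotient C P (with_triangles (quotient_cat C P) sO sM Std)"
  by unfold_locales (simp_all add: quotient_cat_def)

text \<open>
  The axioms of a triangulated category except for the octahedral axiom, and with rotation in one
  direction only.  The other direction follows, see \<open>tri_rotate_back\<close>.
\<close>

locale pretriangulated = additive_category K
  for K :: "('o, 'm, 'z) tricat_scheme" (structure) +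
  assumes sus_equivalence: "additive_equivalence K K (susO K) (susM K)"
    and tri_typed: "T \<in> Tri K \<Longrightarrow> \<exists>X Y Z. triangle_on K X Y Z T"
    and tri_iso_closed: "\<lbrakk>S \<in> Tri K; tri_iso K S T\<rbrakk> \<Longrightarrow> T \<in> Tri K"
    and tri_ident_left: "\<lbrakk>X \<in> ob K; zero_object K N\<rbrakk>
      \<Longrightarrow> (ident K X, zerom K X N, zerom K N (susO K X)) \<in> Tri K"
    and tri_ident_right: "\<lbrakk>X \<in> ob K; zero_object K N\<rbrakk>
      \<Longrightarrow> (zerom K N X, ident K X, zerom K X (susO K N)) \<in> Tri K"
    and tri_cone: "f \<in> arr K \<Longrightarrow> \<exists>g h. (f, g, h) \<in> Tri K"
    and tri_rotate: "(f, g, h) \<in> Tri K \<Longrightarrow> (g, h, \<ominus> (susM K f)) \<in> Tri K"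
    and tri_complete:
      "\<lbrakk>(f, g, h) \<in> Tri K; (f', g', h') \<in> Tri K;
        u \<in> Hom K (src K f) (src K f'); v \<in> Hom K (tgt K f) (tgt K f'); v \<cdot> f = f' \<cdot> u\<rbrakk>
      \<Longrightarrow> \<exists>w. tri_morphism K (f, g, h) (f', g', h') u v w"
begin

sublocale Sus: additive_functor K K "susO K" "susM K"
  by (rule additive_equivalence_functor[OF sus_equivalence]) unfold_locales

lemmas sus_equiv = additive_equivalenceD(1)[OF sus_equivalence]
lemmas sus_full = equivalence_full[OF sus_equiv]

lemma sus_eqD:
  assumes "susM K f = susM K g" "f \<in> arr K" "g \<in> arr K" "src K f = src K g" "tgt K f = tgt K g"
  shows "f = g"
  by (rule equivalence_faithful[OF sus_equiv, of f "src K f" "tgt K f"]) (use assms in auto)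

lemma tri_arrs:
  assumes "(f, g, h) \<in> Tri K"
  shows "f \<in> arr K" "g \<in> arr K" "h \<in> arr K" "src K g = tgt K f" "src K h = tgt K g"
    "tgt K h = susO K (src K f)"
  using tri_typed[OF assms] by (auto simp: triangle_on_def)

lemma tri_completeE:
  assumes "(f, g, h) \<in> Tri K" "(f', g', h') \<in> Tri K"
    "u \<in> Hom K (src K f) (src K f')" "v \<in> Hom K (tgt K f) (tgt K f')" "v \<cdot> f = f' \<cdot> u"
  obtains w where "w \<in> Hom K (tgt K g) (tgt K g')" "w \<cdot> g = g' \<cdot> v" "susM K u \<cdot> h = h' \<cdot> w"
  using tri_complete[OF assms] by (auto simp: tri_morphism_def)

lemma ex_zero: obtains N where "zero_object K N" "N \<in> ob K"
  using ex_zero_object by (auto simp: zero_object_def)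

lemma tri_gf_zero:
  assumes "(f, g, h) \<in> Tri K"
  shows "g \<cdot> f = zerom K (src K f) (tgt K g)"
proof -
  note [simp] = tri_arrs[OF assms]
  obtain N where N: "zero_object K N" "N \<in> ob K" by (rule ex_zero)
  have 1: "(ident K (src K f), zerom K (src K f) N, zerom K N (susO K (src K f))) \<in> Tri K"
    using N by (intro tri_ident_left) auto
  obtain w where w: "w \<in> Hom K N (tgt K g)" "w \<cdot> zerom K (src K f) N = g \<cdot> f"
    by (rule tri_completeE[OF 1 assms, of "ident K (src K f)" f]) (use N in auto)
  show ?thesis using w N by (simp flip: w(2))
qed

lemma tri_hg_zero:
  assumes "(f, g, h) \<in> Tri K"
  shows "h \<cdot> g = zerom K (tgt K f) (susO K (src K f))"
  using tri_gf_zero[OF tri_rotate[OF assms]] tri_arrs[OF assms] by simp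

text \<open>
  Complete \<open>0\<close> and \<open>t\<close> to a morphism into the triangle \<open>0 \<rightarrow> T \<rightarrow> T \<rightarrow> 0\<close>.
\<close>

lemma weak_cokernel:
  assumes "(f, g, h) \<in> Tri K" "t \<in> Hom K (tgt K f) T" "t \<cdot> f = zerom K (src K f) T"
  obtains s where "s \<in> Hom K (tgt K g) T" "s \<cdot> g = t"
proof -
  note [simp] = tri_arrs[OF assms(1)]
  have [unfolded Hom_iff, simp]: "t \<in> Hom K (tgt K f) T" "T \<in> ob K" using assms(2) by auto
  obtain N where N: "zero_object K N" "N \<in> ob K" by (rule ex_zero)
  have 1: "(zerom K N T, ident K T, zerom K T (susO K N)) \<in> Tri K"
    using N by (intro tri_ident_right) auto
  obtain w where w: "w \<in> Hom K (tgt K g) T" "w \<cdot> g = ident K T \<cdot> t"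
    by (rule tri_completeE[OF assms(1) 1, of "zerom K (src K f) N" t]) (use N assms in auto)
  show ?thesis by (rule that[of w]) (use w in auto)
qed

text \<open>
  Complete \<open>t\<close> and \<open>0\<close> to a morphism from the rotated triangle \<open>T \<rightarrow> 0 \<rightarrow> \<Sigma>T \<rightarrow> \<Sigma>T\<close>; its third component
  is, up to sign, the suspension of the required factor.
\<close>

lemma weak_kernel:
  assumes "(f, g, h) \<in> Tri K" "t \<in> Hom K T (tgt K f)" "g \<cdot> t = zerom K T (tgt K g)"
  obtains s where "s \<in> Hom K T (src K f)" "f \<cdot> s = t"
proof -
  note [simp] = tri_arrs[OF assms(1)]
  have [unfolded Hom_iff, simp]: "t \<in> Hom K T (tgt K f)" "T \<in> ob K" using assms(2) by auto
  obtain N where N: "zero_object K N" "N \<in> ob K" by (rule ex_zero)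
  have 1: "(zerom K T N, zerom K N (susO K T), \<ominus> (susM K (ident K T))) \<in> Tri K"
    using N by (intro tri_rotate tri_ident_left) auto
  obtain w where w: "w \<in> Hom K (susO K T) (susO K (src K f))"
    "susM K t \<cdot> \<ominus> (susM K (ident K T)) = \<ominus> (susM K f) \<cdot> w"
    by (rule tri_completeE[OF 1 tri_rotate[OF assms(1)], of t "zerom K N (tgt K g)"]) (use N assms in auto)
  obtain s where s: "s \<in> Hom K T (src K f)" "susM K s = w"
    using sus_full[of T "src K f" w] w by auto
  have "\<ominus> (susM K t) = \<ominus> (susM K (f \<cdot> s))" using w s by simp
  then have "susM K t = susM K (f \<cdot> s)" by (subst (asm) neg_eq_iff) (use s in auto)
  then have "f \<cdot> s = t" by (rule sus_eqD[symmetric]) (use s in auto)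
  with s show ?thesis by (intro that[of s]) auto
qed

lemma weak_kernel2:
  assumes "(f, g, h) \<in> Tri K" "t \<in> Hom K T (tgt K g)" "h \<cdot> t = zerom K T (susO K (src K f))"
  obtains s where "s \<in> Hom K T (tgt K f)" "g \<cdot> s = t"
  by (rule weak_kernel[OF tri_rotate[OF assms(1)], of t T]) (use assms tri_arrs[OF assms(1)] that in auto)

lemma weak_cokernel2:
  assumes "(f, g, h) \<in> Tri K" "t \<in> Hom K (tgt K g) T" "t \<cdot> g = zerom K (tgt K f) T"
  obtains s where "s \<in> Hom K (susO K (src K f)) T" "s \<cdot> h = t"
  by (rule weak_cokernel[OF tri_rotate[OF assms(1)], of t T]) (use assms tri_arrs[OF assms(1)] that in auto)

text \<open>
  Complete the inverses of \<open>u\<close> and \<open>v\<close> to a morphism with third component \<open>w'\<close>.  The difference \<open>n\<close> of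
  \<open>w' \<cdot> w\<close> and the identity satisfies \<open>h \<cdot> n = 0\<close>, hence factors through \<open>g\<close>, and \<open>n \<cdot> g = 0\<close>; so \<open>n\<close>
  has square zero.  The same applies to \<open>w \<cdot> w'\<close>.
\<close>

lemma five:
  assumes T: "(f, g, h) \<in> Tri K" "(f', g', h') \<in> Tri K"
    and m: "tri_morphism K (f, g, h) (f', g', h') u v w"
    and iso: "iso_arr K (src K f) (src K f') u" "iso_arr K (tgt K f) (tgt K f') v"
  shows "iso_arr K (tgt K g) (tgt K g') w"
proof -
  note [simp] = tri_arrs[OF T(1)] tri_arrs[OF T(2)]
  have [unfolded Hom_iff, simp]: "u \<in> Hom K (src K f) (src K f')" "v \<in> Hom K (tgt K f) (tgt K f')"
    "w \<in> Hom K (tgt K g) (tgt K g')"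
    and sq: "v \<cdot> f = f' \<cdot> u" "w \<cdot> g = g' \<cdot> v" "susM K u \<cdot> h = h' \<cdot> w"
    using m by (auto simp: tri_morphism_def)
  obtain u' where u': "u' \<in> Hom K (src K f') (src K f)" "u' \<cdot> u = ident K (src K f)" "u \<cdot> u' = ident K (src K f')"
    using iso(1) by (auto elim: iso_arrE)
  obtain v' where v': "v' \<in> Hom K (tgt K f') (tgt K f)" "v' \<cdot> v = ident K (tgt K f)" "v \<cdot> v' = ident K (tgt K f')"
    using iso(2) by (auto elim: iso_arrE)
  have [unfolded Hom_iff, simp]: "u' \<in> Hom K (src K f') (src K f)" "v' \<in> Hom K (tgt K f') (tgt K f)"
    using u'(1) v'(1) by auto
  have "v' \<cdot> f' = v' \<cdot> (f' \<cdot> (u \<cdot> u'))" unfolding u' by simp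
  also have "\<dots> = v' \<cdot> (v \<cdot> (f \<cdot> u'))" using sq(1) by (simp add: reassoc[OF sq(1)])
  also have "\<dots> = f \<cdot> u'" by (simp add: reassoc[OF v'(2)])
  finally have sq1: "v' \<cdot> f' = f \<cdot> u'" .
  obtain w' where w': "w' \<in> Hom K (tgt K g') (tgt K g)" "w' \<cdot> g' = g \<cdot> v'" "susM K u' \<cdot> h' = h \<cdot> w'"
    by (rule tri_completeE[OF T(2,1) _ _ sq1]) (use u' v' in auto)
  have [unfolded Hom_iff, simp]: "w' \<in> Hom K (tgt K g') (tgt K g)" using w'(1) by auto
  have su: "susM K u' \<cdot> susM K u = ident K (susO K (src K f))" "susM K u \<cdot> susM K u' = ident K (susO K (src K f'))"
    using u' by (simp_all flip: Sus.functor_comp)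
  define n where "n = w' \<cdot> w \<ominus> ident K (tgt K g)"
  define m where "m = w \<cdot> w' \<ominus> ident K (tgt K g')"
  have [unfolded Hom_iff, simp]: "n \<in> Hom K (tgt K g) (tgt K g)" "m \<in> Hom K (tgt K g') (tgt K g')"
    by (auto simp: n_def m_def)
  have ng: "n \<cdot> g = zerom K (tgt K f) (tgt K g)"
    by (simp add: n_def sq reassoc[OF w'(2)] v')
  have mg: "m \<cdot> g' = zerom K (tgt K f') (tgt K g')"
    by (simp add: m_def w' reassoc[OF sq(2)] v')
  have "h \<cdot> n = zerom K (tgt K g) (susO K (src K f))"
    by (simp add: n_def reassoc[OF w'(3)[symmetric]] sq(3)[symmetric] reassoc[OF su(1)])
  then obtain s where s: "s \<in> Hom K (tgt K g) (tgt K f)" "g \<cdot> s = n"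
    by (rule weak_kernel2[OF T(1), rotated]) auto
  have "h' \<cdot> m = zerom K (tgt K g') (susO K (src K f'))"
    by (simp add: m_def reassoc[OF sq(3)[symmetric]] w'(3)[symmetric] reassoc[OF su(2)])
  then obtain r where r: "r \<in> Hom K (tgt K g') (tgt K f')" "g' \<cdot> r = m"
    by (rule weak_kernel2[OF T(2), rotated]) auto
  have "n \<cdot> n = n \<cdot> (g \<cdot> s)" using s by simp
  also have "\<dots> = zerom K (tgt K g) (tgt K g)" using s(1) by (simp add: reassoc[OF ng])
  finally have nn: "n \<cdot> n = zerom K (tgt K g) (tgt K g)" .
  have "m \<cdot> m = m \<cdot> (g' \<cdot> r)" using r by simp
  also have "\<dots> = zerom K (tgt K g') (tgt K g')" using r(1) by (simp add: reassoc[OF mg])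
  finally have mm: "m \<cdot> m = zerom K (tgt K g') (tgt K g')" .
  have "w' \<cdot> w = ident K (tgt K g) \<oplus> n" "w \<cdot> w' = ident K (tgt K g') \<oplus> m"
    by (simp_all add: n_def m_def subm_def add_ac)
  then show ?thesis by (intro iso_of_nilpotent[of w _ _ w' n m] nn mm) auto
qed

lemma tri_iso_of_isos:
  assumes T: "(f, g, h) \<in> Tri K" "(f', g', h') \<in> Tri K"
    and iso: "iso_arr K (src K f) (src K f') u" "iso_arr K (tgt K f) (tgt K f') v" "v \<cdot> f = f' \<cdot> u"
  obtains w where "iso_arr K (tgt K g) (tgt K g') w" "w \<cdot> g = g' \<cdot> v" "susM K u \<cdot> h = h' \<cdot> w"
proof -
  have uv: "u \<in> Hom K (src K f) (src K f')" "v \<in> Hom K (tgt K f) (tgt K f')" using iso by (auto elim: iso_arrE)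
  obtain w where w: "tri_morphism K (f, g, h) (f', g', h') u v w"
    using tri_complete[OF T uv iso(3)] by blast
  show ?thesis using five[OF T w iso(1,2)] w by (intro that[of w]) (auto simp: tri_morphism_def)
qed

lemma tri_isoI:
  assumes "(f', g', h') \<in> Tri K"
    "f \<in> Hom K X Y" "g \<in> Hom K Y Z" "h \<in> Hom K Z (susO K X)"
    "iso_arr K X (src K f') u" "iso_arr K Y (tgt K f') v" "iso_arr K Z (tgt K g') w"
    "v \<cdot> f = f' \<cdot> u" "w \<cdot> g = g' \<cdot> v" "susM K u \<cdot> h = h' \<cdot> w"
  shows "(f, g, h) \<in> Tri K"
proof -
  note [simp] = tri_arrs[OF assms(1)]
  obtain u' where u': "u \<in> Hom K X (src K f')" "u' \<in> Hom K (src K f') X" "u' \<cdot> u = ident K X" "u \<cdot> u' = ident K (src K f')" "iso_arr K (src K f') X u'"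
    using assms(5) by (rule iso_arrE)
  obtain v' where v': "v \<in> Hom K Y (tgt K f')" "v' \<in> Hom K (tgt K f') Y" "v' \<cdot> v = ident K Y" "v \<cdot> v' = ident K (tgt K f')" "iso_arr K (tgt K f') Y v'"
    using assms(6) by (rule iso_arrE)
  obtain w' where w': "w \<in> Hom K Z (tgt K g')" "w' \<in> Hom K (tgt K g') Z" "w' \<cdot> w = ident K Z" "w \<cdot> w' = ident K (tgt K g')" "iso_arr K (tgt K g') Z w'"
    using assms(7) by (rule iso_arrE)
  have [unfolded Hom_iff, simp]: "f \<in> Hom K X Y" "g \<in> Hom K Y Z" "h \<in> Hom K Z (susO K X)" using assms(2-4) by auto
  have [unfolded Hom_iff, simp]: "u \<in> Hom K X (src K f')" "u' \<in> Hom K (src K f') X" "v \<in> Hom K Y (tgt K f')"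
    "v' \<in> Hom K (tgt K f') Y" "w \<in> Hom K Z (tgt K g')" "w' \<in> Hom K (tgt K g') Z"
    using u' v' w' by auto
  have ob [simp]: "X \<in> ob K" "Y \<in> ob K" "Z \<in> ob K" using assms(2-4) Hom_ob by blast+
  have su: "susM K u' \<cdot> susM K u = ident K (susO K X)" "susM K u \<cdot> susM K u' = ident K (susO K (src K f'))"
    using u' by (simp_all flip: Sus.functor_comp)
  have "v' \<cdot> f' = v' \<cdot> (f' \<cdot> (u \<cdot> u'))" unfolding u' by simp
  also have "\<dots> = v' \<cdot> (v \<cdot> (f \<cdot> u'))" by (simp add: reassoc[OF assms(8)])
  also have "\<dots> = f \<cdot> u'" by (simp add: reassoc[OF v'(3)])
  finally have 1: "v' \<cdot> f' = f \<cdot> u'" .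
  have "w' \<cdot> g' = w' \<cdot> (g' \<cdot> (v \<cdot> v'))" unfolding v' by simp
  also have "\<dots> = w' \<cdot> (w \<cdot> (g \<cdot> v'))" by (simp add: reassoc[OF assms(9)])
  also have "\<dots> = g \<cdot> v'" by (simp add: reassoc[OF w'(3)])
  finally have 2: "w' \<cdot> g' = g \<cdot> v'" .
  have "susM K u' \<cdot> h' = susM K u' \<cdot> (h' \<cdot> (w \<cdot> w'))" unfolding w' by simp
  also have "\<dots> = susM K u' \<cdot> (susM K u \<cdot> (h \<cdot> w'))" by (simp add: reassoc[OF assms(10)])
  also have "\<dots> = h \<cdot> w'" by (simp add: reassoc[OF su(1)])
  finally have 3: "susM K u' \<cdot> h' = h \<cdot> w'" .
  have "tri_iso K (f', g', h') (f, g, h)"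
    unfolding tri_iso_def triangle_on_def tri_morphism_def prod.case
    by (rule exI[of _ "src K f'"], rule exI[of _ "tgt K f'"], rule exI[of _ "tgt K g'"],
       rule exI[of _ X], rule exI[of _ Y], rule exI[of _ Z], rule exI[of _ u'], rule exI[of _ v'], rule exI[of _ w'])
      (use 1 2 3 u' v' w' in auto)
  then show ?thesis using assms(1) by (rule tri_iso_closed[rotated])
qed

text \<open>
  Rotated twice, the given triangle starts with \<open>- \<Sigma>f\<close>, and so does a cone of \<open>f\<close> rotated three times.
  They are therefore isomorphic, and the isomorphism of their third objects is a suspension.
\<close>

lemma tri_rotate_back:
  assumes T: "(g, h, \<ominus> (susM K f)) \<in> Tri K" and f: "f \<in> Hom K X Y" "src K g = Y" "tgt K h = susO K X"
  shows "(f, g, h) \<in> Tri K"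
proof -
  note [simp] = tri_arrs[OF T]
  have [unfolded Hom_iff, simp]: "f \<in> Hom K X Y" using f by auto
  have ob [simp]: "X \<in> ob K" "Y \<in> ob K" using f Hom_ob by blast+
  obtain g1 h1 where T1: "(f, g1, h1) \<in> Tri K" using tri_cone[of f] by auto
  note [simp] = tri_arrs[OF T1]
  let ?Z = "tgt K g1"
  have A: "(\<ominus> (susM K f), \<ominus> (susM K g1), \<ominus> (susM K h1)) \<in> Tri K" by (intro tri_rotate T1)
  have B: "(\<ominus> (susM K f), \<ominus> (susM K g), \<ominus> (susM K h)) \<in> Tri K" by (intro tri_rotate T)
  have "iso_arr K (susO K X) (susO K X) (ident K (susO K X))" "iso_arr K (susO K Y) (susO K Y) (ident K (susO K Y))"
    by (intro iso_ident; simp)+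
  then obtain w where w: "iso_arr K (susO K ?Z) (susO K (tgt K g)) w"
    "w \<cdot> \<ominus> (susM K g1) = \<ominus> (susM K g)" "\<ominus> (susM K h1) = \<ominus> (susM K h) \<cdot> w"
    using tri_iso_of_isos[OF A B, of "ident K (susO K X)" "ident K (susO K Y)"] f(2,3) by auto
  have w0: "w \<in> Hom K (susO K ?Z) (susO K (tgt K g))" using w(1) by (auto elim: iso_arrE)
  obtain k where k: "k \<in> Hom K ?Z (tgt K g)" "susM K k = w"
    using sus_full[of ?Z "tgt K g" w] w0 by auto
  have ki: "iso_arr K ?Z (tgt K g) k" using equivalence_reflects_iso[OF sus_equiv k(1)] k w by simp
  have [unfolded Hom_iff, simp]: "k \<in> Hom K (?Z) (tgt K g)" using k by auto
  have "susM K g = \<ominus> (w \<cdot> \<ominus> (susM K g1))" using f w(2) by simp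
  also have "\<dots> = susM K (k \<cdot> g1)" using k(2)[symmetric] by simp
  finally have kg: "k \<cdot> g1 = g" by (rule sus_eqD[symmetric]) (use f in auto)
  have "susM K h1 = \<ominus> (\<ominus> (susM K h) \<cdot> w)" using w(3)[symmetric] by simp
  also have "\<dots> = susM K (h \<cdot> k)" using k(2)[symmetric] by simp
  finally have kh: "h1 = h \<cdot> k" by (rule sus_eqD) (use f in auto)
  have "tri_iso K (f, g1, h1) (f, g, h)"
    unfolding tri_iso_def triangle_on_def tri_morphism_def prod.case
    by (rule exI[of _ X], rule exI[of _ Y], rule exI[of _ ?Z],
       rule exI[of _ X], rule exI[of _ Y], rule exI[of _ "tgt K g"], rule exI[of _ "ident K X"], rule exI[of _ "ident K Y"], rule exI[of _ k])
      (use kg kh ki f iso_ident in auto)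
  then show ?thesis using T1 by (rule tri_iso_closed[rotated])
qed

text \<open>
  The completion axiom for the rotated triangles gives the suspension of \<open>u\<close>.
\<close>

lemma complete_first:
  assumes T: "(f, g, h) \<in> Tri K" "(f', g', h') \<in> Tri K"
    and v: "v \<in> Hom K (tgt K f) (tgt K f')" "w \<in> Hom K (tgt K g) (tgt K g')" "w \<cdot> g = g' \<cdot> v"
  obtains u where "u \<in> Hom K (src K f) (src K f')" "v \<cdot> f = f' \<cdot> u" "susM K u \<cdot> h = h' \<cdot> w"
    "\<lbrakk>iso_arr K (tgt K f) (tgt K f') v; iso_arr K (tgt K g) (tgt K g') w\<rbrakk> \<Longrightarrow> iso_arr K (src K f) (src K f') u"
proof -
  note [simp] = tri_arrs[OF T(1)] tri_arrs[OF T(2)]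
  have [unfolded Hom_iff, simp]: "v \<in> Hom K (tgt K f) (tgt K f')" "w \<in> Hom K (tgt K g) (tgt K g')"
    using v by auto
  obtain x where x: "tri_morphism K (g, h, \<ominus> (susM K f)) (g', h', \<ominus> (susM K f')) v w x"
    using tri_complete[OF tri_rotate[OF T(1)] tri_rotate[OF T(2)], of v w] v by auto
  then have x': "x \<in> Hom K (susO K (src K f)) (susO K (src K f'))" "x \<cdot> h = h' \<cdot> w"
     "susM K v \<cdot> \<ominus> (susM K f) = \<ominus> (susM K f') \<cdot> x"
    by (auto simp: tri_morphism_def)
  obtain u where u: "u \<in> Hom K (src K f) (src K f')" "susM K u = x"
    using sus_full[of "src K f" "src K f'" x] x' by auto
  have [unfolded Hom_iff, simp]: "u \<in> Hom K (src K f) (src K f')" using u by auto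
  have "susM K (v \<cdot> f) = \<ominus> (susM K v \<cdot> \<ominus> (susM K f))" by simp
  also have "\<dots> = susM K (f' \<cdot> u)" unfolding x' u(2)[symmetric] by simp
  finally have vf: "v \<cdot> f = f' \<cdot> u" by (rule sus_eqD) auto
  have iso: "iso_arr K (src K f) (src K f') u" if "iso_arr K (tgt K f) (tgt K f') v" "iso_arr K (tgt K g) (tgt K g') w"
  proof -
    have "iso_arr K (tgt K h) (tgt K h') x"
      by (rule five[OF tri_rotate[OF T(1)] tri_rotate[OF T(2)] x]) (use that in auto)
    then show ?thesis using u equivalence_reflects_iso[OF sus_equiv u(1)] by simp
  qed
  show ?thesis by (rule that[OF u(1) vf _ iso]) (use u x' in auto)
qed

lemma complete_middle:
  assumes T: "(f, g, h) \<in> Tri K" "(f', g', h') \<in> Tri K"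
    and v: "u \<in> Hom K (src K f) (src K f')" "w \<in> Hom K (tgt K g) (tgt K g')" "susM K u \<cdot> h = h' \<cdot> w"
  obtains v where "v \<in> Hom K (tgt K f) (tgt K f')" "v \<cdot> f = f' \<cdot> u" "w \<cdot> g = g' \<cdot> v"
proof -
  note [simp] = tri_arrs[OF T(1)] tri_arrs[OF T(2)]
  have [unfolded Hom_iff, simp]: "u \<in> Hom K (src K f) (src K f')" using v(1) by auto
  obtain y where y: "y \<in> Hom K (tgt K f) (tgt K f')" "w \<cdot> g = g' \<cdot> y"
    "susM K y \<cdot> \<ominus> (susM K f) = \<ominus> (susM K f') \<cdot> susM K u"
  proof (rule complete_first[OF tri_rotate[OF T(1)] tri_rotate[OF T(2)]])
    show "w \<in> Hom K (tgt K g) (tgt K g')" using v by simp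
    show "susM K u \<in> Hom K (tgt K h) (tgt K h')" by simp
    show "susM K u \<cdot> h = h' \<cdot> w" by fact
    fix y assume y: "y \<in> Hom K (src K g) (src K g')" "w \<cdot> g = g' \<cdot> y"
       "susM K y \<cdot> \<ominus> (susM K f) = \<ominus> (susM K f') \<cdot> susM K u"
    show thesis using y v by (intro that[of y]) auto
  qed
  have [unfolded Hom_iff, simp]: "y \<in> Hom K (tgt K f) (tgt K f')" using y by auto
  have "susM K (y \<cdot> f) = \<ominus> (susM K y \<cdot> \<ominus> (susM K f))" by simp
  also have "\<dots> = susM K (f' \<cdot> u)" unfolding y(3) by simp
  finally have "y \<cdot> f = f' \<cdot> u" by (rule sus_eqD) auto
  then show ?thesis using y by (intro that[of y]) auto
qed

text \<open>
  The five lemma for the triangles rotated twice, where \<open>\<Sigma>v\<close> is the third component.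
\<close>

lemma five_middle:
  assumes T: "(f, g, h) \<in> Tri K" "(f', g', h') \<in> Tri K"
    and v: "v \<in> Hom K (tgt K f) (tgt K f')" "v \<cdot> f = f' \<cdot> u" "w \<cdot> g = g' \<cdot> v" "susM K u \<cdot> h = h' \<cdot> w"
    and iso: "iso_arr K (src K f) (src K f') u" "iso_arr K (tgt K g) (tgt K g') w"
  shows "iso_arr K (tgt K f) (tgt K f') v"
proof -
  note [simp] = tri_arrs[OF T(1)] tri_arrs[OF T(2)]
  have [unfolded Hom_iff, simp]: "v \<in> Hom K (tgt K f) (tgt K f')" "u \<in> Hom K (src K f) (src K f')"
    "w \<in> Hom K (tgt K g) (tgt K g')" using v(1) iso by (auto elim: iso_arrE)
  have "susM K v \<cdot> susM K f = susM K f' \<cdot> susM K u" "susM K w \<cdot> susM K g = susM K g' \<cdot> susM K v"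
    using v(2,3) by (simp_all flip: Sus.functor_comp)
  then have "tri_morphism K (h, \<ominus> (susM K f), \<ominus> (susM K g)) (h', \<ominus> (susM K f'), \<ominus> (susM K g')) w (susM K u) (susM K v)"
    using v(4) by (simp add: tri_morphism_def)
  then have "iso_arr K (tgt K (\<ominus> (susM K f))) (tgt K (\<ominus> (susM K f'))) (susM K v)"
    by (rule five[OF tri_rotate[OF tri_rotate[OF T(1)]] tri_rotate[OF tri_rotate[OF T(2)]]])
      (use iso Sus.functor_iso[OF iso(1)] in auto)
  then show ?thesis using equivalence_reflects_iso[OF sus_equiv v(1)] by simp
qed

lemma iso_of_zero_middle:
  assumes T: "(f, g, h) \<in> Tri K" and N: "zero_object K (tgt K f)"
  shows "iso_arr K (tgt K g) (susO K (src K f)) h"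
proof -
  note [simp] = tri_arrs[OF T]
  have "ident K (tgt K g) \<cdot> g = zerom K (tgt K f) (tgt K g)"
    by (rule zero_object_unique[OF N]) auto
  then obtain s where s: "s \<in> Hom K (susO K (src K f)) (tgt K g)" "s \<cdot> h = ident K (tgt K g)"
    by - (rule weak_cokernel2[OF T, of "ident K (tgt K g)" "tgt K g"], auto)
  have "\<ominus> (susM K f) \<cdot> ident K (susO K (src K f)) = zerom K (susO K (src K f)) (susO K (tgt K f))"
    by (rule zero_object_unique[OF Sus.functor_zero_object[OF N]]) auto
  then obtain t where t: "t \<in> Hom K (susO K (src K f)) (tgt K g)" "h \<cdot> t = ident K (susO K (src K f))"
    by - (rule weak_kernel2[OF tri_rotate[OF T], of "ident K (susO K (src K f))" "susO K (src K f)"], auto)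
  have [unfolded Hom_iff, simp]: "s \<in> Hom K (susO K (src K f)) (tgt K g)" "t \<in> Hom K (susO K (src K f)) (tgt K g)" using s t by auto
  have "s = s \<cdot> (h \<cdot> t)" by (simp add: t(2))
  also have "\<dots> = t" by (simp add: reassoc[OF s(2)])
  finally show ?thesis by (intro iso_arrI[where g = s]) (use s t in auto)
qed

end

section \<open>The octahedral axiom and homotopy pushouts\<close>

text \<open>
  The octahedral axiom for one composite \<open>g \<cdot> f\<close>, where \<open>(f, f1, f2)\<close>, \<open>(g, g1, g2)\<close> and
  \<open>(g \<cdot> f, k1, k2)\<close> are the chosen triangles.
\<close>

definition has_octahedron ::
  "('o, 'm, 'z) tricat_scheme \<Rightarrow> 'm \<Rightarrow> 'm \<Rightarrow> 'm \<Rightarrow> 'm \<Rightarrow> 'm \<Rightarrow> 'm \<Rightarrow> 'm \<Rightarrow> 'm \<Rightarrow> bool" where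
  "has_octahedron K f g f1 f2 g1 g2 k1 k2 \<longleftrightarrow>
    (\<exists>a b. (a, b, susM K f1 \<cdot>\<^bsub>K\<^esub> g2) \<in> Tri K \<and>
       a \<in> Hom K (tgt K f1) (tgt K k1) \<and> b \<in> Hom K (tgt K k1) (tgt K g1) \<and>
       a \<cdot>\<^bsub>K\<^esub> f1 = k1 \<cdot>\<^bsub>K\<^esub> g \<and> k2 \<cdot>\<^bsub>K\<^esub> a = f2 \<and> b \<cdot>\<^bsub>K\<^esub> k1 = g1 \<and> g2 \<cdot>\<^bsub>K\<^esub> b = susM K f \<cdot>\<^bsub>K\<^esub> k2)"

context pretriangulated
begin

text \<open>
  Cones are unique up to isomorphism, so it suffices to know the octahedral axiom for one choice of
  cones and for an isomorphic pair of maps.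
\<close>

lemma has_octahedron_transport:
  assumes fg: "f \<in> Hom K X Y" "g \<in> Hom K Y Z"
    and T: "(f, f1, f2) \<in> Tri K" "(g, g1, g2) \<in> Tri K" "(g \<cdot> f, k1, k2) \<in> Tri K"
    and fg': "f' \<in> Hom K X' Y'" "g' \<in> Hom K Y' Z'"
    and T': "(f', f1', f2') \<in> Tri K" "(g', g1', g2') \<in> Tri K" "(g' \<cdot> f', k1', k2') \<in> Tri K"
    and oct: "has_octahedron K f' g' f1' f2' g1' g2' k1' k2'"
    and iso: "iso_arr K X X' x" "iso_arr K Y Y' y" "iso_arr K Z Z' z"
    and sq: "y \<cdot> f = f' \<cdot> x" "z \<cdot> g = g' \<cdot> y"
  shows "has_octahedron K f g f1 f2 g1 g2 k1 k2"
proof -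
  have [unfolded Hom_iff, simp]: "f \<in> Hom K X Y" "g \<in> Hom K Y Z" "f' \<in> Hom K X' Y'" "g' \<in> Hom K Y' Z'"
    using fg fg' by auto
  have [unfolded Hom_iff, simp]: "f1 \<in> arr K" "src K f1 = Y" "f2 \<in> Hom K (tgt K f1) (susO K X)"
    using tri_arrs[OF T(1)] by auto
  have [unfolded Hom_iff, simp]: "g1 \<in> arr K" "src K g1 = Z" "g2 \<in> Hom K (tgt K g1) (susO K Y)"
    using tri_arrs[OF T(2)] by auto
  have [unfolded Hom_iff, simp]: "k1 \<in> arr K" "src K k1 = Z" "k2 \<in> Hom K (tgt K k1) (susO K X)"
    using tri_arrs[OF T(3)] by auto
  have [unfolded Hom_iff, simp]: "f1' \<in> arr K" "src K f1' = Y'" "f2' \<in> Hom K (tgt K f1') (susO K X')"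
    using tri_arrs[OF T'(1)] by auto
  have [unfolded Hom_iff, simp]: "g1' \<in> arr K" "src K g1' = Z'" "g2' \<in> Hom K (tgt K g1') (susO K Y')"
    using tri_arrs[OF T'(2)] by auto
  have [unfolded Hom_iff, simp]: "k1' \<in> arr K" "src K k1' = Z'" "k2' \<in> Hom K (tgt K k1') (susO K X')"
    using tri_arrs[OF T'(3)] by auto
  have [unfolded Hom_iff, simp]: "x \<in> Hom K X X'" "y \<in> Hom K Y Y'" "z \<in> Hom K Z Z'"
    using iso by (auto elim: iso_arrE)
  obtain \<alpha> where \<alpha>: "iso_arr K (tgt K f1) (tgt K f1') \<alpha>" "\<alpha> \<cdot> f1 = f1' \<cdot> y" "susM K x \<cdot> f2 = f2' \<cdot> \<alpha>"
    by (rule tri_iso_of_isos[OF T(1) T'(1), of x y]) (use iso sq in auto)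
  obtain \<beta> where \<beta>: "iso_arr K (tgt K g1) (tgt K g1') \<beta>" "\<beta> \<cdot> g1 = g1' \<cdot> z" "susM K y \<cdot> g2 = g2' \<cdot> \<beta>"
    by (rule tri_iso_of_isos[OF T(2) T'(2), of y z]) (use iso sq in auto)
  have zgf: "z \<cdot> (g \<cdot> f) = g' \<cdot> f' \<cdot> x" using sq by (simp add: reassoc[OF sq(2)])
  obtain \<gamma> where \<gamma>: "iso_arr K (tgt K k1) (tgt K k1') \<gamma>" "\<gamma> \<cdot> k1 = k1' \<cdot> z" "susM K x \<cdot> k2 = k2' \<cdot> \<gamma>"
    by (rule tri_iso_of_isos[OF T(3) T'(3), of x z]) (use iso zgf in auto)
  obtain \<gamma>' where \<gamma>': "\<gamma> \<in> Hom K (tgt K k1) (tgt K k1')" "\<gamma>' \<in> Hom K (tgt K k1') (tgt K k1)" "\<gamma> \<cdot> \<gamma>' = ident K (tgt K k1')"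
    using \<gamma>(1) by (auto elim: iso_arrE)
  obtain \<beta>' where \<beta>': "\<beta> \<in> Hom K (tgt K g1) (tgt K g1')" "\<beta>' \<in> Hom K (tgt K g1') (tgt K g1)" "\<beta> \<cdot> \<beta>' = ident K (tgt K g1')"
    using \<beta>(1) by (auto elim: iso_arrE)
  have [unfolded Hom_iff, simp]: "\<alpha> \<in> Hom K (tgt K f1) (tgt K f1')" using \<alpha>(1) by (auto elim: iso_arrE)
  have [unfolded Hom_iff, simp]: "\<gamma> \<in> Hom K (tgt K k1) (tgt K k1')" "\<gamma>' \<in> Hom K (tgt K k1') (tgt K k1)"
    using \<gamma>' by auto
  have [unfolded Hom_iff, simp]: "\<beta> \<in> Hom K (tgt K g1) (tgt K g1')" "\<beta>' \<in> Hom K (tgt K g1') (tgt K g1)"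
    using \<beta>' by auto
  obtain a' b' where ab': "(a', b', susM K f1' \<cdot> g2') \<in> Tri K"
       "a' \<in> Hom K (tgt K f1') (tgt K k1')" "b' \<in> Hom K (tgt K k1') (tgt K g1')"
       "a' \<cdot> f1' = k1' \<cdot> g'" "k2' \<cdot> a' = f2'" "b' \<cdot> k1' = g1'" "g2' \<cdot> b' = susM K f' \<cdot> k2'"
    using oct unfolding has_octahedron_def by blast
  have [unfolded Hom_iff, simp]: "a' \<in> Hom K (tgt K f1') (tgt K k1')" "b' \<in> Hom K (tgt K k1') (tgt K g1')" using ab' by auto
  define a where "a = \<gamma>' \<cdot> (a' \<cdot> \<alpha>)"
  define b where "b = \<beta>' \<cdot> (b' \<cdot> \<gamma>)"
  have [unfolded Hom_iff, simp]: "a \<in> Hom K (tgt K f1) (tgt K k1)" "b \<in> Hom K (tgt K k1) (tgt K g1)" by (auto simp: a_def b_def)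
  have a: "\<gamma> \<cdot> a = a' \<cdot> \<alpha>" by (simp add: a_def reassoc[OF \<gamma>'(3)])
  have b: "\<beta> \<cdot> b = b' \<cdot> \<gamma>" by (simp add: b_def reassoc[OF \<beta>'(3)])
  have s\<alpha>: "susM K \<alpha> \<cdot> susM K f1 = susM K f1' \<cdot> susM K y" using \<alpha>(2) by (simp flip: Sus.functor_comp)
  have sx: "susM K y \<cdot> susM K f = susM K f' \<cdot> susM K x" using sq(1) by (simp flip: Sus.functor_comp)
  have isox: "iso_arr K (susO K X) (susO K X') (susM K x)" "iso_arr K (susO K Y) (susO K Y') (susM K y)"
    using iso by (auto intro: Sus.functor_iso)
  have "(a, b, susM K f1 \<cdot> g2) \<in> Tri K"
  proof (rule tri_isoI[OF ab'(1)])
    show "susM K \<alpha> \<cdot> (susM K f1 \<cdot> g2) = susM K f1' \<cdot> g2' \<cdot> \<beta>"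
      by (simp add: reassoc[OF s\<alpha>] \<beta>(3))
  qed (use \<alpha> \<beta> \<gamma> a b in auto)
  moreover have "a \<cdot> f1 = k1 \<cdot> g"
  proof (rule iso_cancel_left[OF \<gamma>(1)])
    show "\<gamma> \<cdot> (a \<cdot> f1) = \<gamma> \<cdot> (k1 \<cdot> g)"
      by (simp add: reassoc[OF a] \<alpha>(2) reassoc[OF ab'(4)] reassoc[OF \<gamma>(2)] sq(2))
  qed auto
  moreover have "k2 \<cdot> a = f2"
  proof (rule iso_cancel_left[OF isox(1)])
    show "susM K x \<cdot> (k2 \<cdot> a) = susM K x \<cdot> f2"
      by (simp add: reassoc[OF \<gamma>(3)] a reassoc[OF ab'(5)] \<alpha>(3))
  qed auto
  moreover have "b \<cdot> k1 = g1"
  proof (rule iso_cancel_left[OF \<beta>(1)])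
    show "\<beta> \<cdot> (b \<cdot> k1) = \<beta> \<cdot> g1"
      by (simp add: reassoc[OF b] \<gamma>(2) reassoc[OF ab'(6)] \<beta>(2))
  qed auto
  moreover have "g2 \<cdot> b = susM K f \<cdot> k2"
  proof (rule iso_cancel_left[OF isox(2)])
    show "susM K y \<cdot> (g2 \<cdot> b) = susM K y \<cdot> (susM K f \<cdot> k2)"
      by (simp add: reassoc[OF \<beta>(3)] b reassoc[OF ab'(7)] reassoc[OF sx] \<gamma>(3))
  qed auto
  moreover have "a \<in> Hom K (tgt K f1) (tgt K k1)" "b \<in> Hom K (tgt K k1) (tgt K g1)" by simp_all
  ultimately show ?thesis unfolding has_octahedron_def by blast
qed

lemma triangulatedI:
  assumes "\<And>f g X Y Z f1 f2 g1 g2 k1 k2. \<lbrakk>f \<in> Hom K X Y; g \<in> Hom K Y Z;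
    (f, f1, f2) \<in> Tri K; (g, g1, g2) \<in> Tri K; (g \<cdot> f, k1, k2) \<in> Tri K\<rbrakk>
    \<Longrightarrow> has_octahedron K f g f1 f2 g1 g2 k1 k2"
  shows "triangulated_category K"
proof unfold_locales
  fix X Y Z f g h assume t: "triangle_on K X Y Z (f, g, h)"
  show "(f, g, h) \<in> Tri K \<longleftrightarrow> (g, h, \<ominus> (susM K f)) \<in> Tri K"
    using tri_rotate tri_rotate_back[of g h f X Y] t by (auto simp: triangle_on_def)
next
  fix f X Y g Z f1 f2 g1 g2 k1 k2
  assume f: "f \<in> Hom K X Y" "g \<in> Hom K Y Z"
    "(f, f1, f2) \<in> Tri K" "(g, g1, g2) \<in> Tri K" "(g \<cdot> f, k1, k2) \<in> Tri K"
  obtain a b where ab: "(a, b, susM K f1 \<cdot> g2) \<in> Tri K"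
       "a \<in> Hom K (tgt K f1) (tgt K k1)" "b \<in> Hom K (tgt K k1) (tgt K g1)"
       "a \<cdot> f1 = k1 \<cdot> g" "k2 \<cdot> a = f2" "b \<cdot> k1 = g1" "g2 \<cdot> b = susM K f \<cdot> k2"
    using assms[OF f] unfolding has_octahedron_def by blast
  moreover have "triangle_on K (tgt K f1) (tgt K k1) (tgt K g1) (a, b, susM K f1 \<cdot> g2)"
    using ab(2,3) tri_arrs[OF ab(1)] by (auto simp: triangle_on_def)
  ultimately show "\<exists>a b. (a, b, susM K f1 \<cdot> g2) \<in> Tri K \<and>
            triangle_on K (tgt K f1) (tgt K k1) (tgt K g1) (a, b, susM K f1 \<cdot> g2) \<and>
            a \<cdot> f1 = k1 \<cdot> g \<and> k2 \<cdot> a = f2 \<and> b \<cdot> k1 = g1 \<and> g2 \<cdot> b = susM K f \<cdot> k2"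
    by blast
qed (fact sus_equivalence tri_typed tri_iso_closed tri_ident_left tri_cone tri_complete)+

text \<open>
  A split monomorphism has zero connecting map, hence its cone is a cokernel, which is the
  complementary summand.
\<close>

lemma split_triangle:
  assumes S: "biproduct K A B S i1 i2 p1 p2"
  shows "(i1, p2, zerom K B (susO K A)) \<in> Tri K"
proof -
  note [simp] = biproduct_simps[OF S]
  obtain c d where T: "(i1, c, d) \<in> Tri K" using tri_cone[of i1] by auto
  define D where "D = tgt K c"
  have [simp]: "c \<in> arr K" "d \<in> arr K" "src K c = S" "tgt K c = D" "src K d = D" "tgt K d = susO K A"
    using tri_arrs[OF T] by (auto simp: D_def)
  have [simp]: "D \<in> ob K" using tgt_in_ob[of c] by simp
  have ci: "c \<cdot> i1 = zerom K A D" using tri_gf_zero[OF T] by simp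
  have sp: "susM K p1 \<cdot> susM K i1 = ident K (susO K A)" by (simp flip: Sus.functor_comp)
  have "\<ominus> (susM K i1) \<cdot> d = zerom K D (susO K S)"
    using tri_hg_zero[OF tri_rotate[OF T]] by simp
  then have "susM K p1 \<cdot> (\<ominus> (susM K i1) \<cdot> d) = susM K p1 \<cdot> zerom K D (susO K S)" by (simp only:)
  then have "\<ominus> d = zerom K D (susO K A)" by (simp add: reassoc[OF sp])
  then have "\<ominus> (\<ominus> d) = \<ominus> (zerom K D (susO K A))" by (simp only:)
  then have d: "d = zerom K D (susO K A)" by simp
  obtain w where w: "w \<in> Hom K D B" "w \<cdot> c = p2"
    by (rule weak_cokernel[OF T, of p2 B]) auto
  have [unfolded Hom_iff, simp]: "w \<in> Hom K D B" using w by auto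
  define v where "v = c \<cdot> i2"
  have [unfolded Hom_iff, simp]: "v \<in> Hom K B D" by (auto simp: v_def)
  have c: "c = v \<cdot> p2"
    using biproduct_decomp_out[OF S, of c] by (simp add: ci v_def)
  have wv: "w \<cdot> v = ident K B" by (simp add: v_def reassoc[OF w(2)])
  have vwc: "(v \<cdot> w \<ominus> ident K D) \<cdot> c = zerom K S D"
    by (simp add: w(2) c[symmetric])
  obtain s where "s \<in> Hom K (susO K A) D" "s \<cdot> d = v \<cdot> w \<ominus> ident K D"
    by (rule weak_cokernel2[OF T, of "v \<cdot> w \<ominus> ident K D" D]) (use vwc in auto)
  then have "v \<cdot> w \<ominus> ident K D = zerom K D D" by (simp add: d)
  then have vw: "v \<cdot> w = ident K D"
    using sub_eq_zero_iff[of "v \<cdot> w" "ident K D"] by simp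
  have "iso_arr K B D v" by (rule iso_arrI[where g = w]) (use vw wv in auto)
  then show ?thesis
    by (intro tri_isoI[OF T, of _ A S _ B _ "ident K A" "ident K S" v])
      (use c iso_ident in \<open>auto simp: d\<close>)
qed

end

lemma biproduct_swap:
  assumes "additive_category C" "biproduct C A B S i1 i2 p1 p2"
  shows "biproduct C B A S i2 i1 p2 p1"
proof -
  interpret additive_category C by fact
  note [simp] = biproduct_simps[OF assms(2)]
  show ?thesis using assms(2) unfolding biproduct_def by (auto simp: add_commute)
qed

lemma (in triangulated_category) pretriangulated: "pretriangulated K"
proof unfold_locales
  interpret S: additive_functor K K "susO K" "susM K"
    by (rule additive_equivalence_functor[OF suspension]) unfold_locales
  show "additive_equivalence K K (susO K) (susM K)" by (rule suspension)
  show "\<exists>X Y Z. triangle_on K X Y Z T" if "T \<in> Tri K" for T using that by (rule Tri_triangle)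
  show "T \<in> Tri K" if "S \<in> Tri K" "tri_iso K S T" for S T using that by (rule Tri_iso)
  show "(ident K X, zerom K X N, zerom K N (susO K X)) \<in> Tri K" if "X \<in> ob K" "zero_object K N" for X N
    using that by (rule Tri_ident)
  show "(zerom K N X, ident K X, zerom K X (susO K N)) \<in> Tri K" if X: "X \<in> ob K" and N: "zero_object K N" for X N
  proof -
    have N': "N \<in> ob K" using N by (simp add: zero_object_def)
    have "(ident K X, zerom K X (susO K N), zerom K (susO K N) (susO K X)) \<in> Tri K"
      using X S.functor_zero_object[OF N] by (rule Tri_ident)
    then show ?thesis
      using X N' by (subst Tri_rotate[of N X X]) (auto simp: triangle_on_def)
  qed
  show "\<exists>g h. (f, g, h) \<in> Tri K" if "f \<in> arr K" for f using that by (rule Tri_cone)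
  show "(g, h, \<ominus> (susM K f)) \<in> Tri K" if "(f, g, h) \<in> Tri K" for f g h
    using Tri_triangle[OF that] Tri_rotate that by blast
  show "\<exists>w. tri_morphism K (f, g, h) (f', g', h') u v w" if
    "(f, g, h) \<in> Tri K" "(f', g', h') \<in> Tri K"
        "u \<in> Hom K (src K f) (src K f')" "v \<in> Hom K (tgt K f) (tgt K f')" "v \<cdot> f = f' \<cdot> u"
    for f g h f' g' h' u v
    using that by (rule Tri_complete)
qed

sublocale triangulated_category \<subseteq> pretriangulated
  by (rule pretriangulated)

text \<open>
  Apply the octahedral axiom to \<open>X \<rightarrow> I \<oplus> Y \<rightarrow> I\<close>, where the first map is \<open>(i, f)\<close>, the second the
  projection, and the composite is \<open>i\<close>.  The three cones are \<open>Z\<close>, \<open>\<Sigma>Y\<close> and \<open>W\<close>, and the triangle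
  \<open>Z \<rightarrow> W \<rightarrow> \<Sigma>Y\<close> rotates back to the one on \<open>g : Y \<rightarrow> Z\<close>.  The compatibilities of the octahedron
  moreover determine the connecting map.
\<close>

lemma (in triangulated_category) homotopy_pushout:
  assumes T: "(i, p, q) \<in> Tri K" and f: "f \<in> Hom K (src K i) Y"
  obtains f' g h k where "homotopy_cartesian K i f f' g" "(g, h, k) \<in> Tri K"
    "tri_morphism K (i, p, q) (g, h, k) f f' (ident K (tgt K p))" "tgt K h = tgt K p" "k = susM K f \<cdot> q"
proof -
  define X where "X = src K i"
  define I where "I = tgt K i"
  define W where "W = tgt K p"
  have [unfolded Hom_iff, simp]: "i \<in> Hom K X I" "p \<in> Hom K I W" "q \<in> Hom K W (susO K X)" "f \<in> Hom K X Y"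
    using tri_arrs[OF T] f by (auto simp: X_def I_def W_def)
  have ob [simp]: "X \<in> ob K" "I \<in> ob K" "Y \<in> ob K" using Hom_ob[OF f] tgt_in_ob[of i] by auto
  obtain S i1 i2 p1 p2 where S: "biproduct K I Y S i1 i2 p1 p2" using ex_biproduct[OF ob(2,3)] by blast
  note [simp] = biproduct_simps[OF S]
  define c where "c = i1 \<cdot> i \<oplus> i2 \<cdot> f"
  have [unfolded Hom_iff, simp]: "c \<in> Hom K X S" by (auto simp: c_def)
  obtain m d where Tc: "(c, m, d) \<in> Tri K" using Tri_cone[of c] by auto
  define Z where "Z = tgt K m"
  have [unfolded Hom_iff, simp]: "m \<in> Hom K S Z" "d \<in> Hom K Z (susO K X)"
    using tri_arrs[OF Tc] by (auto simp: Z_def)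
  have zob [simp]: "Z \<in> ob K" "W \<in> ob K" using tgt_in_ob[of m] tgt_in_ob[of p] by simp_all
  have "(i2, p1, zerom K I (susO K Y)) \<in> Tri K"
    by (rule split_triangle[OF biproduct_swap[OF _ S]]) unfold_locales
  then have Tp: "(p1, zerom K I (susO K Y), \<ominus> (susM K i2)) \<in> Tri K" by (rule tri_rotate)
  have pc: "p1 \<cdot> c = i" "p2 \<cdot> c = f" by (simp_all add: c_def)
  have Ti: "(p1 \<cdot> c, p, q) \<in> Tri K" using T by (simp add: pc)
  obtain a b where ab: "(a, b, susM K m \<cdot> \<ominus> (susM K i2)) \<in> Tri K"
    "a \<cdot> m = p \<cdot> p1" "q \<cdot> a = d" "\<ominus> (susM K i2) \<cdot> b = susM K c \<cdot> q"
    "a \<in> Hom K Z W" "b \<in> Hom K W (susO K Y)"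
    using Tri_octahedral[OF _ _ Tc Tp Ti, of X S I] by (auto simp: triangle_on_def)
  have [unfolded Hom_iff, simp]: "a \<in> Hom K Z W" "b \<in> Hom K W (susO K Y)"
    using ab by auto
  have sp: "susM K p2 \<cdot> susM K i2 = ident K (susO K Y)" "susM K p2 \<cdot> susM K c = susM K f"
    by (simp_all add: pc flip: Sus.functor_comp)
  have "susM K p2 \<cdot> (\<ominus> (susM K i2) \<cdot> b) = susM K p2 \<cdot> (susM K c \<cdot> q)" by (simp only: ab(4))
  then have "\<ominus> b = susM K f \<cdot> q" by (simp add: reassoc[OF sp(1)] reassoc[OF sp(2)])
  then have "\<ominus> (\<ominus> b) = \<ominus> (susM K f \<cdot> q)" by (simp only:)
  then have b: "b = \<ominus> (susM K f \<cdot> q)" by simp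
  define f' where "f' = m \<cdot> i1"
  \<comment> \<open>The sign is that of the second map \<open>(f', - g)\<close> in the definition of a homotopy cartesian square.\<close>
  define g where "g = \<ominus> (m \<cdot> i2)"
  have [unfolded Hom_iff, simp]: "f' \<in> Hom K I Z" "g \<in> Hom K Y Z"
    by (auto simp: f'_def g_def)
  have m: "m = f' \<cdot> p1 \<ominus> g \<cdot> p2"
    using biproduct_decomp_out[OF S, of m] by (simp add: f'_def g_def subm_def)
  have "m \<cdot> c = zerom K X Z" using tri_gf_zero[OF Tc] by simp
  moreover have "m \<cdot> c = f' \<cdot> i \<ominus> g \<cdot> f"
    by (simp add: c_def f'_def g_def subm_def)
  ultimately have sq: "f' \<cdot> i = g \<cdot> f" using sub_eq_zero_iff[of "f' \<cdot> i" "g \<cdot> f"] by simp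
  have af: "a \<cdot> f' = p" by (simp add: f'_def reassoc[OF ab(2)])
  have "(a, b, \<ominus> (susM K (\<ominus> g))) \<in> Tri K" using ab(1) by (simp add: g_def)
  then have "(\<ominus> g, a, b) \<in> Tri K" by (rule tri_rotate_back[of _ _ _ Y Z]) auto
  moreover have "iso_arr K Y Y (\<ominus> (ident K Y))"
    by (rule iso_arrI[where g = "\<ominus> (ident K Y)"]) auto
  ultimately have Tg: "(g, a, susM K f \<cdot> q) \<in> Tri K"
    by (intro tri_isoI[of "\<ominus> g" a b g Y Z a W _ "\<ominus> (ident K Y)" "ident K Z" "ident K W"])
      (auto intro: iso_ident simp: b)
  have "homotopy_cartesian K i f f' g"
    unfolding homotopy_cartesian_def
    by (rule exI[of _ X], rule exI[of _ I], rule exI[of _ Y], rule exI[of _ Z], rule exI[of _ S],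
        rule exI[of _ i1], rule exI[of _ i2], rule exI[of _ p1], rule exI[of _ p2], rule exI[of _ d])
      (use S Tc in \<open>auto simp: c_def simp flip: m\<close>)
  then show ?thesis
    by (rule that[OF _ Tg]) (use sq af in \<open>auto simp: tri_morphism_def\<close>)
qed

section \<open>Exact categories\<close>

context category
begin

lemma pushoutE:
  assumes "is_pushout C f u v f'"
  obtains X Y X' Y' where "f \<in> Hom C X Y" "u \<in> Hom C X X'" "v \<in> Hom C Y Y'" "f' \<in> Hom C X' Y'"
    "v \<cdot> f = f' \<cdot> u"
    "\<And>T a b. \<lbrakk>a \<in> Hom C Y T; b \<in> Hom C X' T; a \<cdot> f = b \<cdot> u\<rbrakk> \<Longrightarrow> \<exists>t \<in> Hom C Y' T. t \<cdot> v = a \<and> t \<cdot> f' = b"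
    "\<And>T t t'. \<lbrakk>t \<in> Hom C Y' T; t' \<in> Hom C Y' T; t \<cdot> v = t' \<cdot> v; t \<cdot> f' = t' \<cdot> f'\<rbrakk> \<Longrightarrow> t = t'"
proof -
  obtain X Y X' Y' where 1: "f \<in> Hom C X Y" "u \<in> Hom C X X'" "v \<in> Hom C Y Y'" "f' \<in> Hom C X' Y'"
    "v \<cdot> f = f' \<cdot> u" and
    2: "\<forall>T \<in> ob C. \<forall>a \<in> Hom C Y T. \<forall>b \<in> Hom C X' T. a \<cdot> f = b \<cdot> u \<longrightarrow>
        (\<exists>!t. t \<in> Hom C Y' T \<and> t \<cdot> v = a \<and> t \<cdot> f' = b)"
    using assms unfolding is_pushout_def by blast
  have 3: "\<exists>!t. t \<in> Hom C Y' T \<and> t \<cdot> v = a \<and> t \<cdot> f' = b"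
    if "a \<in> Hom C Y T" "b \<in> Hom C X' T" "a \<cdot> f = b \<cdot> u" for T a b
    using 2 that Hom_ob(2)[OF that(1)] by blast
  have 4: "t = t'" if "t \<in> Hom C Y' T" "t' \<in> Hom C Y' T" "t \<cdot> v = t' \<cdot> v" "t \<cdot> f' = t' \<cdot> f'" for T t t'
  proof -
    have "t \<cdot> v \<in> Hom C Y T" "t \<cdot> f' \<in> Hom C X' T" using that(1) 1 by auto
    moreover have "t \<cdot> v \<cdot> f = t \<cdot> f' \<cdot> u" using that(1) 1 by simp
    ultimately have "\<exists>!s. s \<in> Hom C Y' T \<and> s \<cdot> v = t \<cdot> v \<and> s \<cdot> f' = t \<cdot> f'" by (rule 3)
    then show ?thesis using that by metis
  qed
  show ?thesis using 1 3 4 by (intro that) (blast+)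
qed

lemma pushoutI:
  assumes "f \<in> Hom C X Y" "u \<in> Hom C X X'" "v \<in> Hom C Y Y'" "f' \<in> Hom C X' Y'"
    "v \<cdot> f = f' \<cdot> u"
    "\<And>T a b. \<lbrakk>T \<in> ob C; a \<in> Hom C Y T; b \<in> Hom C X' T; a \<cdot> f = b \<cdot> u\<rbrakk> \<Longrightarrow> \<exists>t \<in> Hom C Y' T. t \<cdot> v = a \<and> t \<cdot> f' = b"
    "\<And>T t t'. \<lbrakk>T \<in> ob C; t \<in> Hom C Y' T; t' \<in> Hom C Y' T; t \<cdot> v = t' \<cdot> v; t \<cdot> f' = t' \<cdot> f'\<rbrakk> \<Longrightarrow> t = t'"
  shows "is_pushout C f u v f'"
proof -
  have "\<exists>!t. t \<in> Hom C Y' T \<and> t \<cdot> v = a \<and> t \<cdot> f' = b"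
    if "T \<in> ob C" "a \<in> Hom C Y T" "b \<in> Hom C X' T" "a \<cdot> f = b \<cdot> u" for T a b
    using assms(6)[OF that] assms(7)[OF that(1)] by (metis (no_types, lifting))
  then show ?thesis unfolding is_pushout_def using assms(1-5) by blast
qed

end

context exact_category
begin

lemma inflationI: "(i, p) \<in> Confl C \<Longrightarrow> inflation C i"
  by (auto simp: inflation_def)

lemma confl_facts:
  assumes "(i, p) \<in> Confl C"
  shows "i \<in> arr C" "p \<in> arr C" "src C p = tgt C i" "p \<cdot> i = zerom C (src C i) (tgt C p)"
  using conflation_pair[OF assms] by (auto simp: kernel_cokernel_pair_def)

lemma confl_kernel:
  assumes "(i, p) \<in> Confl C" "t \<in> Hom C T (tgt C i)" "p \<cdot> t = zerom C T (tgt C p)"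
  obtains s where "s \<in> Hom C T (src C i)" "i \<cdot> s = t"
proof -
  have *: "kernel_cokernel_pair C (src C i) (tgt C i) (tgt C p) i p"
    using conflation_pair[OF assms(1)] by (auto simp: kernel_cokernel_pair_def)
  have "T \<in> ob C" using Hom_ob[OF assms(2)] by simp
  then have "\<exists>!s. s \<in> Hom C T (src C i) \<and> i \<cdot> s = t"
    using * assms(2,3) unfolding kernel_cokernel_pair_def by blast
  then show ?thesis using that by blast
qed

lemma confl_cokernel:
  assumes "(i, p) \<in> Confl C" "t \<in> Hom C (tgt C i) T" "t \<cdot> i = zerom C (src C i) T"
  obtains s where "s \<in> Hom C (tgt C p) T" "s \<cdot> p = t"
proof -
  have *: "kernel_cokernel_pair C (src C i) (tgt C i) (tgt C p) i p"
    using conflation_pair[OF assms(1)] by (auto simp: kernel_cokernel_pair_def)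
  have "T \<in> ob C" using Hom_ob[OF assms(2)] by simp
  then have "\<exists>!s. s \<in> Hom C (tgt C p) T \<and> s \<cdot> p = t"
    using * assms(2,3) unfolding kernel_cokernel_pair_def by blast
  then show ?thesis using that by blast
qed

lemma confl_mono:
  assumes "(i, p) \<in> Confl C" "s \<in> Hom C T (src C i)" "s' \<in> Hom C T (src C i)" "i \<cdot> s = i \<cdot> s'"
  shows "s = s'"
proof -
  have *: "kernel_cokernel_pair C (src C i) (tgt C i) (tgt C p) i p"
    using conflation_pair[OF assms(1)] by (auto simp: kernel_cokernel_pair_def)
  have T: "T \<in> ob C" using Hom_ob[OF assms(2)] by simp
  note [simp] = confl_facts[OF assms(1)]
  have "i \<cdot> s \<in> Hom C T (tgt C i)" "p \<cdot> (i \<cdot> s) = zerom C T (tgt C p)"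
    using assms(2) by (auto simp: reassoc[OF confl_facts(4)[OF assms(1)]])
  then have "\<exists>!r. r \<in> Hom C T (src C i) \<and> i \<cdot> r = i \<cdot> s"
    using * T unfolding kernel_cokernel_pair_def by blast
  then show ?thesis using assms(2-4) by metis
qed

lemma confl_epi:
  assumes "(i, p) \<in> Confl C" "s \<in> Hom C (tgt C p) T" "s' \<in> Hom C (tgt C p) T" "s \<cdot> p = s' \<cdot> p"
  shows "s = s'"
proof -
  have *: "kernel_cokernel_pair C (src C i) (tgt C i) (tgt C p) i p"
    using conflation_pair[OF assms(1)] by (auto simp: kernel_cokernel_pair_def)
  have T: "T \<in> ob C" using Hom_ob[OF assms(2)] by simp
  note [simp] = confl_facts[OF assms(1)]
  have "s \<cdot> p \<in> Hom C (tgt C i) T" "s \<cdot> p \<cdot> i = zerom C (src C i) T"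
    using assms(2) T by auto
  then have "\<exists>!r. r \<in> Hom C (tgt C p) T \<and> r \<cdot> p = s \<cdot> p"
    using * T unfolding kernel_cokernel_pair_def by blast
  then show ?thesis using assms(2-4) by metis
qed

text \<open>
  An inflation has some cokernel with which it forms a conflation, and cokernels are isomorphic.
\<close>

lemma conflI_cokernel:
  assumes i: "inflation C i" "i \<in> Hom C X Y" and p: "p \<in> Hom C Y Z" "p \<cdot> i = zerom C X Z"
    and cok: "\<And>T t. \<lbrakk>t \<in> Hom C Y T; t \<cdot> i = zerom C X T\<rbrakk> \<Longrightarrow> \<exists>s \<in> Hom C Z T. s \<cdot> p = t"
    and epi: "\<And>T s s'. \<lbrakk>s \<in> Hom C Z T; s' \<in> Hom C Z T; s \<cdot> p = s' \<cdot> p\<rbrakk> \<Longrightarrow> s = s'"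
  shows "(i, p) \<in> Confl C"
proof -
  obtain p' where c: "(i, p') \<in> Confl C" using i by (auto simp: inflation_def)
  define Z' where "Z' = tgt C p'"
  have [unfolded Hom_iff, simp]: "i \<in> Hom C X Y" "p \<in> Hom C Y Z" using i p by auto
  have [unfolded Hom_iff, simp]: "p' \<in> Hom C Y Z'" using confl_facts[OF c] by (auto simp: Z'_def)
  have p'i: "p' \<cdot> i = zerom C X Z'" using confl_facts[OF c] by simp
  have ob [simp]: "X \<in> ob C" "Y \<in> ob C" "Z \<in> ob C" using i(2) p(1) Hom_ob by blast+
  have [simp]: "Z' \<in> ob C" using tgt_in_ob[of p'] by simp
  obtain a where a: "a \<in> Hom C Z' Z" "a \<cdot> p' = p"
    by (rule confl_cokernel[OF c, of p Z]) (use p in auto)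
  obtain b where b: "b \<in> Hom C Z Z'" "b \<cdot> p = p'" using cok[of p' Z'] p'i by auto
  have [unfolded Hom_iff, simp]: "a \<in> Hom C Z' Z" "b \<in> Hom C Z Z'" using a b by auto
  have "b \<cdot> a = ident C Z'"
    by (rule confl_epi[OF c, of _ Z']) (use a b in auto)
  moreover have "a \<cdot> b = ident C Z"
    by (rule epi[of _ Z]) (use a b in auto)
  ultimately have "iso_arr C Z' Z a" by (intro iso_arrI[where g = b]) auto
  then show ?thesis
    by (intro conflation_iso[OF c, of X Y Z' _ X Y _ Z "ident C X" "ident C Y" a]) (use a in \<open>auto intro: iso_ident\<close>)
qed

lemma confl_ident_zero:
  assumes "zero_object C N" "X \<in> ob C"
  shows "(ident C X, zerom C X N) \<in> Confl C"
proof (rule conflI_cokernel)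
  have N: "N \<in> ob C" using assms by (simp add: zero_object_def)
  show "inflation C (ident C X)" using assms by (intro inflation_ident)
  show "ident C X \<in> Hom C X X" "zerom C X N \<in> Hom C X N" "zerom C X N \<cdot> ident C X = zerom C X N" using assms N by auto
  show "\<exists>s\<in>Hom C N T. s \<cdot> zerom C X N = t" if "t \<in> Hom C X T" "t \<cdot> ident C X = zerom C X T" for T t
    by (rule bexI[of _ "zerom C N T"]) (use that Hom_ob[OF that(1)] assms N in auto)
  show "s = s'" if "s \<in> Hom C N T" "s' \<in> Hom C N T" for s s' T
    by (rule zero_object_unique[OF assms(1)]) (use that in auto)
qed

lemma confl_zero_ident:
  assumes "zero_object C N" "X \<in> ob C"
  shows "(zerom C N X, ident C X) \<in> Confl C"
proof -
  have N: "N \<in> ob C" using assms by (simp add: zero_object_def)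
  obtain i where c: "(i, ident C X) \<in> Confl C" using deflation_ident[OF assms(2)] by (auto simp: deflation_def)
  define M where "M = src C i"
  have [unfolded Hom_iff, simp]: "i \<in> Hom C M X" using confl_facts[OF c] assms by (auto simp: M_def)
  have [simp]: "M \<in> ob C" using src_in_ob[of i] by simp
  have i0: "i = zerom C M X" using confl_facts(4)[OF c] assms by simp
  have "ident C M = zerom C M M"
  proof (rule confl_mono[OF c, of _ M])
    show "i \<cdot> ident C M = i \<cdot> zerom C M M" by (simp add: i0 assms(2))
  qed auto
  then have "zero_object C M" by (intro zero_objectI) auto
  then obtain u where u: "iso_arr C M N u" using zero_object_iso assms(1) by blast
  show ?thesis
    by (rule conflation_iso[OF c, of M X X _ N X _ X u "ident C X" "ident C X"])
      (use assms N u i0 in \<open>auto intro: iso_ident elim: iso_arrE\<close>)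
qed

lemma inflation_iso_cmp:
  assumes "inflation C i" "i \<in> Hom C X Y" "iso_arr C Y Y' v"
  shows "inflation C (v \<cdot> i)"
proof -
  obtain p where c: "(i, p) \<in> Confl C" using assms by (auto simp: inflation_def)
  obtain v' where v: "v \<in> Hom C Y Y'" "v' \<in> Hom C Y' Y" "v' \<cdot> v = ident C Y" "v \<cdot> v' = ident C Y'"
    using assms(3) by (auto elim: iso_arrE)
  have [unfolded Hom_iff, simp]: "i \<in> Hom C X Y" "v \<in> Hom C Y Y'" "v' \<in> Hom C Y' Y" using assms v by auto
  have [simp]: "p \<in> arr C" "src C p = Y" using confl_facts[OF c] by auto
  have ob: "X \<in> ob C" "tgt C p \<in> ob C" using Hom_ob[OF assms(2)] by auto
  have "(v \<cdot> i, p \<cdot> v') \<in> Confl C"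
    by (rule conflation_iso[OF c, of X Y "tgt C p" _ X Y' _ "tgt C p" "ident C X" v "ident C (tgt C p)"])
      (use assms(3) v ob in \<open>auto intro: iso_ident\<close>)
  then show ?thesis by (auto simp: inflation_def)
qed

text \<open>
  By axiom there is one pushout square whose parallel map is an inflation; any other is isomorphic to
  it.
\<close>

lemma pushout_inflation:
  assumes po: "is_pushout C i f v i'" and i: "inflation C i"
  shows "inflation C i'"
proof -
  obtain X Y X' Y' where 1: "i \<in> Hom C X Y" "f \<in> Hom C X X'" "v \<in> Hom C Y Y'" "i' \<in> Hom C X' Y'"
    "v \<cdot> i = i' \<cdot> f" and
    ex1: "\<And>T a b. \<lbrakk>a \<in> Hom C Y T; b \<in> Hom C X' T; a \<cdot> i = b \<cdot> f\<rbrakk> \<Longrightarrow> \<exists>t \<in> Hom C Y' T. t \<cdot> v = a \<and> t \<cdot> i' = b" and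
    un1: "\<And>T t t'. \<lbrakk>t \<in> Hom C Y' T; t' \<in> Hom C Y' T; t \<cdot> v = t' \<cdot> v; t \<cdot> i' = t' \<cdot> i'\<rbrakk> \<Longrightarrow> t = t'"
    using po by (rule pushoutE) blast
  obtain v2 i2 where po2: "is_pushout C i f v2 i2" "inflation C i2"
    using inflation_pushout[OF 1(1) i 1(2)] by blast
  obtain Y2 where 2: "v2 \<in> Hom C Y Y2" "i2 \<in> Hom C X' Y2" "v2 \<cdot> i = i2 \<cdot> f" and
    ex2: "\<And>T a b. \<lbrakk>a \<in> Hom C Y T; b \<in> Hom C X' T; a \<cdot> i = b \<cdot> f\<rbrakk> \<Longrightarrow> \<exists>t \<in> Hom C Y2 T. t \<cdot> v2 = a \<and> t \<cdot> i2 = b" and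
    un2: "\<And>T t t'. \<lbrakk>t \<in> Hom C Y2 T; t' \<in> Hom C Y2 T; t \<cdot> v2 = t' \<cdot> v2; t \<cdot> i2 = t' \<cdot> i2\<rbrakk> \<Longrightarrow> t = t'"
    using po2(1) 1(1,2) by (elim pushoutE) auto
  obtain t where t: "t \<in> Hom C Y' Y2" "t \<cdot> v = v2" "t \<cdot> i' = i2" using ex1[OF 2] by blast
  obtain s where s: "s \<in> Hom C Y2 Y'" "s \<cdot> v2 = v" "s \<cdot> i2 = i'" using ex2[OF 1(3-5)] by blast
  have ob: "Y' \<in> ob C" "Y2 \<in> ob C" using t(1) Hom_ob by blast+
  have "s \<cdot> t = ident C Y'" by (rule un1) (use s t ob 1 2 in auto)
  moreover have "t \<cdot> s = ident C Y2" by (rule un2) (use s t ob 1 2 in auto)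
  ultimately have "iso_arr C Y2 Y' s" using s(1) t(1) by (intro iso_arrI[where g = t])
  then have "inflation C (s \<cdot> i2)" by (rule inflation_iso_cmp[OF po2(2) 2(2)])
  then show ?thesis using s by simp
qed

lemma pushout_conflation:
  assumes c: "(i, p) \<in> Confl C" and po: "is_pushout C i f v i'"
    and h: "h \<in> Hom C (tgt C i') (tgt C p)" "h \<cdot> v = p" "h \<cdot> i' = zerom C (src C i') (tgt C p)"
  shows "(i', h) \<in> Confl C"
proof -
  obtain X Y X' Y' where 1: "i \<in> Hom C X Y" "f \<in> Hom C X X'" "v \<in> Hom C Y Y'" "i' \<in> Hom C X' Y'"
    "v \<cdot> i = i' \<cdot> f" and
    un: "\<And>T t t'. \<lbrakk>t \<in> Hom C Y' T; t' \<in> Hom C Y' T; t \<cdot> v = t' \<cdot> v; t \<cdot> i' = t' \<cdot> i'\<rbrakk> \<Longrightarrow> t = t'"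
    using po by (rule pushoutE) blast
  define Z where "Z = tgt C p"
  have [unfolded Hom_iff, simp]: "i \<in> Hom C X Y" "f \<in> Hom C X X'" "v \<in> Hom C Y Y'" "i' \<in> Hom C X' Y'" using 1 by auto
  have [unfolded Hom_iff, simp]: "h \<in> Hom C Y' Z" "p \<in> Hom C Y Z"
    using h confl_facts[OF c] by (auto simp: Z_def)
  have ob [simp]: "X \<in> ob C" "X' \<in> ob C" using 1(2) Hom_ob by blast+
  show ?thesis
  proof (rule conflI_cokernel[of _ X' Y' _ Z])
    show "inflation C i'" by (rule pushout_inflation[OF po inflationI[OF c]])
    show "h \<cdot> i' = zerom C X' Z" using h by simp
  next
    fix T t assume t: "t \<in> Hom C Y' T" "t \<cdot> i' = zerom C X' T"
    then have [unfolded Hom_iff, simp]: "t \<in> Hom C Y' T" "T \<in> ob C" by auto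
    have tvi: "t \<cdot> v \<cdot> i = zerom C X T" using t(2) 1(5) by (simp add: reassoc[OF t(2)])
    obtain s where s: "s \<in> Hom C Z T" "s \<cdot> p = t \<cdot> v"
      by (rule confl_cokernel[OF c, of "t \<cdot> v" T]) (use tvi in auto)
    have "s \<cdot> h = t" by (rule un[of _ T]) (use s t h in auto)
    then show "\<exists>s\<in>Hom C Z T. s \<cdot> h = t" using s by blast
  next
    fix T s s' assume s: "s \<in> Hom C Z T" "s' \<in> Hom C Z T" "s \<cdot> h = s' \<cdot> h"
    have [unfolded Hom_iff, simp]: "s \<in> Hom C Z T" "s' \<in> Hom C Z T"
      using s by auto
    have "s \<cdot> p = s \<cdot> h \<cdot> v" using h(2) by simp
    also have "\<dots> = s' \<cdot> p" unfolding s(3) using h(2) by simp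
    finally show "s = s'" by - (rule confl_epi[OF c, of s T s'], auto)
  qed auto
qed

lemma ex_pushout:
  assumes c: "(i, p) \<in> Confl C" and f: "f \<in> Hom C (src C i) X'"
  obtains v i' h where "is_pushout C i f v i'" "(i', h) \<in> Confl C" "h \<cdot> v = p" "tgt C h = tgt C p"
    "v \<in> Hom C (tgt C i) (tgt C i')" "src C i' = X'" "v \<cdot> i = i' \<cdot> f"
proof -
  note [simp] = confl_facts[OF c]
  obtain v i' where po: "is_pushout C i f v i'"
    using inflation_pushout[of i "src C i" "tgt C i" f X'] f c by (auto simp: inflation_def)
  obtain Y' where 1: "v \<in> Hom C (tgt C i) Y'" "i' \<in> Hom C X' Y'" "v \<cdot> i = i' \<cdot> f" and
    ex: "\<And>T a b. \<lbrakk>a \<in> Hom C (tgt C i) T; b \<in> Hom C X' T; a \<cdot> i = b \<cdot> f\<rbrakk> \<Longrightarrow> \<exists>t \<in> Hom C Y' T. t \<cdot> v = a \<and> t \<cdot> i' = b"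
    using po f by (elim pushoutE) auto
  have X': "X' \<in> ob C" using f Hom_ob by blast
  obtain h where h: "h \<in> Hom C Y' (tgt C p)" "h \<cdot> v = p" "h \<cdot> i' = zerom C X' (tgt C p)"
    using ex[of p "tgt C p" "zerom C X' (tgt C p)"] f X' by auto
  have "(i', h) \<in> Confl C" by (rule pushout_conflation[OF c po]) (use h 1 in auto)
  then show ?thesis using that[OF po] h 1 by auto
qed

text \<open>
  A biproduct is a pushout over the zero object, and \<open>0 \<rightarrow> A\<close> is an inflation.
\<close>

lemma inflation_biproduct:
  assumes S: "biproduct C A B S i1 i2 p1 p2"
  shows "inflation C i2"
proof -
  note [simp] = biproduct_simps[OF S]
  obtain N where N: "zero_object C N" using ex_zero_object by blast
  have [simp]: "N \<in> ob C" using N by (simp add: zero_object_def)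
  have "is_pushout C (zerom C N A) (zerom C N B) i1 i2"
  proof (rule pushoutI[of _ N A _ B _ S])
    fix T a b assume ab: "a \<in> Hom C A T" "b \<in> Hom C B T" "T \<in> ob C"
    show "\<exists>t\<in>Hom C S T. t \<cdot> i1 = a \<and> t \<cdot> i2 = b"
      by (rule bexI[of _ "a \<cdot> p1 \<oplus> b \<cdot> p2"]) (use ab in auto)
  next
    fix T t t' assume "t \<in> Hom C S T" "t' \<in> Hom C S T" "t \<cdot> i1 = t' \<cdot> i1" "t \<cdot> i2 = t' \<cdot> i2"
    then show "t = t'" by - (rule biproduct_eq_out[OF S], auto)
  qed auto
  then show ?thesis
    by (rule pushout_inflation) (use inflationI[OF confl_zero_ident[OF N, of A]] in simp)
qed

text \<open>
  The map \<open>(f, i) : X \<rightarrow> Y \<oplus> I\<close> is an inflation, as it is composed of the inclusion of \<open>X\<close> into \<open>Y \<oplus> X\<close>,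
  a shear of \<open>Y \<oplus> X\<close> and the pushout \<open>1 \<oplus> i\<close> of \<open>i\<close>.  The universal property of a pushout says that
  \<open>(i', - v)\<close> is its cokernel.
\<close>

lemma pushout_diagonal_conflation:
  assumes c: "(i, p) \<in> Confl C" and po: "is_pushout C i f v i'"
    and S: "biproduct C (src C i') (tgt C i) S i1 i2 p1 p2"
  shows "(i1 \<cdot> f \<oplus> i2 \<cdot> i, i' \<cdot> p1 \<ominus> v \<cdot> p2) \<in> Confl C"
proof -
  obtain X I Y Z where 1: "i \<in> Hom C X I" "f \<in> Hom C X Y" "v \<in> Hom C I Z" "i' \<in> Hom C Y Z"
    "v \<cdot> i = i' \<cdot> f" and
    ex: "\<And>T a b. \<lbrakk>a \<in> Hom C I T; b \<in> Hom C Y T; a \<cdot> i = b \<cdot> f\<rbrakk> \<Longrightarrow> \<exists>t \<in> Hom C Z T. t \<cdot> v = a \<and> t \<cdot> i' = b" and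
    un: "\<And>T t t'. \<lbrakk>t \<in> Hom C Z T; t' \<in> Hom C Z T; t \<cdot> v = t' \<cdot> v; t \<cdot> i' = t' \<cdot> i'\<rbrakk> \<Longrightarrow> t = t'"
    using po by (rule pushoutE) blast
  have [unfolded Hom_iff, simp]: "i \<in> Hom C X I" "f \<in> Hom C X Y" "v \<in> Hom C I Z" "i' \<in> Hom C Y Z" using 1 by auto
  have ob [simp]: "X \<in> ob C" "Y \<in> ob C" "I \<in> ob C" "Z \<in> ob C" using 1(2,3) Hom_ob by blast+
  have S': "biproduct C Y I S i1 i2 p1 p2" using S by simp
  note [simp] = biproduct_simps[OF S']
  obtain S0 j1 j2 q1 q2 where S0: "biproduct C Y X S0 j1 j2 q1 q2" using ex_biproduct[of Y X] by auto
  note [simp] = biproduct_simps[OF S0]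
  \<comment> \<open>The shear, its inverse, and \<open>1 \<oplus> i\<close>.\<close>
  define \<sigma> where "\<sigma> = j1 \<cdot> (f \<cdot> q2) \<oplus> ident C S0"
  define \<tau> where "\<tau> = \<ominus> (j1 \<cdot> (f \<cdot> q2)) \<oplus> ident C S0"
  define m where "m = i1 \<cdot> q1 \<oplus> i2 \<cdot> (i \<cdot> q2)"
  have [unfolded Hom_iff, simp]: "\<sigma> \<in> Hom C S0 S0" "\<tau> \<in> Hom C S0 S0" "m \<in> Hom C S0 S" by (auto simp: \<sigma>_def \<tau>_def m_def)
  have "iso_arr C S0 S0 \<sigma>"
  proof (rule iso_arrI[where g = \<tau>])
    show "\<tau> \<cdot> \<sigma> = ident C S0" "\<sigma> \<cdot> \<tau> = ident C S0"
      by (auto simp: \<sigma>_def \<tau>_def intro!: add_neg_cancel)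
  qed auto
  then have 2: "inflation C (\<sigma> \<cdot> j2)"
    by (rule inflation_iso_cmp[OF inflation_biproduct[OF S0], of X, rotated]) simp
  have "is_pushout C i j2 i2 m"
  proof (rule pushoutI[of _ X I _ S0 _ S])
    show "i2 \<cdot> i = m \<cdot> j2" by (simp add: m_def)
  next
    fix T a b assume ab: "a \<in> Hom C I T" "b \<in> Hom C S0 T" "T \<in> ob C" "a \<cdot> i = b \<cdot> j2"
    have [unfolded Hom_iff, simp]: "a \<in> Hom C I T" "b \<in> Hom C S0 T" using ab by auto
    define t where "t = b \<cdot> (j1 \<cdot> p1) \<oplus> a \<cdot> p2"
    have [unfolded Hom_iff, simp]: "t \<in> Hom C S T" by (auto simp: t_def)
    have "t \<cdot> i2 = a" using ab(3) by (simp add: t_def)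
    moreover have "t \<cdot> m = b"
      by (rule biproduct_eq_out[OF S0]) (use ab(3,4) in \<open>simp_all add: t_def m_def\<close>)
    ultimately show "\<exists>t\<in>Hom C S T. t \<cdot> i2 = a \<and> t \<cdot> m = b" by (intro bexI[of _ t]) auto
  next
    fix T t t' assume t: "t \<in> Hom C S T" "t' \<in> Hom C S T" "t \<cdot> i2 = t' \<cdot> i2" "t \<cdot> m = t' \<cdot> m"
    have [unfolded Hom_iff, simp]: "t \<in> Hom C S T" "t' \<in> Hom C S T" using t by auto
    have mj: "m \<cdot> j1 = i1" by (simp add: m_def)
    have "t \<cdot> i1 = t \<cdot> m \<cdot> j1" by (simp add: mj)
    also have "\<dots> = t' \<cdot> i1" unfolding t(4) by (simp add: mj)
    finally show "t = t'" using t(3) by - (rule biproduct_eq_out[OF S'], auto)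
  qed auto
  then have "inflation C m" by (rule pushout_inflation) (rule inflationI[OF c])
  then have "inflation C (m \<cdot> (\<sigma> \<cdot> j2))" using 2 by - (rule inflation_cmp[of _ X S0 _ S], auto)
  moreover have "m \<cdot> (\<sigma> \<cdot> j2) = i1 \<cdot> f \<oplus> i2 \<cdot> i" by (simp add: m_def \<sigma>_def)
  ultimately have infl: "inflation C (i1 \<cdot> f \<oplus> i2 \<cdot> i)" by simp
  show ?thesis
  proof (rule conflI_cokernel[OF infl, of X S _ Z])
    show "(i' \<cdot> p1 \<ominus> v \<cdot> p2) \<cdot> (i1 \<cdot> f \<oplus> i2 \<cdot> i) = zerom C X Z"
      using 1(5) by (simp add: subm_def)
  next
    fix T t assume t: "t \<in> Hom C S T" "t \<cdot> (i1 \<cdot> f \<oplus> i2 \<cdot> i) = zerom C X T"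
    have [unfolded Hom_iff, simp]: "t \<in> Hom C S T" "T \<in> ob C" using t Hom_ob(2)[OF t(1)] by auto
    have "t \<cdot> (i1 \<cdot> f) \<oplus> t \<cdot> (i2 \<cdot> i) = zerom C X T" using t(2) by simp
    then have "t \<cdot> (i2 \<cdot> i) = \<ominus> (t \<cdot> (i1 \<cdot> f))" by (intro neg_unique) auto
    then have "\<ominus> (t \<cdot> i2) \<cdot> i = t \<cdot> i1 \<cdot> f" by simp
    then obtain s where s: "s \<in> Hom C Z T" "s \<cdot> v = \<ominus> (t \<cdot> i2)" "s \<cdot> i' = t \<cdot> i1"
      using ex[of "\<ominus> (t \<cdot> i2)" T "t \<cdot> i1"] by auto
    have [unfolded Hom_iff, simp]: "s \<in> Hom C Z T" using s by auto
    have "s \<cdot> (i' \<cdot> p1 \<ominus> v \<cdot> p2) = t"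
      by (rule biproduct_eq_out[OF S']) (simp_all add: s(2,3) subm_def)
    then show "\<exists>s\<in>Hom C Z T. s \<cdot> (i' \<cdot> p1 \<ominus> v \<cdot> p2) = t" using s by blast
  next
    fix T s s' assume s: "s \<in> Hom C Z T" "s' \<in> Hom C Z T" "s \<cdot> (i' \<cdot> p1 \<ominus> v \<cdot> p2) = s' \<cdot> (i' \<cdot> p1 \<ominus> v \<cdot> p2)"
    have [unfolded Hom_iff, simp]: "s \<in> Hom C Z T" "s' \<in> Hom C Z T" "T \<in> ob C" using s Hom_ob(2)[OF s(1)] by auto
    have "s \<cdot> (i' \<cdot> p1 \<ominus> v \<cdot> p2) \<cdot> i1 = s' \<cdot> (i' \<cdot> p1 \<ominus> v \<cdot> p2) \<cdot> i1"
       "s \<cdot> (i' \<cdot> p1 \<ominus> v \<cdot> p2) \<cdot> i2 = s' \<cdot> (i' \<cdot> p1 \<ominus> v \<cdot> p2) \<cdot> i2" by (simp_all only: s(3))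
    then have "s \<cdot> i' = s' \<cdot> i'" "\<ominus> (s \<cdot> v) = \<ominus> (s' \<cdot> v)" by (simp_all add: subm_def)
    moreover from this(2) have "s \<cdot> v = s' \<cdot> v" by (subst (asm) neg_eq_iff) auto
    ultimately show "s = s'" by - (rule un[of s T s'], auto)
  qed auto
qed

text \<open>
  Noether's isomorphism \<open>(Z/X) / (Y/X) = Z/Y\<close>: the square formed by \<open>Y \<rightarrow> Z\<close> and \<open>Y/X \<rightarrow> Z/X\<close> is a
  pushout, and pushouts of inflations have the same cokernel.
\<close>

lemma conflation_quotients:
  assumes c: "(i, p) \<in> Confl C" "(j, q) \<in> Confl C" "(j \<cdot> i, r) \<in> Confl C"
    and ij: "tgt C i = src C j"
    and a: "a \<in> Hom C (tgt C p) (tgt C r)" "a \<cdot> p = r \<cdot> j"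
    and b: "b \<in> Hom C (tgt C r) (tgt C q)" "b \<cdot> r = q"
  shows "(a, b) \<in> Confl C"
proof -
  define X where "X = src C i"
  define Y where "Y = src C j"
  define Z where "Z = tgt C j"
  define A where "A = tgt C p"
  define B where "B = tgt C q"
  define D where "D = tgt C r"
  have [unfolded Hom_iff, simp]: "i \<in> Hom C X Y" "j \<in> Hom C Y Z"
    using confl_facts[OF c(1)] confl_facts[OF c(2)] ij by (auto simp: X_def Y_def Z_def)
  have [unfolded Hom_iff, simp]: "p \<in> Hom C Y A" "q \<in> Hom C Z B" "r \<in> Hom C Z D"
    using confl_facts[OF c(1)] confl_facts[OF c(2)] confl_facts[OF c(3)] by (auto simp: A_def B_def D_def)
  have [unfolded Hom_iff, simp]: "a \<in> Hom C A D" "b \<in> Hom C D B"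
    using a b by auto
  have ob [simp]: "X \<in> ob C" "Y \<in> ob C" "A \<in> ob C" "B \<in> ob C"
    using src_in_ob[of i] src_in_ob[of j] tgt_in_ob[of p] tgt_in_ob[of q] by auto
  have pi: "p \<cdot> i = zerom C X A" using confl_facts(4)[OF c(1)] by simp
  have qj: "q \<cdot> j = zerom C Y B" using confl_facts(4)[OF c(2)] by simp
  have po: "is_pushout C j p r a"
  proof (rule pushoutI[of _ Y Z _ A _ D])
    show "r \<cdot> j = a \<cdot> p" using a by simp
  next
    fix T t s assume t: "t \<in> Hom C Z T" "s \<in> Hom C A T" "t \<cdot> j = s \<cdot> p" "T \<in> ob C"
    have [unfolded Hom_iff, simp]: "t \<in> Hom C Z T" "s \<in> Hom C A T" using t by auto
    have "t \<cdot> (j \<cdot> i) = zerom C X T" using t(4) by (simp add: reassoc[OF t(3)] pi)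
    then obtain t' where t': "t' \<in> Hom C D T" "t' \<cdot> r = t"
      by - (rule confl_cokernel[OF c(3), of t T], auto)
    have [unfolded Hom_iff, simp]: "t' \<in> Hom C D T" using t' by auto
    have "t' \<cdot> a \<cdot> p = s \<cdot> p" by (simp add: a(2) reassoc[OF t'(2)] t(3))
    then have "t' \<cdot> a = s" by - (rule confl_epi[OF c(1), of _ T], auto)
    then show "\<exists>t'\<in>Hom C D T. t' \<cdot> r = t \<and> t' \<cdot> a = s" using t' by blast
  next
    fix T t t' assume "t \<in> Hom C D T" "t' \<in> Hom C D T" "t \<cdot> r = t' \<cdot> r"
    then show "t = t'" by - (rule confl_epi[OF c(3), of _ T], auto)
  qed auto
  show ?thesis
  proof (rule pushout_conflation[OF c(2) po])
    have "b \<cdot> a \<cdot> p = zerom C A B \<cdot> p" by (simp add: a(2) reassoc[OF b(2)] qj)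
    then have "b \<cdot> a = zerom C A B" by - (rule confl_epi[OF c(1), of _ B], auto)
    then show "b \<cdot> a = zerom C (src C a) (tgt C q)" by simp
  qed (use b in auto)
qed

end

section \<open>The stable category of a Frobenius category\<close>

context frobenius_category
begin

lemma proj_ob: "Q \<in> exact_proj C \<Longrightarrow> Q \<in> ob C"
  by (simp add: exact_proj_def)

lemma proj_lift:
  assumes "Q \<in> exact_proj C" "(j, q) \<in> Confl C" "f \<in> Hom C Q (tgt C q)"
  obtains g where "g \<in> Hom C Q (tgt C j)" "q \<cdot> g = f"
proof -
  note c = confl_facts[OF assms(2)]
  have "deflation C q" using assms(2) by (auto simp: deflation_def)
  then show ?thesis using assms(1,3) c that unfolding exact_proj_def by fastforce
qed

lemma inj_extend:
  assumes "Q \<in> exact_proj C" "(j, q) \<in> Confl C" "f \<in> Hom C (src C j) Q"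
  obtains g where "g \<in> Hom C (tgt C j) Q" "g \<cdot> j = f"
proof -
  note c = confl_facts[OF assms(2)]
  have "inflation C j" using assms(2) by (auto simp: inflation_def)
  then show ?thesis using assms(1,3) c that unfolding proj_eq_inj exact_inj_def by fastforce
qed

lemma proj_sum:
  assumes "A \<in> exact_proj C" "B \<in> exact_proj C" "biproduct C A B S i1 i2 p1 p2"
  shows "S \<in> exact_proj C"
proof -
  note [simp] = biproduct_simps[OF assms(3)]
  have "\<exists>g \<in> Hom C S (src C d). d \<cdot> g = f" if d: "d \<in> arr C" "deflation C d" "f \<in> Hom C S (tgt C d)" for d f
  proof -
    have [unfolded Hom_iff, simp]: "f \<in> Hom C S (tgt C d)" using d by auto
    obtain k where k: "(k, d) \<in> Confl C" using d by (auto simp: deflation_def)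
    note [simp] = confl_facts(1-3)[OF k]
    obtain g1 where g1: "g1 \<in> Hom C A (tgt C k)" "d \<cdot> g1 = f \<cdot> i1" by (rule proj_lift[OF assms(1) k, of "f \<cdot> i1"]) auto
    obtain g2 where g2: "g2 \<in> Hom C B (tgt C k)" "d \<cdot> g2 = f \<cdot> i2" by (rule proj_lift[OF assms(2) k, of "f \<cdot> i2"]) auto
    have [unfolded Hom_iff, simp]: "g1 \<in> Hom C A (tgt C k)" "g2 \<in> Hom C B (tgt C k)"
      using g1 g2 by auto
    have "d \<cdot> (g1 \<cdot> p1 \<oplus> g2 \<cdot> p2) = f"
      by (rule biproduct_eq_out[OF assms(3)]) (simp_all add: g1(2) g2(2) reassoc[OF g1(2)] reassoc[OF g2(2)])
    then show ?thesis by (intro bexI[of _ "g1 \<cdot> p1 \<oplus> g2 \<cdot> p2"]) auto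
  qed
  then show ?thesis by (simp add: exact_proj_def del: Hom_iff)
qed

lemma proj_ideal: "additive_ideal C (exact_proj C)"
proof unfold_locales
  show "exact_proj C \<subseteq> ob C" using proj_ob by blast
  show "exact_proj C \<noteq> {}"
  proof -
    obtain N where "N \<in> ob C" using ex_zero_object unfolding zero_object_def by blast
    then obtain P q where "P \<in> exact_proj C \<and> q \<in> Hom C P N \<and> deflation C q"
      using enough_projectives[of N] by blast
    then show ?thesis by blast
  qed
  fix A B assume AB: "A \<in> exact_proj C" "B \<in> exact_proj C"
  obtain S i1 i2 p1 p2 where S: "biproduct C A B S i1 i2 p1 p2"
    using ex_biproduct[OF AB[THEN proj_ob]] by blast
  then show "\<exists>S i1 i2 p1 p2. S \<in> exact_proj C \<and> biproduct C A B S i1 i2 p1 p2"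
    using proj_sum[OF AB S] by blast
qed

end

sublocale frobenius_category \<subseteq> additive_ideal C "exact_proj C"
  by (rule proj_ideal)

locale frobenius_choice = frobenius_category C
  for C :: "('o, 'm) excat" (structure) +
  fixes i p :: "'o \<Rightarrow> 'm"
  assumes choice: "injective_conflations C i p"
begin

abbreviation "L \<equiv> stable_category C i p"

lemma choice_confl: "X \<in> ob C \<Longrightarrow> (i X, p X) \<in> Confl C"
  using choice by (simp add: injective_conflations_def)

lemma choice_facts [simp]:
  assumes "X \<in> ob C"
  shows "i X \<in> arr C" "src C (i X) = X" "p X \<in> arr C" "src C (p X) = tgt C (i X)"
    "tgt C (i X) \<in> exact_proj C" "p X \<cdot> i X = zerom C X (tgt C (p X))"
  using choice assms confl_facts[OF choice_confl[OF assms]]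
  by (auto simp: injective_conflations_def proj_eq_inj)

lemma choice_zero [simp]:
  assumes "X \<in> ob C" "t \<in> arr C" "tgt C t = X"
  shows "p X \<cdot> (i X \<cdot> t) = zerom C (src C t) (tgt C (p X))"
  using assms by (simp add: reassoc[OF choice_facts(6)])

sublocale Q: additive_quotient C "exact_proj C" L
  unfolding stable_category_def Let_def by (rule additive_quotient_with_triangles)

declare Q.ob_D [simp]

lemma susO_L [simp]: "susO L = (\<lambda>X. tgt C (p X))"
  by (simp add: stable_category_def Let_def)

subsection \<open>The suspension\<close>

text \<open>
  \<open>(f, s, t)\<close> is a morphism between the chosen conflations, so that \<open>t\<close> represents the suspension
  of \<open>f\<close>.
\<close>

definition susrel :: "'m \<Rightarrow> 'm \<Rightarrow> 'm \<Rightarrow> bool" where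
  "susrel f s t \<longleftrightarrow> f \<in> arr C \<and>
     s \<in> Hom C (tgt C (i (src C f))) (tgt C (i (tgt C f))) \<and>
     t \<in> Hom C (tgt C (p (src C f))) (tgt C (p (tgt C f))) \<and>
     s \<cdot> i (src C f) = i (tgt C f) \<cdot> f \<and> t \<cdot> p (src C f) = p (tgt C f) \<cdot> s"

lemma susrel_ex:
  assumes "f \<in> arr C"
  obtains s t where "susrel f s t"
proof -
  let ?X = "src C f" and ?Y = "tgt C f"
  obtain s where s: "s \<in> Hom C (tgt C (i ?X)) (tgt C (i ?Y))" "s \<cdot> i ?X = i ?Y \<cdot> f"
    by (rule inj_extend[OF _ choice_confl, of "tgt C (i ?Y)" ?X "i ?Y \<cdot> f"]) (use assms in auto)
  obtain t where t: "t \<in> Hom C (tgt C (p ?X)) (tgt C (p ?Y))" "t \<cdot> p ?X = p ?Y \<cdot> s"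
    by (rule confl_cokernel[OF choice_confl, of ?X "p ?Y \<cdot> s" "tgt C (p ?Y)"]) (use assms s in auto)
  show ?thesis using that s t assms by (auto simp: susrel_def)
qed

text \<open>
  \<open>conn j q \<delta>\<close>: the map \<open>\<delta>\<close> classifies the conflation \<open>(j, q)\<close> as a pullback of the chosen
  injective conflation of the source of \<open>j\<close>.  In the stable category, \<open>- \<delta>\<close> is the connecting map of the conflation.
\<close>

definition conn :: "'m \<Rightarrow> 'm \<Rightarrow> 'm \<Rightarrow> bool" where
  "conn j q \<delta> \<longleftrightarrow> (j, q) \<in> Confl C \<and> \<delta> \<in> Hom C (tgt C q) (tgt C (p (src C j))) \<and>
     (\<exists>e \<in> Hom C (tgt C j) (tgt C (i (src C j))). e \<cdot> j = i (src C j) \<and> \<delta> \<cdot> q = p (src C j) \<cdot> e)"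

lemma connE:
  assumes "conn j q \<delta>"
  obtains e where "(j, q) \<in> Confl C" "\<delta> \<in> Hom C (tgt C q) (tgt C (p (src C j)))"
    "e \<in> Hom C (tgt C j) (tgt C (i (src C j)))" "e \<cdot> j = i (src C j)" "\<delta> \<cdot> q = p (src C j) \<cdot> e"
  using assms unfolding conn_def by blast

lemma conn_confl: "conn j q \<delta> \<Longrightarrow> (j, q) \<in> Confl C"
  by (simp add: conn_def)

lemma conn_arr:
  assumes "conn j q \<delta>"
  shows "\<delta> \<in> arr C" "src C \<delta> = tgt C q" "tgt C \<delta> = tgt C (p (src C j))"
  using assms by (auto simp: conn_def)

lemma conn_ex:
  assumes c: "(j, q) \<in> Confl C"
  obtains \<delta> where "conn j q \<delta>"
proof -
  note [simp] = confl_facts[OF c]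
  let ?X = "src C j"
  obtain e where e: "e \<in> Hom C (tgt C j) (tgt C (i ?X))" "e \<cdot> j = i ?X"
    by (rule inj_extend[OF _ c, of "tgt C (i ?X)" "i ?X"]) auto
  obtain \<delta> where "\<delta> \<in> Hom C (tgt C q) (tgt C (p ?X))" "\<delta> \<cdot> q = p ?X \<cdot> e"
    by (rule confl_cokernel[OF c, of "p ?X \<cdot> e" "tgt C (p ?X)"]) (use e in auto)
  then show ?thesis using that c e unfolding conn_def by blast
qed

lemma conn_choice: "X \<in> ob C \<Longrightarrow> conn (i X) (p X) (ident C (tgt C (p X)))"
  unfolding conn_def using choice_confl[of X]
  by (auto intro!: bexI[of _ "ident C (tgt C (i X))"])

text \<open>
  The two maps \<open>s \<cdot> e\<close> and \<open>e' \<cdot> v\<close> to the injective object agree on the source of \<open>j\<close>, so their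
  difference factors through \<open>q\<close>.  The factor, followed by \<open>p\<close>, is the difference in question.
\<close>

lemma conn_natural_fac:
  assumes 1: "conn j q \<delta>" and 2: "conn j' q' \<delta>'" and sus: "susrel u s t"
    and u: "src C u = src C j" "tgt C u = src C j'"
    and v: "v \<in> Hom C (tgt C j) (tgt C j')" "v \<cdot> j = j' \<cdot> u"
    and w: "w \<in> Hom C (tgt C q) (tgt C q')" "w \<cdot> q = q' \<cdot> v"
  shows "fac (t \<cdot> \<delta> \<ominus> \<delta>' \<cdot> w)"
proof -
  define X where "X = src C j"
  define X' where "X' = src C j'"
  obtain e where e: "(j, q) \<in> Confl C" "\<delta> \<in> Hom C (tgt C q) (tgt C (p X))"
    "e \<in> Hom C (tgt C j) (tgt C (i X))" "e \<cdot> j = i X" "\<delta> \<cdot> q = p X \<cdot> e"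
    using 1 unfolding X_def by (rule connE)
  obtain e' where e': "(j', q') \<in> Confl C" "\<delta>' \<in> Hom C (tgt C q') (tgt C (p X'))"
    "e' \<in> Hom C (tgt C j') (tgt C (i X'))" "e' \<cdot> j' = i X'" "\<delta>' \<cdot> q' = p X' \<cdot> e'"
    using 2 unfolding X'_def by (rule connE)
  have [simp]: "j \<in> arr C" "q \<in> arr C" "src C j = X" "src C q = tgt C j"
    using confl_facts[OF e(1)] by (auto simp: X_def)
  have [simp]: "j' \<in> arr C" "q' \<in> arr C" "src C j' = X'" "src C q' = tgt C j'"
    using confl_facts[OF e'(1)] by (auto simp: X'_def)
  have ob [simp]: "X \<in> ob C" "X' \<in> ob C" using src_in_ob[of j] src_in_ob[of j'] by auto
  have s: "s \<in> Hom C (tgt C (i X)) (tgt C (i X'))" "t \<in> Hom C (tgt C (p X)) (tgt C (p X'))"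
    "s \<cdot> i X = i X' \<cdot> u" "t \<cdot> p X = p X' \<cdot> s" "u \<in> arr C"
    using sus u by (auto simp: susrel_def)
  have [unfolded Hom_iff, simp]: "e \<in> Hom C (tgt C j) (tgt C (i X))" "\<delta> \<in> Hom C (tgt C q) (tgt C (p X))"
    "e' \<in> Hom C (tgt C j') (tgt C (i X'))" "\<delta>' \<in> Hom C (tgt C q') (tgt C (p X'))"
    "s \<in> Hom C (tgt C (i X)) (tgt C (i X'))" "t \<in> Hom C (tgt C (p X)) (tgt C (p X'))" "u \<in> Hom C X X'"
    "v \<in> Hom C (tgt C j) (tgt C j')" "w \<in> Hom C (tgt C q) (tgt C q')"
    using e e' s u v w by auto
  have "(s \<cdot> e \<ominus> e' \<cdot> v) \<cdot> j = zerom C X (tgt C (i X'))"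
    by (simp add: e(4) s(3) v(2) reassoc[OF e'(4)])
  then obtain r where r: "r \<in> Hom C (tgt C q) (tgt C (i X'))" "r \<cdot> q = s \<cdot> e \<ominus> e' \<cdot> v"
    by - (rule confl_cokernel[OF e(1), of "s \<cdot> e \<ominus> e' \<cdot> v" "tgt C (i X')"], auto)
  have [unfolded Hom_iff, simp]: "r \<in> Hom C (tgt C q) (tgt C (i X'))" using r by auto
  have "(t \<cdot> \<delta> \<ominus> \<delta>' \<cdot> w) \<cdot> q = p X' \<cdot> r \<cdot> q"
    by (simp add: r(2) e(5) w(2) reassoc[OF e'(5)] reassoc[OF s(4)])
  then have "t \<cdot> \<delta> \<ominus> \<delta>' \<cdot> w = p X' \<cdot> r"
    by - (rule confl_epi[OF e(1), of _ "tgt C (p X')"], auto)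
  then show ?thesis using facI[of r "tgt C q" "tgt C (i X')" "p X'" "tgt C (p X')"] by simp
qed

text \<open>
  The factorization of \<open>f - f'\<close> extends to the injective object.  Subtracting the extension from \<open>s\<close>
  makes \<open>s\<close> a map over \<open>f'\<close>, and the claim becomes naturality for the chosen conflations themselves.
\<close>

lemma susrel_fac:
  assumes 1: "susrel f s t" and 2: "susrel f' s' t'" and st: "src C f = src C f'" "tgt C f = tgt C f'"
    and f: "fac (f \<ominus> f')"
  shows "fac (t \<ominus> t')"
proof -
  define X where "X = src C f'"
  define Y where "Y = tgt C f'"
  have [unfolded Hom_iff, simp]: "f \<in> Hom C X Y" "f' \<in> Hom C X Y"
    using 1 2 st by (auto simp: susrel_def X_def Y_def)
  have ob [simp]: "X \<in> ob C" "Y \<in> ob C" using src_in_ob[of f] tgt_in_ob[of f] by auto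
  have [unfolded Hom_iff, simp]: "s \<in> Hom C (tgt C (i X)) (tgt C (i Y))" "t \<in> Hom C (tgt C (p X)) (tgt C (p Y))"
    "s' \<in> Hom C (tgt C (i X)) (tgt C (i Y))" "t' \<in> Hom C (tgt C (p X)) (tgt C (p Y))"
    and e: "s \<cdot> i X = i Y \<cdot> f" "t \<cdot> p X = p Y \<cdot> s" "s' \<cdot> i X = i Y \<cdot> f'" "t' \<cdot> p X = p Y \<cdot> s'"
    using 1 2 by (auto simp: susrel_def)
  obtain R a b where R: "R \<in> exact_proj C" "a \<in> Hom C X R" "b \<in> Hom C R Y" "f \<ominus> f' = b \<cdot> a"
    by (rule facE_hom[OF f, of X Y]) auto
  have [unfolded Hom_iff, simp]: "a \<in> Hom C X R" "b \<in> Hom C R Y" using R by auto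
  obtain a' where a': "a' \<in> Hom C (tgt C (i X)) R" "a' \<cdot> i X = a"
    by (rule inj_extend[OF R(1) choice_confl[OF ob(1)], of a]) auto
  have [unfolded Hom_iff, simp]: "a' \<in> Hom C (tgt C (i X)) R" using a' by auto
  have f': "f = b \<cdot> a \<oplus> f'" using R(4) sub_eq_iff[of f f' "b \<cdot> a"] by simp
  define s2 where "s2 = s \<ominus> i Y \<cdot> (b \<cdot> a')"
  have "susrel f' s2 t"
    unfolding susrel_def by (simp add: s2_def e a'(2)) (simp add: f' subm_def add_ac)
  then have "fac (t \<cdot> ident C (tgt C (p X)) \<ominus> ident C (tgt C (p Y)) \<cdot> t')"
    by (rule conn_natural_fac[OF conn_choice[OF ob(1)] conn_choice[OF ob(2)], of f' s2 t s' t'])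
       (use e in auto)
  then show ?thesis by simp
qed

text \<open>
  By \<open>susrel_fac\<close> the arbitrary choice in the definition of the suspension does not affect the result.
\<close>

lemma susM_L:
  assumes "susrel f s t" shows "susM L (\<pi> f) = \<pi> t"
proof -
  define W where "W = (\<lambda>w. \<exists>g \<in> \<pi> f. \<exists>v.
          v \<in> Hom C (tgt C (i (src C g))) (tgt C (i (tgt C g))) \<and>
          w \<in> Hom C (tgt C (p (src C g))) (tgt C (p (tgt C g))) \<and>
          v \<cdot> i (src C g) = i (tgt C g) \<cdot> g \<and>
          w \<cdot> p (src C g) = p (tgt C g) \<cdot> v)"
  define w where "w = (SOME w. W w)"
  have f: "f \<in> arr C" using assms by (simp add: susrel_def)
  have "W t" unfolding W_def using cls_self[OF f] assms unfolding susrel_def by blast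
  then have "W w" unfolding w_def by (rule someI)
  then obtain g v where g: "g \<in> \<pi> f" and
    v: "v \<in> Hom C (tgt C (i (src C g))) (tgt C (i (tgt C g)))"
       "w \<in> Hom C (tgt C (p (src C g))) (tgt C (p (tgt C g)))"
       "v \<cdot> i (src C g) = i (tgt C g) \<cdot> g" "w \<cdot> p (src C g) = p (tgt C g) \<cdot> v"
    unfolding W_def by blast
  have g': "g \<in> arr C" "src C g = src C f" "tgt C g = tgt C f" "fac (g \<ominus> f)" using g f by (simp_all add: mem_cls)
  have *: "susrel g v w" unfolding susrel_def using v g'(1) by blast
  have "fac (w \<ominus> t)" by (rule susrel_fac[OF * assms g'(2-4)])
  moreover have "t \<in> Hom C (tgt C (p (src C f))) (tgt C (p (tgt C f)))" using assms unfolding susrel_def by blast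
  ultimately have "\<pi> w = \<pi> t"
    by - (rule cls_eq_iff[THEN iffD2], use v(2) g' in auto)
  then show ?thesis by (simp add: stable_category_def Let_def w_def W_def)
qed

lemma conn_natural:
  assumes "conn j q \<delta>" "conn j' q' \<delta>'"
    and u: "u \<in> Hom C (src C j) (src C j')"
    and v: "v \<in> Hom C (tgt C j) (tgt C j')" "v \<cdot> j = j' \<cdot> u"
    and w: "w \<in> Hom C (tgt C q) (tgt C q')" "w \<cdot> q = q' \<cdot> v"
  shows "susM L (\<pi> u) \<cdot>\<^bsub>L\<^esub> \<pi> \<delta> = \<pi> \<delta>' \<cdot>\<^bsub>L\<^esub> \<pi> w"
proof -
  have u': "u \<in> arr C" using u by simp
  obtain s t where st: "susrel u s t" using susrel_ex[OF u'] .
  have t: "t \<in> Hom C (tgt C (p (src C j))) (tgt C (p (src C j')))" using st u by (auto simp: susrel_def)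
  have "fac (t \<cdot> \<delta> \<ominus> \<delta>' \<cdot> w)" by (rule conn_natural_fac[OF assms(1,2) st]) (use u v w in auto)
  moreover note [simp] = conn_arr[OF assms(1)] conn_arr[OF assms(2)]
  ultimately have "\<pi> (t \<cdot> \<delta>) = \<pi> (\<delta>' \<cdot> w)"
    by - (rule cls_eq_iff[THEN iffD2], use w t in auto)
  then show ?thesis using t w by (simp add: susM_L[OF st] Q.quot_cmp)
qed

lemma susrel_sub:
  assumes "susrel f s t" "susrel f' s' t'" "src C f = src C f'" "tgt C f = tgt C f'"
  shows "susrel (f \<ominus> f') (s \<ominus> s') (t \<ominus> t')"
proof -
  have "src C f' \<in> ob C" "tgt C f' \<in> ob C" using assms by (auto simp: susrel_def)
  then show ?thesis using assms by (auto simp: susrel_def)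
qed

text \<open>
  The factorization of \<open>t\<close> lifts along \<open>p\<close>, and subtracting the lift from \<open>s\<close> gives a map that factors
  through \<open>i\<close>.  This extends \<open>f\<close> to the injective object of the chosen conflation.
\<close>

lemma susrel_reflects_fac:
  assumes f: "susrel f s t" and t: "fac t"
  shows "fac f"
proof -
  define X where "X = src C f"
  define Y where "Y = tgt C f"
  have [unfolded Hom_iff, simp]: "f \<in> Hom C X Y"
    using f by (auto simp: susrel_def X_def Y_def)
  have ob [simp]: "X \<in> ob C" "Y \<in> ob C" using src_in_ob[of f] tgt_in_ob[of f] by auto
  have [unfolded Hom_iff, simp]: "s \<in> Hom C (tgt C (i X)) (tgt C (i Y))" "t \<in> Hom C (tgt C (p X)) (tgt C (p Y))"
    and e: "s \<cdot> i X = i Y \<cdot> f" "t \<cdot> p X = p Y \<cdot> s"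
    using f by (auto simp: susrel_def)
  obtain R a b where R: "R \<in> exact_proj C" "a \<in> Hom C (tgt C (p X)) R" "b \<in> Hom C R (tgt C (p Y))" "t = b \<cdot> a"
    by (rule facE_hom[OF t, of "tgt C (p X)" "tgt C (p Y)"]) auto
  have [unfolded Hom_iff, simp]: "a \<in> Hom C (tgt C (p X)) R" "b \<in> Hom C R (tgt C (p Y))" using R by auto
  obtain b' where b': "b' \<in> Hom C R (tgt C (i Y))" "p Y \<cdot> b' = b"
    by (rule proj_lift[OF R(1) choice_confl[OF ob(2)], of b]) auto
  have [unfolded Hom_iff, simp]: "b' \<in> Hom C R (tgt C (i Y))" using b' by auto
  have "p Y \<cdot> (s \<ominus> b' \<cdot> (a \<cdot> p X)) = zerom C (tgt C (i X)) (tgt C (p Y))"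
    by (simp add: e(2)[symmetric] reassoc[OF b'(2)] R(4))
  then obtain r where r: "r \<in> Hom C (tgt C (i X)) Y" "i Y \<cdot> r = s \<ominus> b' \<cdot> (a \<cdot> p X)"
    by - (rule confl_kernel[OF choice_confl[OF ob(2)], of "s \<ominus> b' \<cdot> (a \<cdot> p X)" "tgt C (i X)"], auto)
  have [unfolded Hom_iff, simp]: "r \<in> Hom C (tgt C (i X)) Y" using r by auto
  have "i Y \<cdot> (r \<cdot> i X) = i Y \<cdot> f" by (simp add: reassoc[OF r(2)] e)
  then have "r \<cdot> i X = f" by - (rule confl_mono[OF choice_confl[OF ob(2)], of _ X], auto)
  then show ?thesis using facI[of "i X" X "tgt C (i X)" r Y] by simp
qed

lemma susL_functor: "cat_functor L L (susO L) (susM L)"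
proof unfold_locales
  fix X assume "X \<in> ob L" then show "susO L X \<in> ob L" by simp
next
  fix S X Y assume "S \<in> Hom L X Y"
  then obtain f where f: "f \<in> Hom C X Y" "S = \<pi> f" by (rule Q.quot_lift)
  then obtain s t where st: "susrel f s t" using susrel_ex[of f] by auto
  then show "susM L S \<in> Hom L (susO L X) (susO L Y)" using f by (auto simp: susM_L[OF st]) (auto simp: susrel_def)
next
  fix X assume X: "X \<in> ob L"
  then have "susrel (ident C X) (ident C (tgt C (i X))) (ident C (tgt C (p X)))" by (simp add: susrel_def)
  from susM_L[OF this] show "susM L (ident L X) = ident L (susO L X)" by (simp add: Q.quot_ident)
next
  fix S T X Y Z assume "S \<in> Hom L X Y" "T \<in> Hom L Y Z"
  then obtain f g where f: "f \<in> Hom C X Y" "S = \<pi> f" and g: "g \<in> Hom C Y Z" "T = \<pi> g" by (metis Q.quot_lift)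
  have ob [simp]: "X \<in> ob C" "Y \<in> ob C" "Z \<in> ob C" using f g Hom_ob by blast+
  obtain s t where st: "susrel f s t" using susrel_ex[of f] f by auto
  obtain s' t' where st': "susrel g s' t'" using susrel_ex[of g] g by auto
  have e: "s \<cdot> i X = i Y \<cdot> f" "t \<cdot> p X = p Y \<cdot> s" "s' \<cdot> i Y = i Z \<cdot> g" "t' \<cdot> p Y = p Z \<cdot> s'"
   and [unfolded Hom_iff, simp]: "s \<in> Hom C (tgt C (i X)) (tgt C (i Y))" "t \<in> Hom C (tgt C (p X)) (tgt C (p Y))"
    "s' \<in> Hom C (tgt C (i Y)) (tgt C (i Z))" "t' \<in> Hom C (tgt C (p Y)) (tgt C (p Z))"
    using st st' f g by (auto simp: susrel_def)
  have "susrel (g \<cdot> f) (s' \<cdot> s) (t' \<cdot> t)"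
    using f(1) g(1) by (simp add: susrel_def e reassoc[OF e(3)] reassoc[OF e(4)])
  from susM_L[OF this] show "susM L (T \<cdot>\<^bsub>L\<^esub> S) = susM L T \<cdot>\<^bsub>L\<^esub> susM L S"
    using f g by (simp add: Q.quot_cmp susM_L[OF st] susM_L[OF st'])
qed

text \<open>
  Lifting along the deflations of the chosen conflations and restricting to their kernels shows that the
  suspension is full, and \<open>susrel_reflects_fac\<close> that it is faithful.  An object \<open>Z\<close> is the suspension
  of the kernel of a deflation \<open>R \<rightarrow> Z\<close> with \<open>R\<close> projective.
\<close>

lemma susL_equivalence: "additive_equivalence L L (susO L) (susM L)"
proof -
  interpret S: cat_functor L L "susO L" "susM L" by (rule susL_functor)
  have "equivalence L L (susO L) (susM L)"
  proof (rule S.equivalenceI)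
    fix X Y T assume X: "X \<in> ob L" "Y \<in> ob L" and T: "T \<in> Hom L (susO L X) (susO L Y)"
    have ob [simp]: "X \<in> ob C" "Y \<in> ob C" using X by simp_all
    obtain t where t: "t \<in> Hom C (tgt C (p X)) (tgt C (p Y))" "T = \<pi> t" using T Q.quot_lift by (metis susO_L)
    obtain s where s: "s \<in> Hom C (tgt C (i X)) (tgt C (i Y))" "p Y \<cdot> s = t \<cdot> p X"
      by (rule proj_lift[OF _ choice_confl[OF ob(2)], of "tgt C (i X)" "t \<cdot> p X"]) (use t in auto)
    obtain f where f: "f \<in> Hom C X Y" "i Y \<cdot> f = s \<cdot> i X"
      by (rule confl_kernel[OF choice_confl[OF ob(2)], of "s \<cdot> i X" X])
         (use s t in \<open>auto simp: reassoc[OF s(2)]\<close>)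
    have "susrel f s t" using f s t by (auto simp: susrel_def)
    from susM_L[OF this] show "\<exists>f\<in>Hom L X Y. susM L f = T"
      using f t by (intro bexI[of _ "\<pi> f"]) auto
  next
    fix X Y T T' assume T: "T \<in> Hom L X Y" "T' \<in> Hom L X Y" "susM L T = susM L T'"
    obtain f f' where f: "f \<in> Hom C X Y" "T = \<pi> f" "f' \<in> Hom C X Y" "T' = \<pi> f'" using T(1,2) by (metis Q.quot_lift)
    obtain s t where st: "susrel f s t" using susrel_ex[of f] f by auto
    obtain s' t' where st': "susrel f' s' t'" using susrel_ex[of f'] f by auto
    have "\<pi> t = \<pi> t'" using T(3) f by (simp add: susM_L[OF st] susM_L[OF st'])
    then have "fac (t \<ominus> t')"
      by - (rule cls_eq_iff[THEN iffD1], use st st' f in \<open>auto simp: susrel_def\<close>)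
    then have "fac (f \<ominus> f')"
      by (rule susrel_reflects_fac[OF susrel_sub[OF st st'], rotated -1]) (use f in auto)
    then show "T = T'" unfolding f(2,4) by - (rule cls_eq_iff[THEN iffD2], use f in auto)
  next
    fix Z assume "Z \<in> ob L" then have Z [simp]: "Z \<in> ob C" by simp
    obtain R r where R: "R \<in> exact_proj C" "r \<in> Hom C R Z" "deflation C r" using enough_projectives[OF Z] by blast
    obtain k where c: "(k, r) \<in> Confl C" using R by (auto simp: deflation_def)
    define X where "X = src C k"
    have [unfolded Hom_iff, simp]: "k \<in> Hom C X R" "r \<in> Hom C R Z"
      using R(2) confl_facts[OF c] by (auto simp: X_def)
    have ob [simp]: "X \<in> ob C" using src_in_ob[of k] by simp
    obtain \<delta> where \<delta>: "conn k r \<delta>" using conn_ex[OF c] .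
    obtain e where e: "\<delta> \<in> Hom C Z (tgt C (p X))" "e \<in> Hom C R (tgt C (i X))" "e \<cdot> k = i X" "\<delta> \<cdot> r = p X \<cdot> e"
      using \<delta> by (rule connE) auto
    obtain a where a: "a \<in> Hom C (tgt C (i X)) R" "a \<cdot> i X = k"
      by (rule inj_extend[OF R(1) choice_confl[OF ob], of k]) auto
    have rk: "r \<cdot> k = zerom C X Z" using confl_facts(4)[OF c] by simp
    obtain \<epsilon> where \<epsilon>: "\<epsilon> \<in> Hom C (tgt C (p X)) Z" "\<epsilon> \<cdot> p X = r \<cdot> a"
      by (rule confl_cokernel[OF choice_confl[OF ob], of "r \<cdot> a" Z]) (use a rk in auto)
    have [unfolded Hom_iff, simp]: "\<delta> \<in> Hom C Z (tgt C (p X))" "e \<in> Hom C R (tgt C (i X))" "a \<in> Hom C (tgt C (i X)) R"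
    "\<epsilon> \<in> Hom C (tgt C (p X)) Z"
      using e a \<epsilon> by auto
    have "susrel (ident C X) (e \<cdot> a) (\<delta> \<cdot> \<epsilon>)"
      by (simp add: susrel_def a e \<epsilon> reassoc[OF e(4)])
    then have 1: "\<pi> \<delta> \<cdot>\<^bsub>L\<^esub> \<pi> \<epsilon> = ident L (susO L X)"
      using susM_L S.functor_id[of X] by (simp add: Q.quot_cmp Q.quot_ident)
    have "(a \<cdot> e \<ominus> ident C R) \<cdot> k = zerom C X R" by (simp add: e a proj_ob[OF R(1)])
    then obtain x where x: "x \<in> Hom C Z R" "x \<cdot> r = a \<cdot> e \<ominus> ident C R"
      by - (rule confl_cokernel[OF c, of "a \<cdot> e \<ominus> ident C R" R], auto simp: proj_ob[OF R(1)])
    have [unfolded Hom_iff, simp]: "x \<in> Hom C Z R" using x by auto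
    have "(\<epsilon> \<cdot> \<delta> \<ominus> ident C Z) \<cdot> r = r \<cdot> x \<cdot> r"
      by (simp add: x(2) e(4) reassoc[OF \<epsilon>(2)] proj_ob[OF R(1)])
    then have "\<epsilon> \<cdot> \<delta> \<ominus> ident C Z = r \<cdot> x"
      by - (rule confl_epi[OF c, of _ Z], auto)
    then have "fac (\<epsilon> \<cdot> \<delta> \<ominus> ident C Z)" using facI[of x Z R r Z] R(1) by simp
    then have "\<pi> (\<epsilon> \<cdot> \<delta>) = \<pi> (ident C Z)" by - (rule cls_eq_iff[THEN iffD2], auto)
    then have 2: "\<pi> \<epsilon> \<cdot>\<^bsub>L\<^esub> \<pi> \<delta> = ident L Z" by (simp add: Q.quot_cmp Q.quot_ident)
    have "iso_arr L (susO L X) Z (\<pi> \<epsilon>)"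
      by (rule Q.D.iso_arrI[where g = "\<pi> \<delta>"]) (use 1 2 in auto)
    then show "\<exists>X\<in>ob L. \<exists>e. iso_arr L (susO L X) Z e" using ob by auto
  qed
  moreover have "susM L (S \<oplus>\<^bsub>L\<^esub> T) = susM L S \<oplus>\<^bsub>L\<^esub> susM L T" if ST: "S \<in> Hom L X Y" "T \<in> Hom L X Y" for X Y S T
  proof -
    obtain f f' where f: "f \<in> Hom C X Y" "S = \<pi> f" "f' \<in> Hom C X Y" "T = \<pi> f'" using ST by (metis Q.quot_lift)
    have ob [simp]: "X \<in> ob C" "Y \<in> ob C" using f(1) Hom_ob by blast+
    obtain s t where st: "susrel f s t" using susrel_ex[of f] f by auto
    obtain s' t' where st': "susrel f' s' t'" using susrel_ex[of f'] f by auto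
    have "susrel (f \<oplus> f') (s \<oplus> s') (t \<oplus> t')" using st st' f by (auto simp: susrel_def)
    from susM_L[OF this] show ?thesis using f st st'
      by (auto simp: Q.quot_add susM_L[OF st] susM_L[OF st'] susrel_def)
  qed
  ultimately show ?thesis unfolding additive_equivalence_def by blast
qed

end

section \<open>Triangulations given by representatives\<close>

lemma tri_iso_iff:
  "tri_iso K (f, g, h) (f', g', h') \<longleftrightarrow> (\<exists>x y z.
     f \<in> arr K \<and> g \<in> arr K \<and> h \<in> arr K \<and> src K g = tgt K f \<and> src K h = tgt K g \<and> tgt K h = susO K (src K f) \<and>
     f' \<in> arr K \<and> g' \<in> arr K \<and> h' \<in> arr K \<and> src K g' = tgt K f' \<and> src K h' = tgt K g' \<and> tgt K h' = susO K (src K f') \<and>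
     iso_arr K (src K f) (src K f') x \<and> iso_arr K (tgt K f) (tgt K f') y \<and> iso_arr K (tgt K g) (tgt K g') z \<and>
     y \<cdot>\<^bsub>K\<^esub> f = f' \<cdot>\<^bsub>K\<^esub> x \<and> z \<cdot>\<^bsub>K\<^esub> g = g' \<cdot>\<^bsub>K\<^esub> y \<and> susM K x \<cdot>\<^bsub>K\<^esub> h = h' \<cdot>\<^bsub>K\<^esub> z)"
  unfolding tri_iso_def triangle_on_def tri_morphism_def prod.case
  by (auto simp: iso_arr_def)

text \<open>
  As soon as the suspension is an additive functor, isomorphism of triangles is an equivalence relation
  compatible with rotation.  This is needed before the axioms on triangles are established.
\<close>

locale suspended_category = additive_category K
  for K :: "('o, 'm, 'z) tricat_scheme" (structure) +
  assumes suspension_equivalence: "additive_equivalence K K (susO K) (susM K)"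
begin

sublocale Sus: additive_functor K K "susO K" "susM K"
  by (rule additive_equivalence_functor[OF suspension_equivalence]) unfold_locales

lemma tri_iso_refl:
  assumes "f \<in> Hom K X Y" "g \<in> Hom K Y Z" "h \<in> Hom K Z (susO K X)"
  shows "tri_iso K (f, g, h) (f, g, h)"
  unfolding tri_iso_iff
  by (rule exI[of _ "ident K X"], rule exI[of _ "ident K Y"], rule exI[of _ "ident K Z"])
    (use assms Hom_ob in \<open>auto intro!: iso_ident\<close>)

lemma iso_square_inverse:
  assumes "iso_arr K X X' x" "x' \<in> Hom K X' X" "x \<cdot> x' = ident K X'"
    "y' \<in> Hom K Y' Y" "y \<in> Hom K Y Y'" "y' \<cdot> y = ident K Y"
    "f \<in> Hom K X Y" "f' \<in> Hom K X' Y'" "y \<cdot> f = f' \<cdot> x"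
  shows "y' \<cdot> f' = f \<cdot> x'"
proof -
  have x: "x \<in> Hom K X X'" using assms(1) by (auto elim: iso_arrE)
  have [simp]: "X' \<in> ob K" using Hom_ob[OF x] by simp
  have "y' \<cdot> f' = y' \<cdot> (f' \<cdot> (x \<cdot> x'))" unfolding assms(3) using assms(8) by simp
  also have "\<dots> = y' \<cdot> (y \<cdot> (f \<cdot> x'))" using assms x by (simp add: reassoc[OF assms(9)])
  also have "\<dots> = f \<cdot> x'" using assms x by (simp add: reassoc[OF assms(6)])
  finally show ?thesis .
qed

lemma tri_iso_sym:
  assumes "tri_iso K (f, g, h) (f', g', h')" shows "tri_iso K (f', g', h') (f, g, h)"
proof -
  obtain x y z where [simp]: "f \<in> arr K" "g \<in> arr K" "h \<in> arr K" "src K g = tgt K f" "src K h = tgt K g" "tgt K h = susO K (src K f)"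
     "f' \<in> arr K" "g' \<in> arr K" "h' \<in> arr K" "src K g' = tgt K f'" "src K h' = tgt K g'" "tgt K h' = susO K (src K f')" and
     i: "iso_arr K (src K f) (src K f') x" "iso_arr K (tgt K f) (tgt K f') y" "iso_arr K (tgt K g) (tgt K g') z"
     "y \<cdot> f = f' \<cdot> x" "z \<cdot> g = g' \<cdot> y" "susM K x \<cdot> h = h' \<cdot> z"
    using assms unfolding tri_iso_iff by blast
  obtain x' where x: "x \<in> Hom K (src K f) (src K f')" "x' \<in> Hom K (src K f') (src K f)" "x' \<cdot> x = ident K (src K f)" "x \<cdot> x' = ident K (src K f')" "iso_arr K (src K f') (src K f) x'"
    using i(1) by (rule iso_arrE)
  obtain y' where y: "y \<in> Hom K (tgt K f) (tgt K f')" "y' \<in> Hom K (tgt K f') (tgt K f)" "y' \<cdot> y = ident K (tgt K f)" "y \<cdot> y' = ident K (tgt K f')" "iso_arr K (tgt K f') (tgt K f) y'"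
    using i(2) by (rule iso_arrE)
  obtain z' where z: "z \<in> Hom K (tgt K g) (tgt K g')" "z' \<in> Hom K (tgt K g') (tgt K g)" "z' \<cdot> z = ident K (tgt K g)" "z \<cdot> z' = ident K (tgt K g')" "iso_arr K (tgt K g') (tgt K g) z'"
    using i(3) by (rule iso_arrE)
  have s: "susM K x' \<cdot> susM K x = ident K (susO K (src K f))"
    using x by (simp flip: Sus.functor_comp)
  have "y' \<cdot> f' = f \<cdot> x'" by (rule iso_square_inverse[OF i(1) x(2,4) y(2,1,3) _ _ i(4)]) auto
  moreover have "z' \<cdot> g' = g \<cdot> y'" by (rule iso_square_inverse[OF i(2) y(2,4) z(2,1,3) _ _ i(5)]) auto
  moreover have "susM K x' \<cdot> h' = h \<cdot> z'"
    by (rule iso_square_inverse[OF i(3) z(2,4) _ _ s _ _ i(6)]) (use x in auto)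
  ultimately show ?thesis unfolding tri_iso_iff using x(5) y(5) z(5) by auto
qed

lemma tri_iso_trans:
  assumes "tri_iso K (f, g, h) (f', g', h')" "tri_iso K (f', g', h') (f'', g'', h'')"
  shows "tri_iso K (f, g, h) (f'', g'', h'')"
proof -
  obtain x y z where [simp]: "f \<in> arr K" "g \<in> arr K" "h \<in> arr K" "src K g = tgt K f" "src K h = tgt K g" "tgt K h = susO K (src K f)"
     "f' \<in> arr K" "g' \<in> arr K" "h' \<in> arr K" "src K g' = tgt K f'" "src K h' = tgt K g'" "tgt K h' = susO K (src K f')" and
     1: "iso_arr K (src K f) (src K f') x" "iso_arr K (tgt K f) (tgt K f') y" "iso_arr K (tgt K g) (tgt K g') z"
     "y \<cdot> f = f' \<cdot> x" "z \<cdot> g = g' \<cdot> y" "susM K x \<cdot> h = h' \<cdot> z"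
    using assms(1) unfolding tri_iso_iff by blast
  obtain x' y' z' where [simp]: "f'' \<in> arr K" "g'' \<in> arr K" "h'' \<in> arr K" "src K g'' = tgt K f''" "src K h'' = tgt K g''" "tgt K h'' = susO K (src K f'')" and
     2: "iso_arr K (src K f') (src K f'') x'" "iso_arr K (tgt K f') (tgt K f'') y'" "iso_arr K (tgt K g') (tgt K g'') z'"
     "y' \<cdot> f' = f'' \<cdot> x'" "z' \<cdot> g' = g'' \<cdot> y'" "susM K x' \<cdot> h' = h'' \<cdot> z'"
    using assms(2) unfolding tri_iso_iff by blast
  have [unfolded Hom_iff, simp]: "x \<in> Hom K (src K f) (src K f')" "y \<in> Hom K (tgt K f) (tgt K f')"
    "z \<in> Hom K (tgt K g) (tgt K g')" "x' \<in> Hom K (src K f') (src K f'')" "y' \<in> Hom K (tgt K f') (tgt K f'')"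
    "z' \<in> Hom K (tgt K g') (tgt K g'')"
    using 1 2 by (auto elim: iso_arrE)
  have "iso_arr K (src K f) (src K f'') (x' \<cdot> x)" "iso_arr K (tgt K f) (tgt K f'') (y' \<cdot> y)"
    "iso_arr K (tgt K g) (tgt K g'') (z' \<cdot> z)" using 1 2 iso_cmp by blast+
  moreover have "y' \<cdot> y \<cdot> f = f'' \<cdot> (x' \<cdot> x)" by (simp add: 1(4) reassoc[OF 2(4)])
  moreover have "z' \<cdot> z \<cdot> g = g'' \<cdot> (y' \<cdot> y)" by (simp add: 1(5) reassoc[OF 2(5)])
  moreover have "susM K (x' \<cdot> x) \<cdot> h = h'' \<cdot> (z' \<cdot> z)" by (simp add: 1(6) reassoc[OF 2(6)])
  ultimately show ?thesis unfolding tri_iso_iff by force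
qed

lemma tri_iso_rotate:
  assumes "tri_iso K (f, g, h) (f', g', h')"
  shows "tri_iso K (g, h, \<ominus> (susM K f)) (g', h', \<ominus> (susM K f'))"
proof -
  obtain x y z where [simp]: "f \<in> arr K" "g \<in> arr K" "h \<in> arr K" "src K g = tgt K f" "src K h = tgt K g" "tgt K h = susO K (src K f)"
     "f' \<in> arr K" "g' \<in> arr K" "h' \<in> arr K" "src K g' = tgt K f'" "src K h' = tgt K g'" "tgt K h' = susO K (src K f')" and
     1: "iso_arr K (src K f) (src K f') x" "iso_arr K (tgt K f) (tgt K f') y" "iso_arr K (tgt K g) (tgt K g') z"
     "y \<cdot> f = f' \<cdot> x" "z \<cdot> g = g' \<cdot> y" "susM K x \<cdot> h = h' \<cdot> z"
    using assms(1) unfolding tri_iso_iff by blast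
  have [unfolded Hom_iff, simp]: "x \<in> Hom K (src K f) (src K f')" "y \<in> Hom K (tgt K f) (tgt K f')"
    "z \<in> Hom K (tgt K g) (tgt K g')"
    using 1 by (auto elim: iso_arrE)
  have "susM K y \<cdot> susM K f = susM K f' \<cdot> susM K x" using 1(4) by (simp flip: Sus.functor_comp)
  moreover have "iso_arr K (susO K (src K f)) (susO K (src K f')) (susM K x)" by (rule Sus.functor_iso[OF 1(1)])
  ultimately show ?thesis unfolding tri_iso_iff using 1
    by (intro exI[of _ y] exI[of _ z] exI[of _ "susM K x"]) simp
qed

text \<open>
  The axioms are invariant under isomorphism, so they may be verified on representatives.  Two families
  of representatives are admitted because, for stable categories, rotation is easy to check on the
  standard triangles and completion on the triangles of conflations.
\<close>

lemma pretriangulatedI: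
  assumes Tri: "\<And>T. T \<in> Tri K \<longleftrightarrow> (\<exists>S \<in> \<Delta>. tri_iso K S T)"
    and Tri': "\<And>T. T \<in> Tri K \<longleftrightarrow> (\<exists>S \<in> \<Delta>'. tri_iso K S T)"
    and ident_l: "\<And>X. X \<in> ob K \<Longrightarrow> \<exists>N. zero_object K N \<and> (ident K X, zerom K X N, zerom K N (susO K X)) \<in> Tri K"
    and ident_r: "\<And>X. X \<in> ob K \<Longrightarrow> \<exists>N. zero_object K N \<and> (zerom K N X, ident K X, zerom K X (susO K N)) \<in> Tri K"
    and cone: "\<And>f. f \<in> arr K \<Longrightarrow> \<exists>g h. (f, g, h) \<in> Tri K"
    and rot: "\<And>f g h. (f, g, h) \<in> \<Delta>' \<Longrightarrow> (g, h, \<ominus> (susM K f)) \<in> Tri K"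
    and compl: "\<And>f g h f' g' h' u v. \<lbrakk>(f, g, h) \<in> \<Delta>; (f', g', h') \<in> \<Delta>;
        u \<in> Hom K (src K f) (src K f'); v \<in> Hom K (tgt K f) (tgt K f'); v \<cdot> f = f' \<cdot> u\<rbrakk>
      \<Longrightarrow> \<exists>w. w \<in> Hom K (tgt K g) (tgt K g') \<and> w \<cdot> g = g' \<cdot> v \<and> susM K u \<cdot> h = h' \<cdot> w"
  shows "pretriangulated K"
proof unfold_locales
  show "additive_equivalence K K (susO K) (susM K)" by (rule suspension_equivalence)
  show "\<exists>X Y Z. triangle_on K X Y Z T" if "T \<in> Tri K" for T
    using that unfolding Tri tri_iso_def by blast
  show iso_closed: "T \<in> Tri K" if "S \<in> Tri K" "tri_iso K S T" for S T
    using that unfolding Tri by (metis prod_cases3 tri_iso_trans)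
  show "(ident K X, zerom K X N, zerom K N (susO K X)) \<in> Tri K" if X: "X \<in> ob K" and N: "zero_object K N" for X N
  proof -
    obtain M where M: "zero_object K M" "(ident K X, zerom K X M, zerom K M (susO K X)) \<in> Tri K" using ident_l[OF X] by blast
    obtain u where u: "iso_arr K M N u" using zero_object_iso[OF M(1) N] by blast
    have [simp]: "N \<in> ob K" "M \<in> ob K" using N M by (auto simp: zero_object_def)
    have [unfolded Hom_iff, simp]: "u \<in> Hom K M N" using u by (auto elim: iso_arrE)
    have "tri_iso K (ident K X, zerom K X M, zerom K M (susO K X)) (ident K X, zerom K X N, zerom K N (susO K X))"
      unfolding tri_iso_iff
      by (rule exI[of _ "ident K X"], rule exI[of _ "ident K X"], rule exI[of _ u])
        (use X u in \<open>auto intro!: iso_ident\<close>)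
    then show ?thesis using M(2) iso_closed by blast
  qed
  show "(zerom K N X, ident K X, zerom K X (susO K N)) \<in> Tri K" if X: "X \<in> ob K" and N: "zero_object K N" for X N
  proof -
    obtain M where M: "zero_object K M" "(zerom K M X, ident K X, zerom K X (susO K M)) \<in> Tri K" using ident_r[OF X] by blast
    obtain u where u: "iso_arr K M N u" using zero_object_iso[OF M(1) N] by blast
    have [simp]: "N \<in> ob K" "M \<in> ob K" using N M by (auto simp: zero_object_def)
    have [unfolded Hom_iff, simp]: "u \<in> Hom K M N" using u by (auto elim: iso_arrE)
    have "tri_iso K (zerom K M X, ident K X, zerom K X (susO K M)) (zerom K N X, ident K X, zerom K X (susO K N))"
      unfolding tri_iso_iff
      by (rule exI[of _ u], rule exI[of _ "ident K X"], rule exI[of _ "ident K X"])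
        (use X u in \<open>auto intro!: iso_ident\<close>)
    then show ?thesis using M(2) iso_closed by blast
  qed
  show "\<exists>g h. (f, g, h) \<in> Tri K" if "f \<in> arr K" for f by (rule cone[OF that])
  show "(g, h, \<ominus> (susM K f)) \<in> Tri K" if T: "(f, g, h) \<in> Tri K" for f g h
  proof -
    obtain f0 g0 h0 where S: "(f0, g0, h0) \<in> \<Delta>'" "tri_iso K (f0, g0, h0) (f, g, h)"
      using T unfolding Tri' by (metis prod_cases3)
    show ?thesis using iso_closed[OF rot[OF S(1)] tri_iso_rotate[OF S(2)]] .
  qed
  show "\<exists>w. tri_morphism K (f, g, h) (f', g', h') u v w" if
    T: "(f, g, h) \<in> Tri K" "(f', g', h') \<in> Tri K" and
    uv: "u \<in> Hom K (src K f) (src K f')" "v \<in> Hom K (tgt K f) (tgt K f')" "v \<cdot> f = f' \<cdot> u"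
    for f g h f' g' h' u v
  proof -
    obtain f0 g0 h0 where S: "(f0, g0, h0) \<in> \<Delta>" "tri_iso K (f0, g0, h0) (f, g, h)"
      using T(1) unfolding Tri by (metis prod_cases3)
    obtain f1 g1 h1 where S': "(f1, g1, h1) \<in> \<Delta>" "tri_iso K (f1, g1, h1) (f', g', h')"
      using T(2) unfolding Tri by (metis prod_cases3)
    obtain x y z where [simp]: "f \<in> arr K" "g \<in> arr K" "h \<in> arr K" "src K g = tgt K f" "src K h = tgt K g" "tgt K h = susO K (src K f)"
       "f0 \<in> arr K" "g0 \<in> arr K" "h0 \<in> arr K" "src K g0 = tgt K f0" "src K h0 = tgt K g0" "tgt K h0 = susO K (src K f0)" and
       1: "iso_arr K (src K f) (src K f0) x" "iso_arr K (tgt K f) (tgt K f0) y" "iso_arr K (tgt K g) (tgt K g0) z"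
       "y \<cdot> f = f0 \<cdot> x" "z \<cdot> g = g0 \<cdot> y" "susM K x \<cdot> h = h0 \<cdot> z"
      using tri_iso_sym[OF S(2)] unfolding tri_iso_iff by blast
    obtain x' y' z' where [simp]: "f' \<in> arr K" "g' \<in> arr K" "h' \<in> arr K" "src K g' = tgt K f'" "src K h' = tgt K g'" "tgt K h' = susO K (src K f')"
       "f1 \<in> arr K" "g1 \<in> arr K" "h1 \<in> arr K" "src K g1 = tgt K f1" "src K h1 = tgt K g1" "tgt K h1 = susO K (src K f1)" and
       2: "iso_arr K (src K f1) (src K f') x'" "iso_arr K (tgt K f1) (tgt K f') y'" "iso_arr K (tgt K g1) (tgt K g') z'"
       "y' \<cdot> f1 = f' \<cdot> x'" "z' \<cdot> g1 = g' \<cdot> y'" "susM K x' \<cdot> h1 = h' \<cdot> z'"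
      using S'(2) unfolding tri_iso_iff by blast
    obtain xi where xi: "x \<in> Hom K (src K f) (src K f0)" "xi \<in> Hom K (src K f0) (src K f)" "xi \<cdot> x = ident K (src K f)" "x \<cdot> xi = ident K (src K f0)"
      using 1(1) by (rule iso_arrE)
    obtain yi where yi: "y \<in> Hom K (tgt K f) (tgt K f0)" "yi \<in> Hom K (tgt K f0) (tgt K f)" "yi \<cdot> y = ident K (tgt K f)" "y \<cdot> yi = ident K (tgt K f0)"
      using 1(2) by (rule iso_arrE)
    obtain xj where xj: "x' \<in> Hom K (src K f1) (src K f')" "xj \<in> Hom K (src K f') (src K f1)" "xj \<cdot> x' = ident K (src K f1)" "x' \<cdot> xj = ident K (src K f')"
      using 2(1) by (rule iso_arrE)
    obtain yj where yj: "y' \<in> Hom K (tgt K f1) (tgt K f')" "yj \<in> Hom K (tgt K f') (tgt K f1)" "yj \<cdot> y' = ident K (tgt K f1)" "y' \<cdot> yj = ident K (tgt K f')"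
      using 2(2) by (rule iso_arrE)
    have z: "z \<in> Hom K (tgt K g) (tgt K g0)" "z' \<in> Hom K (tgt K g1) (tgt K g')" using 1(3) 2(3) by (auto elim: iso_arrE)
    have [unfolded Hom_iff, simp]: "x \<in> Hom K (src K f) (src K f0)" "xi \<in> Hom K (src K f0) (src K f)"
    "y \<in> Hom K (tgt K f) (tgt K f0)" "yi \<in> Hom K (tgt K f0) (tgt K f)" "x' \<in> Hom K (src K f1) (src K f')"
    "xj \<in> Hom K (src K f') (src K f1)" "y' \<in> Hom K (tgt K f1) (tgt K f')" "yj \<in> Hom K (tgt K f') (tgt K f1)"
    "z \<in> Hom K (tgt K g) (tgt K g0)" "z' \<in> Hom K (tgt K g1) (tgt K g')" "u \<in> Hom K (src K f) (src K f')"
    "v \<in> Hom K (tgt K f) (tgt K f')"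
      using xi yi xj yj z uv by auto
    have a: "f \<cdot> xi = yi \<cdot> f0" by (rule iso_square_inverse[OF 1(1) xi(2,4) yi(2,1,3) _ _ 1(4), symmetric]) auto
    have b: "yj \<cdot> f' = f1 \<cdot> xj" by (rule iso_square_inverse[OF 2(1) xj(2,4) yj(2,1,3) _ _ 2(4)]) auto
    have "yj \<cdot> (v \<cdot> yi) \<cdot> f0 = f1 \<cdot> (xj \<cdot> (u \<cdot> xi))"
      by (simp add: a[symmetric] reassoc[OF uv(3)] reassoc[OF b])
    then obtain w where w: "w \<in> Hom K (tgt K g0) (tgt K g1)" "w \<cdot> g0 = g1 \<cdot> (yj \<cdot> (v \<cdot> yi))"
       "susM K (xj \<cdot> (u \<cdot> xi)) \<cdot> h0 = h1 \<cdot> w"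
      using compl[OF S(1) S'(1), of "xj \<cdot> (u \<cdot> xi)" "yj \<cdot> (v \<cdot> yi)"] by auto
    have [unfolded Hom_iff, simp]: "w \<in> Hom K (tgt K g0) (tgt K g1)" using w by auto
    have "z' \<cdot> (w \<cdot> z) \<cdot> g = g' \<cdot> v"
      by (simp add: 1(5) reassoc[OF w(2)] reassoc[OF 2(5)] reassoc[OF yj(4)] yi(3))
    moreover have "susM K u \<cdot> h = h' \<cdot> (z' \<cdot> (w \<cdot> z))"
    proof -
      have s: "susM K xi \<cdot> susM K x = ident K (susO K (src K f))" "susM K x' \<cdot> susM K xj = ident K (susO K (src K f'))"
        using xi xj by (simp_all flip: Sus.functor_comp)
      have "susM K u \<cdot> h = susM K x' \<cdot> (susM K xj \<cdot> (susM K u \<cdot> (susM K xi \<cdot> (susM K x \<cdot> h))))"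
        by (simp add: reassoc[OF s(1)] reassoc[OF s(2)])
      also have "\<dots> = susM K x' \<cdot> (susM K (xj \<cdot> (u \<cdot> xi)) \<cdot> h0 \<cdot> z)" by (simp add: 1(6))
      also have "\<dots> = h' \<cdot> (z' \<cdot> (w \<cdot> z))" unfolding w(3) by (simp add: reassoc[OF 2(6)])
      finally show ?thesis .
    qed
    ultimately have "tri_morphism K (f, g, h) (f', g', h') u v (z' \<cdot> (w \<cdot> z))"
      unfolding tri_morphism_def using uv by simp
    then show ?thesis by blast
  qed
qed

end

section \<open>Happel's theorem\<close>

context frobenius_choice
begin

sublocale L: suspended_category L
  by unfold_locales (rule susL_equivalence)

definition std_triangles :: "('m set \<times> 'm set \<times> 'm set) set" where
  "std_triangles = {(\<pi> f, \<pi> g, \<pi> h) | f g h. \<exists>X Y Z f'.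
          f \<in> Hom C X Y \<and> g \<in> Hom C Y Z \<and> h \<in> Hom C Z (tgt C (p X)) \<and>
          is_pushout C (i X) f f' g \<and>
          h \<cdot> f' = p X \<and> h \<cdot> g = zerom C Y (tgt C (p X))}"

lemma Tri_L: "T \<in> Tri L \<longleftrightarrow> (\<exists>S \<in> std_triangles. tri_iso L S T)"
  unfolding std_triangles_def stable_category_def Let_def Tri_with_triangles by simp

text \<open>
  The sign makes these triangles isomorphic to the standard ones, see \<open>std_conn\<close> and \<open>conn_Tri\<close>.
\<close>

definition conn_triangles :: "('m set \<times> 'm set \<times> 'm set) set" where
  "conn_triangles = {(\<pi> j, \<pi> q, \<ominus>\<^bsub>L\<^esub> (\<pi> \<delta>)) | j q \<delta>. conn j q \<delta>}"

lemma pi_eqI: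
  assumes "f \<in> arr C" "g \<in> arr C" "src C f = src C g" "tgt C f = tgt C g" "fac (f \<ominus> g)"
  shows "\<pi> f = \<pi> g"
  using assms cls_eq_iff by blast

lemma std_trianglesI:
  assumes "f \<in> Hom C X Y" "g \<in> Hom C Y Z" "h \<in> Hom C Z (tgt C (p X))" "is_pushout C (i X) f f' g"
    "h \<cdot> f' = p X" "h \<cdot> g = zerom C Y (tgt C (p X))"
  shows "(\<pi> f, \<pi> g, \<pi> h) \<in> std_triangles"
  unfolding std_triangles_def using assms by blast

lemma std_Tri:
  assumes "f \<in> Hom C X Y" "g \<in> Hom C Y Z" "h \<in> Hom C Z (tgt C (p X))" "is_pushout C (i X) f f' g"
    "h \<cdot> f' = p X" "h \<cdot> g = zerom C Y (tgt C (p X))"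
  shows "(\<pi> f, \<pi> g, \<pi> h) \<in> Tri L"
proof -
  have "(\<pi> f, \<pi> g, \<pi> h) \<in> std_triangles" using assms by (rule std_trianglesI)
  moreover have "tri_iso L (\<pi> f, \<pi> g, \<pi> h) (\<pi> f, \<pi> g, \<pi> h)"
    by (rule L.tri_iso_refl) (use assms in auto)
  ultimately show ?thesis unfolding Tri_L by blast
qed

lemma P_summand_iso:
  assumes S: "biproduct C A B S i1 i2 p1 p2" and B: "B \<in> exact_proj C"
  shows "iso_arr L A S (\<pi> i1)"
proof -
  note [simp] = biproduct_simps[OF S]
  have "ident C S \<ominus> i1 \<cdot> p1 = i2 \<cdot> p2"
    by (rule biproduct_eq_out[OF S]) auto
  then have "fac (ident C S \<ominus> i1 \<cdot> p1)" using facI[of p2 S B i2 S] B by simp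
  then have "\<pi> (ident C S) = \<pi> (i1 \<cdot> p1)" by (intro pi_eqI) auto
  then show ?thesis
    by (intro Q.D.iso_arrI[where g = "\<pi> p1"]) (auto simp: Q.quot_cmp Q.quot_ident)
qed

text \<open>
  Adding the injective object of the chosen conflation to the target of \<open>f\<close> turns \<open>f\<close> into an inflation
  and does not change the target up to isomorphism in the stable category.
\<close>

lemma inflation_replacement:
  assumes f: "f \<in> Hom C X Y" and po: "is_pushout C (i X) f f' g"
    and S: "biproduct C Y (tgt C (i X)) S i1 i2 p1 p2"
  defines "c \<equiv> i1 \<cdot> f \<oplus> i2 \<cdot> i X"
  shows "(c, g \<cdot> p1 \<ominus> f' \<cdot> p2) \<in> Confl C" "c \<in> Hom C X S" "iso_arr L Y S (\<pi> i1)"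
    "\<pi> c = \<pi> i1 \<cdot>\<^bsub>L\<^esub> \<pi> f"
proof -
  have X [simp]: "X \<in> ob C" "Y \<in> ob C" using Hom_ob[OF f] by auto
  have [unfolded Hom_iff, simp]: "f \<in> Hom C X Y" using f by auto
  note [simp] = biproduct_simps[OF S]
  have "src C g = Y" using po f by (auto elim!: pushoutE)
  then show "(c, g \<cdot> p1 \<ominus> f' \<cdot> p2) \<in> Confl C"
    unfolding c_def using pushout_diagonal_conflation[OF choice_confl[OF X(1)] po] S by simp
  show "c \<in> Hom C X S" by (simp add: c_def)
  show "iso_arr L Y S (\<pi> i1)" by (rule P_summand_iso[OF S]) simp
  have "c \<ominus> i1 \<cdot> f = i2 \<cdot> i X"
    by (rule biproduct_eq_in[OF S]) (simp_all add: c_def subm_def)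
  then have "fac (c \<ominus> i1 \<cdot> f)" using facI[of "i X" X "tgt C (i X)" i2 S] by simp
  then have "\<pi> c = \<pi> (i1 \<cdot> f)" by (intro pi_eqI) (auto simp: c_def)
  then show "\<pi> c = \<pi> i1 \<cdot>\<^bsub>L\<^esub> \<pi> f" by (simp add: Q.quot_cmp)
qed

text \<open>
  The inflation that replaces \<open>f\<close> has the pushout \<open>Z\<close> as its cokernel, and the projection to the
  injective summand exhibits \<open>- h\<close> as the classifying map of this conflation.
\<close>

lemma std_conn:
  assumes f: "f \<in> Hom C X Y" "g \<in> Hom C Y Z" "h \<in> Hom C Z (tgt C (p X))" and po: "is_pushout C (i X) f f' g"
    and h: "h \<cdot> f' = p X" "h \<cdot> g = zerom C Y (tgt C (p X))"
  shows "\<exists>S \<in> conn_triangles. tri_iso L S (\<pi> f, \<pi> g, \<pi> h)"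
proof -
  have X [simp]: "X \<in> ob C" "Y \<in> ob C" "Z \<in> ob C" using Hom_ob[OF f(1)] Hom_ob[OF f(2)] by auto
  obtain S i1 i2 p1 p2 where S: "biproduct C Y (tgt C (i X)) S i1 i2 p1 p2"
    using ex_biproduct[of Y "tgt C (i X)"] by auto
  note [simp] = biproduct_simps[OF S]
  define c where "c = i1 \<cdot> f \<oplus> i2 \<cdot> i X"
  define m where "m = g \<cdot> p1 \<ominus> f' \<cdot> p2"
  note c = inflation_replacement[OF f(1) po S, folded c_def m_def]
  have [unfolded Hom_iff, simp]: "f \<in> Hom C X Y" "g \<in> Hom C Y Z" "h \<in> Hom C Z (tgt C (p X))" "c \<in> Hom C X S" using f c(2) by auto
  have [unfolded Hom_iff, simp]: "f' \<in> Hom C (tgt C (i X)) Z" using po f by (auto elim!: pushoutE)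
  have [unfolded Hom_iff, simp]: "m \<in> Hom C S Z" by (auto simp: m_def)
  have "conn c m (\<ominus> h)"
    unfolding conn_def
  proof (intro conjI bexI)
    show "p2 \<cdot> c = i (src C c)" by (simp add: c_def)
    show "\<ominus> h \<cdot> m = p (src C c) \<cdot> p2"
      by (rule biproduct_eq_out[OF S]) (auto simp: m_def h subm_def reassoc[OF h(1)] reassoc[OF h(2)])
  qed (use c in auto)
  then have "(\<pi> c, \<pi> m, \<ominus>\<^bsub>L\<^esub> \<pi> (\<ominus> h)) \<in> conn_triangles" unfolding conn_triangles_def by blast
  moreover have "\<ominus>\<^bsub>L\<^esub> \<pi> (\<ominus> h) = \<pi> h" by (simp add: Q.quot_neg)
  moreover have "tri_iso L (\<pi> f, \<pi> g, \<pi> h) (\<pi> c, \<pi> m, \<pi> h)"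
    unfolding tri_iso_iff
  proof (intro exI conjI)
    show "iso_arr L (src L (\<pi> f)) (src L (\<pi> c)) (ident L X)" using Q.D.iso_ident[of X] by simp
    show "iso_arr L (tgt L (\<pi> f)) (tgt L (\<pi> c)) (\<pi> i1)" using c(3) by simp
    show "iso_arr L (tgt L (\<pi> g)) (tgt L (\<pi> m)) (ident L Z)" using Q.D.iso_ident[of Z] by simp
    show "ident L Z \<cdot>\<^bsub>L\<^esub> \<pi> g = \<pi> m \<cdot>\<^bsub>L\<^esub> \<pi> i1" by (simp add: Q.quot_cmp m_def subm_def)
  qed (use c(4) in auto)
  ultimately show ?thesis using L.tri_iso_sym by metis
qed

lemma Tri_conn:
  assumes "T \<in> Tri L" shows "\<exists>S \<in> conn_triangles. tri_iso L S T"
proof -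
  obtain S where S: "S \<in> std_triangles" "tri_iso L S T" using assms unfolding Tri_L by blast
  then obtain S' where "S' \<in> conn_triangles" "tri_iso L S' S" using std_conn unfolding std_triangles_def by blast
  then show ?thesis using S by (metis prod_cases3 L.tri_iso_trans)
qed

lemma std_ex:
  assumes "f \<in> Hom C X Y"
  obtains f' g h Z where "g \<in> Hom C Y Z" "h \<in> Hom C Z (tgt C (p X))" "is_pushout C (i X) f f' g" "(g, h) \<in> Confl C"
    "h \<cdot> f' = p X" "h \<cdot> g = zerom C Y (tgt C (p X))" "f' \<in> Hom C (tgt C (i X)) Z" "f' \<cdot> i X = g \<cdot> f"
proof -
  have X: "X \<in> ob C" using Hom_ob[OF assms] by auto
  obtain f' g h where 1: "is_pushout C (i X) f f' g" "(g, h) \<in> Confl C" "h \<cdot> f' = p X" "tgt C h = tgt C (p X)"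
    "f' \<in> Hom C (tgt C (i X)) (tgt C g)" "src C g = Y" "f' \<cdot> i X = g \<cdot> f"
    by (rule ex_pushout[OF choice_confl[OF X], of f Y]) (use assms X in auto)
  show ?thesis
    by (rule that[of g "tgt C g" h f']) (use 1 confl_facts[OF 1(2)] in auto)
qed

text \<open>
  The pushout \<open>W\<close> of \<open>i X\<close> along \<open>j\<close> is an extension of \<open>Z\<close> by the injective target of \<open>i X\<close>.  Hence
  \<open>r : W \<rightarrow> Z\<close> is an isomorphism in the stable category, and \<open>h\<close> corresponds to \<open>- \<delta>\<close> under it.
\<close>

lemma conn_Tri:
  assumes "conn j q \<delta>" shows "(\<pi> j, \<pi> q, \<ominus>\<^bsub>L\<^esub> (\<pi> \<delta>)) \<in> Tri L"
proof -
  define X where "X = src C j"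
  define Y where "Y = tgt C j"
  define Z where "Z = tgt C q"
  obtain e where c: "(j, q) \<in> Confl C" and \<delta>: "\<delta> \<in> Hom C Z (tgt C (p X))"
    and e: "e \<in> Hom C Y (tgt C (i X))" "e \<cdot> j = i X" "\<delta> \<cdot> q = p X \<cdot> e"
    using assms unfolding X_def Y_def Z_def by (rule connE)
  have [unfolded Hom_iff, simp]: "j \<in> Hom C X Y" "q \<in> Hom C Y Z"
    using confl_facts[OF c] by (auto simp: X_def Y_def Z_def)
  have ob [simp]: "X \<in> ob C" "Y \<in> ob C" "Z \<in> ob C" using src_in_ob[of j] tgt_in_ob[of j] tgt_in_ob[of q] by auto
  have qj: "q \<cdot> j = zerom C X Z" using confl_facts(4)[OF c] by simp
  obtain f' g h W where gh: "g \<in> Hom C Y W" "h \<in> Hom C W (tgt C (p X))" and po: "is_pushout C (i X) j f' g"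
    and "(g, h) \<in> Confl C"
    and h: "h \<cdot> f' = p X" "h \<cdot> g = zerom C Y (tgt C (p X))" and f': "f' \<in> Hom C (tgt C (i X)) W" "f' \<cdot> i X = g \<cdot> j"
    by (rule std_ex[of j X Y]) auto
  have [unfolded Hom_iff, simp]: "\<delta> \<in> Hom C Z (tgt C (p X))" "e \<in> Hom C Y (tgt C (i X))" "g \<in> Hom C Y W"
    "h \<in> Hom C W (tgt C (p X))" "f' \<in> Hom C (tgt C (i X)) W" using \<delta> e gh f' by auto
  have W [simp]: "W \<in> ob C" using tgt_in_ob[of g] by simp
  have ex: "\<And>T a b. \<lbrakk>a \<in> Hom C (tgt C (i X)) T; b \<in> Hom C Y T; a \<cdot> i X = b \<cdot> j\<rbrakk> \<Longrightarrow> \<exists>t \<in> Hom C W T. t \<cdot> f' = a \<and> t \<cdot> g = b"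
    and un: "\<And>T t t'. \<lbrakk>t \<in> Hom C W T; t' \<in> Hom C W T; t \<cdot> f' = t' \<cdot> f'; t \<cdot> g = t' \<cdot> g\<rbrakk> \<Longrightarrow> t = t'"
    using po by (auto elim!: pushoutE)
  obtain r where r: "r \<in> Hom C W Z" "r \<cdot> f' = zerom C (tgt C (i X)) Z" "r \<cdot> g = q"
    using ex[of "zerom C (tgt C (i X)) Z" Z q] qj by auto
  obtain s where s: "s \<in> Hom C W (tgt C (i X))" "s \<cdot> f' = ident C (tgt C (i X))" "s \<cdot> g = e"
    using ex[of "ident C (tgt C (i X))" "tgt C (i X)" e] e by auto
  have [unfolded Hom_iff, simp]: "r \<in> Hom C W Z" "s \<in> Hom C W (tgt C (i X))" using r s by auto
  \<comment> \<open>The extension splits: \<open>s\<close> is a retraction of \<open>f'\<close>, and \<open>c'\<close> is the corresponding section of \<open>r\<close>.\<close>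
  have "(g \<ominus> f' \<cdot> e) \<cdot> j = zerom C X W" by (simp add: e f')
  then obtain c' where c': "c' \<in> Hom C Z W" "c' \<cdot> q = g \<ominus> f' \<cdot> e"
    by - (rule confl_cokernel[OF c, of "g \<ominus> f' \<cdot> e" W], auto)
  have [unfolded Hom_iff, simp]: "c' \<in> Hom C Z W" using c' by auto
  have "r \<cdot> c' \<cdot> q = ident C Z \<cdot> q"
    by (simp add: c'(2) r reassoc[OF r(2)])
  then have rc: "r \<cdot> c' = ident C Z" by - (rule confl_epi[OF c, of _ Z], auto)
  have "ident C W \<ominus> c' \<cdot> r = f' \<cdot> s"
  proof (rule un[of _ W])
    show "(ident C W \<ominus> c' \<cdot> r) \<cdot> f' = f' \<cdot> s \<cdot> f'" using r s by simp
    have "g \<ominus> (g \<ominus> f' \<cdot> e) = f' \<cdot> e" by (simp add: subm_def neg_add add_ac)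
    then show "(ident C W \<ominus> c' \<cdot> r) \<cdot> g = f' \<cdot> s \<cdot> g" using r s c' by simp
  qed auto
  then have "fac (ident C W \<ominus> c' \<cdot> r)" using facI[of s W "tgt C (i X)" f' W] by simp
  then have cr: "\<pi> (ident C W) = \<pi> (c' \<cdot> r)" by (intro pi_eqI) auto
  have iso: "iso_arr L W Z (\<pi> r)"
    by (rule Q.D.iso_arrI[where g = "\<pi> c'"]) (auto simp: Q.quot_cmp Q.quot_ident rc cr)
  have "h \<oplus> \<delta> \<cdot> r = p X \<cdot> s"
    by (rule un[of _ "tgt C (p X)"]) (auto simp: h r s e)
  then have "h \<ominus> \<ominus> (\<delta> \<cdot> r) = p X \<cdot> s" by (simp add: subm_def)
  then have "fac (h \<ominus> \<ominus> (\<delta> \<cdot> r))" using facI[of s W "tgt C (i X)" "p X" "tgt C (p X)"] by simp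
  then have \<pi>h: "\<pi> h = \<pi> (\<ominus> (\<delta> \<cdot> r))" by (intro pi_eqI) auto
  have "tri_iso L (\<pi> j, \<pi> g, \<pi> h) (\<pi> j, \<pi> q, \<ominus>\<^bsub>L\<^esub> (\<pi> \<delta>))"
    unfolding tri_iso_iff
  proof (intro exI conjI)
    show "iso_arr L (src L (\<pi> j)) (src L (\<pi> j)) (ident L X)" using Q.D.iso_ident[of X] by simp
    show "iso_arr L (tgt L (\<pi> j)) (tgt L (\<pi> j)) (ident L Y)" using Q.D.iso_ident[of Y] by simp
    show "iso_arr L (tgt L (\<pi> g)) (tgt L (\<pi> q)) (\<pi> r)" using iso by simp
    show "susM L (ident L X) \<cdot>\<^bsub>L\<^esub> \<pi> h = \<ominus>\<^bsub>L\<^esub> \<pi> \<delta> \<cdot>\<^bsub>L\<^esub> \<pi> r"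
      by (simp add: \<pi>h Q.quot_cmp Q.quot_neg)
    show "\<pi> r \<cdot>\<^bsub>L\<^esub> \<pi> g = \<pi> q \<cdot>\<^bsub>L\<^esub> ident L Y" by (simp add: Q.quot_cmp r)
  qed auto
  moreover have "(\<pi> j, \<pi> g, \<pi> h) \<in> std_triangles"
    by (rule std_trianglesI[OF _ gh po h]) simp
  ultimately show ?thesis unfolding Tri_L by blast
qed

lemma Tri_L': "T \<in> Tri L \<longleftrightarrow> (\<exists>S \<in> conn_triangles. tri_iso L S T)"
proof
  assume "\<exists>S \<in> conn_triangles. tri_iso L S T"
  then obtain S where S: "S \<in> conn_triangles" "tri_iso L S T" by blast
  then have "S \<in> Tri L" using conn_Tri unfolding conn_triangles_def by blast
  then show "T \<in> Tri L" using S(2) unfolding Tri_L by (metis prod_cases3 L.tri_iso_trans)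
qed (rule Tri_conn)

text \<open>
  The universal property of the pushout gives a morphism from the conflation \<open>(g, h)\<close> to the chosen
  conflation of \<open>Y\<close> which is the identity on \<open>Y\<close>.  Its last component represents \<open>\<Sigma>f\<close>.
\<close>

lemma std_rotate:
  assumes f: "f \<in> Hom C X Y" "g \<in> Hom C Y Z" "h \<in> Hom C Z (tgt C (p X))" and po: "is_pushout C (i X) f f' g"
    and h: "h \<cdot> f' = p X" "h \<cdot> g = zerom C Y (tgt C (p X))"
  shows "(\<pi> g, \<pi> h, \<ominus>\<^bsub>L\<^esub> (susM L (\<pi> f))) \<in> Tri L"
proof -
  have ob [simp]: "X \<in> ob C" "Y \<in> ob C" "Z \<in> ob C" using Hom_ob[OF f(1)] Hom_ob[OF f(2)] by auto
  have [unfolded Hom_iff, simp]: "f \<in> Hom C X Y" "g \<in> Hom C Y Z" "h \<in> Hom C Z (tgt C (p X))" using f by auto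
  have [unfolded Hom_iff, simp]: "f' \<in> Hom C (tgt C (i X)) Z" using po f by (auto elim!: pushoutE)
  have ex: "\<And>T a b. \<lbrakk>a \<in> Hom C (tgt C (i X)) T; b \<in> Hom C Y T; a \<cdot> i X = b \<cdot> f\<rbrakk> \<Longrightarrow> \<exists>t \<in> Hom C Z T. t \<cdot> f' = a \<and> t \<cdot> g = b"
    and un: "\<And>T t t'. \<lbrakk>t \<in> Hom C Z T; t' \<in> Hom C Z T; t \<cdot> f' = t' \<cdot> f'; t \<cdot> g = t' \<cdot> g\<rbrakk> \<Longrightarrow> t = t'"
    using po by (auto elim!: pushoutE)
  obtain s t where st: "susrel f s t" using susrel_ex[of f] by auto
  then have [unfolded Hom_iff, simp]: "s \<in> Hom C (tgt C (i X)) (tgt C (i Y))" "t \<in> Hom C (tgt C (p X)) (tgt C (p Y))"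
    and e: "s \<cdot> i X = i Y \<cdot> f" "t \<cdot> p X = p Y \<cdot> s" by (auto simp: susrel_def)
  obtain e' where e': "e' \<in> Hom C Z (tgt C (i Y))" "e' \<cdot> f' = s" "e' \<cdot> g = i Y"
    using ex[of s "tgt C (i Y)" "i Y"] e by auto
  have "t \<cdot> h = p Y \<cdot> e'" by (rule un[of _ "tgt C (p Y)"]) (use e' in \<open>auto simp: h e\<close>)
  moreover have "(g, h) \<in> Confl C" by (rule pushout_conflation[OF choice_confl[OF ob(1)] po]) (use h in auto)
  ultimately have "conn g h t" unfolding conn_def using e' by auto
  from conn_Tri[OF this] show ?thesis by (simp add: susM_L[OF st])
qed

text \<open>
  The square commutes only modulo maps through projective-injective objects.  The error extends along
  \<open>j\<close>, so that \<open>v\<close> can be corrected within its class to make the square commute in \<open>C\<close>; then the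
  induced map on cokernels is the required one.
\<close>

lemma conn_complete:
  assumes 1: "conn j q \<delta>" and 2: "conn j' q' \<delta>'"
    and u: "u \<in> Hom C (src C j) (src C j')" and v: "v \<in> Hom C (tgt C j) (tgt C j')" and uv: "fac (v \<cdot> j \<ominus> j' \<cdot> u)"
  obtains w where "w \<in> Hom C (tgt C q) (tgt C q')" "\<pi> w \<cdot>\<^bsub>L\<^esub> \<pi> q = \<pi> q' \<cdot>\<^bsub>L\<^esub> \<pi> v"
    "susM L (\<pi> u) \<cdot>\<^bsub>L\<^esub> \<pi> \<delta> = \<pi> \<delta>' \<cdot>\<^bsub>L\<^esub> \<pi> w"
proof -
  define X where "X = src C j"
  define Y where "Y = tgt C j"
  define Z where "Z = tgt C q"
  define X' where "X' = src C j'"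
  define Y' where "Y' = tgt C j'"
  define Z' where "Z' = tgt C q'"
  note c = conn_confl[OF 1] and c' = conn_confl[OF 2]
  have [unfolded Hom_iff, simp]: "j \<in> Hom C X Y" "q \<in> Hom C Y Z"
    using confl_facts[OF c] by (auto simp: X_def Y_def Z_def)
  have [unfolded Hom_iff, simp]: "j' \<in> Hom C X' Y'" "q' \<in> Hom C Y' Z'"
    using confl_facts[OF c'] by (auto simp: X'_def Y'_def Z'_def)
  have [unfolded Hom_iff, simp]: "u \<in> Hom C X X'" "v \<in> Hom C Y Y'" using u v by auto
  have ob [simp]: "X' \<in> ob C" "Z' \<in> ob C" using src_in_ob[of j'] tgt_in_ob[of q'] by simp_all
  have qj': "q' \<cdot> j' = zerom C X' Z'" using confl_facts(4)[OF c'] by simp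
  have vju: "v \<cdot> j \<ominus> j' \<cdot> u \<in> Hom C X Y'" by simp
  obtain R a b where R: "R \<in> exact_proj C" "a \<in> Hom C X R" "b \<in> Hom C R Y'" "v \<cdot> j \<ominus> j' \<cdot> u = b \<cdot> a"
    by (rule facE_hom[OF uv vju])
  obtain a' where a': "a' \<in> Hom C Y R" "a' \<cdot> j = a"
    by (rule inj_extend[OF R(1) c, of a]) (use R in auto)
  have [unfolded Hom_iff, simp]: "a \<in> Hom C X R" "b \<in> Hom C R Y'" "a' \<in> Hom C Y R" using R a' by auto
  define v' where "v' = v \<ominus> b \<cdot> a'"
  have [unfolded Hom_iff, simp]: "v' \<in> Hom C Y Y'" by (simp_all add: v'_def)
  have vj: "v \<cdot> j = b \<cdot> a \<oplus> j' \<cdot> u" using R(4) sub_eq_iff[of "v \<cdot> j" "j' \<cdot> u" "b \<cdot> a"] by simp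
  have sq: "v' \<cdot> j = j' \<cdot> u" by (simp add: v'_def a'(2) vj subm_def add_ac)
  have "q' \<cdot> v' \<cdot> j = zerom C X Z'" by (simp add: sq reassoc[OF qj'])
  then obtain w where w: "w \<in> Hom C Z Z'" "w \<cdot> q = q' \<cdot> v'"
    by - (rule confl_cokernel[OF c, of "q' \<cdot> v'" Z'], auto)
  have vv: "v \<ominus> v' = b \<cdot> a'" by (simp add: v'_def subm_def neg_add)
  have "fac (v \<ominus> v')" unfolding vv using facI[of a' Y R b Y'] R(1) by simp
  then have \<pi>v: "\<pi> v = \<pi> v'" by (intro pi_eqI) auto
  have "\<pi> w \<cdot>\<^bsub>L\<^esub> \<pi> q = \<pi> q' \<cdot>\<^bsub>L\<^esub> \<pi> v" unfolding \<pi>v using w by (simp add: Q.quot_cmp)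
  moreover have "susM L (\<pi> u) \<cdot>\<^bsub>L\<^esub> \<pi> \<delta> = \<pi> \<delta>' \<cdot>\<^bsub>L\<^esub> \<pi> w"
    by (rule conn_natural[OF 1 2 _ _ sq]) (use w in auto)
  ultimately show ?thesis using that[of w] w by simp
qed

lemma stable_pretriangulated: "pretriangulated L"
proof (rule L.pretriangulatedI[of conn_triangles std_triangles])
  fix T show "T \<in> Tri L \<longleftrightarrow> (\<exists>S \<in> conn_triangles. tri_iso L S T)" by (rule Tri_L')
  show "T \<in> Tri L \<longleftrightarrow> (\<exists>S \<in> std_triangles. tri_iso L S T)" by (rule Tri_L)
next
  fix X assume "X \<in> ob L" then have [simp]: "X \<in> ob C" by simp
  obtain N where N: "zero_object C N" using ex_zero_object by blast
  have NL: "zero_object L N" by (rule Q.quot_zero_object[OF N])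
  have [simp]: "N \<in> ob C" using N by (simp add: zero_object_def)
  obtain \<delta> where \<delta>: "conn (ident C X) (zerom C X N) \<delta>" using conn_ex[OF confl_ident_zero[OF N \<open>X \<in> ob C\<close>]] by blast
  note [simp] = conn_arr[OF \<delta>]
  have "\<ominus>\<^bsub>L\<^esub> \<pi> \<delta> = zerom L N (susO L X)"
    by (rule Q.D.zero_object_unique[OF NL]) auto
  then show "\<exists>N. zero_object L N \<and> (ident L X, zerom L X N, zerom L N (susO L X)) \<in> Tri L"
    using conn_Tri[OF \<delta>] NL by (auto simp: Q.quot_ident Q.quot_zerom)
  obtain \<epsilon> where \<epsilon>: "conn (zerom C N X) (ident C X) \<epsilon>" using conn_ex[OF confl_zero_ident[OF N \<open>X \<in> ob C\<close>]] by blast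
  note [simp] = conn_arr[OF \<epsilon>]
  have "\<ominus>\<^bsub>L\<^esub> \<pi> \<epsilon> = zerom L X (susO L N)"
    by (rule Q.D.zero_object_unique[OF L.Sus.functor_zero_object[OF NL]]) auto
  then show "\<exists>N. zero_object L N \<and> (zerom L N X, ident L X, zerom L X (susO L N)) \<in> Tri L"
    using conn_Tri[OF \<epsilon>] NL by (auto simp: Q.quot_ident Q.quot_zerom)
next
  fix F assume "F \<in> arr L"
  then have "F \<in> Hom L (src L F) (tgt L F)" by simp
  then obtain f where f: "f \<in> Hom C (src L F) (tgt L F)" "F = \<pi> f" by (rule Q.quot_lift)
  obtain f' g h Z where "g \<in> Hom C (tgt L F) Z" "h \<in> Hom C Z (tgt C (p (src L F)))" "is_pushout C (i (src L F)) f f' g"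
    "h \<cdot> f' = p (src L F)" "h \<cdot> g = zerom C (tgt L F) (tgt C (p (src L F)))"
    by (rule std_ex[OF f(1)])
  from std_Tri[OF f(1) this] show "\<exists>g h. (F, g, h) \<in> Tri L" using f(2) by blast
next
  fix F G H assume "(F, G, H) \<in> std_triangles"
  then show "(G, H, \<ominus>\<^bsub>L\<^esub> (susM L F)) \<in> Tri L" unfolding std_triangles_def using std_rotate by blast
next
  fix F G H F' G' H' U V
  assume S: "(F, G, H) \<in> conn_triangles" and S': "(F', G', H') \<in> conn_triangles"
    and U: "U \<in> Hom L (src L F) (src L F')" and V: "V \<in> Hom L (tgt L F) (tgt L F')" and sq: "V \<cdot>\<^bsub>L\<^esub> F = F' \<cdot>\<^bsub>L\<^esub> U"
  obtain j q \<delta> where 1: "conn j q \<delta>" "F = \<pi> j" "G = \<pi> q" "H = \<ominus>\<^bsub>L\<^esub> (\<pi> \<delta>)" using S unfolding conn_triangles_def by blast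
  obtain j' q' \<delta>' where 2: "conn j' q' \<delta>'" "F' = \<pi> j'" "G' = \<pi> q'" "H' = \<ominus>\<^bsub>L\<^esub> (\<pi> \<delta>')" using S' unfolding conn_triangles_def by blast
  note [simp] = confl_facts(1-3)[OF conn_confl[OF 1(1)]] confl_facts(1-3)[OF conn_confl[OF 2(1)]] conn_arr[OF 1(1)] conn_arr[OF 2(1)]
  obtain u where u: "u \<in> Hom C (src C j) (src C j')" "U = \<pi> u" using Q.quot_lift[OF U] 1(2) 2(2) by auto
  obtain v where v: "v \<in> Hom C (tgt C j) (tgt C j')" "V = \<pi> v" using Q.quot_lift[OF V] 1(2) 2(2) by auto
  have "\<pi> (v \<cdot> j) = \<pi> (j' \<cdot> u)" using sq u v 1(2) 2(2) by (simp add: Q.quot_cmp)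
  then have "fac (v \<cdot> j \<ominus> j' \<cdot> u)" by - (rule cls_eq_iff[THEN iffD1], use u v in auto)
  then obtain w where w: "w \<in> Hom C (tgt C q) (tgt C q')" "\<pi> w \<cdot>\<^bsub>L\<^esub> \<pi> q = \<pi> q' \<cdot>\<^bsub>L\<^esub> \<pi> v"
    "susM L (\<pi> u) \<cdot>\<^bsub>L\<^esub> \<pi> \<delta> = \<pi> \<delta>' \<cdot>\<^bsub>L\<^esub> \<pi> w"
    by (rule conn_complete[OF 1(1) 2(1) u(1) v(1)])
  have "susM L (\<pi> u) \<cdot>\<^bsub>L\<^esub> \<ominus>\<^bsub>L\<^esub> (\<pi> \<delta>) = \<ominus>\<^bsub>L\<^esub> (\<pi> \<delta>') \<cdot>\<^bsub>L\<^esub> \<pi> w" using w u by simp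
  then show "\<exists>w. w \<in> Hom L (tgt L G) (tgt L G') \<and> w \<cdot>\<^bsub>L\<^esub> G = G' \<cdot>\<^bsub>L\<^esub> V \<and> susM L U \<cdot>\<^bsub>L\<^esub> H = H' \<cdot>\<^bsub>L\<^esub> w"
    using w 1 2 u v by (intro exI[of _ "\<pi> w"]) auto
qed

end

sublocale frobenius_choice \<subseteq> T: pretriangulated L
  by (rule stable_pretriangulated)

context frobenius_choice
begin

text \<open>
  For composable inflations the octahedron is Noether's isomorphism, and its compatibilities with the
  connecting maps are instances of naturality.
\<close>

lemma conflation_octahedron:
  assumes 1: "conn j1 q1 \<delta>1" and 2: "conn j2 q2 \<delta>2" and 3: "conn (j2 \<cdot> j1) q3 \<delta>3" and ij: "tgt C j1 = src C j2"
  shows "has_octahedron L (\<pi> j1) (\<pi> j2) (\<pi> q1) (\<ominus>\<^bsub>L\<^esub> (\<pi> \<delta>1)) (\<pi> q2) (\<ominus>\<^bsub>L\<^esub> (\<pi> \<delta>2)) (\<pi> q3) (\<ominus>\<^bsub>L\<^esub> (\<pi> \<delta>3))"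
proof -
  define X where "X = src C j1"
  define Y where "Y = src C j2"
  define Z where "Z = tgt C j2"
  define A where "A = tgt C q1"
  define B where "B = tgt C q2"
  define D where "D = tgt C q3"
  note c = conn_confl[OF 1] conn_confl[OF 2] conn_confl[OF 3]
  have [unfolded Hom_iff, simp]: "j1 \<in> Hom C X Y" "j2 \<in> Hom C Y Z"
    using confl_facts[OF c(1)] confl_facts[OF c(2)] ij by (auto simp: X_def Y_def Z_def)
  have [unfolded Hom_iff, simp]: "q1 \<in> Hom C Y A" "q2 \<in> Hom C Z B" "q3 \<in> Hom C Z D"
    using confl_facts[OF c(1)] confl_facts[OF c(2)] confl_facts[OF c(3)] by (auto simp: A_def B_def D_def)
  have ob [simp]: "X \<in> ob C" "Y \<in> ob C" "Z \<in> ob C" "A \<in> ob C" "B \<in> ob C" "D \<in> ob C"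
    using src_in_ob[of j1] src_in_ob[of j2] tgt_in_ob[of q1] tgt_in_ob[of q2] tgt_in_ob[of q3] tgt_in_ob[of j2] by auto
  have [unfolded Hom_iff, simp]: "\<delta>1 \<in> Hom C A (tgt C (p X))" "\<delta>2 \<in> Hom C B (tgt C (p Y))" "\<delta>3 \<in> Hom C D (tgt C (p X))"
    using conn_arr[OF 1] conn_arr[OF 2] conn_arr[OF 3] by auto
  have qj2: "q2 \<cdot> j2 = zerom C Y B" and qj3: "q3 \<cdot> (j2 \<cdot> j1) = zerom C X D"
    using confl_facts(4)[OF c(2)] confl_facts(4)[OF c(3)] by simp_all
  obtain a where a: "a \<in> Hom C A D" "a \<cdot> q1 = q3 \<cdot> j2"
    by (rule confl_cokernel[OF c(1), of "q3 \<cdot> j2" D]) (use qj3 in auto)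
  obtain b where b: "b \<in> Hom C D B" "b \<cdot> q3 = q2"
    by (rule confl_cokernel[OF c(3), of q2 B]) (auto simp: reassoc[OF qj2])
  have [unfolded Hom_iff, simp]: "a \<in> Hom C A D" "b \<in> Hom C D B" using a b by auto
  have "(a, b) \<in> Confl C" by (rule conflation_quotients[OF c ij]) (use a b in auto)
  then obtain \<delta> where \<delta>: "conn a b \<delta>" by (rule conn_ex)
  have [unfolded Hom_iff, simp]: "\<delta> \<in> Hom C B (tgt C (p A))" using conn_arr[OF \<delta>] by auto
  have "susM L (\<pi> q1) \<cdot>\<^bsub>L\<^esub> \<pi> \<delta>2 = \<pi> \<delta> \<cdot>\<^bsub>L\<^esub> \<pi> (ident C B)"
    by (rule conn_natural[OF 2 \<delta>, of q1 q3 "ident C B"]) (use a b in auto)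
  then have "\<ominus>\<^bsub>L\<^esub> (\<pi> \<delta>) = susM L (\<pi> q1) \<cdot>\<^bsub>L\<^esub> \<ominus>\<^bsub>L\<^esub> (\<pi> \<delta>2)"
    by (simp flip: Q.quot_ident)
  then have "(\<pi> a, \<pi> b, susM L (\<pi> q1) \<cdot>\<^bsub>L\<^esub> \<ominus>\<^bsub>L\<^esub> (\<pi> \<delta>2)) \<in> Tri L" using conn_Tri[OF \<delta>] by simp
  moreover have "\<pi> a \<cdot>\<^bsub>L\<^esub> \<pi> q1 = \<pi> q3 \<cdot>\<^bsub>L\<^esub> \<pi> j2" "\<pi> b \<cdot>\<^bsub>L\<^esub> \<pi> q3 = \<pi> q2" using a b by (simp_all add: Q.quot_cmp)
  moreover have "\<ominus>\<^bsub>L\<^esub> (\<pi> \<delta>3) \<cdot>\<^bsub>L\<^esub> \<pi> a = \<ominus>\<^bsub>L\<^esub> (\<pi> \<delta>1)"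
  proof -
    have "susM L (\<pi> (ident C X)) \<cdot>\<^bsub>L\<^esub> \<pi> \<delta>1 = \<pi> \<delta>3 \<cdot>\<^bsub>L\<^esub> \<pi> a"
      by (rule conn_natural[OF 1 3, of "ident C X" j2 a]) (use a in auto)
    then show ?thesis by (simp flip: Q.quot_ident)
  qed
  moreover have "\<ominus>\<^bsub>L\<^esub> (\<pi> \<delta>2) \<cdot>\<^bsub>L\<^esub> \<pi> b = susM L (\<pi> j1) \<cdot>\<^bsub>L\<^esub> \<ominus>\<^bsub>L\<^esub> (\<pi> \<delta>3)"
  proof -
    have "susM L (\<pi> j1) \<cdot>\<^bsub>L\<^esub> \<pi> \<delta>3 = \<pi> \<delta>2 \<cdot>\<^bsub>L\<^esub> \<pi> b"
      by (rule conn_natural[OF 3 2, of j1 "ident C Z" b]) (use b in auto)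
    then show ?thesis by simp
  qed
  moreover have "\<pi> a \<in> Hom L (tgt L (\<pi> q1)) (tgt L (\<pi> q3))" "\<pi> b \<in> Hom L (tgt L (\<pi> q3)) (tgt L (\<pi> q2))" by simp_all
  ultimately show ?thesis unfolding has_octahedron_def by blast
qed

lemma replace_by_inflation:
  assumes "f \<in> Hom C X Y"
  obtains c m S y where "(c, m) \<in> Confl C" "c \<in> Hom C X S" "y \<in> Hom C Y S" "iso_arr L Y S (\<pi> y)"
    "\<pi> c = \<pi> y \<cdot>\<^bsub>L\<^esub> \<pi> f"
proof -
  have ob: "X \<in> ob C" "Y \<in> ob C" using Hom_ob[OF assms] by auto
  obtain f' g h Z where "is_pushout C (i X) f f' g" by (rule std_ex[OF assms])
  moreover obtain S i1 i2 p1 p2 where S: "biproduct C Y (tgt C (i X)) S i1 i2 p1 p2"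
    using ex_biproduct[of Y "tgt C (i X)"] ob by auto
  ultimately show ?thesis using inflation_replacement[OF assms _ S] that biproduct_simps[OF S]
    by (metis Hom_iff)
qed

text \<open>
  Up to isomorphism in the stable category every composable pair consists of inflations, which reduces
  the octahedral axiom to \<open>conflation_octahedron\<close>.
\<close>

theorem stable_triangulated: "triangulated_category L"
proof (rule T.triangulatedI)
  fix F G X Y Z F1 F2 G1 G2 K1 K2
  assume F: "F \<in> Hom L X Y" and G: "G \<in> Hom L Y Z"
    and T: "(F, F1, F2) \<in> Tri L" "(G, G1, G2) \<in> Tri L" "(G \<cdot>\<^bsub>L\<^esub> F, K1, K2) \<in> Tri L"
  obtain f where f: "f \<in> Hom C X Y" "F = \<pi> f" using F by (rule Q.quot_lift)
  obtain g where g: "g \<in> Hom C Y Z" "G = \<pi> g" using G by (rule Q.quot_lift)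
  have ob [simp]: "X \<in> ob C" "Y \<in> ob C" "Z \<in> ob C" using Hom_ob[OF f(1)] Hom_ob[OF g(1)] by auto
  obtain c m S y where c: "(c, m) \<in> Confl C" "c \<in> Hom C X S" "y \<in> Hom C Y S" "iso_arr L Y S (\<pi> y)"
    "\<pi> c = \<pi> y \<cdot>\<^bsub>L\<^esub> \<pi> f" by (rule replace_by_inflation[OF f(1)])
  obtain Y' where Y': "Y' \<in> Hom L S Y" "Y' \<cdot>\<^bsub>L\<^esub> \<pi> y = ident L Y" using c(4) by (auto elim: Q.D.iso_arrE)
  obtain y' where y': "y' \<in> Hom C S Y" "Y' = \<pi> y'" using Y'(1) by (rule Q.quot_lift)
  have [unfolded Hom_iff, simp]: "f \<in> Hom C X Y" "g \<in> Hom C Y Z" "c \<in> Hom C X S" "y \<in> Hom C Y S" "y' \<in> Hom C S Y"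
    using f g c y' by auto
  \<comment> \<open>The second inflation has to start at \<open>S\<close>; it replaces \<open>g\<close> composed with an inverse of \<open>y\<close> in the
    stable category.\<close>
  have "g \<cdot> y' \<in> Hom C S Z" by simp
  then obtain d n R z where d: "(d, n) \<in> Confl C" "d \<in> Hom C S R" "z \<in> Hom C Z R" "iso_arr L Z R (\<pi> z)"
    "\<pi> d = \<pi> z \<cdot>\<^bsub>L\<^esub> \<pi> (g \<cdot> y')" by (rule replace_by_inflation)
  have [unfolded Hom_iff, simp]: "d \<in> Hom C S R" "z \<in> Hom C Z R" using d by auto
  have "inflation C (d \<cdot> c)" by (rule inflation_cmp[OF c(2) d(2) inflationI[OF c(1)] inflationI[OF d(1)]])
  then obtain r where r: "(d \<cdot> c, r) \<in> Confl C" by (auto simp: inflation_def)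
  obtain \<delta>1 where \<delta>1: "conn c m \<delta>1" using conn_ex[OF c(1)] .
  obtain \<delta>2 where \<delta>2: "conn d n \<delta>2" using conn_ex[OF d(1)] .
  obtain \<delta>3 where \<delta>3: "conn (d \<cdot> c) r \<delta>3" using conn_ex[OF r] .
  have oct: "has_octahedron L (\<pi> c) (\<pi> d) (\<pi> m) (\<ominus>\<^bsub>L\<^esub> (\<pi> \<delta>1)) (\<pi> n) (\<ominus>\<^bsub>L\<^esub> (\<pi> \<delta>2)) (\<pi> r) (\<ominus>\<^bsub>L\<^esub> (\<pi> \<delta>3))"
    by (rule conflation_octahedron[OF \<delta>1 \<delta>2 \<delta>3]) simp
  have T3: "(\<pi> d \<cdot>\<^bsub>L\<^esub> \<pi> c, \<pi> r, \<ominus>\<^bsub>L\<^esub> (\<pi> \<delta>3)) \<in> Tri L"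
    using conn_Tri[OF \<delta>3] by (simp add: Q.quot_cmp)
  have zg: "\<pi> z \<cdot>\<^bsub>L\<^esub> G = \<pi> d \<cdot>\<^bsub>L\<^esub> \<pi> y"
  proof -
    have "\<pi> d \<cdot>\<^bsub>L\<^esub> \<pi> y = \<pi> z \<cdot>\<^bsub>L\<^esub> (\<pi> g \<cdot>\<^bsub>L\<^esub> (\<pi> y' \<cdot>\<^bsub>L\<^esub> \<pi> y))"
      unfolding d(5) by (simp add: Q.quot_cmp[symmetric] del: Q.quot_cmp)
    then show ?thesis using Y'(2) y'(2) g(2) by simp
  qed
  show "has_octahedron L F G F1 F2 G1 G2 K1 K2"
  proof (rule T.has_octahedron_transport[OF F G T _ _ conn_Tri[OF \<delta>1] conn_Tri[OF \<delta>2] T3 oct])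
    show "iso_arr L X X (ident L X)" by (rule Q.D.iso_ident) simp
    show "iso_arr L Y S (\<pi> y)" "iso_arr L Z R (\<pi> z)" using c d by auto
    show "\<pi> y \<cdot>\<^bsub>L\<^esub> F = \<pi> c \<cdot>\<^bsub>L\<^esub> ident L X" using c f by simp
    show "\<pi> z \<cdot>\<^bsub>L\<^esub> G = \<pi> d \<cdot>\<^bsub>L\<^esub> \<pi> y" by (rule zg)
  qed auto
qed

end

text \<open>
  As \<open>Z\<close> is the suspension of the kernel \<open>M\<close> of a deflation \<open>R \<rightarrow> Z\<close> with \<open>R\<close> projective, the map \<open>H\<close> is the
  suspension of a map \<open>M \<rightarrow> X\<close>.  Pushing out the conflation \<open>M \<rightarrow> R \<rightarrow> Z\<close> along it gives a conflation with
  connecting map \<open>H\<close>.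
\<close>

lemma (in frobenius_choice) realize_third_arrow:
  assumes H: "H \<in> Hom L Z (susO L X)" and X: "X \<in> ob C"
  obtains j q where "(j, q) \<in> Confl C" "src C j = X" "tgt C q = Z" "(\<pi> j, \<pi> q, H) \<in> Tri L"
proof -
  have Z [simp]: "Z \<in> ob C" using Q.D.Hom_ob[OF H] by simp
  obtain R r where R: "R \<in> exact_proj C" "r \<in> Hom C R Z" "deflation C r" using enough_projectives[OF Z] by blast
  obtain k where c: "(k, r) \<in> Confl C" using R by (auto simp: deflation_def)
  define M where "M = src C k"
  have [unfolded Hom_iff, simp]: "k \<in> Hom C M R" "r \<in> Hom C R Z"
    using R(2) confl_facts[OF c] by (auto simp: M_def)
  have M [simp]: "M \<in> ob C" using src_in_ob[of k] by simp
  obtain \<delta> where \<delta>: "conn k r \<delta>" using conn_ex[OF c] .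
  have [unfolded Hom_iff, simp]: "\<delta> \<in> Hom C Z (tgt C (p M))" using conn_arr[OF \<delta>] by auto
  have "iso_arr L (tgt L (\<pi> r)) (susO L (src L (\<pi> k))) (\<ominus>\<^bsub>L\<^esub> (\<pi> \<delta>))"
    by (rule T.iso_of_zero_middle[OF conn_Tri[OF \<delta>]]) (use Q.P_zero_object[OF R(1)] in simp)
  then obtain D where D: "D \<in> Hom L (tgt C (p M)) Z" "D \<cdot>\<^bsub>L\<^esub> \<ominus>\<^bsub>L\<^esub> (\<pi> \<delta>) = ident L Z" by (auto elim: Q.D.iso_arrE)
  have "H \<cdot>\<^bsub>L\<^esub> D \<in> Hom L (susO L M) (susO L X)" using H D by auto
  then obtain U where U: "U \<in> Hom L M X" "susM L U = H \<cdot>\<^bsub>L\<^esub> D" using T.sus_full[of M X] X M Q.ob_D by metis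
  obtain \<mu> where \<mu>: "\<mu> \<in> Hom C M X" "U = \<pi> \<mu>" using U(1) by (rule Q.quot_lift)
  obtain v j q where j: "(j, q) \<in> Confl C" "q \<cdot> v = r" "tgt C q = Z" "v \<in> Hom C R (tgt C j)" "src C j = X" "v \<cdot> k = j \<cdot> \<mu>"
    by (rule ex_pushout[OF c, of \<mu> X]) (use \<mu> in auto)
  note [simp] = confl_facts(1-3)[OF j(1)]
  obtain \<delta>' where \<delta>': "conn j q \<delta>'" using conn_ex[OF j(1)] .
  have [unfolded Hom_iff, simp]: "\<delta>' \<in> Hom C Z (tgt C (p X))" using conn_arr[OF \<delta>'] j by auto
  have "susM L (\<pi> \<mu>) \<cdot>\<^bsub>L\<^esub> \<pi> \<delta> = \<pi> \<delta>' \<cdot>\<^bsub>L\<^esub> \<pi> (ident C Z)"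
    by (rule conn_natural[OF \<delta> \<delta>', of \<mu> v "ident C Z"]) (use j \<mu> in auto)
  then have "\<ominus>\<^bsub>L\<^esub> (\<pi> \<delta>') = susM L (\<pi> \<mu>) \<cdot>\<^bsub>L\<^esub> \<ominus>\<^bsub>L\<^esub> (\<pi> \<delta>)" using \<mu> by (simp flip: Q.quot_ident)
  also have "\<dots> = H \<cdot>\<^bsub>L\<^esub> (D \<cdot>\<^bsub>L\<^esub> \<ominus>\<^bsub>L\<^esub> (\<pi> \<delta>))" using U \<mu> H D(1) by simp
  also have "\<dots> = H" unfolding D(2) using H by simp
  finally show ?thesis using that[OF j(1,5,3)] conn_Tri[OF \<delta>'] by simp
qed

section \<open>Phantoms\<close>

definition phantom :: "('o, 'm, 'z) tricat_scheme \<Rightarrow> 'o set \<Rightarrow> 'm \<Rightarrow> bool" where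
  "phantom K P h \<longleftrightarrow> (\<forall>Q \<in> P. \<forall>b \<in> Hom K Q (src K h). h \<cdot>\<^bsub>K\<^esub> b = zerom K Q (tgt K h))"

text \<open>
  This is meant for maps \<open>h\<close> to \<open>\<Sigma>X\<close>.  The object \<open>X\<close> is an argument of its own because it cannot be
  recovered from its suspension.
\<close>

definition cophantom :: "('o, 'm, 'z) tricat_scheme \<Rightarrow> 'o set \<Rightarrow> 'o \<Rightarrow> 'm \<Rightarrow> bool" where
  "cophantom K P X h \<longleftrightarrow> (\<forall>Q \<in> P. \<forall>b \<in> Hom K X Q. susM K b \<cdot>\<^bsub>K\<^esub> h = zerom K (src K h) (susO K Q))"

context pretriangulated
begin

lemma phantom_iff_lift:
  assumes T: "(f, g, h) \<in> Tri K"
  shows "phantom K P h \<longleftrightarrow> (\<forall>Q \<in> P. \<forall>b \<in> Hom K Q (tgt K g). \<exists>c \<in> Hom K Q (tgt K f). g \<cdot> c = b)"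
proof safe
  note [simp] = tri_arrs[OF T]
  fix Q b assume ph: "phantom K P h" and Q: "Q \<in> P" "b \<in> Hom K Q (tgt K g)"
  then have "h \<cdot> b = zerom K Q (susO K (src K f))" unfolding phantom_def by fastforce
  then show "\<exists>c\<in>Hom K Q (tgt K f). g \<cdot> c = b" using weak_kernel2[OF T Q(2)] by blast
next
  note [simp] = tri_arrs[OF T]
  assume l: "\<forall>Q \<in> P. \<forall>b \<in> Hom K Q (tgt K g). \<exists>c \<in> Hom K Q (tgt K f). g \<cdot> c = b"
  show "phantom K P h"
    unfolding phantom_def
  proof safe
    fix Q b assume Q: "Q \<in> P" "b \<in> Hom K Q (src K h)"
    then have "b \<in> Hom K Q (tgt K g)" by simp
    then obtain c where c: "c \<in> Hom K Q (tgt K f)" "b = g \<cdot> c" using l Q(1) by metis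
    show "h \<cdot> b = zerom K Q (tgt K h)"
      unfolding c(2) using c(1) by (simp add: reassoc[OF tri_hg_zero[OF T]])
  qed
qed

lemma cophantom_iff_extend:
  assumes T: "(f, g, h) \<in> Tri K"
  shows "cophantom K P (src K f) h \<longleftrightarrow> (\<forall>Q \<in> P. \<forall>b \<in> Hom K (src K f) Q. \<exists>c \<in> Hom K (tgt K f) Q. c \<cdot> f = b)"
proof safe
  note [simp] = tri_arrs[OF T]
  fix Q b assume ph: "cophantom K P (src K f) h" and Q: "Q \<in> P" "b \<in> Hom K (src K f) Q"
  have [unfolded Hom_iff, simp]: "b \<in> Hom K (src K f) Q" using Q by auto
  have ob: "Q \<in> ob K" using tgt_in_ob[of b] by simp
  have "susM K b \<cdot> h = zerom K (tgt K g) (susO K Q)" using ph Q unfolding cophantom_def by fastforce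
  then obtain s where s: "s \<in> Hom K (susO K (tgt K f)) (susO K Q)" "s \<cdot> \<ominus> (susM K f) = susM K b"
    by - (rule weak_cokernel2[OF tri_rotate[OF T], of "susM K b" "susO K Q"], auto)
  obtain c where c: "c \<in> Hom K (tgt K f) Q" "susM K c = s"
    using sus_full[of "tgt K f" Q s] s ob by auto
  have "susM K (\<ominus> c \<cdot> f) = susM K b" using c s by (auto simp flip: s(2))
  then have "\<ominus> c \<cdot> f = b" by (rule sus_eqD) (use c in auto)
  then show "\<exists>c \<in> Hom K (tgt K f) Q. c \<cdot> f = b" using c by (intro bexI[of _ "\<ominus> c"]) auto
next
  note [simp] = tri_arrs[OF T]
  assume l: "\<forall>Q \<in> P. \<forall>b \<in> Hom K (src K f) Q. \<exists>c \<in> Hom K (tgt K f) Q. c \<cdot> f = b"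
  have fh: "susM K f \<cdot> h = zerom K (tgt K g) (susO K (tgt K f))"
    using tri_hg_zero[OF tri_rotate[OF T]] neg_eq_iff[of "susM K f \<cdot> h" "zerom K (tgt K g) (susO K (tgt K f))"] by simp
  show "cophantom K P (src K f) h"
    unfolding cophantom_def
  proof safe
    fix Q b assume Q: "Q \<in> P" "b \<in> Hom K (src K f) Q"
    then obtain c where c: "c \<in> Hom K (tgt K f) Q" "b = c \<cdot> f" using l by metis
    have ob: "Q \<in> ob K" using Hom_ob[OF Q(2)] by simp
    show "susM K b \<cdot> h = zerom K (src K h) (susO K Q)"
      unfolding c(2) using c(1) ob by (simp add: fh)
  qed
qed

end

text \<open>
  The part of a Frobenius class that matters for its stable category: the projective objects and, for
  every object, triangles with projective middle term whose connecting maps are phantoms and cophantoms.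
  In this form it can be transported along equivalences.
\<close>

locale frobenius_ideal = pretriangulated K
  for K :: "('o, 'm, 'z) tricat_scheme" (structure) +
  fixes P :: "'o set"
  assumes P_ob: "P \<subseteq> ob K"
    and P_retract: "\<lbrakk>Q \<in> P; s \<in> Hom K R Q; r \<in> Hom K Q R; r \<cdot> s = ident K R\<rbrakk> \<Longrightarrow> R \<in> P"
    and enough_proj: "A \<in> ob K \<Longrightarrow> \<exists>f g h. (f, g, h) \<in> Tri K \<and> tgt K g = A \<and> tgt K f \<in> P \<and>
      phantom K P h \<and> cophantom K P (src K f) h"
    and enough_inj: "A \<in> ob K \<Longrightarrow> \<exists>f g h. (f, g, h) \<in> Tri K \<and> src K f = A \<and> tgt K f \<in> P \<and>
      phantom K P h \<and> cophantom K P A h"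
begin

text \<open>
  A phantom on \<open>Z\<close> vanishes on the middle object of a triangle \<open>W \<rightarrow> Q \<rightarrow> Z \<rightarrow> \<Sigma>W\<close> with \<open>Q\<close> in \<open>P\<close>, hence
  factors through its connecting map.  This connecting map is a cophantom, and maps \<open>\<Sigma>W \<rightarrow> \<Sigma>X\<close> are
  suspensions.  The converse is dual.
\<close>

lemma phantom_iff_cophantom:
  assumes h: "h \<in> Hom K Z (susO K X)" and X: "X \<in> ob K"
  shows "phantom K P h \<longleftrightarrow> cophantom K P X h"
proof
  assume ph: "phantom K P h"
  have Z: "Z \<in> ob K" using Hom_ob[OF h] by simp
  obtain f g h' where T: "(f, g, h') \<in> Tri K" "tgt K g = Z" "tgt K f \<in> P" "cophantom K P (src K f) h'"
    using enough_proj[OF Z] by blast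
  have [unfolded Hom_iff, simp]: "h \<in> Hom K Z (susO K X)" using h by auto
  define W where "W = src K f"
  have [simp]: "f \<in> arr K" "g \<in> arr K" "h' \<in> arr K" "src K f = W" "src K g = tgt K f" "tgt K g = Z" "src K h' = Z" "tgt K h' = susO K W"
    using tri_arrs[OF T(1)] T(2) by (auto simp: W_def)
  have W: "W \<in> ob K" using src_in_ob[of f] by simp
  have "h \<cdot> g = zerom K (tgt K f) (susO K X)" using ph T(2,3) unfolding phantom_def by fastforce
  then obtain s where s: "s \<in> Hom K (susO K W) (susO K X)" "s \<cdot> h' = h"
    by - (rule weak_cokernel2[OF T(1), of h "susO K X"], auto)
  obtain s' where s': "s' \<in> Hom K W X" "susM K s' = s" using sus_full[OF W X s(1)] .
  show "cophantom K P X h"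
    unfolding cophantom_def
  proof safe
    fix Q b assume Q: "Q \<in> P" "b \<in> Hom K X Q"
    then have "b \<cdot> s' \<in> Hom K W Q" using s' by auto
    then have "susM K (b \<cdot> s') \<cdot> h' = zerom K Z (susO K Q)"
      using T(4) Q(1) unfolding cophantom_def by fastforce
    moreover have "susM K (b \<cdot> s') = susM K b \<cdot> s" using Q s' by auto
    ultimately show "susM K b \<cdot> h = zerom K (src K h) (susO K Q)" using Q s by (auto simp flip: s(2))
  qed
next
  assume ph: "cophantom K P X h"
  obtain f g h' where T: "(f, g, h') \<in> Tri K" "src K f = X" "tgt K f \<in> P" "phantom K P h'"
    using enough_inj[OF X] by blast
  define W where "W = tgt K g"
  have [unfolded Hom_iff, simp]: "h \<in> Hom K Z (susO K X)" using h by auto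
  have [simp]: "f \<in> arr K" "g \<in> arr K" "h' \<in> arr K" "src K f = X" "src K g = tgt K f" "tgt K g = W" "src K h' = W" "tgt K h' = susO K X"
    using tri_arrs[OF T(1)] T(2) by (auto simp: W_def)
  have Z: "Z \<in> ob K" using Hom_ob[OF h] by simp
  have "susM K f \<cdot> h = zerom K Z (susO K (tgt K f))" using ph T(2,3) unfolding cophantom_def by fastforce
  then obtain t where t: "t \<in> Hom K Z W" "h' \<cdot> t = h"
    by - (rule weak_kernel2[OF tri_rotate[OF T(1)], of h Z], use Z in auto)
  have ob: "X \<in> ob K" by (rule X)
  show "phantom K P h"
    unfolding phantom_def
  proof safe
    fix Q b assume Q: "Q \<in> P" "b \<in> Hom K Q (src K h)"
    then have "t \<cdot> b \<in> Hom K Q W" using t by auto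
    then have "h' \<cdot> (t \<cdot> b) = zerom K Q (susO K X)"
      using T(4) Q(1) unfolding phantom_def by fastforce
    moreover have "h' \<cdot> t \<cdot> b = h' \<cdot> (t \<cdot> b)" using Q t(1) by (intro assoc) auto
    ultimately show "h \<cdot> b = zerom K Q (tgt K h)" unfolding t(2) by simp
  qed
qed

lemma zero_in_P: assumes "zero_object K N" shows "N \<in> P"
proof -
  have N: "N \<in> ob K" using assms by (simp add: zero_object_def)
  obtain Q where Q: "Q \<in> P" using enough_proj[OF N] by blast
  then have Q': "Q \<in> ob K" using P_ob by blast
  show ?thesis
    by (rule P_retract[OF Q, of "zerom K N Q" N "zerom K Q N"])
      (use N Q' zero_object_ident[OF assms] in auto)
qed

lemma P_iso: assumes "Q \<in> P" "iso_arr K Q R e" shows "R \<in> P"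
proof -
  obtain e' where "e \<in> Hom K Q R" "e' \<in> Hom K R Q" "e \<cdot> e' = ident K R" using assms(2) by (auto elim: iso_arrE)
  then show ?thesis using P_retract[OF assms(1)] by blast
qed

text \<open>
  Lifting the identity of \<open>A\<close> along a map from an object of \<open>P\<close> makes \<open>A\<close> a retract of that object.
\<close>

lemma P_by_lifting:
  assumes A: "A \<in> ob K"
    and l: "\<And>f g h b. \<lbrakk>(f, g, h) \<in> Tri K; phantom K P h; tgt K f \<in> P; b \<in> Hom K A (tgt K g)\<rbrakk>
      \<Longrightarrow> \<exists>c \<in> Hom K A (tgt K f). g \<cdot> c = b"
  shows "A \<in> P"
proof -
  obtain f g h where T: "(f, g, h) \<in> Tri K" "tgt K g = A" "tgt K f \<in> P" "phantom K P h"
    using enough_proj[OF A] by blast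
  obtain c where c: "c \<in> Hom K A (tgt K f)" "g \<cdot> c = ident K A"
    using l[OF T(1,4,3), of "ident K A"] T(2) A by auto
  show ?thesis by (rule P_retract[OF T(3) c(1) _ c(2)]) (use tri_arrs[OF T(1)] T(2) in auto)
qed

lemma P_biproduct:
  assumes "A \<in> P" "B \<in> P" "biproduct K A B S i1 i2 p1 p2"
  shows "S \<in> P"
proof (rule P_by_lifting)
  note [simp] = biproduct_simps[OF assms(3)]
  show "S \<in> ob K" by simp
  fix f g h b assume T: "(f, g, h) \<in> Tri K" "phantom K P h" "b \<in> Hom K S (tgt K g)"
  note [simp] = tri_arrs[OF T(1)]
  have [unfolded Hom_iff, simp]: "b \<in> Hom K S (tgt K g)" using T by auto
  note l = T(2)[unfolded phantom_iff_lift[OF T(1)], rule_format]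
  have bA: "b \<cdot> i1 \<in> Hom K A (tgt K g)" and bB: "b \<cdot> i2 \<in> Hom K B (tgt K g)" by simp_all
  obtain a where a: "a \<in> Hom K A (tgt K f)" "g \<cdot> a = b \<cdot> i1" using l[OF assms(1) bA] by blast
  obtain c where c: "c \<in> Hom K B (tgt K f)" "g \<cdot> c = b \<cdot> i2" using l[OF assms(2) bB] by blast
  have [unfolded Hom_iff, simp]: "a \<in> Hom K A (tgt K f)" "c \<in> Hom K B (tgt K f)" using a c by auto
  have "g \<cdot> (a \<cdot> p1 \<oplus> c \<cdot> p2) = b"
    by (rule biproduct_eq_out[OF assms(3)]) (simp_all add: reassoc[OF a(2)] reassoc[OF c(2)] a c)
  then show "\<exists>c\<in>Hom K S (tgt K f). g \<cdot> c = b" by (intro bexI[of _ "a \<cdot> p1 \<oplus> c \<cdot> p2"]) auto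
qed

lemma P_ideal: "additive_ideal K P"
proof unfold_locales
  show "P \<subseteq> ob K" by (rule P_ob)
  show "P \<noteq> {}" using ex_zero_object zero_in_P by blast
  fix A B assume AB: "A \<in> P" "B \<in> P"
  then have "A \<in> ob K" "B \<in> ob K" using P_ob by auto
  then obtain S i1 i2 p1 p2 where S: "biproduct K A B S i1 i2 p1 p2" using ex_biproduct by blast
  then show "\<exists>S i1 i2 p1 p2. S \<in> P \<and> biproduct K A B S i1 i2 p1 p2" using P_biproduct[OF AB S] by blast
qed

end

section \<open>The relative exact structure\<close>

text \<open>
  Here \<open>P\<close> is a class of objects of the stable category of \<open>C\<close>, hence of \<open>C\<close>.  The relative conflations
  are those along whose deflations the objects of \<open>P\<close> lift in \<open>C\<close>.  By \<open>rel_confl_phantom\<close> this means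
  that the connecting map in the stable category is a phantom.
\<close>

locale relative_exact = frobenius_choice C i p + I: frobenius_ideal "stable_category C i p" P
  for C :: "('o, 'm) excat" (structure) and i p :: "'o \<Rightarrow> 'm" and P :: "'o set"
begin

definition rel_confl :: "('m \<times> 'm) set" where
  "rel_confl = {(j, q). (j, q) \<in> Confl C \<and> (\<forall>Q \<in> P. \<forall>b \<in> Hom C Q (tgt C q). \<exists>c \<in> Hom C Q (tgt C j). q \<cdot> c = b)}"

abbreviation "E \<equiv> C\<lparr>Confl := rel_confl\<rparr>"

lemma P_obC: "Q \<in> P \<Longrightarrow> Q \<in> ob C"
  using I.P_ob by auto

lemma proj_in_P: "R \<in> exact_proj C \<Longrightarrow> R \<in> P"
  using I.zero_in_P Q.P_zero_object by blast

text \<open>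
  Lifts may be sought in the stable category instead of \<open>C\<close>: the error of a stable lift factors through a
  projective object, which lifts along every deflation.
\<close>

lemma phantom_iff_lifts:
  assumes c: "(j, q) \<in> Confl C" and T: "(\<pi> j, \<pi> q, h) \<in> Tri L"
  shows "phantom L P h \<longleftrightarrow> (\<forall>Q \<in> P. \<forall>b \<in> Hom C Q (tgt C q). \<exists>c \<in> Hom C Q (tgt C j). q \<cdot> c = b)"
proof
  note [simp] = confl_facts(1-3)[OF c]
  assume "phantom L P h"
  then have l: "\<And>Q B. \<lbrakk>Q \<in> P; B \<in> Hom L Q (tgt C q)\<rbrakk> \<Longrightarrow> \<exists>D \<in> Hom L Q (tgt C j). \<pi> q \<cdot>\<^bsub>L\<^esub> D = B"
    unfolding T.phantom_iff_lift[OF T] by simp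
  show "\<forall>Q \<in> P. \<forall>b \<in> Hom C Q (tgt C q). \<exists>c \<in> Hom C Q (tgt C j). q \<cdot> c = b"
  proof (intro ballI)
    fix Q b assume Q: "Q \<in> P" "b \<in> Hom C Q (tgt C q)"
    then have "\<pi> b \<in> Hom L Q (tgt C q)" by auto
    then obtain D where D: "D \<in> Hom L Q (tgt C j)" "\<pi> q \<cdot>\<^bsub>L\<^esub> D = \<pi> b" using l[OF Q(1)] by blast
    obtain d where d: "d \<in> Hom C Q (tgt C j)" "D = \<pi> d" using D(1) by (rule Q.quot_lift)
    have [unfolded Hom_iff, simp]: "b \<in> Hom C Q (tgt C q)" "d \<in> Hom C Q (tgt C j)" using Q d by auto
    have "\<pi> b = \<pi> (q \<cdot> d)" using D d by (simp add: Q.quot_cmp)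
    then have f: "fac (b \<ominus> q \<cdot> d)" by - (rule cls_eq_iff[THEN iffD1], auto)
    have "b \<ominus> q \<cdot> d \<in> Hom C Q (tgt C q)" by simp
    then obtain R x y where R: "R \<in> exact_proj C" "x \<in> Hom C Q R" "y \<in> Hom C R (tgt C q)" "b \<ominus> q \<cdot> d = y \<cdot> x"
      by (rule facE_hom[OF f])
    obtain y' where y': "y' \<in> Hom C R (tgt C j)" "q \<cdot> y' = y" by (rule proj_lift[OF R(1) c R(3)])
    have [unfolded Hom_iff, simp]: "x \<in> Hom C Q R" "y \<in> Hom C R (tgt C q)" "y' \<in> Hom C R (tgt C j)" using R y' by auto
    have "b = y \<cdot> x \<oplus> q \<cdot> d" using R(4) sub_eq_iff[of b "q \<cdot> d" "y \<cdot> x"] by simp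
    then have "q \<cdot> (y' \<cdot> x \<oplus> d) = b" by (simp add: reassoc[OF y'(2)])
    then show "\<exists>c \<in> Hom C Q (tgt C j). q \<cdot> c = b" by (intro bexI[of _ "y' \<cdot> x \<oplus> d"]) auto
  qed
next
  note [simp] = confl_facts(1-3)[OF c]
  assume l: "\<forall>Q \<in> P. \<forall>b \<in> Hom C Q (tgt C q). \<exists>c \<in> Hom C Q (tgt C j). q \<cdot> c = b"
  show "phantom L P h"
    unfolding T.phantom_iff_lift[OF T]
  proof (intro ballI)
    fix Q B assume Q: "Q \<in> P" "B \<in> Hom L Q (tgt L (\<pi> q))"
    then obtain b where b: "b \<in> Hom C Q (tgt C q)" "B = \<pi> b" using Q.quot_lift by (metis Q.quot_arr(3) confl_facts(2)[OF c])
    then obtain c where c: "c \<in> Hom C Q (tgt C j)" "q \<cdot> c = b" using l Q(1) by blast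
    then show "\<exists>D\<in>Hom L Q (tgt L (\<pi> j)). \<pi> q \<cdot>\<^bsub>L\<^esub> D = B"
      using b by (intro bexI[of _ "\<pi> c"]) (auto simp: Q.quot_cmp)
  qed
qed

text \<open>Dual to \<open>phantom_iff_lifts\<close>.\<close>

lemma cophantom_iff_extends:
  assumes c: "(j, q) \<in> Confl C" and T: "(\<pi> j, \<pi> q, h) \<in> Tri L"
  shows "cophantom L P (src C j) h \<longleftrightarrow> (\<forall>Q \<in> P. \<forall>b \<in> Hom C (src C j) Q. \<exists>c \<in> Hom C (tgt C j) Q. c \<cdot> j = b)"
proof
  note [simp] = confl_facts(1-3)[OF c]
  assume "cophantom L P (src C j) h"
  then have l: "\<And>Q B. \<lbrakk>Q \<in> P; B \<in> Hom L (src C j) Q\<rbrakk> \<Longrightarrow> \<exists>D \<in> Hom L (tgt C j) Q. D \<cdot>\<^bsub>L\<^esub> \<pi> j = B"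
    using T.cophantom_iff_extend[OF T, of P] by simp
  show "\<forall>Q \<in> P. \<forall>b \<in> Hom C (src C j) Q. \<exists>c \<in> Hom C (tgt C j) Q. c \<cdot> j = b"
  proof (intro ballI)
    fix Q b assume Q: "Q \<in> P" "b \<in> Hom C (src C j) Q"
    then have "\<pi> b \<in> Hom L (src C j) Q" by auto
    then obtain D where D: "D \<in> Hom L (tgt C j) Q" "D \<cdot>\<^bsub>L\<^esub> \<pi> j = \<pi> b" using l[OF Q(1)] by blast
    obtain d where d: "d \<in> Hom C (tgt C j) Q" "D = \<pi> d" using D(1) by (rule Q.quot_lift)
    have [unfolded Hom_iff, simp]: "b \<in> Hom C (src C j) Q" "d \<in> Hom C (tgt C j) Q" using Q d by auto
    have "\<pi> b = \<pi> (d \<cdot> j)" using D d by (simp add: Q.quot_cmp)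
    then have f: "fac (b \<ominus> d \<cdot> j)" by - (rule cls_eq_iff[THEN iffD1], auto)
    have "b \<ominus> d \<cdot> j \<in> Hom C (src C j) Q" by simp
    then obtain R x y where R: "R \<in> exact_proj C" "x \<in> Hom C (src C j) R" "y \<in> Hom C R Q" "b \<ominus> d \<cdot> j = y \<cdot> x"
      by (rule facE_hom[OF f])
    obtain x' where x': "x' \<in> Hom C (tgt C j) R" "x' \<cdot> j = x" by (rule inj_extend[OF R(1) c R(2)])
    have [unfolded Hom_iff, simp]: "x \<in> Hom C (src C j) R" "y \<in> Hom C R Q" "x' \<in> Hom C (tgt C j) R" using R x' by auto
    have "b = y \<cdot> x \<oplus> d \<cdot> j" using R(4) sub_eq_iff[of b "d \<cdot> j" "y \<cdot> x"] by simp
    then have "(y \<cdot> x' \<oplus> d) \<cdot> j = b" by (simp add: x'(2))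
    then show "\<exists>c \<in> Hom C (tgt C j) Q. c \<cdot> j = b" by (intro bexI[of _ "y \<cdot> x' \<oplus> d"]) auto
  qed
next
  note [simp] = confl_facts(1-3)[OF c]
  assume l: "\<forall>Q \<in> P. \<forall>b \<in> Hom C (src C j) Q. \<exists>c \<in> Hom C (tgt C j) Q. c \<cdot> j = b"
  have "cophantom L P (src L (\<pi> j)) h"
    unfolding T.cophantom_iff_extend[OF T]
  proof (intro ballI)
    fix Q B assume Q: "Q \<in> P" "B \<in> Hom L (src L (\<pi> j)) Q"
    then obtain b where b: "b \<in> Hom C (src C j) Q" "B = \<pi> b" using Q.quot_lift by (metis Q.quot_arr(2) confl_facts(1)[OF c])
    then obtain c where c: "c \<in> Hom C (tgt C j) Q" "c \<cdot> j = b" using l Q(1) by blast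
    then show "\<exists>D\<in>Hom L (tgt L (\<pi> j)) Q. D \<cdot>\<^bsub>L\<^esub> \<pi> j = B"
      using b by (intro bexI[of _ "\<pi> c"]) (auto simp: Q.quot_cmp)
  qed
  then show "cophantom L P (src C j) h" by simp
qed

lemma rel_conflI:
  assumes "(j, q) \<in> Confl C" "\<And>Q b. \<lbrakk>Q \<in> P; b \<in> Hom C Q (tgt C q)\<rbrakk> \<Longrightarrow> \<exists>c \<in> Hom C Q (tgt C j). q \<cdot> c = b"
  shows "(j, q) \<in> rel_confl"
  unfolding rel_confl_def using assms by blast

lemma rel_conflD:
  assumes "(j, q) \<in> rel_confl"
  shows "(j, q) \<in> Confl C" "\<And>Q b. \<lbrakk>Q \<in> P; b \<in> Hom C Q (tgt C q)\<rbrakk> \<Longrightarrow> \<exists>c \<in> Hom C Q (tgt C j). q \<cdot> c = b"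
  using assms unfolding rel_confl_def by blast+

lemma rel_confl_phantom:
  assumes "(j, q) \<in> Confl C" "(\<pi> j, \<pi> q, h) \<in> Tri L"
  shows "(j, q) \<in> rel_confl \<longleftrightarrow> phantom L P h"
  unfolding phantom_iff_lifts[OF assms] rel_confl_def using assms(1) by blast

text \<open>
  This expresses the symmetry \<open>phantom_iff_cophantom\<close> in terms of \<open>C\<close>, and it makes the class of relative
  conflations self-dual.
\<close>

lemma rel_confl_iff_extends:
  assumes c: "(j, q) \<in> Confl C"
  shows "(j, q) \<in> rel_confl \<longleftrightarrow> (\<forall>Q \<in> P. \<forall>b \<in> Hom C (src C j) Q. \<exists>c \<in> Hom C (tgt C j) Q. c \<cdot> j = b)"
proof -
  note [simp] = confl_facts(1-3)[OF c]
  obtain \<delta> where \<delta>: "conn j q \<delta>" using conn_ex[OF c] .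
  note T = conn_Tri[OF \<delta>]
  have "phantom L P (\<ominus>\<^bsub>L\<^esub> \<pi> \<delta>) \<longleftrightarrow> cophantom L P (src C j) (\<ominus>\<^bsub>L\<^esub> \<pi> \<delta>)"
    by (rule I.phantom_iff_cophantom[of _ "tgt C q"]) (use T.tri_arrs[OF T] in auto)
  then show ?thesis using rel_confl_phantom[OF c T] cophantom_iff_extends[OF c T] by blast
qed

text \<open>
  The connecting map of a triangle \<open>X \<rightarrow> Q \<rightarrow> A \<rightarrow> \<Sigma>X\<close> is realized by a conflation of \<open>C\<close>.  Its middle
  object is isomorphic to \<open>Q\<close> in the stable category, hence lies in \<open>P\<close>.
\<close>

lemma rel_enough_proj:
  assumes A: "A \<in> ob C"
  obtains j q where "(j, q) \<in> rel_confl" "tgt C q = A" "tgt C j \<in> P"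
proof -
  have "A \<in> ob L" using A by simp
  from I.enough_proj[OF this] obtain f g h where
    T: "(f, g, h) \<in> Tri L" "tgt L g = A" "tgt L f \<in> P" "phantom L P h" by blast
  define X where "X = src L f"
  have [simp]: "f \<in> arr L" "g \<in> arr L" "h \<in> arr L" "src L f = X" "src L g = tgt L f" "tgt L g = A" "src L h = A"
    "tgt L h = susO L X" using T.tri_arrs[OF T(1)] T(2) by (auto simp: X_def)
  have X: "X \<in> ob C" using Q.D.src_in_ob[of f] by simp
  have "h \<in> Hom L A (susO L X)" by simp
  then obtain j q where j: "(j, q) \<in> Confl C" "src C j = X" "tgt C q = A" "(\<pi> j, \<pi> q, h) \<in> Tri L"
    using realize_third_arrow[OF _ X] by blast
  note [simp] = confl_facts(1-3)[OF j(1)]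
  have ids: "iso_arr L X X (ident L X)" "iso_arr L A A (ident L A)" using X A by (simp_all add: Q.D.iso_ident)
  obtain v where v: "v \<in> Hom L (tgt L f) (tgt L (\<pi> j))" "v \<cdot>\<^bsub>L\<^esub> f = \<pi> j \<cdot>\<^bsub>L\<^esub> ident L X" "ident L A \<cdot>\<^bsub>L\<^esub> g = \<pi> q \<cdot>\<^bsub>L\<^esub> v"
    by (rule T.complete_middle[OF T(1) j(4), of "ident L X" "ident L A"]) (use X A j in auto)
  have "iso_arr L (tgt L f) (tgt L (\<pi> j)) v"
    by (rule T.five_middle[OF T(1) j(4) v]) (use ids j in auto)
  then have "tgt C j \<in> P" using I.P_iso[OF T(3)] by simp
  then show ?thesis using that j rel_confl_phantom[OF j(1,4)] T(4) by blast
qed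

lemma rel_enough_inj:
  assumes A: "A \<in> ob C"
  obtains j q where "(j, q) \<in> rel_confl" "src C j = A" "tgt C j \<in> P"
proof -
  have "A \<in> ob L" using A by simp
  from I.enough_inj[OF this] obtain f g h where
    T: "(f, g, h) \<in> Tri L" "src L f = A" "tgt L f \<in> P" "phantom L P h" by blast
  define Z where "Z = tgt L g"
  have [simp]: "f \<in> arr L" "g \<in> arr L" "h \<in> arr L" "src L f = A" "src L g = tgt L f" "tgt L g = Z" "src L h = Z"
    "tgt L h = susO L A" using T.tri_arrs[OF T(1)] T(2) by (auto simp: Z_def)
  have Z: "Z \<in> ob C" using Q.D.tgt_in_ob[of g] by simp
  have "h \<in> Hom L Z (susO L A)" by simp
  then obtain j q where j: "(j, q) \<in> Confl C" "src C j = A" "tgt C q = Z" "(\<pi> j, \<pi> q, h) \<in> Tri L"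
    using realize_third_arrow[OF _ A] by blast
  note [simp] = confl_facts(1-3)[OF j(1)]
  have ids: "iso_arr L Z Z (ident L Z)" "iso_arr L A A (ident L A)" using Z A by (simp_all add: Q.D.iso_ident)
  obtain v where v: "v \<in> Hom L (tgt L f) (tgt L (\<pi> j))" "v \<cdot>\<^bsub>L\<^esub> f = \<pi> j \<cdot>\<^bsub>L\<^esub> ident L A" "ident L Z \<cdot>\<^bsub>L\<^esub> g = \<pi> q \<cdot>\<^bsub>L\<^esub> v"
    by (rule T.complete_middle[OF T(1) j(4), of "ident L A" "ident L Z"]) (use Z A j in auto)
  have "iso_arr L (tgt L f) (tgt L (\<pi> j)) v"
    by (rule T.five_middle[OF T(1) j(4) v]) (use ids j in auto)
  then have "tgt C j \<in> P" using I.P_iso[OF T(3)] by simp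
  then show ?thesis using that j rel_confl_phantom[OF j(1,4)] T(4) by blast
qed

subsection \<open>The axioms of a Frobenius category\<close>

lemma Hom_E: "Hom E = Hom C"
  by (simp add: fun_eq_iff Hom_def)

lemma E_simps: "iso_arr E = iso_arr C" "hom_group E = hom_group C" "zero_object E = zero_object C"
  "biproduct E = biproduct C" "is_pushout E = is_pushout C" "is_pullback E = is_pullback C"
  "kernel_cokernel_pair E = kernel_cokernel_pair C"
  unfolding fun_eq_iff iso_arr_def hom_group_def zero_object_def biproduct_def is_pushout_def is_pullback_def
    kernel_cokernel_pair_def Hom_E by simp_all

lemma E_inflation: "inflation E j \<longleftrightarrow> (\<exists>q. (j, q) \<in> rel_confl)"
  and E_deflation: "deflation E q \<longleftrightarrow> (\<exists>j. (j, q) \<in> rel_confl)"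
  by (simp_all add: inflation_def deflation_def)

lemma E_additive: "additive_category E"
proof (intro additive_category.intro category.intro additive_category_axioms.intro; (unfold Hom_E E_simps)?)
  show "\<exists>N. zero_object C N" by (rule ex_zero_object)
  show "\<exists>S i1 i2 p1 p2. biproduct C A B S i1 i2 p1 p2" if "A \<in> ob E" "B \<in> ob E" for A B
    using ex_biproduct that by simp
  show "comm_group (hom_group C X Y)" if "X \<in> ob E" "Y \<in> ob E" for X Y
    using hom_comm_group that by simp
qed (simp_all)

text \<open>
  Each axiom follows from that of \<open>C\<close>.  The additional property is checked as lifting for deflations and
  as extension, by \<open>rel_confl_iff_extends\<close>, for inflations.
\<close>

lemma E_exact: "exact_category E"
proof (intro exact_category.intro E_additive exact_category_axioms.intro; unfold Hom_E E_simps E_inflation E_deflation)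
  fix j q assume "(j, q) \<in> Confl E"
  then have "(j, q) \<in> Confl C" using rel_conflD by simp
  then show "\<exists>X Y Z. kernel_cokernel_pair C X Y Z j q" by (rule conflation_pair)
next
  fix j q X Y Z j' X' Y' q' Z' u v w
  assume c: "(j, q) \<in> Confl E" and h: "j \<in> Hom C X Y" "q \<in> Hom C Y Z" "j' \<in> Hom C X' Y'" "q' \<in> Hom C Y' Z'"
    and iso: "iso_arr C X X' u" "iso_arr C Y Y' v" "iso_arr C Z Z' w" and sq: "v \<cdot>\<^bsub>E\<^esub> j = j' \<cdot>\<^bsub>E\<^esub> u" "w \<cdot>\<^bsub>E\<^esub> q = q' \<cdot>\<^bsub>E\<^esub> v"
  have c': "(j, q) \<in> rel_confl" using c by simp
  have sq': "v \<cdot> j = j' \<cdot> u" "w \<cdot> q = q' \<cdot> v" using sq by simp_all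
  have "(j', q') \<in> rel_confl"
  proof (rule rel_conflI)
    show "(j', q') \<in> Confl C" by (rule conflation_iso[OF rel_conflD(1)[OF c'] h iso sq'])
  next
    fix Q b assume Q: "Q \<in> P" "b \<in> Hom C Q (tgt C q')"
    obtain w' where w: "w \<in> Hom C Z Z'" "w' \<in> Hom C Z' Z" "w \<cdot> w' = ident C Z'" using iso(3) by (auto elim: iso_arrE)
    have v: "v \<in> Hom C Y Y'" using iso(2) by (auto elim: iso_arrE)
    have "w' \<cdot> b \<in> Hom C Q (tgt C q)" using Q w h by auto
    then obtain c where c: "c \<in> Hom C Q (tgt C j)" "q \<cdot> c = w' \<cdot> b" using rel_conflD(2)[OF c' Q(1)] by blast
    have "q' \<cdot> (v \<cdot> c) = w \<cdot> (q \<cdot> c)" using h v w c(1) by (simp add: reassoc[OF sq'(2)])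
    also have "\<dots> = b" unfolding c(2) using h w Q by (auto simp: reassoc[OF w(3)])
    finally show "\<exists>c \<in> Hom C Q (tgt C j'). q' \<cdot> c = b" using c(1) v h by (intro bexI[of _ "v \<cdot> c"]) auto
  qed
  then show "(j', q') \<in> Confl E" by simp
next
  fix X assume "X \<in> ob E" then have X: "X \<in> ob C" by simp
  obtain N where N: "zero_object C N" using ex_zero_object by blast
  have N': "N \<in> ob C" using N by (simp add: zero_object_def)
  have "(ident C X, zerom C X N) \<in> rel_confl"
  proof (rule rel_conflI[OF confl_ident_zero[OF N X]])
    fix Q b assume Q: "Q \<in> P" "b \<in> Hom C Q (tgt C (zerom C X N))"
    have "zerom C X N \<cdot> zerom C Q X = b"
      by (rule zero_object_unique[OF N]) (use Q N' X P_obC in auto)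
    then show "\<exists>c\<in>Hom C Q (tgt C (ident C X)). zerom C X N \<cdot> c = b"
      using X P_obC[OF Q(1)] by (intro bexI[of _ "zerom C Q X"]) auto
  qed
  then show "\<exists>q. (ident E X, q) \<in> rel_confl" by auto
  have "(zerom C N X, ident C X) \<in> rel_confl"
  proof (rule rel_conflI[OF confl_zero_ident[OF N X]])
    fix Q b assume Q: "Q \<in> P" "b \<in> Hom C Q (tgt C (ident C X))"
    then show "\<exists>c\<in>Hom C Q (tgt C (zerom C N X)). ident C X \<cdot> c = b"
      using X N' by (intro bexI[of _ b]) auto
  qed
  then show "\<exists>j. (j, ident E X) \<in> rel_confl" by auto
next
  fix j X Y k Z assume h: "j \<in> Hom C X Y" "k \<in> Hom C Y Z" and c: "\<exists>q. (j, q) \<in> rel_confl" "\<exists>q. (k, q) \<in> rel_confl"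
  obtain q r where q: "(j, q) \<in> rel_confl" and r: "(k, r) \<in> rel_confl" using c by blast
  note q' = rel_conflD(1)[OF q] and r' = rel_conflD(1)[OF r]
  have "inflation C (k \<cdot> j)" using inflation_cmp[OF h inflationI[OF q'] inflationI[OF r']] .
  then obtain s where s: "(k \<cdot> j, s) \<in> Confl C" by (auto simp: inflation_def)
  have "(k \<cdot> j, s) \<in> rel_confl"
    unfolding rel_confl_iff_extends[OF s]
  proof (intro ballI)
    fix Q b assume Q: "Q \<in> P" "b \<in> Hom C (src C (k \<cdot> j)) Q"
    have "b \<in> Hom C (src C j) Q" using Q h by auto
    then obtain d where d: "d \<in> Hom C (tgt C j) Q" "d \<cdot> j = b"
      using q[unfolded rel_confl_iff_extends[OF q']] Q(1) by blast
    have "d \<in> Hom C (src C k) Q" using d h by auto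
    then obtain e where e: "e \<in> Hom C (tgt C k) Q" "e \<cdot> k = d"
      using r[unfolded rel_confl_iff_extends[OF r']] Q(1) by blast
    show "\<exists>c \<in> Hom C (tgt C (k \<cdot> j)) Q. c \<cdot> (k \<cdot> j) = b"
      by (rule bexI[of _ e]) (use e d h in \<open>auto simp: reassoc[OF e(2)]\<close>)
  qed
  then show "\<exists>q. (k \<cdot>\<^bsub>E\<^esub> j, q) \<in> rel_confl" by auto
next
  fix q X Y r Z assume h: "q \<in> Hom C X Y" "r \<in> Hom C Y Z" and c: "\<exists>j. (j, q) \<in> rel_confl" "\<exists>j. (j, r) \<in> rel_confl"
  obtain j k where j: "(j, q) \<in> rel_confl" and k: "(k, r) \<in> rel_confl" using c by blast
  note j' = rel_conflD(1)[OF j] and k' = rel_conflD(1)[OF k]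
  have "deflation C (r \<cdot> q)" using deflation_cmp[OF h] j' k' unfolding deflation_def by blast
  then obtain s where s: "(s, r \<cdot> q) \<in> Confl C" by (auto simp: deflation_def)
  have t: "tgt C s = X" "tgt C j = X" "tgt C k = Y" using confl_facts[OF s] confl_facts[OF j'] confl_facts[OF k'] h by auto
  have "(s, r \<cdot> q) \<in> rel_confl"
  proof (rule rel_conflI[OF s])
    fix Q b assume Q: "Q \<in> P" "b \<in> Hom C Q (tgt C (r \<cdot> q))"
    have "b \<in> Hom C Q (tgt C r)" using Q h by auto
    then obtain d where d: "d \<in> Hom C Q Y" "r \<cdot> d = b" using rel_conflD(2)[OF k Q(1)] t by blast
    have "d \<in> Hom C Q (tgt C q)" using d h by auto
    then obtain e where e: "e \<in> Hom C Q (tgt C j)" "q \<cdot> e = d" using rel_conflD(2)[OF j Q(1)] by blast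
    show "\<exists>c\<in>Hom C Q (tgt C s). r \<cdot> q \<cdot> c = b"
      by (rule bexI[of _ e]) (use e d h t in auto)
  qed
  then show "\<exists>j. (j, r \<cdot>\<^bsub>E\<^esub> q) \<in> rel_confl" by auto
next
  fix j X Y f X' assume h: "j \<in> Hom C X Y" "\<exists>q. (j, q) \<in> rel_confl" "f \<in> Hom C X X'"
  obtain q where q: "(j, q) \<in> rel_confl" using h by blast
  note q' = rel_conflD(1)[OF q]
  obtain v j' where po: "is_pushout C j f v j'" "inflation C j'"
    using inflation_pushout[OF h(1) inflationI[OF q'] h(3)] by blast
  obtain q2 where q2: "(j', q2) \<in> Confl C" using po(2) by (auto simp: inflation_def)
  obtain Y' where 1: "v \<in> Hom C Y Y'" "j' \<in> Hom C X' Y'" "v \<cdot> j = j' \<cdot> f" and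
    ex: "\<And>T a b. \<lbrakk>a \<in> Hom C Y T; b \<in> Hom C X' T; a \<cdot> j = b \<cdot> f\<rbrakk> \<Longrightarrow> \<exists>t \<in> Hom C Y' T. t \<cdot> v = a \<and> t \<cdot> j' = b"
    using po(1) h(1,3) by (elim pushoutE) auto
  have "(j', q2) \<in> rel_confl"
    unfolding rel_confl_iff_extends[OF q2]
  proof (intro ballI)
    fix Q b assume Q: "Q \<in> P" "b \<in> Hom C (src C j') Q"
    have b: "b \<in> Hom C X' Q" using Q 1 by auto
    have "b \<cdot> f \<in> Hom C (src C j) Q" using b h by auto
    then obtain d where d: "d \<in> Hom C (tgt C j) Q" "d \<cdot> j = b \<cdot> f"
      using q[unfolded rel_confl_iff_extends[OF q']] Q(1) by blast
    have "d \<in> Hom C Y Q" using d(1) h by auto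
    then show "\<exists>c\<in>Hom C (tgt C j') Q. c \<cdot> j' = b" using ex[OF _ b d(2)] 1 by auto
  qed
  then show "\<exists>v j'. is_pushout C j f v j' \<and> (\<exists>q. (j', q) \<in> rel_confl)" using po(1) by blast
next
  fix q Y Z f Z' assume h: "q \<in> Hom C Y Z" "\<exists>j. (j, q) \<in> rel_confl" "f \<in> Hom C Z' Z"
  obtain j where j: "(j, q) \<in> rel_confl" using h by blast
  note j' = rel_conflD(1)[OF j]
  have tj: "tgt C j = Y" using confl_facts[OF j'] h by auto
  obtain v q' where pb: "is_pullback C v q' q f" "deflation C q'"
    using deflation_pullback[OF h(1) _ h(3)] j' unfolding deflation_def by blast
  obtain k where k: "(k, q') \<in> Confl C" using pb(2) by (auto simp: deflation_def)
  obtain W where W: "v \<in> Hom C W Y" "q' \<in> Hom C W Z'" and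
    ex: "\<And>T a b. \<lbrakk>T \<in> ob C; a \<in> Hom C T Y; b \<in> Hom C T Z'; q \<cdot> a = f \<cdot> b\<rbrakk> \<Longrightarrow> \<exists>t. t \<in> Hom C T W \<and> v \<cdot> t = a \<and> q' \<cdot> t = b"
  proof -
    obtain X1 Y1 X1' Y1' where *: "v \<in> Hom C X1 Y1" "q' \<in> Hom C X1 X1'" "q \<in> Hom C Y1 Y1'" "f \<in> Hom C X1' Y1'"
      "\<forall>T \<in> ob C. \<forall>a \<in> Hom C T Y1. \<forall>b \<in> Hom C T X1'. q \<cdot> a = f \<cdot> b \<longrightarrow>
        (\<exists>!t. t \<in> Hom C T X1 \<and> v \<cdot> t = a \<and> q' \<cdot> t = b)"
      using pb(1) unfolding is_pullback_def by blast
    have "Y1 = Y" "X1' = Z'" using * h by auto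
    then show thesis using * by (intro that[of X1]) blast+
  qed
  have tk: "tgt C k = W" using confl_facts[OF k] W by auto
  have "(k, q') \<in> rel_confl"
  proof (rule rel_conflI[OF k])
    fix Q b assume Q: "Q \<in> P" "b \<in> Hom C Q (tgt C q')"
    have b: "b \<in> Hom C Q Z'" using Q W by auto
    have "f \<cdot> b \<in> Hom C Q (tgt C q)" using b h by auto
    then obtain c where c: "c \<in> Hom C Q Y" "q \<cdot> c = f \<cdot> b" using rel_conflD(2)[OF j Q(1)] tj by blast
    show "\<exists>c\<in>Hom C Q (tgt C k). q' \<cdot> c = b" using ex[OF P_obC[OF Q(1)] c(1) b c(2)] tk by blast
  qed
  then show "\<exists>v q'. is_pullback C v q' q f \<and> (\<exists>j. (j, q') \<in> rel_confl)" using pb(1) by blast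
qed

lemma E_proj_lift:
  assumes "Q \<in> P" "(j, q) \<in> rel_confl" "b \<in> Hom C Q (tgt C q)"
  shows "\<exists>c \<in> Hom C Q (src C q). q \<cdot> c = b"
  using rel_conflD(2)[OF assms(2,1,3)] confl_facts(3)[OF rel_conflD(1)[OF assms(2)]] by simp

text \<open>
  A relative projective is a retract of the object of \<open>P\<close> that covers it, already in \<open>C\<close> and so in the stable
  category.
\<close>

lemma exact_proj_E: "exact_proj E = P"
proof
  show "P \<subseteq> exact_proj E"
    unfolding exact_proj_def E_deflation Hom_E using P_obC E_proj_lift by auto
  show "exact_proj E \<subseteq> P"
  proof
    fix A assume A: "A \<in> exact_proj E"
    then have Aob: "A \<in> ob C" by (simp add: exact_proj_def)
    obtain j q where j: "(j, q) \<in> rel_confl" "tgt C q = A" "tgt C j \<in> P" by (rule rel_enough_proj[OF Aob])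
    note f = confl_facts[OF rel_conflD(1)[OF j(1)]]
    have "ident C A \<in> Hom C A (tgt C q)" using Aob j by simp
    then obtain s where s: "s \<in> Hom C A (src C q)" "q \<cdot> s = ident C A"
      using A j(1) f unfolding exact_proj_def E_deflation Hom_E by fastforce
    have [unfolded Hom_iff, simp]: "q \<in> Hom C (tgt C j) A" "s \<in> Hom C A (tgt C j)" using s f j by auto
    show "A \<in> P"
      by (rule I.P_retract[OF j(3), of "\<pi> s" A "\<pi> q"]) (simp_all add: Q.quot_cmp Q.quot_ident s(2))
  qed
qed

lemma exact_inj_E: "exact_inj E = P"
proof
  show "P \<subseteq> exact_inj E"
    unfolding exact_inj_def E_inflation Hom_E using P_obC rel_confl_iff_extends rel_conflD(1) by fastforce
  show "exact_inj E \<subseteq> P"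
  proof
    fix A assume A: "A \<in> exact_inj E"
    then have Aob: "A \<in> ob C" by (simp add: exact_inj_def)
    obtain j q where j: "(j, q) \<in> rel_confl" "src C j = A" "tgt C j \<in> P" by (rule rel_enough_inj[OF Aob])
    note f = confl_facts[OF rel_conflD(1)[OF j(1)]]
    have "ident C A \<in> Hom C (src C j) A" using Aob j by simp
    then obtain s where s: "s \<in> Hom C (tgt C j) A" "s \<cdot> j = ident C A"
      using A j(1) f unfolding exact_inj_def E_inflation Hom_E by fastforce
    have [unfolded Hom_iff, simp]: "j \<in> arr C" "src C j = A" "s \<in> Hom C (tgt C j) A" using s f j by auto
    show "A \<in> P"
      by (rule I.P_retract[OF j(3), of "\<pi> j" A "\<pi> s"]) (simp_all add: Q.quot_cmp Q.quot_ident s(2))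
  qed
qed

theorem E_frobenius: "frobenius_category E"
proof (intro frobenius_category.intro E_exact frobenius_category_axioms.intro; unfold Hom_E exact_proj_E exact_inj_E E_inflation E_deflation)
  fix X assume "X \<in> ob E" then have X: "X \<in> ob C" by simp
  obtain j q where j: "(j, q) \<in> rel_confl" "tgt C q = X" "tgt C j \<in> P" by (rule rel_enough_proj[OF X])
  then show "\<exists>R q. R \<in> P \<and> q \<in> Hom C R X \<and> (\<exists>j. (j, q) \<in> rel_confl)"
    using confl_facts[OF rel_conflD(1)[OF j(1)]] by (intro exI[of _ "tgt C j"] exI[of _ q]) auto
  obtain j q where j: "(j, q) \<in> rel_confl" "src C j = X" "tgt C j \<in> P" by (rule rel_enough_inj[OF X])
  then show "\<exists>R j. R \<in> P \<and> j \<in> Hom C X R \<and> (\<exists>q. (j, q) \<in> rel_confl)"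
    using confl_facts[OF rel_conflD(1)[OF j(1)]] by (intro exI[of _ "tgt C j"] exI[of _ j]) auto
qed simp

lemma E_injective_conflations:
  obtains i' p' where "injective_conflations E i' p'"
proof -
  have "\<forall>X. \<exists>j q. X \<in> ob C \<longrightarrow> (j, q) \<in> rel_confl \<and> src C j = X \<and> tgt C j \<in> P"
    by (metis rel_enough_inj)
  then obtain i' p' where "\<And>X. X \<in> ob C \<Longrightarrow> (i' X, p' X) \<in> rel_confl \<and> src C (i' X) = X \<and> tgt C (i' X) \<in> P"
    by metis
  then have "injective_conflations E i' p'"
    unfolding injective_conflations_def exact_inj_E by simp
  then show ?thesis by (rule that)
qed

end

section \<open>Equivalences of triangulated categories\<close>

locale tri_equiv = K: pretriangulated K + L: pretriangulated L
  for K :: "('o, 'm, 'z) tricat_scheme" and L :: "('p, 'n, 'y) tricat_scheme" +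
  fixes FO FM \<phi>
  assumes tri_equivalence: "triangle_equivalence K L FO FM \<phi>"
begin

lemma F_additive_equivalence: "additive_equivalence K L FO FM"
  using tri_equivalence by (simp add: triangle_equivalence_def)

lemmas F_equivalence = additive_equivalenceD(1)[OF F_additive_equivalence]

sublocale F: additive_functor K L FO FM
  by (rule additive_equivalence_functor[OF F_additive_equivalence]) unfold_locales

lemma F_eqD:
  assumes "FM f = FM g" "f \<in> arr K" "g \<in> arr K" "src K f = src K g" "tgt K f = tgt K g"
  shows "f = g"
  by (rule equivalence_faithful[OF F_equivalence, of f "src K f" "tgt K f"]) (use assms in auto)

lemmas F_full = equivalence_full[OF F_equivalence]
lemmas F_ess_surj = equivalence_ess_surj[OF F_equivalence]

lemma phi_iso: "X \<in> ob K \<Longrightarrow> iso_arr L (FO (susO K X)) (susO L (FO X)) (\<phi> X)"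
  using tri_equivalence natural_isoD(1) unfolding triangle_equivalence_def by fastforce

lemma phi_arr [simp]:
  assumes "X \<in> ob K"
  shows "\<phi> X \<in> arr L" "src L (\<phi> X) = FO (susO K X)" "tgt L (\<phi> X) = susO L (FO X)"
  using phi_iso[OF assms] by (auto elim: L.iso_arrE)

lemma phi_natural:
  assumes "f \<in> arr K"
  shows "\<phi> (tgt K f) \<cdot>\<^bsub>L\<^esub> FM (susM K f) = susM L (FM f) \<cdot>\<^bsub>L\<^esub> \<phi> (src K f)"
proof -
  have "natural_iso K L (FO \<circ> susO K) (FM \<circ> susM K) (susO L \<circ> FO) (susM L \<circ> FM) \<phi>"
    using tri_equivalence unfolding triangle_equivalence_def by blast
  from natural_isoD(2)[OF this, of "src K f" "tgt K f" f] assms show ?thesis by simp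
qed

lemma F_Tri: "(f, g, h) \<in> Tri K \<Longrightarrow> (FM f, FM g, \<phi> (src K f) \<cdot>\<^bsub>L\<^esub> FM h) \<in> Tri L"
  using tri_equivalence unfolding triangle_equivalence_def by blast

text \<open>Closed under isomorphism, since the class has to be closed under retracts.\<close>

definition image_class :: "'o set \<Rightarrow> 'p set" where
  "image_class P = {A \<in> ob L. \<exists>Q \<in> P. \<exists>e. iso_arr L (FO Q) A e}"

lemma image_classI: "\<lbrakk>Q \<in> P; P \<subseteq> ob K\<rbrakk> \<Longrightarrow> FO Q \<in> image_class P"
  unfolding image_class_def using L.iso_ident[of "FO Q"] F.functor_obj[of Q] by blast

lemma phantom_image:
  assumes P: "P \<subseteq> ob K" and h: "h \<in> Hom K Z (susO K X)" "X \<in> ob K" "phantom K P h"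
  shows "phantom L (image_class P) (\<phi> X \<cdot>\<^bsub>L\<^esub> FM h)"
  unfolding phantom_def
proof (intro ballI)
  have [unfolded Hom_iff, simp]: "h \<in> Hom K Z (susO K X)" using h by auto
  have Z: "Z \<in> ob K" using K.src_in_ob[of h] by simp
  fix B b assume B: "B \<in> image_class P" "b \<in> Hom L B (src L (\<phi> X \<cdot>\<^bsub>L\<^esub> FM h))"
  then have b: "b \<in> Hom L B (FO Z)" using h(2) by simp
  obtain Q e where Q: "Q \<in> P" "iso_arr L (FO Q) B e" using B(1) by (auto simp: image_class_def)
  have Qob: "Q \<in> ob K" using Q P by blast
  have e: "e \<in> Hom L (FO Q) B" using Q(2) by (auto elim: L.iso_arrE)
  have Bob: "B \<in> ob L" using L.Hom_ob[OF b] by simp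
  have be: "b \<cdot>\<^bsub>L\<^esub> e \<in> Hom L (FO Q) (FO Z)" using b e by auto
  obtain c where c: "c \<in> Hom K Q Z" "FM c = b \<cdot>\<^bsub>L\<^esub> e" using F_full[OF Qob Z be] .
  have "h \<cdot>\<^bsub>K\<^esub> c = zerom K Q (susO K X)" using h(3) Q(1) c(1) unfolding phantom_def by fastforce
  then have "FM h \<cdot>\<^bsub>L\<^esub> FM c = zerom L (FO Q) (FO (susO K X))"
    using c(1) h(2) Qob by (simp flip: F.functor_comp)
  then have hc: "FM h \<cdot>\<^bsub>L\<^esub> (b \<cdot>\<^bsub>L\<^esub> e) = zerom L (FO Q) (FO (susO K X))" using c(2) by simp
  show "\<phi> X \<cdot>\<^bsub>L\<^esub> FM h \<cdot>\<^bsub>L\<^esub> b = zerom L B (tgt L (\<phi> X \<cdot>\<^bsub>L\<^esub> FM h))"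
    by (rule L.iso_cancel_right[OF Q(2), of _ "susO L (FO X)"]) (use b e h(2) Bob hc Qob in auto)
qed

lemma cophantom_image:
  assumes P: "P \<subseteq> ob K" and h: "h \<in> Hom K Z (susO K X)" "X \<in> ob K" "cophantom K P X h"
  shows "cophantom L (image_class P) (FO X) (\<phi> X \<cdot>\<^bsub>L\<^esub> FM h)"
  unfolding cophantom_def
proof (intro ballI)
  have [unfolded Hom_iff, simp]: "h \<in> Hom K Z (susO K X)" using h by auto
  have Z: "Z \<in> ob K" using K.src_in_ob[of h] by simp
  fix B b assume B: "B \<in> image_class P" "b \<in> Hom L (FO X) B"
  obtain Q e where Q: "Q \<in> P" "iso_arr L (FO Q) B e" using B(1) by (auto simp: image_class_def)
  obtain e' where e': "e' \<in> Hom L B (FO Q)" "iso_arr L B (FO Q) e'" using Q(2) by (auto elim: L.iso_arrE)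
  have Qob: "Q \<in> ob K" using Q P by blast
  have Bob: "B \<in> ob L" using L.Hom_ob[OF B(2)] by simp
  have eb: "e' \<cdot>\<^bsub>L\<^esub> b \<in> Hom L (FO X) (FO Q)" using B e' by auto
  obtain c where c: "c \<in> Hom K X Q" "FM c = e' \<cdot>\<^bsub>L\<^esub> b" using F_full[OF h(2) Qob eb] .
  have [unfolded Hom_iff, simp]: "c \<in> Hom K X Q" "b \<in> Hom L (FO X) B" "e' \<in> Hom L B (FO Q)" using c B e' by auto
  have ch: "susM K c \<cdot>\<^bsub>K\<^esub> h = zerom K Z (susO K Q)" using h(3) Q(1) c(1) unfolding cophantom_def by fastforce
  have nat: "susM L (FM c) \<cdot>\<^bsub>L\<^esub> \<phi> X = \<phi> Q \<cdot>\<^bsub>L\<^esub> FM (susM K c)" using phi_natural[of c] by simp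
  have "susM L e' \<cdot>\<^bsub>L\<^esub> (susM L b \<cdot>\<^bsub>L\<^esub> (\<phi> X \<cdot>\<^bsub>L\<^esub> FM h)) = susM L (FM c) \<cdot>\<^bsub>L\<^esub> (\<phi> X \<cdot>\<^bsub>L\<^esub> FM h)"
    unfolding c(2) using h(2) by simp
  also have "\<dots> = \<phi> Q \<cdot>\<^bsub>L\<^esub> FM (susM K c \<cdot>\<^bsub>K\<^esub> h)" using h(2) Qob by (simp add: L.reassoc[OF nat])
  also have "\<dots> = zerom L (FO Z) (susO L (FO Q))" unfolding ch using Qob Z by simp
  finally have *: "susM L e' \<cdot>\<^bsub>L\<^esub> (susM L b \<cdot>\<^bsub>L\<^esub> (\<phi> X \<cdot>\<^bsub>L\<^esub> FM h)) = susM L e' \<cdot>\<^bsub>L\<^esub> zerom L (FO Z) (susO L B)"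
    using Z Bob by simp
  show "susM L b \<cdot>\<^bsub>L\<^esub> (\<phi> X \<cdot>\<^bsub>L\<^esub> FM h) = zerom L (src L (\<phi> X \<cdot>\<^bsub>L\<^esub> FM h)) (susO L B)"
    by (rule L.iso_cancel_left[OF L.Sus.functor_iso[OF e'(2)], of _ "FO Z"]) (use * h(2) Z Bob in auto)
qed

text \<open>
  An object isomorphic to \<open>F Y\<close> is a retract of \<open>F Q\<close> only if \<open>Y\<close> is a retract of \<open>Q\<close>, since \<open>F\<close> is fully
  faithful.
\<close>

lemma image_class_retract:
  assumes I: "\<And>Q R s r. \<lbrakk>Q \<in> P; s \<in> Hom K R Q; r \<in> Hom K Q R; r \<cdot>\<^bsub>K\<^esub> s = ident K R\<rbrakk> \<Longrightarrow> R \<in> P" and P: "P \<subseteq> ob K"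
    and A: "A \<in> image_class P" "s \<in> Hom L R A" "r \<in> Hom L A R" "r \<cdot>\<^bsub>L\<^esub> s = ident L R"
  shows "R \<in> image_class P"
proof -
  obtain Q e where Q: "Q \<in> P" "iso_arr L (FO Q) A e" using A(1) by (auto simp: image_class_def)
  have Qob: "Q \<in> ob K" using Q P by blast
  obtain e' where e: "e \<in> Hom L (FO Q) A" "e' \<in> Hom L A (FO Q)" "e' \<cdot>\<^bsub>L\<^esub> e = ident L (FO Q)" "e \<cdot>\<^bsub>L\<^esub> e' = ident L A"
    using Q(2) by (auto elim: L.iso_arrE)
  have R: "R \<in> ob L" using L.Hom_ob[OF A(2)] by simp
  obtain Y y where Y: "Y \<in> ob K" "iso_arr L (FO Y) R y" using F_ess_surj[OF R] .
  obtain y' where y: "y \<in> Hom L (FO Y) R" "y' \<in> Hom L R (FO Y)" "y' \<cdot>\<^bsub>L\<^esub> y = ident L (FO Y)" "y \<cdot>\<^bsub>L\<^esub> y' = ident L R"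
    using Y(2) by (auto elim: L.iso_arrE)
  have [unfolded Hom_iff, simp]: "e \<in> Hom L (FO Q) A" "e' \<in> Hom L A (FO Q)" "y \<in> Hom L (FO Y) R" "y' \<in> Hom L R (FO Y)"
    "s \<in> Hom L R A" "r \<in> Hom L A R" using e y A by auto
  have h1: "e' \<cdot>\<^bsub>L\<^esub> (s \<cdot>\<^bsub>L\<^esub> y) \<in> Hom L (FO Y) (FO Q)" and h2: "y' \<cdot>\<^bsub>L\<^esub> (r \<cdot>\<^bsub>L\<^esub> e) \<in> Hom L (FO Q) (FO Y)" by simp_all
  obtain s' where s': "s' \<in> Hom K Y Q" "FM s' = e' \<cdot>\<^bsub>L\<^esub> (s \<cdot>\<^bsub>L\<^esub> y)" using F_full[OF Y(1) Qob h1] .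
  obtain r' where r': "r' \<in> Hom K Q Y" "FM r' = y' \<cdot>\<^bsub>L\<^esub> (r \<cdot>\<^bsub>L\<^esub> e)" using F_full[OF Qob Y(1) h2] .
  have "FM (r' \<cdot>\<^bsub>K\<^esub> s') = FM r' \<cdot>\<^bsub>L\<^esub> FM s'" using r' s' by simp
  also have "\<dots> = ident L (FO Y)"
    unfolding s'(2) r'(2) by (simp add: L.reassoc[OF e(4)] L.reassoc[OF A(4)] y(3))
  finally have "FM (r' \<cdot>\<^bsub>K\<^esub> s') = FM (ident K Y)" using Y by simp
  then have "r' \<cdot>\<^bsub>K\<^esub> s' = ident K Y" by (rule F_eqD) (use r' s' Y in auto)
  then have "Y \<in> P" using I[OF Q(1) s'(1) r'(1)] by simp
  then show ?thesis using Y(2) R by (auto simp: image_class_def)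
qed

text \<open>
  The required triangles for an object isomorphic to \<open>F X\<close> are the images of those for \<open>X\<close>, modified by
  the isomorphism.
\<close>

lemma frobenius_ideal_image:
  assumes "frobenius_ideal K P"
  shows "frobenius_ideal L (image_class P)"
proof unfold_locales
  interpret I: frobenius_ideal K P by fact
  have P: "P \<subseteq> ob K" by (rule I.P_ob)
  show "image_class P \<subseteq> ob L" by (auto simp: image_class_def)
  show "R \<in> image_class P" if "A \<in> image_class P" "s \<in> Hom L R A" "r \<in> Hom L A R" "r \<cdot>\<^bsub>L\<^esub> s = ident L R" for A R s r
    by (rule image_class_retract[OF I.P_retract P that])
  show "\<exists>f g h. (f, g, h) \<in> Tri L \<and> tgt L g = A \<and> tgt L f \<in> image_class P \<and>
      phantom L (image_class P) h \<and> cophantom L (image_class P) (src L f) h" if A: "A \<in> ob L" for A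
  proof -
    obtain X a where X: "X \<in> ob K" "iso_arr L (FO X) A a" using F_ess_surj[OF A] .
    obtain a' where a: "a \<in> Hom L (FO X) A" "a' \<in> Hom L A (FO X)" "a' \<cdot>\<^bsub>L\<^esub> a = ident L (FO X)" "iso_arr L A (FO X) a'"
      using X(2) by (auto elim: L.iso_arrE)
    obtain f g h where T: "(f, g, h) \<in> Tri K" "tgt K g = X" "tgt K f \<in> P" "phantom K P h" "cophantom K P (src K f) h"
      using I.enough_proj[OF X(1)] by blast
    define W where "W = src K f"
    have [simp]: "f \<in> arr K" "g \<in> arr K" "h \<in> arr K" "src K f = W" "src K g = tgt K f" "tgt K g = X" "src K h = X" "tgt K h = susO K W"
      using K.tri_arrs[OF T(1)] T(2) by (auto simp: W_def)
    have W [simp]: "W \<in> ob K" using K.src_in_ob[of f] by simp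
    have [unfolded Hom_iff, simp]: "a \<in> Hom L (FO X) A" "a' \<in> Hom L A (FO X)" using a by auto
    have T': "(FM f, FM g, \<phi> W \<cdot>\<^bsub>L\<^esub> FM h) \<in> Tri L" using F_Tri[OF T(1)] by simp
    have "(FM f, a \<cdot>\<^bsub>L\<^esub> FM g, \<phi> W \<cdot>\<^bsub>L\<^esub> FM h \<cdot>\<^bsub>L\<^esub> a') \<in> Tri L"
      by (rule L.tri_isoI[OF T', of _ "FO W" "FO (tgt K f)" _ A _ "ident L (FO W)" "ident L (FO (tgt K f))" a'])
        (use a in \<open>auto simp: L.reassoc[OF a(3)] intro: L.iso_ident\<close>)
    moreover have "phantom L (image_class P) (\<phi> W \<cdot>\<^bsub>L\<^esub> FM h)" by (rule phantom_image[OF P _ W T(4)]) simp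
    then have "phantom L (image_class P) (\<phi> W \<cdot>\<^bsub>L\<^esub> FM h \<cdot>\<^bsub>L\<^esub> a')"
      unfolding phantom_def by auto
    moreover have c: "cophantom L (image_class P) (FO W) (\<phi> W \<cdot>\<^bsub>L\<^esub> FM h)" by (rule cophantom_image[OF P]) (use T(5) in auto)
    have "cophantom L (image_class P) (FO W) (\<phi> W \<cdot>\<^bsub>L\<^esub> FM h \<cdot>\<^bsub>L\<^esub> a')"
      unfolding cophantom_def
    proof (intro ballI)
      fix B b assume B: "B \<in> image_class P" "b \<in> Hom L (FO W) B"
      then have Bob: "B \<in> ob L" by (simp add: image_class_def)
      have "susM L b \<cdot>\<^bsub>L\<^esub> (\<phi> W \<cdot>\<^bsub>L\<^esub> FM h) = zerom L (FO X) (susO L B)"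
        using c B unfolding cophantom_def by fastforce
      from L.reassoc[OF this, of a'] show "susM L b \<cdot>\<^bsub>L\<^esub> (\<phi> W \<cdot>\<^bsub>L\<^esub> FM h \<cdot>\<^bsub>L\<^esub> a') =
          zerom L (src L (\<phi> W \<cdot>\<^bsub>L\<^esub> FM h \<cdot>\<^bsub>L\<^esub> a')) (susO L B)"
        using B Bob by auto
    qed
    moreover have "FO (tgt K f) \<in> image_class P" by (rule image_classI[OF T(3) P])
    ultimately show ?thesis
      by (intro exI[of _ "FM f"] exI[of _ "a \<cdot>\<^bsub>L\<^esub> FM g"] exI[of _ "\<phi> W \<cdot>\<^bsub>L\<^esub> FM h \<cdot>\<^bsub>L\<^esub> a'"]) auto
  qed
  show "\<exists>f g h. (f, g, h) \<in> Tri L \<and> src L f = A \<and> tgt L f \<in> image_class P \<and>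
      phantom L (image_class P) h \<and> cophantom L (image_class P) A h" if A: "A \<in> ob L" for A
  proof -
    obtain X a where X: "X \<in> ob K" "iso_arr L (FO X) A a" using F_ess_surj[OF A] .
    obtain a' where a: "a \<in> Hom L (FO X) A" "a' \<in> Hom L A (FO X)" "a' \<cdot>\<^bsub>L\<^esub> a = ident L (FO X)" "iso_arr L A (FO X) a'"
      using X(2) by (auto elim: L.iso_arrE)
    obtain f g h where T: "(f, g, h) \<in> Tri K" "src K f = X" "tgt K f \<in> P" "phantom K P h" "cophantom K P X h"
      using I.enough_inj[OF X(1)] by blast
    define W where "W = tgt K g"
    have [simp]: "f \<in> arr K" "g \<in> arr K" "h \<in> arr K" "src K f = X" "src K g = tgt K f" "tgt K g = W" "src K h = W" "tgt K h = susO K X"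
      using K.tri_arrs[OF T(1)] T(2) by (auto simp: W_def)
    have W [simp]: "W \<in> ob K" "X \<in> ob K" using K.tgt_in_ob[of g] X by simp_all
    have [unfolded Hom_iff, simp]: "a \<in> Hom L (FO X) A" "a' \<in> Hom L A (FO X)" using a by auto
    have T': "(FM f, FM g, \<phi> X \<cdot>\<^bsub>L\<^esub> FM h) \<in> Tri L" using F_Tri[OF T(1)] by simp
    have sa: "susM L a' \<cdot>\<^bsub>L\<^esub> susM L a = ident L (susO L (FO X))" using a(3) by (simp flip: L.Sus.functor_comp)
    have "(FM f \<cdot>\<^bsub>L\<^esub> a', FM g, susM L a \<cdot>\<^bsub>L\<^esub> (\<phi> X \<cdot>\<^bsub>L\<^esub> FM h)) \<in> Tri L"
      by (rule L.tri_isoI[OF T', of _ A "FO (tgt K f)" _ "FO W" _ a' "ident L (FO (tgt K f))" "ident L (FO W)"])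
        (use a in \<open>auto simp: L.reassoc[OF sa] intro: L.iso_ident\<close>)
    moreover have p: "phantom L (image_class P) (\<phi> X \<cdot>\<^bsub>L\<^esub> FM h)" by (rule phantom_image[OF P _ _ T(4)]) simp_all
    have "phantom L (image_class P) (susM L a \<cdot>\<^bsub>L\<^esub> (\<phi> X \<cdot>\<^bsub>L\<^esub> FM h))"
      unfolding phantom_def
    proof (intro ballI)
      fix B b assume B: "B \<in> image_class P" "b \<in> Hom L B (src L (susM L a \<cdot>\<^bsub>L\<^esub> (\<phi> X \<cdot>\<^bsub>L\<^esub> FM h)))"
      then have Bob: "B \<in> ob L" by (simp add: image_class_def)
      have b: "b \<in> Hom L B (FO W)" using B by simp
      have "\<phi> X \<cdot>\<^bsub>L\<^esub> FM h \<cdot>\<^bsub>L\<^esub> b = zerom L B (susO L (FO X))"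
        using p B(1) b unfolding phantom_def by fastforce
      then show "susM L a \<cdot>\<^bsub>L\<^esub> (\<phi> X \<cdot>\<^bsub>L\<^esub> FM h) \<cdot>\<^bsub>L\<^esub> b = zerom L B (tgt L (susM L a \<cdot>\<^bsub>L\<^esub> (\<phi> X \<cdot>\<^bsub>L\<^esub> FM h)))"
        using b Bob by simp
    qed
    moreover have c: "cophantom L (image_class P) (FO X) (\<phi> X \<cdot>\<^bsub>L\<^esub> FM h)" by (rule cophantom_image[OF P]) (use T(5) in auto)
    have "cophantom L (image_class P) A (susM L a \<cdot>\<^bsub>L\<^esub> (\<phi> X \<cdot>\<^bsub>L\<^esub> FM h))"
      unfolding cophantom_def
    proof (intro ballI)
      fix B b assume B: "B \<in> image_class P" "b \<in> Hom L A B"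
      have "b \<cdot>\<^bsub>L\<^esub> a \<in> Hom L (FO X) B" using B by auto
      then have "susM L (b \<cdot>\<^bsub>L\<^esub> a) \<cdot>\<^bsub>L\<^esub> (\<phi> X \<cdot>\<^bsub>L\<^esub> FM h) = zerom L (FO W) (susO L B)"
        using c B(1) unfolding cophantom_def by fastforce
      then show "susM L b \<cdot>\<^bsub>L\<^esub> (susM L a \<cdot>\<^bsub>L\<^esub> (\<phi> X \<cdot>\<^bsub>L\<^esub> FM h)) = zerom L (src L (susM L a \<cdot>\<^bsub>L\<^esub> (\<phi> X \<cdot>\<^bsub>L\<^esub> FM h))) (susO L B)"
        using B by auto
    qed
    moreover have "FO (tgt K f) \<in> image_class P" by (rule image_classI[OF T(3) P])
    ultimately show ?thesis
      by (intro exI[of _ "FM f \<cdot>\<^bsub>L\<^esub> a'"] exI[of _ "FM g"] exI[of _ "susM L a \<cdot>\<^bsub>L\<^esub> (\<phi> X \<cdot>\<^bsub>L\<^esub> FM h)"]) auto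
  qed
qed

end

section \<open>Frobenius classes\<close>

context proper_class
begin

text \<open>Triangles with the same first map are isomorphic.\<close>

lemma E_of_mono:
  assumes T: "(f, g, h) \<in> Tri K" and f: "E_mono E f"
  shows "(f, g, h) \<in> E"
proof -
  obtain g' h' where E: "(f, g', h') \<in> E" using f by (auto simp: E_mono_def)
  then have T': "(f, g', h') \<in> Tri K" using E_Tri by blast
  note [simp] = tri_arrs[OF T] tri_arrs[OF T']
  obtain w where w: "iso_arr K (tgt K g') (tgt K g) w" "w \<cdot> g' = g \<cdot> ident K (tgt K f)"
    "susM K (ident K (src K f)) \<cdot> h' = h \<cdot> w"
    by (rule tri_iso_of_isos[OF T' T, of "ident K (src K f)" "ident K (tgt K f)"]) (auto intro: iso_ident)
  have "w \<in> Hom K (tgt K g') (tgt K g)" using w(1) by (auto elim: iso_arrE)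
  then have "tri_iso K (f, g', h') (f, g, h)"
    unfolding tri_iso_iff
    by - (rule exI[of _ "ident K (src K f)"], rule exI[of _ "ident K (tgt K f)"], rule exI[of _ w],
      use w iso_ident in auto)
  then show ?thesis using E_iso[OF E] by blast
qed

lemma E_phantom:
  assumes T: "(f, g, h) \<in> E" shows "phantom K (E_proj K E) h"
proof -
  have T': "(f, g, h) \<in> Tri K" using T E_Tri by blast
  note t = tri_arrs[OF T']
  have on: "triangle_on K (src K f) (tgt K f) (tgt K g) (f, g, h)" using t by (simp add: triangle_on_def)
  show ?thesis unfolding phantom_iff_lift[OF T']
  proof (intro ballI)
    fix Q b assume Q: "Q \<in> E_proj K E" "b \<in> Hom K Q (tgt K g)"
    then have "(\<lambda>b. g \<cdot> b) ` Hom K Q (tgt K f) = Hom K Q (tgt K g)"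
      using T on unfolding E_proj_def by blast
    then show "\<exists>c\<in>Hom K Q (tgt K f). g \<cdot> c = b" using Q(2) by (metis imageE)
  qed
qed

lemma E_cophantom:
  assumes T: "(f, g, h) \<in> E" shows "cophantom K (E_inj K E) (src K f) h"
proof -
  have T': "(f, g, h) \<in> Tri K" using T E_Tri by blast
  note t = tri_arrs[OF T']
  have on: "triangle_on K (src K f) (tgt K f) (tgt K g) (f, g, h)" using t by (simp add: triangle_on_def)
  show ?thesis unfolding cophantom_iff_extend[OF T']
  proof (intro ballI)
    fix Q b assume Q: "Q \<in> E_inj K E" "b \<in> Hom K (src K f) Q"
    then have "(\<lambda>b. b \<cdot> f) ` Hom K (tgt K f) Q = Hom K (src K f) Q"
      using T on unfolding E_inj_def by blast
    then show "\<exists>c\<in>Hom K (tgt K f) Q. c \<cdot> f = b" using Q(2) by (metis imageE)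
  qed
qed

lemma E_proj_retract:
  assumes Q: "Q \<in> E_proj K E" and s: "s \<in> Hom K R Q" "r \<in> Hom K Q R" "r \<cdot> s = ident K R"
  shows "R \<in> E_proj K E"
proof -
  have [unfolded Hom_iff, simp]: "s \<in> Hom K R Q" "r \<in> Hom K Q R" using s by auto
  have R [simp]: "R \<in> ob K" "Q \<in> ob K" using Hom_ob[OF s(1)] by auto
  have rs: "x \<cdot> r \<cdot> s = x" if "x \<in> Hom K R Y" for x Y using that s(3) by auto
  show ?thesis
    unfolding E_proj_def
  proof (intro CollectI conjI allI impI)
    fix X Y Z f g h assume *: "(f, g, h) \<in> E \<and> triangle_on K X Y Z (f, g, h)"
    have T': "(f, g, h) \<in> Tri K" using * E_Tri by blast
    have [unfolded Hom_iff, simp]: "f \<in> Hom K X Y" "g \<in> Hom K Y Z"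
      using * by (auto simp: triangle_on_def)
    have ob [simp]: "X \<in> ob K" "Y \<in> ob K" "Z \<in> ob K" using src_in_ob[of f] src_in_ob[of g] tgt_in_ob[of g] by simp_all
    have q: "inj_on (\<lambda>a. f \<cdot> a) (Hom K Q X)"
      "(\<lambda>a. f \<cdot> a) ` Hom K Q X = {b \<in> Hom K Q Y. g \<cdot> b = zerom K Q Z}"
      "(\<lambda>b. g \<cdot> b) ` Hom K Q Y = Hom K Q Z"
      using Q * unfolding E_proj_def by blast+
    show "inj_on (\<lambda>a. f \<cdot> a) (Hom K R X)"
    proof (rule inj_onI)
      fix a b assume ab: "a \<in> Hom K R X" "b \<in> Hom K R X" "f \<cdot> a = f \<cdot> b"
      have "f \<cdot> a \<cdot> r = f \<cdot> b \<cdot> r" using ab by simp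
      then have "f \<cdot> (a \<cdot> r) = f \<cdot> (b \<cdot> r)" using ab(1,2) by auto
      moreover have "a \<cdot> r \<in> Hom K Q X" "b \<cdot> r \<in> Hom K Q X" using ab by auto
      ultimately have "a \<cdot> r = b \<cdot> r" using q(1) by (meson inj_onD)
      then have "a \<cdot> r \<cdot> s = b \<cdot> r \<cdot> s" by (simp only:)
      then show "a = b" unfolding rs[OF ab(1)] rs[OF ab(2)] .
    qed
    show "(\<lambda>a. f \<cdot> a) ` Hom K R X = {b \<in> Hom K R Y. g \<cdot> b = zerom K R Z}"
    proof (intro equalityI subsetI)
      fix b assume "b \<in> (\<lambda>a. f \<cdot> a) ` Hom K R X"
      then obtain a where a: "a \<in> Hom K R X" "b = f \<cdot> a" by blast
      have gf: "g \<cdot> f = zerom K X Z" using tri_gf_zero[OF T'] by simp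
      show "b \<in> {b \<in> Hom K R Y. g \<cdot> b = zerom K R Z}" using a by (auto simp: reassoc[OF gf])
    next
      fix b assume "b \<in> {b \<in> Hom K R Y. g \<cdot> b = zerom K R Z}"
      then have b: "b \<in> Hom K R Y" "g \<cdot> b = zerom K R Z" by auto
      have "b \<cdot> r \<in> Hom K Q Y" "g \<cdot> (b \<cdot> r) = zerom K Q Z" using b by (auto simp: reassoc[OF b(2)])
      then have "b \<cdot> r \<in> (\<lambda>a. f \<cdot> a) ` Hom K Q X" unfolding q(2) by (intro CollectI conjI)
      then obtain a where a: "a \<in> Hom K Q X" "f \<cdot> a = b \<cdot> r" by (metis imageE)
      have "f \<cdot> (a \<cdot> s) = f \<cdot> a \<cdot> s" using a(1) by (intro assoc[symmetric]) auto
      also have "\<dots> = b" unfolding a(2) by (rule rs[OF b(1)])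
      finally have "f \<cdot> (a \<cdot> s) = b" .
      then show "b \<in> (\<lambda>a. f \<cdot> a) ` Hom K R X" using a(1) by (intro image_eqI[of _ _ "a \<cdot> s"]) auto
    qed
    show "(\<lambda>b. g \<cdot> b) ` Hom K R Y = Hom K R Z"
    proof (intro equalityI subsetI)
      fix b assume "b \<in> (\<lambda>a. g \<cdot> a) ` Hom K R Y" then show "b \<in> Hom K R Z" by auto
    next
      fix b assume b: "b \<in> Hom K R Z"
      have "b \<cdot> r \<in> Hom K Q Z" using b by auto
      then obtain a where a: "a \<in> Hom K Q Y" "g \<cdot> a = b \<cdot> r" using q(3) by (metis imageE)
      have "g \<cdot> (a \<cdot> s) = g \<cdot> a \<cdot> s" using a(1) by (intro assoc[symmetric]) auto
      also have "\<dots> = b" unfolding a(2) by (rule rs[OF b])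
      finally have "g \<cdot> (a \<cdot> s) = b" .
      then show "b \<in> (\<lambda>b. g \<cdot> b) ` Hom K R Y" using a(1) by (intro image_eqI[of _ _ "a \<cdot> s"]) auto
    qed
  qed simp
qed

end

text \<open>
  The \<open>E\<close>-epimorphisms from projectives and the \<open>E\<close>-monomorphisms to injectives supply the required
  triangles, because the connecting maps of triangles in \<open>E\<close> are phantoms and cophantoms.
\<close>

lemma (in frobenius_class) frobenius_ideal: "frobenius_ideal K (E_proj K E)"
proof unfold_locales
  show "E_proj K E \<subseteq> ob K" by (auto simp: E_proj_def)
  show "R \<in> E_proj K E" if "Q \<in> E_proj K E" "s \<in> Hom K R Q" "r \<in> Hom K Q R" "r \<cdot> s = ident K R" for Q R s r
    using that by (rule E_proj_retract)
  have *: "phantom K (E_proj K E) h \<and> cophantom K (E_proj K E) (src K f) h" if "(f, g, h) \<in> E" for f g h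
    using E_phantom[OF that] E_cophantom[OF that] E_proj_eq_inj by simp
  show "\<exists>f g h. (f, g, h) \<in> Tri K \<and> tgt K g = A \<and> tgt K f \<in> E_proj K E \<and>
      phantom K (E_proj K E) h \<and> cophantom K (E_proj K E) (src K f) h" if A: "A \<in> ob K" for A
  proof -
    obtain Q e where Q: "Q \<in> E_proj K E" "e \<in> Hom K Q A" "E_epi E e" using E_enough_projectives[OF A] by blast
    then obtain f h where E: "(f, e, h) \<in> E" by (auto simp: E_epi_def)
    then have "(f, e, h) \<in> Tri K" using E_Tri by blast
    then show ?thesis using *[OF E] Q tri_arrs[OF \<open>(f, e, h) \<in> Tri K\<close>]
      by (intro exI[of _ f] exI[of _ e] exI[of _ h]) auto
  qed
  show "\<exists>f g h. (f, g, h) \<in> Tri K \<and> src K f = A \<and> tgt K f \<in> E_proj K E \<and>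
      phantom K (E_proj K E) h \<and> cophantom K (E_proj K E) A h" if A: "A \<in> ob K" for A
  proof -
    obtain Q e where Q: "Q \<in> E_inj K E" "e \<in> Hom K A Q" "E_mono E e" using E_enough_injectives[OF A] by blast
    then obtain g h where E: "(e, g, h) \<in> E" by (auto simp: E_mono_def)
    then have "(e, g, h) \<in> Tri K" using E_Tri by blast
    then show ?thesis using *[OF E] Q E_proj_eq_inj tri_arrs[OF \<open>(e, g, h) \<in> Tri K\<close>]
      by (intro exI[of _ e] exI[of _ g] exI[of _ h]) auto
  qed
qed

section \<open>Transport of a triangulation\<close>

text \<open>
  If the triangles of \<open>K\<close> are exactly those that an additive equivalence takes to triangles of \<open>L\<close>, then
  \<open>K\<close> inherits the axioms.
\<close>

locale tri_transfer = K: additive_category K + L: triangulated_category L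
  for K :: "('o, 'm, 'z) tricat_scheme" and L :: "('p, 'n, 'y) tricat_scheme" +
  fixes FO FM \<phi>
  assumes F_equiv: "additive_equivalence K L FO FM"
    and susO_ob: "X \<in> ob K \<Longrightarrow> susO K X \<in> ob K"
    and susM_hom: "f \<in> Hom K X Y \<Longrightarrow> susM K f \<in> Hom K (susO K X) (susO K Y)"
    and phi_iso: "X \<in> ob K \<Longrightarrow> iso_arr L (FO (susO K X)) (susO L (FO X)) (\<phi> X)"
    and phi_nat: "f \<in> Hom K X Y \<Longrightarrow> \<phi> Y \<cdot>\<^bsub>L\<^esub> FM (susM K f) = susM L (FM f) \<cdot>\<^bsub>L\<^esub> \<phi> X"
    and Tri_iff: "(f, g, h) \<in> Tri K \<longleftrightarrow> f \<in> arr K \<and> g \<in> arr K \<and> h \<in> arr K \<and> src K g = tgt K f \<and>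
       src K h = tgt K g \<and> tgt K h = susO K (src K f) \<and> (FM f, FM g, \<phi> (src K f) \<cdot>\<^bsub>L\<^esub> FM h) \<in> Tri L"
begin

lemmas F_equivalence = additive_equivalenceD(1)[OF F_equiv]

sublocale F: additive_functor K L FO FM
  by (rule additive_equivalence_functor[OF F_equiv]) unfold_locales

lemma F_eqD:
  assumes "FM f = FM g" "f \<in> arr K" "g \<in> arr K" "src K f = src K g" "tgt K f = tgt K g"
  shows "f = g"
  by (rule equivalence_faithful[OF F_equivalence, of f "src K f" "tgt K f"]) (use assms in auto)

lemmas F_full = equivalence_full[OF F_equivalence]
lemmas F_ess_surj = equivalence_ess_surj[OF F_equivalence]

lemma phi_arr [simp]:
  assumes "X \<in> ob K"
  shows "\<phi> X \<in> arr L" "src L (\<phi> X) = FO (susO K X)" "tgt L (\<phi> X) = susO L (FO X)"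
  using phi_iso[OF assms] by (auto elim: L.iso_arrE)

lemma sus_arr [simp]:
  assumes "f \<in> arr K"
  shows "susM K f \<in> arr K" "src K (susM K f) = susO K (src K f)" "tgt K (susM K f) = susO K (tgt K f)"
  using susM_hom[of f "src K f" "tgt K f"] assms by auto

lemma phi_natural:
  "f \<in> arr K \<Longrightarrow> \<phi> (tgt K f) \<cdot>\<^bsub>L\<^esub> FM (susM K f) = susM L (FM f) \<cdot>\<^bsub>L\<^esub> \<phi> (src K f)"
  using phi_nat[of f "src K f" "tgt K f"] by simp

text \<open>
  Maps between suspensions may be compared in \<open>L\<close> after composition with \<open>\<phi>\<close>, where functoriality of the
  suspension of \<open>L\<close> and naturality of \<open>\<phi>\<close> are available.
\<close>

lemma sus_eqI:
  assumes "s \<in> Hom K (susO K X) (susO K Y)" "t \<in> Hom K (susO K X) (susO K Y)" "Y \<in> ob K"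
    "\<phi> Y \<cdot>\<^bsub>L\<^esub> FM s = \<phi> Y \<cdot>\<^bsub>L\<^esub> FM t"
  shows "s = t"
proof -
  have "FM s = FM t" by (rule L.iso_cancel_left[OF phi_iso[OF assms(3)] _ _ assms(4)]) (use assms in auto)
  then show ?thesis by (rule F_eqD) (use assms in auto)
qed

lemma sus_ident: "X \<in> ob K \<Longrightarrow> susM K (ident K X) = ident K (susO K X)"
  by (rule sus_eqI[of _ X X]) (use phi_natural[of "ident K X"] susO_ob in auto)

lemma sus_cmp:
  assumes "f \<in> arr K" "g \<in> arr K" "tgt K f = src K g"
  shows "susM K (g \<cdot>\<^bsub>K\<^esub> f) = susM K g \<cdot>\<^bsub>K\<^esub> susM K f"
proof (rule sus_eqI[of _ "src K f" "tgt K g"])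
  note f = phi_natural[OF assms(1)] and g = phi_natural[OF assms(2)]
  show "\<phi> (tgt K g) \<cdot>\<^bsub>L\<^esub> FM (susM K (g \<cdot>\<^bsub>K\<^esub> f)) = \<phi> (tgt K g) \<cdot>\<^bsub>L\<^esub> FM (susM K g \<cdot>\<^bsub>K\<^esub> susM K f)"
    using phi_natural[of "g \<cdot>\<^bsub>K\<^esub> f"] assms f by (simp add: L.reassoc[OF g])
qed (use assms in auto)

lemma sus_add:
  assumes "f \<in> arr K" "g \<in> arr K" "src K f = src K g" "tgt K f = tgt K g"
  shows "susM K (f \<oplus>\<^bsub>K\<^esub> g) = susM K f \<oplus>\<^bsub>K\<^esub> susM K g"
proof (rule sus_eqI[of _ "src K g" "tgt K g"])
  have "src K g \<in> ob K" "tgt K g \<in> ob K" using assms by auto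
  then show "\<phi> (tgt K g) \<cdot>\<^bsub>L\<^esub> FM (susM K (f \<oplus>\<^bsub>K\<^esub> g)) = \<phi> (tgt K g) \<cdot>\<^bsub>L\<^esub> FM (susM K f \<oplus>\<^bsub>K\<^esub> susM K g)"
    using phi_natural[of "f \<oplus>\<^bsub>K\<^esub> g"] phi_natural[of f] phi_natural[of g] assms by simp
qed (use assms in auto)

lemma sus_equivalence: "additive_equivalence K K (susO K) (susM K)"
proof -
  interpret S: cat_functor K K "susO K" "susM K"
    by unfold_locales (auto simp: susO_ob sus_ident sus_cmp)
  have "equivalence K K (susO K) (susM K)"
  proof (rule S.equivalenceI)
    fix X Y t assume X: "X \<in> ob K" "Y \<in> ob K" and t: "t \<in> Hom K (susO K X) (susO K Y)"
    obtain x' where x': "x' \<in> Hom L (susO L (FO X)) (FO (susO K X))" "x' \<cdot>\<^bsub>L\<^esub> \<phi> X = ident L (FO (susO K X))"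
      using phi_iso[OF X(1)] by (auto elim: L.iso_arrE)
    have [unfolded Hom_iff, simp]: "t \<in> Hom K (susO K X) (susO K Y)" "x' \<in> Hom L (susO L (FO X)) (FO (susO K X))"
      using t x' by auto
    have "\<phi> Y \<cdot>\<^bsub>L\<^esub> (FM t \<cdot>\<^bsub>L\<^esub> x') \<in> Hom L (susO L (FO X)) (susO L (FO Y))" using X by simp
    then obtain s where s: "s \<in> Hom L (FO X) (FO Y)" "susM L s = \<phi> Y \<cdot>\<^bsub>L\<^esub> (FM t \<cdot>\<^bsub>L\<^esub> x')"
      using L.sus_full[of "FO X" "FO Y"] X by (metis F.functor_obj)
    obtain f where f: "f \<in> Hom K X Y" "FM f = s" using F_full[OF X s(1)] .
    have "susM K f = t"
    proof (rule sus_eqI[of _ X Y])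
      show "\<phi> Y \<cdot>\<^bsub>L\<^esub> FM (susM K f) = \<phi> Y \<cdot>\<^bsub>L\<^esub> FM t"
        using phi_nat[OF f(1)] X susO_ob by (simp add: f(2) s(2) x'(2))
    qed (use f X in auto)
    then show "\<exists>f\<in>Hom K X Y. susM K f = t" using f by blast
  next
    fix X Y f f' assume f: "f \<in> Hom K X Y" "f' \<in> Hom K X Y" "susM K f = susM K f'"
    have ob: "X \<in> ob K" "Y \<in> ob K" using K.Hom_ob[OF f(1)] by auto
    have "susM L (FM f) \<cdot>\<^bsub>L\<^esub> \<phi> X = susM L (FM f') \<cdot>\<^bsub>L\<^esub> \<phi> X"
      using phi_nat[OF f(1)] phi_nat[OF f(2)] f(3) by simp
    then have "susM L (FM f) = susM L (FM f')"
      by - (rule L.iso_cancel_right[OF phi_iso[OF ob(1)]], use f in auto)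
    then have "FM f = FM f'" by (rule L.sus_eqD) (use f in auto)
    then show "f = f'" by (rule F_eqD) (use f in auto)
  next
    fix Y assume Y: "Y \<in> ob K"
    then have FY: "FO Y \<in> ob L" by simp
    obtain A a where A: "A \<in> ob L" "iso_arr L (susO L A) (FO Y) a" using equivalence_ess_surj[OF L.sus_equiv FY] .
    obtain X b where X: "X \<in> ob K" "iso_arr L (FO X) A b" using F_ess_surj[OF A(1)] .
    have "iso_arr L (FO (susO K X)) (FO Y) (a \<cdot>\<^bsub>L\<^esub> susM L b \<cdot>\<^bsub>L\<^esub> \<phi> X)"
      using L.iso_cmp[OF phi_iso[OF X(1)] L.iso_cmp[OF L.Sus.functor_iso[OF X(2)] A(2)]] .
    moreover from this have "a \<cdot>\<^bsub>L\<^esub> susM L b \<cdot>\<^bsub>L\<^esub> \<phi> X \<in> Hom L (FO (susO K X)) (FO Y)" by (rule L.iso_arrE)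
    then obtain e where "e \<in> Hom K (susO K X) Y" "FM e = a \<cdot>\<^bsub>L\<^esub> susM L b \<cdot>\<^bsub>L\<^esub> \<phi> X"
      by (rule F_full[OF susO_ob[OF X(1)] Y])
    ultimately show "\<exists>X\<in>ob K. \<exists>e. iso_arr K (susO K X) Y e"
      using equivalence_reflects_iso[OF F_equivalence] X(1) by metis
  qed
  then show ?thesis unfolding additive_equivalence_def using sus_add by auto
qed

sublocale K: suspended_category K
  by unfold_locales (rule sus_equivalence)

lemma K_Tri_arrs:
  assumes "(f, g, h) \<in> Tri K"
  shows "f \<in> arr K" "g \<in> arr K" "h \<in> arr K" "src K g = tgt K f" "src K h = tgt K g" "tgt K h = susO K (src K f)"
    "(FM f, FM g, \<phi> (src K f) \<cdot>\<^bsub>L\<^esub> FM h) \<in> Tri L"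
  using assms unfolding Tri_iff by blast+

lemma K_pretriangulated: "pretriangulated K"
proof unfold_locales
  show "additive_equivalence K K (susO K) (susM K)" by (rule sus_equivalence)
  show "\<exists>X Y Z. triangle_on K X Y Z T" if "T \<in> Tri K" for T
    using that by (cases T) (auto simp: triangle_on_def Tri_iff)
  show "T \<in> Tri K" if S: "S \<in> Tri K" "tri_iso K S T" for S T
  proof -
    obtain f g h f' g' h' where e: "S = (f, g, h)" "T = (f', g', h')" by (metis prod_cases3)
    obtain x y z where [simp]: "f \<in> arr K" "g \<in> arr K" "h \<in> arr K" "src K g = tgt K f" "src K h = tgt K g" "tgt K h = susO K (src K f)"
       "f' \<in> arr K" "g' \<in> arr K" "h' \<in> arr K" "src K g' = tgt K f'" "src K h' = tgt K g'" "tgt K h' = susO K (src K f')" and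
       i: "iso_arr K (src K f') (src K f) x" "iso_arr K (tgt K f') (tgt K f) y" "iso_arr K (tgt K g') (tgt K g) z"
       "y \<cdot>\<^bsub>K\<^esub> f' = f \<cdot>\<^bsub>K\<^esub> x" "z \<cdot>\<^bsub>K\<^esub> g' = g \<cdot>\<^bsub>K\<^esub> y" "susM K x \<cdot>\<^bsub>K\<^esub> h' = h \<cdot>\<^bsub>K\<^esub> z"
      using K.tri_iso_sym[of f g h f' g' h'] S(2) unfolding e tri_iso_iff by blast
    have [unfolded Hom_iff, simp]: "x \<in> Hom K (src K f') (src K f)" "y \<in> Hom K (tgt K f') (tgt K f)"
    "z \<in> Hom K (tgt K g') (tgt K g)" using i by (auto elim: K.iso_arrE)
    have "(FM f', FM g', \<phi> (src K f') \<cdot>\<^bsub>L\<^esub> FM h') \<in> Tri L"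
    proof (rule L.tri_isoI[OF K_Tri_arrs(7)[OF S(1)[unfolded e]]])
      show "iso_arr L (FO (src K f')) (src L (FM f)) (FM x)" "iso_arr L (FO (tgt K f')) (tgt L (FM f)) (FM y)"
        "iso_arr L (FO (tgt K g')) (tgt L (FM g)) (FM z)" using i F.functor_iso by simp_all
      show "FM y \<cdot>\<^bsub>L\<^esub> FM f' = FM f \<cdot>\<^bsub>L\<^esub> FM x" "FM z \<cdot>\<^bsub>L\<^esub> FM g' = FM g \<cdot>\<^bsub>L\<^esub> FM y"
        using i(4,5) by (simp_all flip: F.functor_comp)
      have nat: "susM L (FM x) \<cdot>\<^bsub>L\<^esub> \<phi> (src K f') = \<phi> (src K f) \<cdot>\<^bsub>L\<^esub> FM (susM K x)" using phi_natural[of x] by simp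
      have "FM (susM K x) \<cdot>\<^bsub>L\<^esub> FM h' = FM h \<cdot>\<^bsub>L\<^esub> FM z" using i(6) by (simp flip: F.functor_comp)
      then show "susM L (FM x) \<cdot>\<^bsub>L\<^esub> (\<phi> (src K f') \<cdot>\<^bsub>L\<^esub> FM h') = \<phi> (src K f) \<cdot>\<^bsub>L\<^esub> FM h \<cdot>\<^bsub>L\<^esub> FM z"
        by (simp add: L.reassoc[OF nat])
    qed auto
    then show ?thesis unfolding e Tri_iff by simp
  qed
  show "(ident K X, zerom K X N, zerom K N (susO K X)) \<in> Tri K" if X: "X \<in> ob K" and N: "zero_object K N" for X N
  proof -
    have [simp]: "N \<in> ob K" "susO K X \<in> ob K" using N X susO_ob by (auto simp: zero_object_def)
    have "(ident L (FO X), zerom L (FO X) (FO N), zerom L (FO N) (susO L (FO X))) \<in> Tri L"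
      by (rule L.tri_ident_left) (use X F.functor_zero_object[OF N] in auto)
    then show ?thesis unfolding Tri_iff using X by simp
  qed
  show "(zerom K N X, ident K X, zerom K X (susO K N)) \<in> Tri K" if X: "X \<in> ob K" and N: "zero_object K N" for X N
  proof -
    have [simp]: "N \<in> ob K" "susO K N \<in> ob K" using N susO_ob by (auto simp: zero_object_def)
    have "(zerom L (FO N) (FO X), ident L (FO X), zerom L (FO X) (susO L (FO N))) \<in> Tri L"
      by (rule L.tri_ident_right) (use X F.functor_zero_object[OF N] in auto)
    then show ?thesis unfolding Tri_iff using X by simp
  qed
  show "\<exists>g h. (f, g, h) \<in> Tri K" if f: "f \<in> arr K" for f
  proof -
    obtain g h where T: "(FM f, g, h) \<in> Tri L" using L.tri_cone[of "FM f"] f by auto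
    define A where "A = tgt L g"
    have [unfolded Hom_iff, simp]: "g \<in> Hom L (FO (tgt K f)) A" "h \<in> Hom L A (susO L (FO (src K f)))"
      using L.tri_arrs[OF T] f by (auto simp: A_def)
    have "A \<in> ob L" using L.tgt_in_ob[of g] by simp
    then obtain Z z where Z: "Z \<in> ob K" "iso_arr L (FO Z) A z" by (rule F_ess_surj)
    obtain z' where z: "z \<in> Hom L (FO Z) A" "z' \<in> Hom L A (FO Z)" "z \<cdot>\<^bsub>L\<^esub> z' = ident L A"
      using Z(2) by (auto elim: L.iso_arrE)
    have ob: "src K f \<in> ob K" "tgt K f \<in> ob K" using f by auto
    obtain y where y: "y \<in> Hom L (susO L (FO (src K f))) (FO (susO K (src K f)))" "\<phi> (src K f) \<cdot>\<^bsub>L\<^esub> y = ident L (susO L (FO (src K f)))"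
      using phi_iso[OF ob(1)] by (auto elim: L.iso_arrE)
    have [unfolded Hom_iff, simp]: "z \<in> Hom L (FO Z) A" "z' \<in> Hom L A (FO Z)"
    "y \<in> Hom L (susO L (FO (src K f))) (FO (susO K (src K f)))" using z y by auto
    have 1: "z' \<cdot>\<^bsub>L\<^esub> g \<in> Hom L (FO (tgt K f)) (FO Z)" and 2: "y \<cdot>\<^bsub>L\<^esub> (h \<cdot>\<^bsub>L\<^esub> z) \<in> Hom L (FO Z) (FO (susO K (src K f)))"
      by simp_all
    obtain g' where g': "g' \<in> Hom K (tgt K f) Z" "FM g' = z' \<cdot>\<^bsub>L\<^esub> g" using F_full[OF ob(2) Z(1) 1] .
    obtain h' where h': "h' \<in> Hom K Z (susO K (src K f))" "FM h' = y \<cdot>\<^bsub>L\<^esub> (h \<cdot>\<^bsub>L\<^esub> z)" using F_full[OF Z(1) susO_ob[OF ob(1)] 2] .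
    have "(FM f, FM g', \<phi> (src K f) \<cdot>\<^bsub>L\<^esub> FM h') \<in> Tri L"
      by (rule L.tri_isoI[OF T, of _ "FO (src K f)" "FO (tgt K f)" _ "FO Z" _ "ident L (FO (src K f))" "ident L (FO (tgt K f))" z])
        (use f ob g' h' Z(2) in \<open>auto simp: L.reassoc[OF z(3)] L.reassoc[OF y(2)] L.iso_ident\<close>)
    then have "(f, g', h') \<in> Tri K" unfolding Tri_iff using f g' h' by auto
    then show ?thesis by blast
  qed
  show "(g, h, \<ominus>\<^bsub>K\<^esub> (susM K f)) \<in> Tri K" if T: "(f, g, h) \<in> Tri K" for f g h
  proof -
    note t = K_Tri_arrs[OF T]
    define X where "X = src K f"
    have [simp]: "f \<in> arr K" "g \<in> arr K" "h \<in> arr K" "src K f = X" "src K g = tgt K f" "src K h = tgt K g" "tgt K h = susO K X"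
      using t by (auto simp: X_def)
    have ob: "X \<in> ob K" "tgt K f \<in> ob K" using K.src_in_ob[of f] by simp_all
    have R: "(FM g, \<phi> X \<cdot>\<^bsub>L\<^esub> FM h, \<ominus>\<^bsub>L\<^esub> (susM L (FM f))) \<in> Tri L" using L.tri_rotate[OF t(7)] by simp
    have nat: "\<phi> (tgt K f) \<cdot>\<^bsub>L\<^esub> FM (susM K f) = susM L (FM f) \<cdot>\<^bsub>L\<^esub> \<phi> X" using phi_natural[of f] by simp
    have "(FM g, FM h, \<phi> (tgt K f) \<cdot>\<^bsub>L\<^esub> FM (\<ominus>\<^bsub>K\<^esub> (susM K f))) \<in> Tri L"
      by (rule L.tri_isoI[OF R, of _ "FO (tgt K f)" "FO (tgt K g)" _ "FO (susO K X)" _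
            "ident L (FO (tgt K f))" "ident L (FO (tgt K g))" "\<phi> X"])
        (use ob phi_iso nat in \<open>auto simp: L.iso_ident\<close>)
    then show ?thesis unfolding Tri_iff by simp
  qed
  show "\<exists>w. tri_morphism K (f, g, h) (f', g', h') u v w" if
    T: "(f, g, h) \<in> Tri K" "(f', g', h') \<in> Tri K" and
    uv: "u \<in> Hom K (src K f) (src K f')" "v \<in> Hom K (tgt K f) (tgt K f')" "v \<cdot>\<^bsub>K\<^esub> f = f' \<cdot>\<^bsub>K\<^esub> u"
    for f g h f' g' h' u v
  proof -
    note t = K_Tri_arrs[OF T(1)] and t' = K_Tri_arrs[OF T(2)]
    note [simp] = t(1-6) t'(1-6)
    have [unfolded Hom_iff, simp]: "u \<in> Hom K (src K f) (src K f')" "v \<in> Hom K (tgt K f) (tgt K f')" using uv by auto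
    have sq: "FM v \<cdot>\<^bsub>L\<^esub> FM f = FM f' \<cdot>\<^bsub>L\<^esub> FM u" using uv(3) by (simp flip: F.functor_comp)
    obtain W where W: "W \<in> Hom L (tgt L (FM g)) (tgt L (FM g'))" "W \<cdot>\<^bsub>L\<^esub> FM g = FM g' \<cdot>\<^bsub>L\<^esub> FM v"
      "susM L (FM u) \<cdot>\<^bsub>L\<^esub> (\<phi> (src K f) \<cdot>\<^bsub>L\<^esub> FM h) = \<phi> (src K f') \<cdot>\<^bsub>L\<^esub> FM h' \<cdot>\<^bsub>L\<^esub> W"
      by (rule L.tri_completeE[OF t(7) t'(7) _ _ sq]) auto
    have W': "W \<in> Hom L (FO (tgt K g)) (FO (tgt K g'))" using W(1) by simp
    obtain w where w: "w \<in> Hom K (tgt K g) (tgt K g')" "FM w = W" by (rule F_full[OF _ _ W']) auto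
    have [unfolded Hom_iff, simp]: "w \<in> Hom K (tgt K g) (tgt K g')" using w by auto
    have "w \<cdot>\<^bsub>K\<^esub> g = g' \<cdot>\<^bsub>K\<^esub> v" by (rule F_eqD) (use W(2) w(2) in auto)
    moreover have "susM K u \<cdot>\<^bsub>K\<^esub> h = h' \<cdot>\<^bsub>K\<^esub> w"
    proof -
      have nat: "\<phi> (src K f') \<cdot>\<^bsub>L\<^esub> FM (susM K u) = susM L (FM u) \<cdot>\<^bsub>L\<^esub> \<phi> (src K f)" using phi_natural[of u] by simp
      have "\<phi> (src K f') \<cdot>\<^bsub>L\<^esub> FM (susM K u \<cdot>\<^bsub>K\<^esub> h) = \<phi> (src K f') \<cdot>\<^bsub>L\<^esub> FM (h' \<cdot>\<^bsub>K\<^esub> w)"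
        using W(3) w(2) W' by (simp add: L.reassoc[OF nat])
      then have "FM (susM K u \<cdot>\<^bsub>K\<^esub> h) = FM (h' \<cdot>\<^bsub>K\<^esub> w)"
        by - (rule L.iso_cancel_left[OF phi_iso[of "src K f'"], of _ "FO (tgt K g)"], auto simp del: F.functor_comp)
      then show ?thesis by (rule F_eqD) auto
    qed
    ultimately have "tri_morphism K (f, g, h) (f', g', h') u v w" using uv(3) by (simp add: tri_morphism_def)
    then show ?thesis by blast
  qed
qed

sublocale K: pretriangulated K
  by (rule K_pretriangulated)

theorem K_triangulated: "triangulated_category K"
proof (rule K.triangulatedI)
  fix f g X Y Z f1 f2 g1 g2 k1 k2
  assume fg: "f \<in> Hom K X Y" "g \<in> Hom K Y Z"
    and T: "(f, f1, f2) \<in> Tri K" "(g, g1, g2) \<in> Tri K" "(g \<cdot>\<^bsub>K\<^esub> f, k1, k2) \<in> Tri K"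
  note t1 = K_Tri_arrs[OF T(1)] and t2 = K_Tri_arrs[OF T(2)] and t3 = K_Tri_arrs[OF T(3)]
  have [unfolded Hom_iff, simp]: "f \<in> Hom K X Y" "g \<in> Hom K Y Z" "f1 \<in> arr K" "src K f1 = Y"
    "f2 \<in> Hom K (tgt K f1) (susO K X)" "g1 \<in> arr K" "src K g1 = Z" "g2 \<in> Hom K (tgt K g1) (susO K Y)" "k1 \<in> arr K"
    "src K k1 = Z" "k2 \<in> Hom K (tgt K k1) (susO K X)"
    using fg t1 t2 t3 by auto
  have ob [simp]: "X \<in> ob K" "Y \<in> ob K" "Z \<in> ob K" using K.Hom_ob[OF fg(1)] K.Hom_ob[OF fg(2)] by auto
  have T1: "(FM f, FM f1, \<phi> X \<cdot>\<^bsub>L\<^esub> FM f2) \<in> Tri L" and T2: "(FM g, FM g1, \<phi> Y \<cdot>\<^bsub>L\<^esub> FM g2) \<in> Tri L"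
    and T3: "(FM g \<cdot>\<^bsub>L\<^esub> FM f, FM k1, \<phi> X \<cdot>\<^bsub>L\<^esub> FM k2) \<in> Tri L"
    using t1(7) t2(7) t3(7) by simp_all
  have "FM f \<in> Hom L (FO X) (FO Y)" "FM g \<in> Hom L (FO Y) (FO Z)" by simp_all
  from L.Tri_octahedral[OF this T1 T2 T3] obtain A B where
    AB: "(A, B, susM L (FM f1) \<cdot>\<^bsub>L\<^esub> (\<phi> Y \<cdot>\<^bsub>L\<^esub> FM g2)) \<in> Tri L"
    "A \<in> Hom L (FO (tgt K f1)) (FO (tgt K k1))" "B \<in> Hom L (FO (tgt K k1)) (FO (tgt K g1))"
    "A \<cdot>\<^bsub>L\<^esub> FM f1 = FM k1 \<cdot>\<^bsub>L\<^esub> FM g" "\<phi> X \<cdot>\<^bsub>L\<^esub> FM k2 \<cdot>\<^bsub>L\<^esub> A = \<phi> X \<cdot>\<^bsub>L\<^esub> FM f2"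
    "B \<cdot>\<^bsub>L\<^esub> FM k1 = FM g1" "\<phi> Y \<cdot>\<^bsub>L\<^esub> FM g2 \<cdot>\<^bsub>L\<^esub> B = susM L (FM f) \<cdot>\<^bsub>L\<^esub> (\<phi> X \<cdot>\<^bsub>L\<^esub> FM k2)"
    by (auto simp: triangle_on_def)
  obtain a where a: "a \<in> Hom K (tgt K f1) (tgt K k1)" "FM a = A" by (rule F_full[OF _ _ AB(2)]) auto
  obtain b where b: "b \<in> Hom K (tgt K k1) (tgt K g1)" "FM b = B" by (rule F_full[OF _ _ AB(3)]) auto
  have [unfolded Hom_iff, simp]: "a \<in> Hom K (tgt K f1) (tgt K k1)" "b \<in> Hom K (tgt K k1) (tgt K g1)"
    using a b by auto
  have 1: "a \<cdot>\<^bsub>K\<^esub> f1 = k1 \<cdot>\<^bsub>K\<^esub> g" by (rule F_eqD) (use AB(4) a in auto)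
  have 2: "b \<cdot>\<^bsub>K\<^esub> k1 = g1" by (rule F_eqD) (use AB(6) b in auto)
  have "FM (k2 \<cdot>\<^bsub>K\<^esub> a) = FM f2"
    by (rule L.iso_cancel_left[OF phi_iso[OF ob(1)], of _ "FO (tgt K f1)"]) (use AB(5) a in auto)
  then have 3: "k2 \<cdot>\<^bsub>K\<^esub> a = f2" by (rule F_eqD) auto
  have nat: "\<phi> Y \<cdot>\<^bsub>L\<^esub> FM (susM K f) = susM L (FM f) \<cdot>\<^bsub>L\<^esub> \<phi> X" using phi_natural[of f] by simp
  have "FM (g2 \<cdot>\<^bsub>K\<^esub> b) = FM (susM K f \<cdot>\<^bsub>K\<^esub> k2)"
    by (rule L.iso_cancel_left[OF phi_iso[OF ob(2)], of _ "FO (tgt K k1)"])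
      (use AB(7) b in \<open>auto simp: L.reassoc[OF nat]\<close>)
  then have 4: "g2 \<cdot>\<^bsub>K\<^esub> b = susM K f \<cdot>\<^bsub>K\<^esub> k2" by (rule F_eqD) auto
  have nat1: "\<phi> (tgt K f1) \<cdot>\<^bsub>L\<^esub> FM (susM K f1) = susM L (FM f1) \<cdot>\<^bsub>L\<^esub> \<phi> Y" using phi_natural[of f1] by simp
  have "\<phi> (src K a) \<cdot>\<^bsub>L\<^esub> FM (susM K f1 \<cdot>\<^bsub>K\<^esub> g2) = susM L (FM f1) \<cdot>\<^bsub>L\<^esub> (\<phi> Y \<cdot>\<^bsub>L\<^esub> FM g2)"
    by (simp add: L.reassoc[OF nat1])
  then have "(a, b, susM K f1 \<cdot>\<^bsub>K\<^esub> g2) \<in> Tri K"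
    unfolding Tri_iff using AB(1) a(2) b(2) by simp
  then show "has_octahedron K f g f1 f2 g1 g2 k1 k2"
    unfolding has_octahedron_def using 1 2 3 4 a(1) b(1) by blast
qed

end

section \<open>Stable quotients\<close>

context frobenius_ideal
begin

text \<open>
  A phantom is a cophantom, so composing it with \<open>\<Sigma>f\<close> gives zero.  Together with \<open>factors_of_eq\<close> this
  shows that \<open>tgt K g\<close> represents, modulo \<open>P\<close>, the functor of phantoms into \<open>\<Sigma> (src K f)\<close> if \<open>h\<close> is a
  phantom.
\<close>

lemma factor_phantom:
  assumes T: "(f, g, h) \<in> Tri K" "tgt K f \<in> P" and k: "k \<in> Hom K Z (susO K (src K f))" "phantom K P k"
  obtains \<theta> where "\<theta> \<in> Hom K Z (tgt K g)" "h \<cdot> \<theta> = k"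
proof -
  note [simp] = tri_arrs[OF T(1)]
  have Z: "Z \<in> ob K" using Hom_ob[OF k(1)] by simp
  have "cophantom K P (src K f) k" using phantom_iff_cophantom[OF k(1)] k(2) by simp
  then have "susM K f \<cdot> k = zerom K Z (susO K (tgt K f))" using T(2) k(1) unfolding cophantom_def by fastforce
  then obtain s where s: "s \<in> Hom K Z (tgt K g)" "h \<cdot> s = k"
    using k(1) Z by - (rule weak_kernel2[OF tri_rotate[OF T(1)], of k Z], auto)
  show ?thesis by (rule that[OF s])
qed

text \<open>
  The difference is killed by \<open>h\<close>, hence factors through \<open>tgt K f\<close>.
\<close>

lemma factors_of_eq:
  assumes T: "(f, g, h) \<in> Tri K" "tgt K f \<in> P" and xy: "x \<in> Hom K Z (tgt K g)" "y \<in> Hom K Z (tgt K g)" "h \<cdot> x = h \<cdot> y"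
  shows "factors_through K P (x \<ominus> y)"
proof -
  interpret P: additive_ideal K P by (rule P_ideal)
  note [simp] = tri_arrs[OF T(1)]
  have [unfolded Hom_iff, simp]: "x \<in> Hom K Z (tgt K g)" "y \<in> Hom K Z (tgt K g)" using xy by auto
  have Z [simp]: "Z \<in> ob K" using src_in_ob[of x] by simp
  have "h \<cdot> (x \<ominus> y) = zerom K Z (susO K (src K f))" using xy(3) by simp
  then obtain s where s: "s \<in> Hom K Z (tgt K f)" "g \<cdot> s = x \<ominus> y"
    by - (rule weak_kernel2[OF T(1), of "x \<ominus> y" Z], auto)
  then show ?thesis using P.facI[of s Z "tgt K f" g "tgt K g"] T(2) by simp
qed

lemma phantom_cmp:
  assumes "phantom K P h" "h \<in> arr K" "x \<in> arr K" "tgt K h = src K x"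
  shows "phantom K P (x \<cdot> h)"
  unfolding phantom_def
proof (intro ballI)
  fix Q b assume Q: "Q \<in> P" "b \<in> Hom K Q (src K (x \<cdot> h))"
  then have b: "b \<in> Hom K Q (src K h)" using assms by simp
  have "h \<cdot> b = zerom K Q (tgt K h)" using assms(1) Q(1) b unfolding phantom_def by blast
  moreover have "Q \<in> ob K" using P_ob Q by blast
  ultimately show "x \<cdot> h \<cdot> b = zerom K Q (tgt K (x \<cdot> h))" using assms b by simp
qed

end

text \<open>
  The common form of the triangulations of \<open>K/proj(E)\<close> and \<open>C/P\<close>.  The functor \<open>\<sigma>\<close> is the projection to
  the quotient by \<open>P\<close>; the suspension of \<open>X\<close> is the third object of the chosen triangle
  \<open>(i X, p X, q X)\<close>; and a standard triangle on \<open>f\<close> is \<open>(f, g, h)\<close> for a triangle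
  \<open>(g, h, \<Sigma>f \<cdot> q X)\<close> of \<open>K\<close>.
\<close>

locale stable_quotient = frobenius_ideal K P + D: additive_category D
  for K :: "('o, 'm, 'z) tricat_scheme" (structure) and P and D :: "('o, 'n, 'y) tricat_scheme" +
  fixes \<sigma> :: "'m \<Rightarrow> 'n" and i p q :: "'o \<Rightarrow> 'm"
  assumes sigma_functor: "additive_functor K D id \<sigma>"
    and ob_D: "ob D = ob K"
    and sigma_full: "S \<in> Hom D X Y \<Longrightarrow> \<exists>f \<in> Hom K X Y. S = \<sigma> f"
    and sigma_zero: "f \<in> Hom K X Y \<Longrightarrow> \<sigma> f = zerom D X Y \<longleftrightarrow> factors_through K P f"
    and chosen: "X \<in> ob K \<Longrightarrow> (i X, p X, q X) \<in> Tri K \<and> src K (i X) = X \<and> tgt K (i X) \<in> P \<and> phantom K P (q X)"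
    and susO_D: "X \<in> ob K \<Longrightarrow> susO D X = tgt K (p X)"
    and susM_D: "\<lbrakk>f \<in> Hom K X Y; w \<in> Hom K (tgt K (p X)) (tgt K (p Y)); q Y \<cdot> w = susM K f \<cdot> q X\<rbrakk> \<Longrightarrow> susM D (\<sigma> f) = \<sigma> w"
    and Tri_D: "T \<in> Tri D \<longleftrightarrow> (\<exists>f g h. f \<in> arr K \<and> src K g = tgt K f \<and> tgt K h = tgt K (p (src K f)) \<and>
        (g, h, susM K f \<cdot> q (src K f)) \<in> Tri K \<and> tri_iso D (\<sigma> f, \<sigma> g, \<sigma> h) T)"
    and tri_exists: "f \<in> arr K \<Longrightarrow> \<exists>g h. src K g = tgt K f \<and> tgt K h = tgt K (p (src K f)) \<and>
        (g, h, susM K f \<cdot> q (src K f)) \<in> Tri K"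
begin

sublocale S: additive_functor K D id \<sigma>
  by (rule sigma_functor)

sublocale P: additive_ideal K P
  by (rule P_ideal)

lemma sigma_arr [simp]:
  "f \<in> arr K \<Longrightarrow> src D (\<sigma> f) = src K f" "f \<in> arr K \<Longrightarrow> tgt D (\<sigma> f) = tgt K f"
  by simp_all

lemma sigma_eq_iff:
  assumes "x \<in> arr K" "y \<in> arr K" "src K x = src K y" "tgt K x = tgt K y"
  shows "\<sigma> x = \<sigma> y \<longleftrightarrow> P.fac (x \<ominus> y)"
proof -
  have "\<sigma> x = \<sigma> y \<longleftrightarrow> \<sigma> (x \<ominus> y) = zerom D (src K y) (tgt K y)"
    using D.sub_eq_zero_iff[of "\<sigma> x" "\<sigma> y"] assms by simp
  also have "\<dots> \<longleftrightarrow> P.fac (x \<ominus> y)" by (rule sigma_zero) (use assms in auto)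
  finally show ?thesis .
qed

lemma sigma_lift:
  assumes "S \<in> Hom D X Y" obtains f where "f \<in> Hom K X Y" "S = \<sigma> f"
  using sigma_full[OF assms] by blast

lemma chosen_arr [simp]:
  assumes "X \<in> ob K"
  shows "i X \<in> arr K" "src K (i X) = X" "p X \<in> arr K" "src K (p X) = tgt K (i X)" "q X \<in> arr K"
    "src K (q X) = tgt K (p X)" "tgt K (q X) = susO K X"
  using chosen[OF assms] tri_arrs[of "i X" "p X" "q X"] by auto

lemma chosen_P [simp]: "X \<in> ob K \<Longrightarrow> tgt K (i X) \<in> P"
  using chosen by blast

lemma sus_lift:
  assumes f: "f \<in> Hom K X Y"
  obtains w where "w \<in> Hom K (tgt K (p X)) (tgt K (p Y))" "q Y \<cdot> w = susM K f \<cdot> q X"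
proof -
  have [simp]: "X \<in> ob K" "Y \<in> ob K" using Hom_ob[OF f] by auto
  have "phantom K P (susM K f \<cdot> q X)" by (rule phantom_cmp) (use chosen f in auto)
  then obtain w where "w \<in> Hom K (tgt K (p X)) (tgt K (p Y))" "q Y \<cdot> w = susM K f \<cdot> q X"
    by - (rule factor_phantom[of "i Y" "p Y" "q Y" "susM K f \<cdot> q X" "tgt K (p X)"], use chosen f in auto)
  then show ?thesis by (rule that)
qed

lemma sigma_eqI:
  assumes "A \<in> ob K" "x \<in> Hom K Z (tgt K (p A))" "y \<in> Hom K Z (tgt K (p A))" "q A \<cdot> x = q A \<cdot> y"
  shows "\<sigma> x = \<sigma> y"
proof -
  have "P.fac (x \<ominus> y)" using factors_of_eq[of "i A" "p A" "q A" x Z y] chosen[OF assms(1)] assms by simp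
  then show ?thesis using sigma_eq_iff[of x y] assms by simp
qed

text \<open>
  A five lemma modulo \<open>P\<close>.  Since \<open>\<theta>\<close> and \<open>\<theta>'\<close> respect the connecting maps, they complete to morphisms of
  triangles over the identity of \<open>B\<close>; the middle components \<open>w\<close> and \<open>w'\<close> are inverse modulo \<open>P\<close> up to
  errors of square zero.
\<close>

lemma middle_iso:
  assumes T: "(g, h, k) \<in> Tri K" "(g', h', k') \<in> Tri K" and B: "src K g = B" "src K g' = B"
    and ph: "phantom K P k" "phantom K P k'"
    and \<theta>: "\<theta> \<in> Hom K (tgt K h) (tgt K h')" "k' \<cdot> \<theta> = k" and \<theta>': "\<theta>' \<in> Hom K (tgt K h') (tgt K h)" "k \<cdot> \<theta>' = k'"
    and inv: "\<sigma> (\<theta>' \<cdot> \<theta>) = ident D (tgt K h)" "\<sigma> (\<theta> \<cdot> \<theta>') = ident D (tgt K h')"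
  obtains w where "w \<in> Hom K (tgt K g) (tgt K g')" "w \<cdot> g = g'" "h' \<cdot> w = \<theta> \<cdot> h" "iso_arr D (tgt K g) (tgt K g') (\<sigma> w)"
proof -
  define Z where "Z = tgt K g"
  define Z' where "Z' = tgt K g'"
  define U where "U = tgt K h"
  define U' where "U' = tgt K h'"
  have [unfolded Hom_iff, simp]: "g \<in> Hom K B Z" "h \<in> Hom K Z U" "k \<in> Hom K U (susO K B)"
    using tri_arrs[OF T(1)] B by (auto simp: Z_def U_def)
  have [unfolded Hom_iff, simp]: "g' \<in> Hom K B Z'" "h' \<in> Hom K Z' U'" "k' \<in> Hom K U' (susO K B)"
    using tri_arrs[OF T(2)] B by (auto simp: Z'_def U'_def)
  have ob [simp]: "B \<in> ob K" "Z \<in> ob K" "Z' \<in> ob K" "U \<in> ob K" "U' \<in> ob K"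
    using src_in_ob[of g] tgt_in_ob[of g] tgt_in_ob[of g'] tgt_in_ob[of h] tgt_in_ob[of h'] by auto
  have [unfolded Hom_iff, simp]: "\<theta> \<in> Hom K U U'" "\<theta>' \<in> Hom K U' U" using \<theta> \<theta>' by auto
  obtain w where w: "w \<in> Hom K Z Z'" "w \<cdot> g = g'" "\<theta> \<cdot> h = h' \<cdot> w"
    by (rule complete_middle[OF T, of "ident K B" \<theta>]) (use \<theta> in auto)
  obtain w' where w': "w' \<in> Hom K Z' Z" "w' \<cdot> g' = g" "\<theta>' \<cdot> h' = h \<cdot> w'"
    by (rule complete_middle[OF T(2,1), of "ident K B" \<theta>']) (use \<theta>' in auto)
  have [unfolded Hom_iff, simp]: "w \<in> Hom K Z Z'" "w' \<in> Hom K Z' Z" using w w' by auto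
  \<comment> \<open>Applied to \<open>w' \<cdot> w - 1\<close> and \<open>w \<cdot> w' - 1\<close>: such an error \<open>n\<close> has \<open>n \<cdot> a = 0\<close>, and it factors through \<open>a\<close> up to
    \<open>P\<close>, because \<open>b \<cdot> n\<close> factors through an object of \<open>P\<close> and that factorization lifts along \<open>b\<close>.\<close>
  have nil: "\<sigma> n \<cdot>\<^bsub>D\<^esub> \<sigma> n = zerom D W W"
    if TT: "(a, b, c) \<in> Tri K" and W: "tgt K a = W" "W \<in> ob K" and p: "phantom K P c"
      and n: "n \<in> Hom K W W" "n \<cdot> a = zerom K (src K a) W" "\<sigma> (b \<cdot> n) = zerom D W (tgt K b)" for a b c n W
  proof -
    note t = tri_arrs[OF TT]
    have [simp]: "a \<in> arr K" "b \<in> arr K" "c \<in> arr K" "src K b = W" "src K c = tgt K b" "tgt K a = W" using t W by auto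
    have [unfolded Hom_iff, simp]: "n \<in> Hom K W W" using n by auto
    have bn: "b \<cdot> n \<in> Hom K W (tgt K b)" by simp
    have "P.fac (b \<cdot> n)" using sigma_zero[OF bn] n(3) by simp
    then obtain R x y where R: "R \<in> P" "x \<in> Hom K W R" "y \<in> Hom K R (tgt K b)" "b \<cdot> n = y \<cdot> x"
      using bn by (rule P.facE_hom)
    obtain y' where y': "y' \<in> Hom K R W" "b \<cdot> y' = y"
      using p[unfolded phantom_iff_lift[OF TT]] R(1,3) W(1) by blast
    have [unfolded Hom_iff, simp]: "x \<in> Hom K W R" "y' \<in> Hom K R W" "y \<in> Hom K R (tgt K b)" using R y' by auto
    have "b \<cdot> (n \<ominus> y' \<cdot> x) = zerom K W (tgt K b)" using W by (simp add: R(4) reassoc[OF y'(2)])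
    then obtain s where s: "s \<in> Hom K W (src K a)" "a \<cdot> s = n \<ominus> y' \<cdot> x"
      using W by - (rule weak_kernel[OF TT, of "n \<ominus> y' \<cdot> x" W], auto)
    have [unfolded Hom_iff, simp]: "s \<in> Hom K W (src K a)" using s by auto
    have "n \<cdot> (n \<ominus> y' \<cdot> x) = zerom K W W" unfolding s(2)[symmetric] using W by (simp add: reassoc[OF n(2)])
    then have "n \<cdot> n = n \<cdot> (y' \<cdot> x)" using sub_eq_zero_iff[of "n \<cdot> n" "n \<cdot> (y' \<cdot> x)"] by simp
    moreover have "P.fac ((n \<cdot> y') \<cdot> x)" by (rule P.facI[of _ W R _ W]) (use R(1) in auto)
    ultimately have "P.fac (n \<cdot> n)" by simp
    then have "\<sigma> (n \<cdot> n) = zerom D W W" using sigma_zero[of "n \<cdot> n" W W] by simp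
    then show ?thesis by simp
  qed
  define n where "n = w' \<cdot> w \<ominus> ident K Z"
  define m where "m = w \<cdot> w' \<ominus> ident K Z'"
  have [unfolded Hom_iff, simp]: "n \<in> Hom K Z Z" "m \<in> Hom K Z' Z'" by (auto simp: n_def m_def)
  have hn: "h \<cdot> n = (\<theta>' \<cdot> \<theta> \<ominus> ident K U) \<cdot> h"
    by (simp add: n_def w(3) reassoc[OF w'(3)[symmetric]])
  have hm: "h' \<cdot> m = (\<theta> \<cdot> \<theta>' \<ominus> ident K U') \<cdot> h'"
    by (simp add: m_def w'(3) reassoc[OF w(3)[symmetric]])
  have i1: "\<sigma> \<theta>' \<cdot>\<^bsub>D\<^esub> \<sigma> \<theta> = ident D U" "\<sigma> \<theta> \<cdot>\<^bsub>D\<^esub> \<sigma> \<theta>' = ident D U'" using inv by simp_all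
  have "\<sigma> n \<cdot>\<^bsub>D\<^esub> \<sigma> n = zerom D Z Z"
  proof (rule nil[OF T(1)])
    have "n \<cdot> g = zerom K B Z" by (simp add: n_def w(2) w'(2))
    then show "n \<cdot> g = zerom K (src K g) Z" by simp
    show "\<sigma> (h \<cdot> n) = zerom D Z (tgt K h)" unfolding hn by (simp add: D.reassoc[OF i1(1)] i1 ob_D)
  qed (use ph in auto)
  moreover have "\<sigma> m \<cdot>\<^bsub>D\<^esub> \<sigma> m = zerom D Z' Z'"
  proof (rule nil[OF T(2)])
    have "m \<cdot> g' = zerom K B Z'" by (simp add: m_def w(2) w'(2))
    then show "m \<cdot> g' = zerom K (src K g') Z'" by simp
    show "\<sigma> (h' \<cdot> m) = zerom D Z' (tgt K h')" unfolding hm by (simp add: D.reassoc[OF i1(2)] i1 ob_D)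
  qed (use ph in auto)
  moreover have "\<sigma> w' \<cdot>\<^bsub>D\<^esub> \<sigma> w = ident D Z \<oplus>\<^bsub>D\<^esub> \<sigma> n" "\<sigma> w \<cdot>\<^bsub>D\<^esub> \<sigma> w' = ident D Z' \<oplus>\<^bsub>D\<^esub> \<sigma> m"
    by (simp_all add: n_def m_def subm_def D.add_ac ob_D)
  ultimately have "iso_arr D Z Z' (\<sigma> w)"
    by - (rule D.iso_of_nilpotent[of "\<sigma> w" Z Z' "\<sigma> w'" "\<sigma> n" "\<sigma> m"], auto)
  then show ?thesis using w by (intro that[of w]) auto
qed

end

section \<open>Comparison of stable quotients\<close>

text \<open>
  Two stable quotients of equivalent triangulated categories with corresponding classes of objects.  The
  target \<open>D'\<close> is triangulated, and from this it is inferred that \<open>D\<close> is.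
\<close>

locale stable_comparison = F: tri_equiv K L FO FM \<phi> + S: stable_quotient K P D \<sigma> i p q +
    S': stable_quotient L P' D' \<sigma>' i' p' q' + D': triangulated_category D'
  for K :: "('o, 'm, 'z) tricat_scheme" and L :: "('u, 'v, 'y) tricat_scheme" and FO FM \<phi> P
    and D :: "('o, 'n, 'x) tricat_scheme" and \<sigma> i p q P' and D' :: "('u, 'w, 't) tricat_scheme" and \<sigma>' i' p' q' +
  assumes P'_image: "P' = F.image_class P"
begin

lemma F_fac:
  assumes "x \<in> arr K" shows "factors_through L P' (FM x) \<longleftrightarrow> factors_through K P x"
proof
  assume "factors_through K P x"
  then obtain Q a b where Q: "Q \<in> P" "a \<in> Hom K (src K x) Q" "b \<in> Hom K Q (tgt K x)" "x = b \<cdot>\<^bsub>K\<^esub> a"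
    by (metis S.P.facE)
  have "FM x = FM b \<cdot>\<^bsub>L\<^esub> FM a" using Q(2,3) unfolding Q(4) by (metis F.F.functor_comp Hom_iff)
  moreover have "FO Q \<in> P'" unfolding P'_image by (rule F.image_classI[OF Q(1) S.P_ob])
  ultimately show "factors_through L P' (FM x)"
    using S'.P.facI[of "FM a" "FO (src K x)" "FO Q" "FM b" "FO (tgt K x)"] F.F.functor_hom[OF Q(2)] F.F.functor_hom[OF Q(3)] by simp
next
  assume f: "factors_through L P' (FM x)"
  define X where "X = src K x"
  define Y where "Y = tgt K x"
  have [simp]: "src K x = X" "tgt K x = Y" by (auto simp: X_def Y_def)
  have ob [simp]: "X \<in> ob K" "Y \<in> ob K" using assms F.K.src_in_ob[of x] F.K.tgt_in_ob[of x] by auto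
  have "FM x \<in> Hom L (FO X) (FO Y)" using assms by simp
  with f obtain B a b where B: "B \<in> P'" "a \<in> Hom L (FO X) B" "b \<in> Hom L B (FO Y)" "FM x = b \<cdot>\<^bsub>L\<^esub> a"
    by (rule S'.P.facE_hom)
  obtain Q e where Q: "Q \<in> P" "iso_arr L (FO Q) B e" using B(1) unfolding P'_image F.image_class_def by blast
  have Qob [simp]: "Q \<in> ob K" using Q S.P_ob by blast
  obtain e' where e: "e \<in> Hom L (FO Q) B" "e' \<in> Hom L B (FO Q)" "e \<cdot>\<^bsub>L\<^esub> e' = ident L B" using Q(2) by (auto elim: F.L.iso_arrE)
  have [unfolded Hom_iff, simp]: "a \<in> Hom L (FO X) B" "b \<in> Hom L B (FO Y)" "e \<in> Hom L (FO Q) B" "e' \<in> Hom L B (FO Q)" using B e by auto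
  have h: "e' \<cdot>\<^bsub>L\<^esub> a \<in> Hom L (FO X) (FO Q)" "b \<cdot>\<^bsub>L\<^esub> e \<in> Hom L (FO Q) (FO Y)" by simp_all
  obtain a' where a': "a' \<in> Hom K X Q" "FM a' = e' \<cdot>\<^bsub>L\<^esub> a" using F.F_full[OF ob(1) Qob h(1)] .
  obtain b' where b': "b' \<in> Hom K Q Y" "FM b' = b \<cdot>\<^bsub>L\<^esub> e" using F.F_full[OF Qob ob(2) h(2)] .
  have "FM x = FM (b' \<cdot>\<^bsub>K\<^esub> a')" using a' b' by (simp add: B(4) F.L.reassoc[OF e(3)])
  then have "x = b' \<cdot>\<^bsub>K\<^esub> a'" by (rule F.F_eqD) (use assms a' b' in auto)
  then show "factors_through K P x" using S.P.facI[OF a'(1) b'(1) Q(1)] by simp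
qed

text \<open>The functor that \<open>F\<close> induces on the quotients.\<close>

definition FbM :: "'n \<Rightarrow> 'w" where
  "FbM S = \<sigma>' (FM (SOME f. f \<in> arr K \<and> \<sigma> f = S))"

lemma FbM_sigma [simp]:
  assumes "f \<in> arr K" shows "FbM (\<sigma> f) = \<sigma>' (FM f)"
proof -
  define f0 where "f0 = (SOME f0. f0 \<in> arr K \<and> \<sigma> f0 = \<sigma> f)"
  have f0: "f0 \<in> arr K \<and> \<sigma> f0 = \<sigma> f" unfolding f0_def by (rule someI[of _ f]) (use assms in simp)
  have st: "src K f0 = src K f" "tgt K f0 = tgt K f"
    using S.sigma_arr f0 assms by metis+
  have "factors_through K P (f0 \<ominus>\<^bsub>K\<^esub> f)" using S.sigma_eq_iff[of f0 f] f0 st assms by simp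
  then have "factors_through L P' (FM f0 \<ominus>\<^bsub>L\<^esub> FM f)" using F_fac[of "f0 \<ominus>\<^bsub>K\<^esub> f"] f0 st assms by simp
  then have "\<sigma>' (FM f0) = \<sigma>' (FM f)" using S'.sigma_eq_iff[of "FM f0" "FM f"] f0 st assms by simp
  then show ?thesis unfolding FbM_def f0_def .
qed

lemma Fb_functor: "additive_functor D D' FO FbM"
proof (unfold_locales)
  show "FO X \<in> ob D'" if "X \<in> ob D" for X using that by (simp add: S.ob_D S'.ob_D)
  show "FbM S \<in> Hom D' (FO X) (FO Y)" if S: "S \<in> Hom D X Y" for S X Y
  proof -
    obtain f where "f \<in> Hom K X Y" "S = \<sigma> f" using S by (rule S.sigma_lift)
    then show ?thesis by auto
  qed
  show "FbM (ident D X) = ident D' (FO X)" if X: "X \<in> ob D" for X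
  proof -
    have X': "X \<in> ob K" using X by (simp add: S.ob_D)
    have "ident D X = \<sigma> (ident K X)" using X' by simp
    then show ?thesis using X' by (simp only: FbM_sigma F.K.ident_arr) simp
  qed
  show "FbM (T \<cdot>\<^bsub>D\<^esub> S) = FbM T \<cdot>\<^bsub>D'\<^esub> FbM S" if ST: "S \<in> Hom D X Y" "T \<in> Hom D Y Z" for S T X Y Z
  proof -
    obtain f where f: "f \<in> Hom K X Y" "S = \<sigma> f" using ST(1) by (rule S.sigma_lift)
    obtain g where g: "g \<in> Hom K Y Z" "T = \<sigma> g" using ST(2) by (rule S.sigma_lift)
    have gf: "g \<cdot>\<^bsub>K\<^esub> f \<in> arr K" using f g by simp
    have "T \<cdot>\<^bsub>D\<^esub> S = \<sigma> (g \<cdot>\<^bsub>K\<^esub> f)" using f g by simp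
    then have "FbM (T \<cdot>\<^bsub>D\<^esub> S) = \<sigma>' (FM (g \<cdot>\<^bsub>K\<^esub> f))" using FbM_sigma[OF gf] by (simp only:)
    also have "\<dots> = FbM T \<cdot>\<^bsub>D'\<^esub> FbM S" using f g by simp
    finally show ?thesis .
  qed
  show "FbM (S \<oplus>\<^bsub>D\<^esub> T) = FbM S \<oplus>\<^bsub>D'\<^esub> FbM T" if ST: "S \<in> Hom D X Y" "T \<in> Hom D X Y" for S T X Y
  proof -
    obtain f where f: "f \<in> Hom K X Y" "S = \<sigma> f" using ST(1) by (rule S.sigma_lift)
    obtain g where g: "g \<in> Hom K X Y" "T = \<sigma> g" using ST(2) by (rule S.sigma_lift)
    have gf: "f \<oplus>\<^bsub>K\<^esub> g \<in> arr K" using f g by simp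
    have "S \<oplus>\<^bsub>D\<^esub> T = \<sigma> (f \<oplus>\<^bsub>K\<^esub> g)" using f g by simp
    then have "FbM (S \<oplus>\<^bsub>D\<^esub> T) = \<sigma>' (FM (f \<oplus>\<^bsub>K\<^esub> g))" using FbM_sigma[OF gf] by (simp only:)
    also have "\<dots> = FbM S \<oplus>\<^bsub>D'\<^esub> FbM T" using f g by simp
    finally show ?thesis .
  qed
qed

sublocale Fb: additive_functor D D' FO FbM
  by (rule Fb_functor)

lemma Fb_equivalence: "additive_equivalence D D' FO FbM"
proof -
  have "equivalence D D' FO FbM"
  proof (rule Fb.equivalenceI)
    fix X Y S assume X: "X \<in> ob D" "Y \<in> ob D" and S: "S \<in> Hom D' (FO X) (FO Y)"
    obtain s where s: "s \<in> Hom L (FO X) (FO Y)" "S = \<sigma>' s" using S by (rule S'.sigma_lift)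
    obtain f where f: "f \<in> Hom K X Y" "FM f = s" using F.F_full[of X Y s] X s S.ob_D by metis
    then show "\<exists>f \<in> Hom D X Y. FbM f = S" using s by (intro bexI[of _ "\<sigma> f"]) auto
  next
    fix X Y S T assume ST: "S \<in> Hom D X Y" "T \<in> Hom D X Y" "FbM S = FbM T"
    obtain f where f: "f \<in> Hom K X Y" "S = \<sigma> f" using ST(1) by (rule S.sigma_lift)
    obtain g where g: "g \<in> Hom K X Y" "T = \<sigma> g" using ST(2) by (rule S.sigma_lift)
    have "\<sigma>' (FM f) = \<sigma>' (FM g)" using ST(3) f g by simp
    then have "factors_through L P' (FM (f \<ominus>\<^bsub>K\<^esub> g))" using S'.sigma_eq_iff[of "FM f" "FM g"] f g by simp
    then have "factors_through K P (f \<ominus>\<^bsub>K\<^esub> g)" using F_fac[of "f \<ominus>\<^bsub>K\<^esub> g"] f g by simp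
    then show "S = T" using S.sigma_eq_iff[of f g] f g by simp
  next
    fix Y assume "Y \<in> ob D'"
    then have "Y \<in> ob L" by (simp add: S'.ob_D)
    then obtain X e where X: "X \<in> ob K" "iso_arr L (FO X) Y e" by (rule F.F_ess_surj)
    then show "\<exists>X\<in>ob D. \<exists>e. iso_arr D' (FO X) Y e"
      using S'.S.functor_iso[OF X(2)] S.ob_D by (intro bexI[of _ X] exI[of _ "\<sigma>' e"]) auto
  qed
  then show ?thesis unfolding additive_equivalence_def using Fb.FM_add by blast
qed

text \<open>
  Maps between the two suspensions of \<open>F X\<close>, the image of the one chosen in \<open>K\<close> and the one chosen in \<open>L\<close>,
  that respect the connecting maps.
\<close>

definition compares :: "'o \<Rightarrow> 'v \<Rightarrow> bool" where
  "compares X \<theta> \<longleftrightarrow> \<theta> \<in> Hom L (FO (tgt K (p X))) (tgt L (p' (FO X))) \<and>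
     q' (FO X) \<cdot>\<^bsub>L\<^esub> \<theta> = \<phi> X \<cdot>\<^bsub>L\<^esub> FM (q X)"

lemma phantom_Fq: "X \<in> ob K \<Longrightarrow> phantom L P' (\<phi> X \<cdot>\<^bsub>L\<^esub> FM (q X))"
  unfolding P'_image by (rule F.phantom_image[OF S.P_ob]) (use S.chosen in auto)

text \<open>
  Both connecting maps are phantoms, so each factors through the other one; the factors are inverse
  modulo \<open>P\<close> because maps into either object are determined modulo \<open>P\<close> by their composite with the
  connecting map.
\<close>

lemma compares_inverse:
  assumes X [simp]: "X \<in> ob K"
  obtains \<theta> \<theta>' where "compares X \<theta>" "\<theta>' \<in> Hom L (tgt L (p' (FO X))) (FO (tgt K (p X)))"
    "\<phi> X \<cdot>\<^bsub>L\<^esub> FM (q X) \<cdot>\<^bsub>L\<^esub> \<theta>' = q' (FO X)"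
    "\<sigma>' (\<theta>' \<cdot>\<^bsub>L\<^esub> \<theta>) = ident D' (FO (tgt K (p X)))" "\<sigma>' (\<theta> \<cdot>\<^bsub>L\<^esub> \<theta>') = ident D' (tgt L (p' (FO X)))"
proof -
  have T: "(FM (i X), FM (p X), \<phi> X \<cdot>\<^bsub>L\<^esub> FM (q X)) \<in> Tri L"
    using F.F_Tri[of "i X" "p X" "q X"] S.chosen[OF X] by simp
  have iP: "tgt L (FM (i X)) \<in> P'" unfolding P'_image using F.image_classI[OF S.chosen_P[OF X] S.P_ob] by simp
  note c = S'.chosen[of "FO X"]
  obtain \<theta> where \<theta>: "\<theta> \<in> Hom L (FO (tgt K (p X))) (tgt L (p' (FO X)))" "q' (FO X) \<cdot>\<^bsub>L\<^esub> \<theta> = \<phi> X \<cdot>\<^bsub>L\<^esub> FM (q X)"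
    by (rule S'.factor_phantom[of "i' (FO X)" "p' (FO X)" "q' (FO X)" "\<phi> X \<cdot>\<^bsub>L\<^esub> FM (q X)" "FO (tgt K (p X))"])
      (use c phantom_Fq in auto)
  obtain \<theta>' where \<theta>': "\<theta>' \<in> Hom L (tgt L (p' (FO X))) (FO (tgt K (p X)))" "\<phi> X \<cdot>\<^bsub>L\<^esub> FM (q X) \<cdot>\<^bsub>L\<^esub> \<theta>' = q' (FO X)"
    by (rule S'.factor_phantom[OF T iP, of "q' (FO X)" "tgt L (p' (FO X))"]) (use c in auto)
  have [unfolded Hom_iff, simp]: "\<theta> \<in> Hom L (FO (tgt K (p X))) (tgt L (p' (FO X)))"
    "\<theta>' \<in> Hom L (tgt L (p' (FO X))) (FO (tgt K (p X)))" using \<theta> \<theta>' by auto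
  have "factors_through L P' (\<theta>' \<cdot>\<^bsub>L\<^esub> \<theta> \<ominus>\<^bsub>L\<^esub> ident L (FO (tgt K (p X))))"
  proof (rule S'.factors_of_eq[OF T iP])
    show "\<phi> X \<cdot>\<^bsub>L\<^esub> FM (q X) \<cdot>\<^bsub>L\<^esub> (\<theta>' \<cdot>\<^bsub>L\<^esub> \<theta>) = \<phi> X \<cdot>\<^bsub>L\<^esub> FM (q X) \<cdot>\<^bsub>L\<^esub> ident L (FO (tgt K (p X)))"
      using F.L.reassoc[OF \<theta>'(2), of \<theta>] \<theta>(2) by simp
  qed auto
  then have "\<sigma>' (\<theta>' \<cdot>\<^bsub>L\<^esub> \<theta>) = \<sigma>' (ident L (FO (tgt K (p X))))"
    by - (rule S'.sigma_eq_iff[THEN iffD2], auto)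
  moreover have "\<sigma>' (\<theta> \<cdot>\<^bsub>L\<^esub> \<theta>') = \<sigma>' (ident L (tgt L (p' (FO X))))"
  proof (rule S'.sigma_eqI[of "FO X"])
    show "q' (FO X) \<cdot>\<^bsub>L\<^esub> (\<theta> \<cdot>\<^bsub>L\<^esub> \<theta>') = q' (FO X) \<cdot>\<^bsub>L\<^esub> ident L (tgt L (p' (FO X)))"
      using F.L.reassoc[OF \<theta>(2), of \<theta>'] \<theta>'(2) by simp
  qed auto
  ultimately show ?thesis using \<theta> \<theta>' by (intro that[of \<theta> \<theta>']) (auto simp: compares_def)
qed

lemma compares_unique:
  assumes "X \<in> ob K" "compares X \<theta>" "compares X \<theta>'" shows "\<sigma>' \<theta> = \<sigma>' \<theta>'"
  by (rule S'.sigma_eqI[of "FO X"]) (use assms in \<open>auto simp: compares_def\<close>)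

definition \<psi> :: "'o \<Rightarrow> 'w" where
  "\<psi> X = \<sigma>' (SOME \<theta>. compares X \<theta>)"

lemma psi_eq:
  assumes "X \<in> ob K" "compares X \<theta>" shows "\<psi> X = \<sigma>' \<theta>"
  unfolding \<psi>_def by (rule compares_unique[OF assms(1) someI[of "compares X", OF assms(2)] assms(2)])

lemma psi_iso: assumes X: "X \<in> ob K" shows "iso_arr D' (FO (susO D X)) (susO D' (FO X)) (\<psi> X)"
proof -
  obtain \<theta> \<theta>' where t: "compares X \<theta>" "\<theta>' \<in> Hom L (tgt L (p' (FO X))) (FO (tgt K (p X)))"
    "\<sigma>' (\<theta>' \<cdot>\<^bsub>L\<^esub> \<theta>) = ident D' (FO (tgt K (p X)))" "\<sigma>' (\<theta> \<cdot>\<^bsub>L\<^esub> \<theta>') = ident D' (tgt L (p' (FO X)))"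
    using compares_inverse[OF X] .
  show ?thesis unfolding psi_eq[OF X t(1)]
    by (rule S'.D.iso_arrI[where g = "\<sigma>' \<theta>'"]) (use t X in \<open>auto simp: S.susO_D S'.susO_D compares_def\<close>)
qed

text \<open>
  Both composites have the same composite with \<open>q'\<close>, and they are determined by it.
\<close>

lemma psi_natural:
  assumes "S \<in> Hom D X Y"
  shows "\<psi> Y \<cdot>\<^bsub>D'\<^esub> FbM (susM D S) = susM D' (FbM S) \<cdot>\<^bsub>D'\<^esub> \<psi> X"
proof -
  obtain f where f: "f \<in> Hom K X Y" "S = \<sigma> f" using assms by (rule S.sigma_lift)
  have [simp]: "X \<in> ob K" "Y \<in> ob K" using F.K.Hom_ob[OF f(1)] by auto
  have [unfolded Hom_iff, simp]: "f \<in> Hom K X Y" using f by auto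
  obtain w where w: "w \<in> Hom K (tgt K (p X)) (tgt K (p Y))" "q Y \<cdot>\<^bsub>K\<^esub> w = susM K f \<cdot>\<^bsub>K\<^esub> q X"
    using S.sus_lift[OF f(1)] .
  have Ff: "FM f \<in> Hom L (FO X) (FO Y)" by simp
  obtain w' where w': "w' \<in> Hom L (tgt L (p' (FO X))) (tgt L (p' (FO Y)))" "q' (FO Y) \<cdot>\<^bsub>L\<^esub> w' = susM L (FM f) \<cdot>\<^bsub>L\<^esub> q' (FO X)"
    using S'.sus_lift[OF Ff] .
  obtain x where x: "compares X x" using compares_inverse[of X] by auto
  obtain y where y: "compares Y y" using compares_inverse[of Y] by auto
  have [unfolded Hom_iff, simp]: "w \<in> Hom K (tgt K (p X)) (tgt K (p Y))"
    "w' \<in> Hom L (tgt L (p' (FO X))) (tgt L (p' (FO Y)))" using w w' by auto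
  have [unfolded Hom_iff, simp]: "x \<in> Hom L (FO (tgt K (p X))) (tgt L (p' (FO X)))"
    "y \<in> Hom L (FO (tgt K (p Y))) (tgt L (p' (FO Y)))"
    and qx: "q' (FO X) \<cdot>\<^bsub>L\<^esub> x = \<phi> X \<cdot>\<^bsub>L\<^esub> FM (q X)" and qy: "q' (FO Y) \<cdot>\<^bsub>L\<^esub> y = \<phi> Y \<cdot>\<^bsub>L\<^esub> FM (q Y)"
    using x y by (auto simp: compares_def)
  have nat: "\<phi> Y \<cdot>\<^bsub>L\<^esub> FM (susM K f) = susM L (FM f) \<cdot>\<^bsub>L\<^esub> \<phi> X" using F.phi_natural[of f] by simp
  have Fw: "FM (q Y) \<cdot>\<^bsub>L\<^esub> FM w = FM (susM K f) \<cdot>\<^bsub>L\<^esub> FM (q X)" using w(2) by (simp flip: F.F.functor_comp)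
  have "\<sigma>' (y \<cdot>\<^bsub>L\<^esub> FM w) = \<sigma>' (w' \<cdot>\<^bsub>L\<^esub> x)"
  proof (rule S'.sigma_eqI[of "FO Y"])
    show "q' (FO Y) \<cdot>\<^bsub>L\<^esub> (y \<cdot>\<^bsub>L\<^esub> FM w) = q' (FO Y) \<cdot>\<^bsub>L\<^esub> (w' \<cdot>\<^bsub>L\<^esub> x)"
      by (simp add: F.L.reassoc[OF qy] F.L.reassoc[OF w'(2)] Fw qx F.L.reassoc[OF nat])
  qed auto
  then show ?thesis
    unfolding f(2) using S.susM_D[OF f(1) w] S'.susM_D[OF Ff w'] psi_eq[OF _ x] psi_eq[OF _ y] by simp
qed

lemma psi_arr [simp]:
  assumes "X \<in> ob K"
  shows "\<psi> X \<in> arr D'" "src D' (\<psi> X) = FO (tgt K (p X))" "tgt D' (\<psi> X) = susO D' (FO X)"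
  using psi_iso[OF assms] S.susO_D[OF assms] by (auto elim: S'.D.iso_arrE)

text \<open>
  The image of the triangle \<open>(g, h, \<Sigma>f \<cdot> q)\<close> and the one that defines a standard triangle on \<open>F f\<close> have
  phantom connecting maps, which correspond to each other under \<open>\<theta>\<close>.  Hence \<open>middle_iso\<close> identifies
  their middle objects in \<open>D'\<close>.
\<close>

lemma std_image:
  assumes f: "f \<in> arr K" and T: "src K g = tgt K f" "tgt K h = tgt K (p (src K f))" "(g, h, susM K f \<cdot>\<^bsub>K\<^esub> q (src K f)) \<in> Tri K"
  shows "(\<sigma>' (FM f), \<sigma>' (FM g), \<psi> (src K f) \<cdot>\<^bsub>D'\<^esub> \<sigma>' (FM h)) \<in> Tri D'"
proof -
  define X where "X = src K f"
  define Y where "Y = tgt K f"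
  define Z where "Z = tgt K g"
  have [unfolded Hom_iff, simp]: "f \<in> Hom K X Y" using f by (auto simp: X_def Y_def)
  have ob [simp]: "X \<in> ob K" "Y \<in> ob K" using F.K.src_in_ob[OF f] F.K.tgt_in_ob[OF f] by auto
  have [unfolded Hom_iff, simp]: "g \<in> Hom K Y Z" "h \<in> Hom K Z (tgt K (p X))"
    using F.K.tri_arrs[OF T(3)] T(1,2) by (auto simp: Z_def)
  have nat: "\<phi> Y \<cdot>\<^bsub>L\<^esub> FM (susM K f) = susM L (FM f) \<cdot>\<^bsub>L\<^esub> \<phi> X" using F.phi_natural[of f] by simp
  define k where "k = susM L (FM f) \<cdot>\<^bsub>L\<^esub> (\<phi> X \<cdot>\<^bsub>L\<^esub> FM (q X))"
  have T1: "(FM g, FM h, k) \<in> Tri L"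
    using F.F_Tri[OF T(3)] by (simp add: k_def F.L.reassoc[OF nat])
  obtain g' h' where "src L g' = tgt L (FM f)" "tgt L h' = tgt L (p' (src L (FM f)))"
     "(g', h', susM L (FM f) \<cdot>\<^bsub>L\<^esub> q' (src L (FM f))) \<in> Tri L"
    using S'.tri_exists[of "FM f"] by auto
  then have T2: "src L g' = FO Y" "tgt L h' = tgt L (p' (FO X))" "(g', h', susM L (FM f) \<cdot>\<^bsub>L\<^esub> q' (FO X)) \<in> Tri L"
    by simp_all
  define Z' where "Z' = tgt L g'"
  have [unfolded Hom_iff, simp]: "g' \<in> Hom L (FO Y) Z'" "h' \<in> Hom L Z' (tgt L (p' (FO X)))"
    using F.L.tri_arrs[OF T2(3)] T2(1,2) by (auto simp: Z'_def)
  have Z'ob [simp]: "Z' \<in> ob L" using F.L.tgt_in_ob[of g'] by simp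
  have p1: "phantom L P' k" unfolding k_def by (rule S'.phantom_cmp[OF phantom_Fq]) auto
  have p2: "phantom L P' (susM L (FM f) \<cdot>\<^bsub>L\<^esub> q' (FO X))"
    by (rule S'.phantom_cmp) (use S'.chosen[of "FO X"] in auto)
  obtain \<theta> \<theta>' where t: "compares X \<theta>" "\<theta>' \<in> Hom L (tgt L (p' (FO X))) (FO (tgt K (p X)))"
    "\<phi> X \<cdot>\<^bsub>L\<^esub> FM (q X) \<cdot>\<^bsub>L\<^esub> \<theta>' = q' (FO X)"
    "\<sigma>' (\<theta>' \<cdot>\<^bsub>L\<^esub> \<theta>) = ident D' (FO (tgt K (p X)))" "\<sigma>' (\<theta> \<cdot>\<^bsub>L\<^esub> \<theta>') = ident D' (tgt L (p' (FO X)))"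
    using compares_inverse[OF ob(1)] .
  have [unfolded Hom_iff, simp]: "\<theta> \<in> Hom L (FO (tgt K (p X))) (tgt L (p' (FO X)))"
    "\<theta>' \<in> Hom L (tgt L (p' (FO X))) (FO (tgt K (p X)))"
    and qt: "q' (FO X) \<cdot>\<^bsub>L\<^esub> \<theta> = \<phi> X \<cdot>\<^bsub>L\<^esub> FM (q X)" using t by (auto simp: compares_def)
  have qt': "\<phi> X \<cdot>\<^bsub>L\<^esub> (FM (q X) \<cdot>\<^bsub>L\<^esub> \<theta>') = q' (FO X)" using t(3) by simp
  obtain w where w: "w \<in> Hom L (FO Z) Z'" "w \<cdot>\<^bsub>L\<^esub> FM g = g'" "h' \<cdot>\<^bsub>L\<^esub> w = \<theta> \<cdot>\<^bsub>L\<^esub> FM h" "iso_arr D' (FO Z) Z' (\<sigma>' w)"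
  proof (rule S'.middle_iso[OF T1 T2(3) _ _ p1 p2, of "FO Y" \<theta> \<theta>'])
    show "susM L (FM f) \<cdot>\<^bsub>L\<^esub> q' (FO X) \<cdot>\<^bsub>L\<^esub> \<theta> = k" by (simp add: k_def qt)
    show "k \<cdot>\<^bsub>L\<^esub> \<theta>' = susM L (FM f) \<cdot>\<^bsub>L\<^esub> q' (FO X)" by (simp add: k_def qt')
  qed (use t that in auto)
  have [unfolded Hom_iff, simp]: "w \<in> Hom L (FO Z) Z'" using w by auto
  interpret D': suspended_category D' by unfold_locales (rule D'.sus_equivalence)
  have sO: "susO D' (FO X) = tgt L (p' (FO X))" using S'.susO_D by simp
  have "tri_iso D' (\<sigma>' (FM f), \<sigma>' g', \<sigma>' h') (\<sigma>' (FM f), \<sigma>' g', \<sigma>' h')"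
    by (rule D'.tri_iso_refl[of _ "FO X" "FO Y" _ Z']) (auto simp: sO)
  then have "(\<sigma>' (FM f), \<sigma>' g', \<sigma>' h') \<in> Tri D'"
    unfolding S'.Tri_D using T2 by (intro exI[of _ "FM f"] exI[of _ g'] exI[of _ h']) simp
  then have "(\<sigma>' (FM f), \<sigma>' (FM g), \<psi> X \<cdot>\<^bsub>D'\<^esub> \<sigma>' (FM h)) \<in> Tri D'"
  proof (rule D'.tri_isoI[of _ _ _ _ "FO X" "FO Y" _ "FO Z" _ "ident D' (FO X)" "ident D' (FO Y)" "\<sigma>' w"])
    show "iso_arr D' (FO X) (src D' (\<sigma>' (FM f))) (ident D' (FO X))" "iso_arr D' (FO Y) (tgt D' (\<sigma>' (FM f))) (ident D' (FO Y))"
      using S'.D.iso_ident[of "FO X"] S'.D.iso_ident[of "FO Y"] by (simp_all add: S'.ob_D)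
    show "\<sigma>' w \<cdot>\<^bsub>D'\<^esub> \<sigma>' (FM g) = \<sigma>' g' \<cdot>\<^bsub>D'\<^esub> ident D' (FO Y)"
      using w(2) by (simp flip: S'.S.functor_comp)
    have "\<sigma>' h' \<cdot>\<^bsub>D'\<^esub> \<sigma>' w = \<sigma>' \<theta> \<cdot>\<^bsub>D'\<^esub> \<sigma>' (FM h)" using w(3) by (simp flip: S'.S.functor_comp)
    then show "susM D' (ident D' (FO X)) \<cdot>\<^bsub>D'\<^esub> (\<psi> X \<cdot>\<^bsub>D'\<^esub> \<sigma>' (FM h)) = \<sigma>' h' \<cdot>\<^bsub>D'\<^esub> \<sigma>' w"
      unfolding psi_eq[OF ob(1) t(1)] by (simp add: S'.ob_D sO)
  qed (use w(4) in \<open>auto simp: sO S.susO_D\<close>)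
  then show ?thesis by simp
qed

text \<open>
  An arbitrary triangle is isomorphic to a standard one, and \<open>\<psi>\<close> is natural.
\<close>

lemma Fb_Tri:
  assumes "(F, G, H) \<in> Tri D"
  shows "(FbM F, FbM G, \<psi> (src D F) \<cdot>\<^bsub>D'\<^esub> FbM H) \<in> Tri D'"
proof -
  obtain f g h where f [simp]: "f \<in> arr K" and T: "src K g = tgt K f" "tgt K h = tgt K (p (src K f))"
        "(g, h, susM K f \<cdot>\<^bsub>K\<^esub> q (src K f)) \<in> Tri K" and iso: "tri_iso D (\<sigma> f, \<sigma> g, \<sigma> h) (F, G, H)"
    using assms unfolding S.Tri_D by blast
  obtain x y z where t: "F \<in> arr D" "G \<in> arr D" "H \<in> arr D" "src D G = tgt D F" "src D H = tgt D G" "tgt D H = susO D (src D F)"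
     and i: "iso_arr D (src D (\<sigma> f)) (src D F) x" "iso_arr D (tgt D (\<sigma> f)) (tgt D F) y" "iso_arr D (tgt D (\<sigma> g)) (tgt D G) z"
     "y \<cdot>\<^bsub>D\<^esub> \<sigma> f = F \<cdot>\<^bsub>D\<^esub> x" "z \<cdot>\<^bsub>D\<^esub> \<sigma> g = G \<cdot>\<^bsub>D\<^esub> y" "susM D x \<cdot>\<^bsub>D\<^esub> \<sigma> h = H \<cdot>\<^bsub>D\<^esub> z"
    using iso unfolding tri_iso_iff by blast
  define X where "X = src K f"
  define X' where "X' = src D F"
  have ob [simp]: "X \<in> ob K" "X' \<in> ob K" using F.K.src_in_ob[OF f] S.D.src_in_ob[OF t(1)] by (simp_all add: X_def X'_def S.ob_D)
  have [unfolded Hom_iff, simp]: "src K f = X" "g \<in> arr K" "src K g = tgt K f" "h \<in> Hom K (tgt K g) (tgt K (p X))"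
    using F.K.tri_arrs[OF T(3)] T(1,2) by (auto simp: X_def)
  have [simp]: "F \<in> arr D" "src D F = X'" "G \<in> arr D" "H \<in> arr D" "src D G = tgt D F" "src D H = tgt D G" "tgt D H = tgt K (p X')"
  proof -
    show "tgt D H = tgt K (p X')" using t(6) S.susO_D[OF ob(2)] unfolding X'_def by simp
  qed (use t in \<open>simp_all add: X'_def\<close>)
  have [unfolded Hom_iff, simp]: "x \<in> Hom D X X'" "y \<in> Hom D (tgt K f) (tgt D F)" "z \<in> Hom D (tgt K g) (tgt D G)" using i(1-3) by (simp_all add: iso_arr_def)
  have sx [simp]: "susM D x \<in> arr D" "src D (susM D x) = tgt K (p X)" "tgt D (susM D x) = tgt K (p X')"
  proof -
    have "x \<in> Hom D X X'" by simp
    then obtain x0 where x0: "x0 \<in> Hom K X X'" "x = \<sigma> x0" by (rule S.sigma_lift)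
    obtain w where w: "w \<in> Hom K (tgt K (p X)) (tgt K (p X'))" "q X' \<cdot>\<^bsub>K\<^esub> w = susM K x0 \<cdot>\<^bsub>K\<^esub> q X" using S.sus_lift[OF x0(1)] .
    show "susM D x \<in> arr D" "src D (susM D x) = tgt K (p X)" "tgt D (susM D x) = tgt K (p X')"
      using S.susM_D[OF x0(1) w] x0(2) w(1) by auto
  qed
  have sO: "susO D' (FO A) = tgt L (p' (FO A))" if "A \<in> ob K" for A using S'.susO_D that by simp
  have nat: "susM D' (FbM x) \<cdot>\<^bsub>D'\<^esub> \<psi> X = \<psi> X' \<cdot>\<^bsub>D'\<^esub> FbM (susM D x)" using psi_natural[of x X X'] by simp
  have sq: "FbM y \<cdot>\<^bsub>D'\<^esub> FbM (\<sigma> f) = FbM F \<cdot>\<^bsub>D'\<^esub> FbM x" "FbM z \<cdot>\<^bsub>D'\<^esub> FbM (\<sigma> g) = FbM G \<cdot>\<^bsub>D'\<^esub> FbM y"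
    "FbM (susM D x) \<cdot>\<^bsub>D'\<^esub> FbM (\<sigma> h) = FbM H \<cdot>\<^bsub>D'\<^esub> FbM z"
    using i(4-6) by (simp_all flip: Fb.functor_comp del: FbM_sigma)
  have "tri_iso D' (FbM (\<sigma> f), FbM (\<sigma> g), \<psi> X \<cdot>\<^bsub>D'\<^esub> FbM (\<sigma> h)) (FbM F, FbM G, \<psi> X' \<cdot>\<^bsub>D'\<^esub> FbM H)"
    unfolding tri_iso_iff
  proof (intro exI conjI)
    show "iso_arr D' (src D' (FbM (\<sigma> f))) (src D' (FbM F)) (FbM x)" using Fb.functor_iso[OF i(1)] by simp
    show "iso_arr D' (tgt D' (FbM (\<sigma> f))) (tgt D' (FbM F)) (FbM y)" using Fb.functor_iso[OF i(2)] by simp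
    show "iso_arr D' (tgt D' (FbM (\<sigma> g))) (tgt D' (FbM G)) (FbM z)" using Fb.functor_iso[OF i(3)] by simp
    show "susM D' (FbM x) \<cdot>\<^bsub>D'\<^esub> (\<psi> X \<cdot>\<^bsub>D'\<^esub> FbM (\<sigma> h)) = \<psi> X' \<cdot>\<^bsub>D'\<^esub> FbM H \<cdot>\<^bsub>D'\<^esub> FbM z"
      using sq(3) S'.D.reassoc[OF nat, of "FbM (\<sigma> h)"] by simp
  qed (use sq(1,2) sO in simp_all)
  moreover have "(FbM (\<sigma> f), FbM (\<sigma> g), \<psi> X \<cdot>\<^bsub>D'\<^esub> FbM (\<sigma> h)) \<in> Tri D'"
    using std_image[OF f T] by simp
  ultimately show ?thesis using D'.tri_iso_closed by simp
qed

text \<open>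
  There is a standard triangle on \<open>F\<close>.  Its image is isomorphic to the given triangle of \<open>D'\<close> by the five
  lemma in \<open>D'\<close>, and this isomorphism comes from \<open>D\<close>.
\<close>

lemma Tri_reflect:
  assumes t: "F \<in> arr D" "G \<in> arr D" "H \<in> arr D" "src D G = tgt D F" "src D H = tgt D G" "tgt D H = susO D (src D F)"
    and T: "(FbM F, FbM G, \<psi> (src D F) \<cdot>\<^bsub>D'\<^esub> FbM H) \<in> Tri D'"
  shows "(F, G, H) \<in> Tri D"
proof -
  define X where "X = src D F"
  define Y where "Y = tgt D F"
  define Z where "Z = tgt D G"
  have ob [simp]: "X \<in> ob K" "Y \<in> ob K" "Z \<in> ob K"
    using S.D.src_in_ob[OF t(1)] S.D.tgt_in_ob[OF t(1)] S.D.tgt_in_ob[OF t(2)] by (simp_all add: X_def Y_def Z_def S.ob_D)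
  have [simp]: "F \<in> arr D" "src D F = X" "tgt D F = Y" "G \<in> arr D" "H \<in> arr D" "src D G = Y" "tgt D G = Z" "src D H = Z" "tgt D H = tgt K (p X)"
  proof -
    show "tgt D H = tgt K (p X)" using t(6) S.susO_D[OF ob(1)] unfolding X_def by simp
  qed (use t in \<open>simp_all add: X_def Y_def Z_def\<close>)
  have "F \<in> Hom D X Y" by simp
  then obtain f where f: "f \<in> Hom K X Y" "F = \<sigma> f" by (rule S.sigma_lift)
  have f' [simp]: "f \<in> arr K" "src K f = X" "tgt K f = Y" using f by auto
  obtain g h where g: "src K g = tgt K f" "tgt K h = tgt K (p (src K f))" "(g, h, susM K f \<cdot>\<^bsub>K\<^esub> q (src K f)) \<in> Tri K"
    using S.tri_exists[OF f'(1)] by blast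
  define W where "W = tgt K g"
  have [unfolded Hom_iff, simp]: "g \<in> Hom K Y W" "h \<in> Hom K W (tgt K (p X))"
    using F.K.tri_arrs[OF g(3)] g(1,2) by (auto simp: W_def)
  have Wob [simp]: "W \<in> ob K" using F.K.tgt_in_ob[of g] by simp
  have T0: "(FbM (\<sigma> f), FbM (\<sigma> g), \<psi> X \<cdot>\<^bsub>D'\<^esub> FbM (\<sigma> h)) \<in> Tri D'" using std_image[OF f'(1) g] by simp
  have T1: "(FbM (\<sigma> f), FbM G, \<psi> X \<cdot>\<^bsub>D'\<^esub> FbM H) \<in> Tri D'" using T f(2) by simp
  have sO: "susO D' (FO X) = tgt L (p' (FO X))" using S'.susO_D by simp
  have obD: "FO X \<in> ob D'" "FO Y \<in> ob D'" "X \<in> ob D" "Y \<in> ob D" by (simp_all add: S'.ob_D S.ob_D)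
  obtain w where w: "iso_arr D' (tgt D' (FbM (\<sigma> g))) (tgt D' (FbM G)) w" "w \<cdot>\<^bsub>D'\<^esub> FbM (\<sigma> g) = FbM G \<cdot>\<^bsub>D'\<^esub> ident D' (FO Y)"
      "susM D' (ident D' (FO X)) \<cdot>\<^bsub>D'\<^esub> (\<psi> X \<cdot>\<^bsub>D'\<^esub> FbM (\<sigma> h)) = \<psi> X \<cdot>\<^bsub>D'\<^esub> FbM H \<cdot>\<^bsub>D'\<^esub> w"
    by (rule D'.tri_iso_of_isos[OF T0 T1, of "ident D' (FO X)" "ident D' (FO Y)"])
      (use S'.D.iso_ident[OF obD(1)] S'.D.iso_ident[OF obD(2)] in auto)
  have w': "w \<in> Hom D' (FO W) (FO Z)" using w(1) by (auto elim: S'.D.iso_arrE)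
  obtain v where v: "v \<in> Hom D W Z" "FbM v = w"
    by (rule equivalence_full[OF additive_equivalenceD(1)[OF Fb_equivalence] _ _ w']) (auto simp: S.ob_D)
  have [unfolded Hom_iff, simp]: "v \<in> Hom D W Z" using v by auto
  have vi: "iso_arr D W Z v"
    by (rule equivalence_reflects_iso[OF additive_equivalenceD(1)[OF Fb_equivalence] v(1)]) (use w(1) v(2) in simp)
  have inj: "A = B" if "FbM A = FbM B" "A \<in> Hom D M N" "B \<in> Hom D M N" for A B M N
    using equivalence_faithful[OF additive_equivalenceD(1)[OF Fb_equivalence] that(2,3,1)] .
  have 1: "v \<cdot>\<^bsub>D\<^esub> \<sigma> g = G"
  proof (rule inj[of _ _ Y Z])
    show "FbM (v \<cdot>\<^bsub>D\<^esub> \<sigma> g) = FbM G" using w(2) v(2) by simp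
  qed auto
  have 2: "\<sigma> h = H \<cdot>\<^bsub>D\<^esub> v"
  proof (rule inj[of _ _ W "tgt K (p X)"])
    have "\<psi> X \<cdot>\<^bsub>D'\<^esub> FbM (\<sigma> h) = \<psi> X \<cdot>\<^bsub>D'\<^esub> FbM (H \<cdot>\<^bsub>D\<^esub> v)"
      using w(3) v(2) w' obD(1) by (simp add: sO)
    then show "FbM (\<sigma> h) = FbM (H \<cdot>\<^bsub>D\<^esub> v)"
      by - (rule S'.D.iso_cancel_left[OF psi_iso[OF ob(1)], of _ "FO W"], auto simp: S.susO_D)
  qed auto
  have sid: "susM D (ident D X) = ident D (tgt K (p X))"
  proof -
    have "susM D (\<sigma> (ident K X)) = \<sigma> (ident K (tgt K (p X)))" by (rule S.susM_D[of _ X X]) auto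
    then show ?thesis by simp
  qed
  have "tri_iso D (\<sigma> f, \<sigma> g, \<sigma> h) (F, G, H)"
    unfolding tri_iso_iff
    by (rule exI[of _ "ident D X"], rule exI[of _ "ident D Y"], rule exI[of _ v])
      (use S.D.iso_ident[OF obD(3)] S.D.iso_ident[OF obD(4)] obD vi 1 2 in \<open>simp add: sid S.susO_D f(2)[symmetric]\<close>)
  then show ?thesis unfolding S.Tri_D using g f'(1) by blast
qed

lemma comparison_equivalence: "triangle_equivalence D D' FO FbM \<psi>"
  unfolding triangle_equivalence_def natural_iso_def
proof (intro conjI ballI)
  show "additive_equivalence D D' FO FbM" by (rule Fb_equivalence)
next
  fix X assume "X \<in> ob D" then show "iso_arr D' ((FO \<circ> susO D) X) ((susO D' \<circ> FO) X) (\<psi> X)"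
    using psi_iso by (simp add: S.ob_D)
next
  fix X Y S assume "S \<in> Hom D X Y"
  then show "\<psi> Y \<cdot>\<^bsub>D'\<^esub> (FbM \<circ> susM D) S = (susM D' \<circ> FbM) S \<cdot>\<^bsub>D'\<^esub> \<psi> X"
    unfolding comp_apply by (rule psi_natural)
next
  fix T assume "T \<in> Tri D"
  then show "case T of (f, g, h) \<Rightarrow> (FbM f, FbM g, \<psi> (src D f) \<cdot>\<^bsub>D'\<^esub> FbM h) \<in> Tri D'"
    by (cases T) (auto intro: Fb_Tri)
qed

theorem quotient_triangulated: "triangulated_category D"
proof -
  have "tri_transfer D D' FO FbM \<psi>"
  proof unfold_locales
    show "additive_equivalence D D' FO FbM" by (rule Fb_equivalence)
    show "susO D X \<in> ob D" if "X \<in> ob D" for X using that by (simp add: S.ob_D S.susO_D)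
    show "susM D S \<in> Hom D (susO D X) (susO D Y)" if S: "S \<in> Hom D X Y" for S X Y
    proof -
      obtain x where x: "x \<in> Hom K X Y" "S = \<sigma> x" using S by (rule S.sigma_lift)
      obtain w where w: "w \<in> Hom K (tgt K (p X)) (tgt K (p Y))" "q Y \<cdot>\<^bsub>K\<^esub> w = susM K x \<cdot>\<^bsub>K\<^esub> q X" using S.sus_lift[OF x(1)] .
      have "X \<in> ob K" "Y \<in> ob K" using F.K.Hom_ob[OF x(1)] by auto
      then show ?thesis using S.susM_D[OF x(1) w] x(2) w(1) by (simp add: S.susO_D)
    qed
    show "iso_arr D' (FO (susO D X)) (susO D' (FO X)) (\<psi> X)" if "X \<in> ob D" for X using that psi_iso by (simp add: S.ob_D)
    show "\<psi> Y \<cdot>\<^bsub>D'\<^esub> FbM (susM D S) = susM D' (FbM S) \<cdot>\<^bsub>D'\<^esub> \<psi> X" if "S \<in> Hom D X Y" for S X Y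
      using that by (rule psi_natural)
    fix F G H
    have "F \<in> arr D \<and> G \<in> arr D \<and> H \<in> arr D \<and> src D G = tgt D F \<and> src D H = tgt D G \<and> tgt D H = susO D (src D F)"
      if T: "(F, G, H) \<in> Tri D"
    proof -
      obtain f g h where "tri_iso D (\<sigma> f, \<sigma> g, \<sigma> h) (F, G, H)" using T unfolding S.Tri_D by blast
      then show ?thesis unfolding tri_iso_iff by blast
    qed
    then show "(F, G, H) \<in> Tri D \<longleftrightarrow> F \<in> arr D \<and> G \<in> arr D \<and> H \<in> arr D \<and> src D G = tgt D F \<and>
       src D H = tgt D G \<and> tgt D H = susO D (src D F) \<and> (FbM F, FbM G, \<psi> (src D F) \<cdot>\<^bsub>D'\<^esub> FbM H) \<in> Tri D'"
      using Fb_Tri Tri_reflect by blast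
  qed
  then interpret tri_transfer D D' FO FbM \<psi> .
  show ?thesis by (rule K_triangulated)
qed

end

section \<open>The relative stable category as a stable quotient\<close>

locale frobenius_class_choice = frobenius_class K E
  for K :: "('o, 'm) tricat" (structure) and E +
  fixes i p q :: "'o \<Rightarrow> 'm"
  assumes choice: "injective_triangles K E i p q"
begin

abbreviation "P \<equiv> E_proj K E"
abbreviation "R \<equiv> relative_stable_category K E i p q"

sublocale I: frobenius_ideal K P
  by (rule frobenius_ideal)

sublocale A: additive_ideal K P
  by (rule I.P_ideal)

sublocale Q: additive_quotient K P R
  unfolding relative_stable_category_def Let_def by (rule A.additive_quotient_with_triangles)

abbreviation "\<pi> \<equiv> cls K P"

lemma choice_E: "X \<in> ob K \<Longrightarrow> (i X, p X, q X) \<in> E"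
  using choice E_of_mono unfolding injective_triangles_def by blast

lemma choice_Tri: "X \<in> ob K \<Longrightarrow> (i X, p X, q X) \<in> Tri K"
  using choice unfolding injective_triangles_def by blast

lemma choice_arr [simp]:
  assumes "X \<in> ob K"
  shows "i X \<in> arr K" "src K (i X) = X" "p X \<in> arr K" "src K (p X) = tgt K (i X)" "q X \<in> arr K"
    "src K (q X) = tgt K (p X)" "tgt K (q X) = susO K X" "tgt K (i X) \<in> P"
  using choice tri_arrs[OF choice_Tri[OF assms]] assms E_proj_eq_inj unfolding injective_triangles_def by auto

lemma susO_R: "susO R X = tgt K (p X)"
  by (simp add: relative_stable_category_def Let_def)

text \<open>
  The definition chooses a representative \<open>f0\<close> and a completion \<open>w0\<close>.  Changing the representative by a map
  through \<open>P\<close> does not change \<open>\<Sigma>f \<cdot> q X\<close>, since \<open>q X\<close> is a cophantom, and this composite determines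
  the class of the completion.
\<close>

lemma susM_R:
  assumes f: "f \<in> Hom K X Y" and w: "w \<in> Hom K (tgt K (p X)) (tgt K (p Y))" "q Y \<cdot> w = susM K f \<cdot> q X"
  shows "susM R (\<pi> f) = \<pi> w"
proof -
  have ob [simp]: "X \<in> ob K" "Y \<in> ob K" using Hom_ob[OF f] by auto
  have [unfolded Hom_iff, simp]: "f \<in> Hom K X Y" "w \<in> Hom K (tgt K (p X)) (tgt K (p Y))" using f w by auto
  define W where "W = (\<lambda>w. \<exists>f0 \<in> \<pi> f. \<exists>v. tri_morphism K (i (src K f0), p (src K f0), q (src K f0))
      (i (tgt K f0), p (tgt K f0), q (tgt K f0)) f0 v w)"
  define w0 where "w0 = (SOME w. W w)"
  obtain v where v: "v \<in> Hom K (tgt K (i X)) (tgt K (i Y))" "v \<cdot> i X = i Y \<cdot> f" "w \<cdot> p X = p Y \<cdot> v"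
    by (rule complete_middle[OF choice_Tri[OF ob(1)] choice_Tri[OF ob(2)], of f w]) (use w in auto)
  have "tri_morphism K (i X, p X, q X) (i Y, p Y, q Y) f v w" using v w by (simp add: tri_morphism_def)
  moreover have "f \<in> \<pi> f" by (rule A.cls_self) simp
  ultimately have "W w" unfolding W_def by (intro bexI[of _ f] exI[of _ v]) auto
  then have "W w0" unfolding w0_def by (rule someI)
  then obtain f0 v0 where f0: "f0 \<in> \<pi> f" and m: "tri_morphism K (i (src K f0), p (src K f0), q (src K f0))
      (i (tgt K f0), p (tgt K f0), q (tgt K f0)) f0 v0 w0" unfolding W_def by blast
  have f0': "f0 \<in> arr K" "src K f0 = X" "tgt K f0 = Y" "A.fac (f0 \<ominus> f)" using f0 by (simp_all add: A.mem_cls)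
  have w0: "w0 \<in> Hom K (tgt K (p X)) (tgt K (p Y))" "susM K f0 \<cdot> q X = q Y \<cdot> w0"
    using m f0'(2,3) unfolding tri_morphism_def by simp_all
  have "f0 \<ominus> f \<in> Hom K X Y" using f0' by simp
  then obtain B a b where B: "B \<in> P" "a \<in> Hom K X B" "b \<in> Hom K B Y" "f0 \<ominus> f = b \<cdot> a"
    by (rule A.facE_hom[OF f0'(4)])
  have Bob [simp]: "B \<in> ob K" using B(1) I.P_ob by blast
  have "cophantom K P (src K (i X)) (q X)" using E_cophantom[OF choice_E[OF ob(1)]] E_proj_eq_inj by simp
  then have "susM K a \<cdot> q X = zerom K (tgt K (p X)) (susO K B)" using B(1,2) unfolding cophantom_def by fastforce
  then have "susM K (b \<cdot> a) \<cdot> q X = zerom K (tgt K (p X)) (susO K Y)" using B(2,3) by simp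
  then have "susM K (f0 \<ominus> f) \<cdot> q X = zerom K (tgt K (p X)) (susO K Y)" by (simp only: B(4))
  then have "susM K f0 \<cdot> q X = susM K f \<cdot> q X"
    using f0' sub_eq_zero_iff[of "susM K f0 \<cdot> q X" "susM K f \<cdot> q X"] by simp
  then have "q Y \<cdot> w0 = q Y \<cdot> w" using w0(2) w(2) by simp
  then have "A.fac (w0 \<ominus> w)"
    using I.factors_of_eq[OF choice_Tri[OF ob(2)], of w0 "tgt K (p X)" w] w0 w by simp
  then have "\<pi> w0 = \<pi> w" by - (rule A.cls_eq_iff[THEN iffD2], use w0(1) in auto)
  then show ?thesis by (simp add: relative_stable_category_def Let_def w0_def W_def)
qed

definition std_triangles :: "('m set \<times> 'm set \<times> 'm set) set" where
  "std_triangles = {(\<pi> f, \<pi> g, \<pi> h) | f g h. \<exists>X Y f' k.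
          f \<in> Hom K X Y \<and> homotopy_cartesian K (i X) f f' g \<and> (g, h, k) \<in> Tri K \<and>
          tri_morphism K (i X, p X, q X) (g, h, k) f f' (ident K (tgt K (p X)))}"

lemma Tri_R: "T \<in> Tri R \<longleftrightarrow> (\<exists>S \<in> std_triangles. tri_iso R S T)"
  unfolding std_triangles_def relative_stable_category_def Let_def Tri_with_triangles by simp

text \<open>
  There is a homotopy pushout with connecting map \<open>\<Sigma>f \<cdot> q X\<close>.  The triangle on \<open>g\<close> is isomorphic to its
  triangle by a map that is the identity on the outer objects, and this isomorphism carries the
  homotopy cartesian square over.
\<close>

lemma homotopy_cartesian_of_third:
  assumes f: "f \<in> Hom K X Y" and T: "(g, h, susM K f \<cdot> q X) \<in> Tri K" "src K g = Y" "tgt K h = tgt K (p X)"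
  obtains f' where "homotopy_cartesian K (i X) f f' g"
    "tri_morphism K (i X, p X, q X) (g, h, susM K f \<cdot> q X) f f' (ident K (tgt K (p X)))"
proof -
  have ob [simp]: "X \<in> ob K" "Y \<in> ob K" using Hom_ob[OF f] by auto
  define Z where "Z = tgt K g"
  have [unfolded Hom_iff, simp]: "f \<in> Hom K X Y" "g \<in> Hom K Y Z" "h \<in> Hom K Z (tgt K (p X))"
    using f T(2,3) tri_arrs[OF T(1)] by (auto simp: Z_def)
  obtain f0 g0 h0 k0 where hc: "homotopy_cartesian K (i X) f f0 g0" and T0: "(g0, h0, k0) \<in> Tri K"
    and m: "tri_morphism K (i X, p X, q X) (g0, h0, k0) f f0 (ident K (tgt K (p X)))"
    and th: "tgt K h0 = tgt K (p X)" and k0: "k0 = susM K f \<cdot> q X"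
    by (rule homotopy_pushout[OF choice_Tri[OF ob(1)], of f Y]) (use f in auto)
  define Z0 where "Z0 = tgt K g0"
  have m0: "f \<in> Hom K X (src K g0)" "f0 \<in> Hom K (tgt K (i X)) Z0" "f0 \<cdot> i X = g0 \<cdot> f" "p X = h0 \<cdot> f0"
    using m unfolding tri_morphism_def prod.case Z0_def by simp_all
  have [unfolded Hom_iff, simp]: "g0 \<in> Hom K Y Z0" "h0 \<in> Hom K Z0 (tgt K (p X))" "f0 \<in> Hom K (tgt K (i X)) Z0"
    using m0(1,2) th tri_arrs[OF T0] by (auto simp: Z0_def)
  have zob [simp]: "Z \<in> ob K" "Z0 \<in> ob K" using tgt_in_ob[of g] tgt_in_ob[of g0] by simp_all
  have T0': "(g0, h0, susM K f \<cdot> q X) \<in> Tri K" using T0 k0 by simp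
  obtain v where v: "v \<in> Hom K (tgt K g) (tgt K g0)" "v \<cdot> g = g0 \<cdot> ident K Y" "ident K (tgt K (p X)) \<cdot> h = h0 \<cdot> v"
    by (rule complete_middle[OF T(1) T0', of "ident K Y" "ident K (tgt K (p X))"]) auto
  have [unfolded Hom_iff, simp]: "v \<in> Hom K Z Z0" using v by auto
  have vi: "iso_arr K Z Z0 v"
    using five_middle[OF T(1) T0' v] by (simp add: iso_ident)
  have vg: "v \<cdot> g = g0" and hv: "h0 \<cdot> v = h" using v by simp_all
  obtain v' where v': "v' \<in> Hom K Z0 Z" "v' \<cdot> v = ident K Z" "v \<cdot> v' = ident K Z0" using vi by (auto elim: iso_arrE)
  have [unfolded Hom_iff, simp]: "v' \<in> Hom K Z0 Z" using v' by auto
  define f' where "f' = v' \<cdot> f0"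
  have [unfolded Hom_iff, simp]: "f' \<in> Hom K (tgt K (i X)) Z" by (simp_all add: f'_def)
  have vf: "v \<cdot> f' = f0" by (simp add: f'_def reassoc[OF v'(3)])
  have v'g: "v' \<cdot> g0 = g" using reassoc[OF v'(2), of g] by (simp add: vg)
  have hv': "h \<cdot> v' = h0" using hv v'(3) by (simp flip: hv)
  have "f' \<cdot> i X = g \<cdot> f" by (simp add: f'_def m0(3) reassoc[OF v'g])
  moreover have "h \<cdot> f' = p X" by (simp add: f'_def reassoc[OF hv'] m0(4))
  ultimately have m': "tri_morphism K (i X, p X, q X) (g, h, susM K f \<cdot> q X) f f' (ident K (tgt K (p X)))"
    by (simp add: tri_morphism_def)
  obtain S i1 i2 p1 p2 d where S: "biproduct K (tgt K (i X)) Y S i1 i2 p1 p2"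
    and Td: "(i1 \<cdot> i X \<oplus> i2 \<cdot> f, f0 \<cdot> p1 \<ominus> g0 \<cdot> p2, d) \<in> Tri K"
  proof -
    obtain X1 Y1 X1' Y1' S i1 i2 p1 p2 d where *: "i X \<in> Hom K X1 Y1" "f \<in> Hom K X1 X1'" "f0 \<in> Hom K Y1 Y1'" "g0 \<in> Hom K X1' Y1'"
      "biproduct K Y1 X1' S i1 i2 p1 p2" "(i1 \<cdot> i X \<oplus> i2 \<cdot> f, f0 \<cdot> p1 \<ominus> g0 \<cdot> p2, d) \<in> Tri K"
      using hc unfolding homotopy_cartesian_def by blast
    have "Y1 = tgt K (i X)" "X1' = Y" using * by auto
    then show thesis using * that by blast
  qed
  note [simp] = biproduct_simps[OF S]
  have [unfolded Hom_iff, simp]: "d \<in> Hom K Z0 (susO K X)" using tri_arrs[OF Td] by auto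
  have "(i1 \<cdot> i X \<oplus> i2 \<cdot> f, f' \<cdot> p1 \<ominus> g \<cdot> p2, d \<cdot> v) \<in> Tri K"
    by (rule tri_isoI[OF Td, of _ X S _ Z _ "ident K X" "ident K S" v])
      (use vi in \<open>simp_all add: iso_ident reassoc[OF vf] reassoc[OF vg]\<close>)
  then have "homotopy_cartesian K (i X) f f' g"
    unfolding homotopy_cartesian_def
    by - (rule exI[of _ X], rule exI[of _ "tgt K (i X)"], rule exI[of _ Y], rule exI[of _ Z], rule exI[of _ S],
        rule exI[of _ i1], rule exI[of _ i2], rule exI[of _ p1], rule exI[of _ p2], rule exI[of _ "d \<cdot> v"], use S in simp)
  then show ?thesis using m' by (rule that)
qed

lemma stable_quotient_R: "stable_quotient K P R \<pi> i p q"
proof unfold_locales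
  show "X \<in> ob K \<Longrightarrow> \<pi> (ident K X) = ident R (id X)" for X by (simp add: Q.quot_ident)
  show "id X \<in> ob R" if "X \<in> ob K" for X using that by (simp add: Q.ob_D)
  show "\<pi> f \<in> Hom R (id X) (id Y)" if "f \<in> Hom K X Y" for f X Y using that by simp
  show "\<pi> (g \<cdot> f) = \<pi> g \<cdot>\<^bsub>R\<^esub> \<pi> f" if "f \<in> Hom K X Y" "g \<in> Hom K Y Z" for f g X Y Z using that by (simp add: Q.quot_cmp)
  show "\<pi> (f \<oplus> g) = \<pi> f \<oplus>\<^bsub>R\<^esub> \<pi> g" if "f \<in> Hom K X Y" "g \<in> Hom K X Y" for f g X Y using that by (simp add: Q.quot_add)
  show "ob R = ob K" by (rule Q.ob_D)
  show "\<exists>f\<in>Hom K X Y. S = \<pi> f" if "S \<in> Hom R X Y" for S X Y using Q.quot_lift[OF that] by blast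
  show "(\<pi> f = zerom R X Y) = A.fac f" if "f \<in> Hom K X Y" for f X Y using Q.quot_eq_zero_iff[of f X Y] that by simp
  show "(i X, p X, q X) \<in> Tri K \<and> src K (i X) = X \<and> tgt K (i X) \<in> P \<and> phantom K P (q X)" if "X \<in> ob K" for X
    using that choice_Tri E_phantom[OF choice_E[OF that]] by simp
  show "susO R X = tgt K (p X)" for X by (rule susO_R)
  show "susM R (\<pi> f) = \<pi> w" if "f \<in> Hom K X Y" "w \<in> Hom K (tgt K (p X)) (tgt K (p Y))" "q Y \<cdot> w = susM K f \<cdot> q X" for f X Y w
    using that by (rule susM_R)
next
  fix f assume f: "f \<in> arr K"
  have X: "src K f \<in> ob K" using f by simp
  obtain f0 g0 h0 k0 where hc: "homotopy_cartesian K (i (src K f)) f f0 g0" and T0: "(g0, h0, k0) \<in> Tri K"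
    and m: "tri_morphism K (i (src K f), p (src K f), q (src K f)) (g0, h0, k0) f f0 (ident K (tgt K (p (src K f))))"
    and k0: "tgt K h0 = tgt K (p (src K f))" "k0 = susM K f \<cdot> q (src K f)"
    by (rule homotopy_pushout[OF choice_Tri[OF X], of f "tgt K f"]) (use f in auto)
  have "src K g0 = tgt K f" using m by (simp add: tri_morphism_def)
  then show "\<exists>g h. src K g = tgt K f \<and> tgt K h = tgt K (p (src K f)) \<and> (g, h, susM K f \<cdot> q (src K f)) \<in> Tri K"
    using T0 k0 by blast
next
  fix T
  show "T \<in> Tri R \<longleftrightarrow> (\<exists>f g h. f \<in> arr K \<and> src K g = tgt K f \<and> tgt K h = tgt K (p (src K f)) \<and>
        (g, h, susM K f \<cdot> q (src K f)) \<in> Tri K \<and> tri_iso R (\<pi> f, \<pi> g, \<pi> h) T)" (is "_ \<longleftrightarrow> ?rhs")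
  proof
    assume "T \<in> Tri R"
    then obtain S where S: "S \<in> std_triangles" "tri_iso R S T" unfolding Tri_R by blast
    obtain f g h X Y f' k where s: "S = (\<pi> f, \<pi> g, \<pi> h)" "f \<in> Hom K X Y" "(g, h, k) \<in> Tri K"
          "tri_morphism K (i X, p X, q X) (g, h, k) f f' (ident K (tgt K (p X)))"
      using S(1) unfolding std_triangles_def by blast
    have f: "f \<in> arr K" "src K f = X" "tgt K f = Y" using s(2) by auto
    have X: "X \<in> ob K" using Hom_ob[OF s(2)] by simp
    have g: "src K g = tgt K f" "tgt K h = tgt K (p X)"
    proof -
      have "ident K (tgt K (p X)) \<in> Hom K (tgt K (p X)) (tgt K h)" and "f \<in> Hom K (src K (i X)) (src K g)"
        using s(4) unfolding tri_morphism_def prod.case by blast+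
      then show "src K g = tgt K f" "tgt K h = tgt K (p X)" using X by simp_all
    qed
    have "susM K f \<cdot> q X = k \<cdot> ident K (tgt K (p X))" using s(4) unfolding tri_morphism_def prod.case by blast
    then have "k = susM K f \<cdot> q X" using tri_arrs[OF s(3)] g X by simp
    then show ?rhs using f s(3) g S(2) unfolding s(1) by blast
  next
    assume ?rhs
    then obtain f g h where f: "f \<in> arr K" and T: "src K g = tgt K f" "tgt K h = tgt K (p (src K f))"
        "(g, h, susM K f \<cdot> q (src K f)) \<in> Tri K" "tri_iso R (\<pi> f, \<pi> g, \<pi> h) T" by blast
    have f': "f \<in> Hom K (src K f) (tgt K f)" using f by simp
    obtain f1 where "homotopy_cartesian K (i (src K f)) f f1 g"
      "tri_morphism K (i (src K f), p (src K f), q (src K f)) (g, h, susM K f \<cdot> q (src K f)) f f1 (ident K (tgt K (p (src K f))))"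
      using homotopy_cartesian_of_third[OF f' T(3,1,2)] .
    then have "(\<pi> f, \<pi> g, \<pi> h) \<in> std_triangles" unfolding std_triangles_def using f' T(3) by blast
    then show "T \<in> Tri R" unfolding Tri_R using T(4) by blast
  qed
qed

end

section \<open>The stable category of the relative exact structure as a stable quotient\<close>

locale relative_exact_choice = relative_exact C i p P
  for C :: "('o, 'm) excat" (structure) and i p :: "'o \<Rightarrow> 'm" and P +
  fixes i' p' :: "'o \<Rightarrow> 'm"
  assumes rel_choice: "injective_conflations E i' p'"
begin

sublocale S: frobenius_choice E i' p'
  using E_frobenius rel_choice by (simp add: frobenius_choice_def frobenius_choice_axioms_def)

abbreviation "L' \<equiv> stable_category E i' p'"
abbreviation "\<pi>' \<equiv> cls C P"

lemma cls_E: "cls E (exact_proj E) = \<pi>'"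
  unfolding exact_proj_E fun_eq_iff cls_def factors_through_def subm_def negm_def Hom_E E_simps by simp

lemma P_ideal_C: "additive_ideal C P"
proof unfold_locales
  show "P \<subseteq> ob C" using P_obC by blast
  show "P \<noteq> {}" using P_nonempty proj_in_P by blast
  fix A B assume AB: "A \<in> P" "B \<in> P"
  obtain S i1 i2 p1 p2 where S: "biproduct C A B S i1 i2 p1 p2" using ex_biproduct[OF AB[THEN P_obC]] by blast
  then show "\<exists>S i1 i2 p1 p2. S \<in> P \<and> biproduct C A B S i1 i2 p1 p2"
    using I.P_biproduct[OF AB Q.quot_biproduct[OF S]] by blast
qed

sublocale R: additive_ideal C P
  by (rule P_ideal_C)

lemma quotient_C: "additive_quotient C P L'"
  by unfold_locales
    (use S.Q.ob_D S.Q.arr_D S.Q.src_D S.Q.tgt_D S.Q.ident_D S.Q.cmp_D S.Q.addm_D S.Q.zerom_D in \<open>simp_all add: cls_E\<close>)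

sublocale R: additive_quotient C P L'
  by (rule quotient_C)

text \<open>
  The projection from the stable category of \<open>C\<close> to the quotient by the larger class \<open>P\<close>.
\<close>

definition \<rho> :: "'m set \<Rightarrow> 'm set" where "\<rho> S = \<pi>' (rep S)"

lemma fac_P_of_proj: "fac f \<Longrightarrow> R.fac f"
  unfolding factors_through_def using proj_in_P by blast

lemma rho_pi [simp]: assumes "f \<in> arr C" shows "\<rho> (\<pi> f) = \<pi>' f"
proof -
  note r = rep_cls[OF assms]
  show ?thesis unfolding \<rho>_def
    by (rule R.cls_eq_iff[THEN iffD2]) (use r assms fac_P_of_proj in auto)
qed

lemma rho_functor: "additive_functor L L' id \<rho>"
proof unfold_locales
  show "id X \<in> ob L'" if "X \<in> ob L" for X using that R.ob_D by simp
  show "\<rho> S \<in> Hom L' (id X) (id Y)" if S: "S \<in> Hom L X Y" for S X Y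
  proof -
    obtain f where "f \<in> Hom C X Y" "S = \<pi> f" using S by (rule Q.quot_lift)
    then show ?thesis by auto
  qed
  show "\<rho> (ident L X) = ident L' (id X)" if "X \<in> ob L" for X using that by (simp add: Q.quot_ident R.quot_ident)
  show "\<rho> (T \<cdot>\<^bsub>L\<^esub> S) = \<rho> T \<cdot>\<^bsub>L'\<^esub> \<rho> S" if ST: "S \<in> Hom L X Y" "T \<in> Hom L Y Z" for S T X Y Z
  proof -
    obtain f where f: "f \<in> Hom C X Y" "S = \<pi> f" using ST(1) by (rule Q.quot_lift)
    obtain g where g: "g \<in> Hom C Y Z" "T = \<pi> g" using ST(2) by (rule Q.quot_lift)
    show ?thesis using f g by (simp add: Q.quot_cmp R.quot_cmp)
  qed
  show "\<rho> (S \<oplus>\<^bsub>L\<^esub> T) = \<rho> S \<oplus>\<^bsub>L'\<^esub> \<rho> T" if ST: "S \<in> Hom L X Y" "T \<in> Hom L X Y" for S T X Y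
  proof -
    obtain f where f: "f \<in> Hom C X Y" "S = \<pi> f" using ST(1) by (rule Q.quot_lift)
    obtain g where g: "g \<in> Hom C X Y" "T = \<pi> g" using ST(2) by (rule Q.quot_lift)
    show ?thesis using f g by (simp add: Q.quot_add R.quot_add)
  qed
qed

sublocale rho: additive_functor L L' id \<rho>
  by (rule rho_functor)

text \<open>
  If the class of \<open>f\<close> factors through \<open>P\<close> in the stable category, then \<open>f\<close> differs from a map through \<open>P\<close>
  by a map through a projective object, which lies in \<open>P\<close> as well.
\<close>

lemma rho_zero:
  assumes "S \<in> Hom L X Y" shows "\<rho> S = zerom L' X Y \<longleftrightarrow> factors_through L P S"
proof -
  obtain f where f: "f \<in> Hom C X Y" "S = \<pi> f" using assms by (rule Q.quot_lift)
  have [unfolded Hom_iff, simp]: "f \<in> Hom C X Y" using f by auto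
  have "\<rho> S = zerom L' X Y \<longleftrightarrow> R.fac f" unfolding f(2) using R.quot_eq_zero_iff[of f X Y] by simp
  also have "\<dots> \<longleftrightarrow> factors_through L P S"
  proof
    assume f1: "R.fac f"
    obtain Q a b where Q: "Q \<in> P" "a \<in> Hom C X Q" "b \<in> Hom C Q Y" "f = b \<cdot> a" by (rule R.facE_hom[OF f1 f(1)])
    have "S = \<pi> b \<cdot>\<^bsub>L\<^esub> \<pi> a" unfolding f(2) Q(4) using Q(2,3) by (simp add: Q.quot_cmp)
    moreover have "\<pi> a \<in> Hom L (src L S) Q" "\<pi> b \<in> Hom L Q (tgt L S)" using Q(2,3) f(2) by auto
    ultimately show "factors_through L P S" unfolding factors_through_def using Q(1) by blast
  next
    assume "factors_through L P S"
    then obtain Q A B where Q: "Q \<in> P" "A \<in> Hom L (src L S) Q" "B \<in> Hom L Q (tgt L S)" "S = B \<cdot>\<^bsub>L\<^esub> A"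
      unfolding factors_through_def by blast
    have "A \<in> Hom L X Q" "B \<in> Hom L Q Y" using Q(2,3) assms by auto
    then obtain a b where a: "a \<in> Hom C X Q" "A = \<pi> a" and b: "b \<in> Hom C Q Y" "B = \<pi> b" by (metis Q.quot_lift)
    have [unfolded Hom_iff, simp]: "a \<in> Hom C X Q" "b \<in> Hom C Q Y" using a b by auto
    have "\<pi> f = \<pi> (b \<cdot> a)" using Q(4) f(2) a(2) b(2) by (simp add: Q.quot_cmp)
    then have "fac (f \<ominus> b \<cdot> a)" by - (rule cls_eq_iff[THEN iffD1], auto)
    then have "R.fac (f \<ominus> b \<cdot> a)" by (rule fac_P_of_proj)
    moreover have "R.fac (b \<cdot> a)" using R.facI[OF a(1) b(1) Q(1)] .
    ultimately have "R.fac ((f \<ominus> b \<cdot> a) \<oplus> b \<cdot> a)" by (rule R.fac_add) auto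
    then show "R.fac f" by (simp add: subm_def)
  qed
  finally show ?thesis .
qed

lemma rho_eqI:
  assumes "S \<in> Hom L X Y" "T \<in> Hom L X Y" "factors_through L P (S \<ominus>\<^bsub>L\<^esub> T)"
  shows "\<rho> S = \<rho> T"
proof -
  have "S \<ominus>\<^bsub>L\<^esub> T \<in> Hom L X Y" using assms by auto
  then have "\<rho> (S \<ominus>\<^bsub>L\<^esub> T) = zerom L' X Y" using rho_zero assms(3) by blast
  then have "\<rho> S \<ominus>\<^bsub>L'\<^esub> \<rho> T = zerom L' X Y" using assms by simp
  then show ?thesis using S.Q.D.sub_eq_zero_iff[of "\<rho> S" "\<rho> T"] assms by auto
qed

text \<open>
  The chosen relative conflations give the chosen triangles \<open>(iL, pL, qL)\<close> of the stable category; the sign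
  in \<open>qL\<close> is that of \<open>conn_Tri\<close>.
\<close>

definition \<delta> :: "'o \<Rightarrow> 'm" where "\<delta> X = (SOME d. conn (i' X) (p' X) d)"
definition iL :: "'o \<Rightarrow> 'm set" where "iL X = \<pi> (i' X)"
definition pL :: "'o \<Rightarrow> 'm set" where "pL X = \<pi> (p' X)"
definition qL :: "'o \<Rightarrow> 'm set" where "qL X = \<ominus>\<^bsub>L\<^esub> (\<pi> (\<delta> X))"

lemma rel_choice_confl: "X \<in> ob C \<Longrightarrow> (i' X, p' X) \<in> rel_confl"
  using S.choice_confl[of X] by simp

lemma rel_choice_arr [simp]:
  assumes "X \<in> ob C"
  shows "i' X \<in> arr C" "src C (i' X) = X" "p' X \<in> arr C" "src C (p' X) = tgt C (i' X)" "tgt C (i' X) \<in> P"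
  using S.choice_facts(1-5)[of X] assms by (simp_all add: exact_proj_E)

lemma conn_delta: assumes "X \<in> ob C" shows "conn (i' X) (p' X) (\<delta> X)"
proof -
  obtain d where "conn (i' X) (p' X) d" using conn_ex[OF rel_conflD(1)[OF rel_choice_confl[OF assms]]] .
  then show ?thesis unfolding \<delta>_def by (rule someI)
qed

lemma delta_arr [simp]:
  assumes "X \<in> ob C"
  shows "\<delta> X \<in> arr C" "src C (\<delta> X) = tgt C (p' X)" "tgt C (\<delta> X) = tgt C (p X)"
  using conn_arr[OF conn_delta[OF assms]] assms by auto

lemma chosen_L:
  assumes X: "X \<in> ob C"
  shows "(iL X, pL X, qL X) \<in> Tri L" "phantom L P (qL X)"
proof -
  show T: "(iL X, pL X, qL X) \<in> Tri L" unfolding iL_def pL_def qL_def by (rule conn_Tri[OF conn_delta[OF X]])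
  show "phantom L P (qL X)"
    using rel_confl_phantom[OF rel_conflD(1)[OF rel_choice_confl[OF X]]] T rel_choice_confl[OF X]
    unfolding iL_def pL_def by blast
qed

text \<open>
  A representative \<open>t\<close> of the relative suspension of \<open>f\<close> satisfies the equation that characterizes \<open>w\<close>, by
  naturality of connecting maps, and this equation determines a map modulo \<open>P\<close>.
\<close>

lemma susM_L':
  assumes f: "F \<in> Hom L X Y" and w: "w \<in> Hom L (tgt L (pL X)) (tgt L (pL Y))" "qL Y \<cdot>\<^bsub>L\<^esub> w = susM L F \<cdot>\<^bsub>L\<^esub> qL X"
  shows "susM L' (\<rho> F) = \<rho> w"
proof -
  obtain f where f: "f \<in> Hom C X Y" "F = \<pi> f" using f by (rule Q.quot_lift)
  have ob [simp]: "X \<in> ob C" "Y \<in> ob C" using Hom_ob[OF f(1)] by auto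
  have [unfolded Hom_iff, simp]: "f \<in> Hom C X Y" using f by auto
  obtain s t where st: "S.susrel f s t" using S.susrel_ex[of f] by auto
  then have s: "s \<in> Hom C (tgt C (i' X)) (tgt C (i' Y))" "t \<in> Hom C (tgt C (p' X)) (tgt C (p' Y))"
    "s \<cdot> i' X = i' Y \<cdot> f" "t \<cdot> p' X = p' Y \<cdot> s" unfolding S.susrel_def by simp_all
  have t: "\<pi> t \<in> Hom L (tgt L (pL X)) (tgt L (pL Y))" using s(2) by (simp add: pL_def)
  have "susM L (\<pi> f) \<cdot>\<^bsub>L\<^esub> \<pi> (\<delta> X) = \<pi> (\<delta> Y) \<cdot>\<^bsub>L\<^esub> \<pi> t"
    by (rule conn_natural[OF conn_delta[OF ob(1)] conn_delta[OF ob(2)], of f s t]) (use s in auto)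
  then have "qL Y \<cdot>\<^bsub>L\<^esub> \<pi> t = susM L F \<cdot>\<^bsub>L\<^esub> qL X" unfolding qL_def f(2) using s(2) by simp
  then have e: "qL Y \<cdot>\<^bsub>L\<^esub> w = qL Y \<cdot>\<^bsub>L\<^esub> \<pi> t" using w(2) by simp
  have "factors_through L P (w \<ominus>\<^bsub>L\<^esub> \<pi> t)"
    by (rule I.factors_of_eq[OF chosen_L(1)[OF ob(2)] _ w(1) t e]) (simp add: iL_def)
  then have "\<rho> w = \<rho> (\<pi> t)" by (rule rho_eqI[OF w(1) t])
  moreover have "susM L' (\<pi>' f) = \<pi>' t" using S.susM_L[OF st] by (simp add: cls_E)
  ultimately show ?thesis using f(2) s(2) by simp
qed

text \<open>
  The pushout of the chosen relative conflation along \<open>f\<close> is a conflation \<open>(g, h)\<close>, and naturality computes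
  its connecting map.
\<close>

lemma std_triangle_L:
  assumes f: "f \<in> Hom C X Y" "g \<in> Hom C Y Z" "h \<in> Hom C Z (tgt C (p' X))" and po: "is_pushout C (i' X) f f' g"
    and h: "h \<cdot> f' = p' X" "h \<cdot> g = zerom C Y (tgt C (p' X))"
  shows "(\<pi> g, \<pi> h, susM L (\<pi> f) \<cdot>\<^bsub>L\<^esub> qL X) \<in> Tri L"
proof -
  have ob [simp]: "X \<in> ob C" "Y \<in> ob C" "Z \<in> ob C" using Hom_ob[OF f(1)] Hom_ob[OF f(2)] by auto
  have [unfolded Hom_iff, simp]: "f \<in> Hom C X Y" "g \<in> Hom C Y Z" "h \<in> Hom C Z (tgt C (p' X))" using f by auto
  have f': "f' \<in> Hom C (tgt C (i' X)) Z" "f' \<cdot> i' X = g \<cdot> f" using po f by (auto elim!: pushoutE)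
  have pX: "tgt C (p' X) \<in> ob C" using tgt_in_ob[of "p' X"] by simp
  have "(g, h) \<in> Confl C"
    by (rule pushout_conflation[OF rel_conflD(1)[OF rel_choice_confl[OF ob(1)]] po]) (use h in auto)
  then obtain d where d: "conn g h d" by (rule conn_ex)
  have [unfolded Hom_iff, simp]: "d \<in> Hom C (tgt C (p' X)) (tgt C (p Y))" using conn_arr[OF d] by auto
  have "susM L (\<pi> f) \<cdot>\<^bsub>L\<^esub> \<pi> (\<delta> X) = \<pi> d \<cdot>\<^bsub>L\<^esub> \<pi> (ident C (tgt C (p' X)))"
    by (rule conn_natural[OF conn_delta[OF ob(1)] d, of f f' "ident C (tgt C (p' X))"]) (use f' h pX in auto)
  then have "susM L (\<pi> f) \<cdot>\<^bsub>L\<^esub> qL X = \<ominus>\<^bsub>L\<^esub> (\<pi> d)" unfolding qL_def using pX by (simp flip: Q.quot_ident)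
  then show ?thesis using conn_Tri[OF d] by simp
qed

lemma E_pushout: "is_pushout E = is_pushout C" by (rule E_simps)

lemma std_exists:
  assumes f: "f \<in> Hom C X Y"
  obtains g h Z f' where "g \<in> Hom C Y Z" "h \<in> Hom C Z (tgt C (p' X))" "is_pushout C (i' X) f f' g"
    "h \<cdot> f' = p' X" "h \<cdot> g = zerom C Y (tgt C (p' X))"
proof -
  have "f \<in> Hom E X Y" using f by (simp add: Hom_E)
  then obtain f' g h Z where "g \<in> Hom E Y Z" "h \<in> Hom E Z (tgt E (p' X))" "is_pushout E (i' X) f f' g"
    "h \<cdot>\<^bsub>E\<^esub> f' = p' X" "h \<cdot>\<^bsub>E\<^esub> g = zerom E Y (tgt E (p' X))" using S.std_ex by metis
  then show ?thesis by (intro that[of g Z h f']) (simp_all add: E_pushout)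
qed

lemma std_L':
  assumes f: "f \<in> Hom C X Y" "g \<in> Hom C Y Z" "h \<in> Hom C Z (tgt C (p' X))" and po: "is_pushout C (i' X) f f' g"
    and h: "h \<cdot> f' = p' X" "h \<cdot> g = zerom C Y (tgt C (p' X))"
  shows "(\<pi>' f, \<pi>' g, \<pi>' h) \<in> S.std_triangles"
proof -
  have "(cls E (exact_proj E) f, cls E (exact_proj E) g, cls E (exact_proj E) h) \<in> S.std_triangles"
    by (rule S.std_trianglesI[of _ X Y _ Z _ f']) (use f po h in \<open>simp_all add: E_pushout\<close>)
  then show ?thesis by (simp add: cls_E)
qed

lemma std_L'E:
  assumes "S \<in> S.std_triangles"
  obtains f g h X Y Z f' where "S = (\<pi>' f, \<pi>' g, \<pi>' h)" "f \<in> Hom C X Y" "g \<in> Hom C Y Z" "h \<in> Hom C Z (tgt C (p' X))"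
    "is_pushout C (i' X) f f' g" "h \<cdot> f' = p' X" "h \<cdot> g = zerom C Y (tgt C (p' X))"
proof -
  obtain f g h X Y Z f' where "S = (cls E (exact_proj E) f, cls E (exact_proj E) g, cls E (exact_proj E) h)"
     "f \<in> Hom E X Y" "g \<in> Hom E Y Z" "h \<in> Hom E Z (tgt E (p' X))"
          "is_pushout E (i' X) f f' g" "h \<cdot>\<^bsub>E\<^esub> f' = p' X" "h \<cdot>\<^bsub>E\<^esub> g = zerom E Y (tgt E (p' X))"
    using assms unfolding S.std_triangles_def by blast
  then show ?thesis using that by (simp add: E_pushout cls_E)
qed

text \<open>
  By \<open>std_triangle_L\<close> the standard triangles are of the required form.  Conversely, a triangle of the
  stable category with connecting map \<open>\<Sigma>f \<cdot> q\<close> is isomorphic to the one coming from the pushout of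
  \<open>f\<close>, by an isomorphism over the identities of \<open>Y\<close> and of the relative suspension of \<open>X\<close>.
\<close>

lemma stable_quotient_L': "stable_quotient L P L' \<rho> iL pL qL"
proof unfold_locales
  show "ob L' = ob L" using R.ob_D by simp
  show "\<exists>F\<in>Hom L X Y. S = \<rho> F" if S: "S \<in> Hom L' X Y" for S X Y
  proof -
    obtain f where f: "f \<in> Hom C X Y" "S = \<pi>' f" using S by (rule R.quot_lift)
    then show ?thesis by (intro bexI[of _ "\<pi> f"]) auto
  qed
  show "(\<rho> F = zerom L' X Y) = factors_through L P F" if "F \<in> Hom L X Y" for F X Y using that by (rule rho_zero)
  show "(iL X, pL X, qL X) \<in> Tri L \<and> src L (iL X) = X \<and> tgt L (iL X) \<in> P \<and> phantom L P (qL X)" if "X \<in> ob L" for X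
    using that chosen_L[of X] by (simp add: iL_def)
  show "susO L' X = tgt L (pL X)" if "X \<in> ob L" for X using that by (simp add: pL_def)
  show "susM L' (\<rho> F) = \<rho> w" if "F \<in> Hom L X Y" "w \<in> Hom L (tgt L (pL X)) (tgt L (pL Y))" "qL Y \<cdot>\<^bsub>L\<^esub> w = susM L F \<cdot>\<^bsub>L\<^esub> qL X" for F X Y w
    using that by (rule susM_L')
next
  fix F assume F: "F \<in> arr L"
  define X where "X = src L F"
  define Y where "Y = tgt L F"
  have FH: "F \<in> Hom L X Y" using F by (simp add: X_def Y_def)
  then obtain f where f: "f \<in> Hom C X Y" "F = \<pi> f" by (rule Q.quot_lift)
  have X: "X \<in> ob C" using Hom_ob[OF f(1)] by simp
  obtain g h Z f' where s: "g \<in> Hom C Y Z" "h \<in> Hom C Z (tgt C (p' X))" "is_pushout C (i' X) f f' g"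
    "h \<cdot> f' = p' X" "h \<cdot> g = zerom C Y (tgt C (p' X))" using std_exists[OF f(1)] .
  have "(\<pi> g, \<pi> h, susM L F \<cdot>\<^bsub>L\<^esub> qL X) \<in> Tri L" unfolding f(2) by (rule std_triangle_L[OF f(1) s])
  moreover have "src L (\<pi> g) = Y" "tgt L (\<pi> h) = tgt L (pL X)" using s X by (simp_all add: pL_def)
  ultimately show "\<exists>g h. src L g = tgt L F \<and> tgt L h = tgt L (pL (src L F)) \<and> (g, h, susM L F \<cdot>\<^bsub>L\<^esub> qL (src L F)) \<in> Tri L"
    unfolding X_def Y_def by blast
next
  fix T
  show "T \<in> Tri L' \<longleftrightarrow> (\<exists>f g h. f \<in> arr L \<and> src L g = tgt L f \<and> tgt L h = tgt L (pL (src L f)) \<and>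
        (g, h, susM L f \<cdot>\<^bsub>L\<^esub> qL (src L f)) \<in> Tri L \<and> tri_iso L' (\<rho> f, \<rho> g, \<rho> h) T)" (is "_ \<longleftrightarrow> ?rhs")
  proof
    assume "T \<in> Tri L'"
    then obtain S where S: "S \<in> S.std_triangles" "tri_iso L' S T" unfolding S.Tri_L by blast
    obtain f g h X Y Z f' where s: "S = (\<pi>' f, \<pi>' g, \<pi>' h)" "f \<in> Hom C X Y" "g \<in> Hom C Y Z" "h \<in> Hom C Z (tgt C (p' X))"
      "is_pushout C (i' X) f f' g" "h \<cdot> f' = p' X" "h \<cdot> g = zerom C Y (tgt C (p' X))"
      using S(1) by (rule std_L'E)
    have X: "X \<in> ob C" using Hom_ob[OF s(2)] by simp
    have "(\<pi> g, \<pi> h, susM L (\<pi> f) \<cdot>\<^bsub>L\<^esub> qL X) \<in> Tri L" by (rule std_triangle_L[OF s(2-7)])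
    moreover have "tri_iso L' (\<rho> (\<pi> f), \<rho> (\<pi> g), \<rho> (\<pi> h)) T" using S(2) s(1-4) by simp
    ultimately show ?rhs using s(2-4) X
      by (intro exI[of _ "\<pi> f"] exI[of _ "\<pi> g"] exI[of _ "\<pi> h"]) (simp add: pL_def)
  next
    assume ?rhs
    then obtain F G H where F: "F \<in> arr L" "src L G = tgt L F" "tgt L H = tgt L (pL (src L F))"
        "(G, H, susM L F \<cdot>\<^bsub>L\<^esub> qL (src L F)) \<in> Tri L" "tri_iso L' (\<rho> F, \<rho> G, \<rho> H) T" by blast
    define X where "X = src L F"
    define Y where "Y = tgt L F"
    define W where "W = tgt L G"
    have FH: "F \<in> Hom L X Y" using F by (simp add: X_def Y_def)
    then obtain f where f: "f \<in> Hom C X Y" "F = \<pi> f" by (rule Q.quot_lift)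
    have ob [simp]: "X \<in> ob C" "Y \<in> ob C" using Hom_ob[OF f(1)] by auto
    have pX [simp]: "tgt C (p' X) \<in> ob C" using tgt_in_ob[of "p' X"] by simp
    have tH: "tgt L H = tgt C (p' X)" using F(3) unfolding X_def[symmetric] by (simp add: pL_def)
    have sG: "src L G = Y" using F(2) unfolding Y_def .
    have TG: "(G, H, susM L F \<cdot>\<^bsub>L\<^esub> qL X) \<in> Tri L" using F(4) unfolding X_def .
    have [unfolded Hom_iff, simp]: "F \<in> Hom L X Y" using FH by auto
    have [unfolded Hom_iff, simp]: "G \<in> Hom L Y W" "H \<in> Hom L W (tgt C (p' X))"
      using T.tri_arrs[OF TG] tH sG by (auto simp: W_def)
    obtain g h Z f' where s: "g \<in> Hom C Y Z" "h \<in> Hom C Z (tgt C (p' X))" "is_pushout C (i' X) f f' g"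
      "h \<cdot> f' = p' X" "h \<cdot> g = zerom C Y (tgt C (p' X))" using std_exists[OF f(1)] .
    have [unfolded Hom_iff, simp]: "g \<in> Hom C Y Z" "h \<in> Hom C Z (tgt C (p' X))" "f \<in> Hom C X Y" using s f by auto
    have T0: "(\<pi> g, \<pi> h, susM L F \<cdot>\<^bsub>L\<^esub> qL X) \<in> Tri L" unfolding f(2) by (rule std_triangle_L[OF f(1) s])
    obtain v where v: "v \<in> Hom L (tgt L (\<pi> g)) (tgt L G)" "v \<cdot>\<^bsub>L\<^esub> \<pi> g = G \<cdot>\<^bsub>L\<^esub> ident L Y" "ident L (tgt C (p' X)) \<cdot>\<^bsub>L\<^esub> \<pi> h = H \<cdot>\<^bsub>L\<^esub> v"
      by (rule T.complete_middle[OF T0 TG, of "ident L Y" "ident L (tgt C (p' X))"])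
        (auto simp: qL_def)
    have vi: "iso_arr L Z W v"
      using T.five_middle[OF T0 TG v] Q.D.iso_ident[of Y] Q.D.iso_ident[of "tgt C (p' X)"] by (simp add: qL_def)
    have [unfolded Hom_iff, simp]: "v \<in> Hom L Z W" using v by auto
    have "\<rho> v \<cdot>\<^bsub>L'\<^esub> \<rho> (\<pi> g) = \<rho> G" using v(2) by (simp flip: rho.functor_comp del: rho_pi)
    then have 1: "\<rho> v \<cdot>\<^bsub>L'\<^esub> \<pi>' g = \<rho> G" by simp
    have "\<rho> (\<pi> h) = \<rho> H \<cdot>\<^bsub>L'\<^esub> \<rho> v" using v(3) by (simp flip: rho.functor_comp del: rho_pi)
    then have 2: "\<pi>' h = \<rho> H \<cdot>\<^bsub>L'\<^esub> \<rho> v" by simp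
    have obL: "X \<in> ob L'" "Y \<in> ob L'" using R.ob_D by simp_all
    have st: "(\<pi>' f, \<pi>' g, \<pi>' h) \<in> S.std_triangles" by (rule std_L'[OF f(1) s])
    have "tri_iso L' (\<pi>' f, \<pi>' g, \<pi>' h) (\<rho> F, \<rho> G, \<rho> H)"
      unfolding tri_iso_iff
    proof (intro exI conjI)
      show "iso_arr L' (src L' (\<pi>' f)) (src L' (\<rho> F)) (ident L' X)" using S.Q.D.iso_ident[OF obL(1)] by simp
      show "iso_arr L' (tgt L' (\<pi>' f)) (tgt L' (\<rho> F)) (ident L' Y)" using S.Q.D.iso_ident[OF obL(2)] by simp
      show "iso_arr L' (tgt L' (\<pi>' g)) (tgt L' (\<rho> G)) (\<rho> v)" using rho.functor_iso[OF vi] by simp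
      show "ident L' Y \<cdot>\<^bsub>L'\<^esub> \<pi>' f = \<rho> F \<cdot>\<^bsub>L'\<^esub> ident L' X" unfolding f(2) by simp
      show "\<rho> v \<cdot>\<^bsub>L'\<^esub> \<pi>' g = \<rho> G \<cdot>\<^bsub>L'\<^esub> ident L' Y" using 1 by simp
      show "susM L' (ident L' X) \<cdot>\<^bsub>L'\<^esub> \<pi>' h = \<rho> H \<cdot>\<^bsub>L'\<^esub> \<rho> v"
        using 2 S.L.Sus.functor_id[OF obL(1)] by simp
    qed auto
    then have "tri_iso L' (\<pi>' f, \<pi>' g, \<pi>' h) T" using F(5) S.L.tri_iso_trans by (metis prod_cases3)
    then show "T \<in> Tri L'" unfolding S.Tri_L using st by blast
  qed
qed

end

section \<open>The relative stable category is algebraic\<close>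

theorem theorem1p2:
  fixes K :: "('o, 'm) tricat"
    and E :: "('m \<times> 'm \<times> 'm) set"
    and i p q :: "'o \<Rightarrow> 'm"
  assumes "algebraic_triangulated TYPE('p \<times> 'q) K"
    and "frobenius_class K E"
    and "injective_triangles K E i p q"
  shows "algebraic_triangulated TYPE('p \<times> 'q) (relative_stable_category K E i p q)"
proof -
  obtain C :: "('p, 'q) excat" and j r FO FM \<phi> where C: "frobenius_category C" "injective_conflations C j r"
    and F: "triangle_equivalence K (stable_category C j r) FO FM \<phi>"
    using assms(1) unfolding algebraic_triangulated_def by blast
  interpret K: frobenius_class_choice K E i p q
    using assms(2,3) by (simp add: frobenius_class_choice_def frobenius_class_choice_axioms_def)
  interpret C: frobenius_choice C j r
    using C by (simp add: frobenius_choice_def frobenius_choice_axioms_def)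
  let ?L = "stable_category C j r"
  interpret F: tri_equiv K ?L FO FM \<phi>
    by (intro tri_equiv.intro K.pretriangulated C.stable_pretriangulated tri_equiv_axioms.intro F)
  let ?P = "F.image_class K.P"
  interpret E: relative_exact C j r ?P
    by (intro relative_exact.intro C.frobenius_choice_axioms F.frobenius_ideal_image K.frobenius_ideal)
  obtain i' p' where c: "injective_conflations E.E i' p'" by (rule E.E_injective_conflations)
  interpret E: relative_exact_choice C j r ?P i' p'
    by (intro relative_exact_choice.intro E.relative_exact_axioms relative_exact_choice_axioms.intro c)
  interpret M: stable_comparison K ?L FO FM \<phi> K.P K.R K.\<pi> i p q ?P E.L' E.\<rho> E.iL E.pL E.qL
    by (intro stable_comparison.intro F.tri_equiv_axioms K.stable_quotient_R E.stable_quotient_L'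
        E.S.stable_triangulated stable_comparison_axioms.intro refl)
  show ?thesis
    unfolding algebraic_triangulated_def
    using M.quotient_triangulated E.E_frobenius c M.comparison_equivalence by blast
qed

end
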